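(* With notation and density functions $\delta_1,\delta_2,\delta_3$ as in the context, considered for real parameters $6<p<7$: (1) For each such $p$, the maximum of $x\mapsto\delta_1(\mathcal{C}^r(x,p))$ on $[0,t(p)-h(p)]$ is attained at $x=0$, i.e. the congruent hyperball packing is the densest for the given $p$; the function $p\mapsto\delta_1(\mathcal{C}^r(0,p))$ on $(6,7)$ attains its maximum at $p^1_{opt}\approx6.33962$, where $\delta_1(\mathcal{C}^r(0,p^1_{opt}))\approx0.70427$. (2) For each such $p$, the maximum of $x\mapsto\delta_2(\mathcal{C}^r(x,p))$ is attained at the endpoint $x=w(p)-t(p)$ of the interval $[0,w(p)-t(p)]$; the function $p\mapsto\delta_2(\mathcal{C}^r(w(p)-t(p),p))$ on $(6,7)$ attains its maximum at $p^2_{opt}\approx6.10563$, with value $\approx0.85684$. (3) For each such $p$, the maximum of $x\mapsto\delta_3(\mathcal{C}^r(x,p))$ is attained at the endpoint $x=s(p)-h(p)$ of the interval $[0,s(p)-h(p)]$; the function $p\mapsto\delta_3(\mathcal{C}^r(s(p)-h(p),p))$ on $(6,7)$ attains its maximum at $p^3_{opt}\approx6.26384$, where $\delta_3(\mathcal{C}^r(s(p^3_{opt})-h(p^3_{opt}),p^3_{opt}))\approx0.86145$.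
   Context: Work in the Beltrami–Cayley–Klein (projective) model of hyperbolic $3$-space $\mathbb{H}^3$ of curvature $-1$: the interior of the unit ball of $\mathbb{R}^3$, with the polarity induced by the unit sphere. For a point $B$ outside the closed unit ball, its polar plane $\mathrm{pol}(B)$ meets $\mathbb{H}^3$ in a hyperbolic plane orthogonal to every line through $B$. For $y>1/\sqrt3$ let $B_1=(y,-y,-y)$, $B_2=(y,y,-y)$, $B_3=(-y,y,-y)$, $B_4=(-y,-y,-y)$, $B_5=(y,-y,y)$, $B_6=(y,y,y)$, $B_7=(-y,y,y)$, $B_8=(-y,-y,y)$ and $\beta_i=\mathrm{pol}(B_i)$. For real $p>6$, $\mathcal{C}^r(p)$ is the truncated regular cube obtained by cutting this cube by $\beta_1,\dots,\beta_8$, with $y=y(p)$ chosen so that the dihedral angle between two adjacent faces coming from faces of the cube is $2\pi/p$. (For non-integer $p$ these truncated cubes do not generate tilings, so the packings considered are local, inside one $\mathcal{C}^r(p)$.) The hyperball $\mathcal{H}^s_i$ (base plane $\beta_i$, height $s>0$) is the set of points at distance at most $s$ from $\beta_i$; $V(s)=\mathrm{Vol}(\mathcal{H}^s_i\cap\mathcal{C}^r(p))$ and $V_0=\mathrm{Vol}(\mathcal{C}^r(p))$. $2h(p)$: distance between $\beta_i,\beta_j$ for vertices joined by an edge; $t(p)$: distance from $\beta_i$ to the origin; $s(p)$: distance from $\beta_i$ to the centre of a face of the cube containing $B_i$; $w(p)$: distance from $\beta_i$ to the plane of a face of $\mathcal{C}^r(p)$ coming from a cube face not containing $B_i$. Density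 functions (quantities evaluated at $p$): $\delta_1(\mathcal{C}^r(x,p))=(2V(h+x)+6V(h-x))/V_0$ (heights $h+x$ at $B_2,B_8$, $h-x$ elsewhere); $\delta_2(\mathcal{C}^r(x,p))=(V(t+x)+V(t-x)+3V(2h-t-x)+3V(2h-t+x))/V_0$ (height $t+x$ at $B_2$, $t-x$ at $B_8$, $2h-t-x$ at $B_1,B_3,B_6$, $2h-t+x$ at $B_4,B_5,B_7$); $\delta_3(\mathcal{C}^r(x,p))=(4V(h+x)+4V(h-x))/V_0$ (height $h+x$ at $B_1,B_3,B_6,B_8$, $h-x$ at $B_2,B_4,B_5,B_7$). *)

theory Defs
  imports "HOL-Analysis.Analysis"
begin

type_synonym pt3 = "real^3"

text \<open>Beltrami-Cayley-Klein model: the open unit ball of R^3.\<close>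
definition kball :: "pt3 set" where
  "kball = ball 0 1"

text \<open>Hyperbolic distance (curvature -1) in the Klein model.\<close>
definition hdist :: "pt3 \<Rightarrow> pt3 \<Rightarrow> real" where
  "hdist u v = arcosh ((1 - u \<bullet> v) / sqrt ((1 - u \<bullet> u) * (1 - v \<bullet> v)))"

definition hptdist :: "pt3 \<Rightarrow> pt3 set \<Rightarrow> real" where
  "hptdist x S = (INF z\<in>S. hdist x z)"

definition hsetdist :: "pt3 set \<Rightarrow> pt3 set \<Rightarrow> real" where
  "hsetdist S T = (INF z\<in>S. hptdist z T)"

definition hvol :: "pt3 set \<Rightarrow> real" where
  "hvol S = measure (density lborel (\<lambda>x::pt3. ennreal (1 / (1 - (norm x)\<^sup>2)\<^sup>2))) S"

definition polplane :: "pt3 \<Rightarrow> pt3 set" where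
  "polplane B = {x \<in> kball. x \<bullet> B = 1}"

text \<open>Hyperbolic angle between the planes with poles a and b (plane a.x = 1 and b.x = 1),
  measured inside the region {a.x \<le> 1, b.x \<le> 1} (projective/Lorentzian formula).\<close>
definition pole_angle :: "pt3 \<Rightarrow> pt3 \<Rightarrow> real" where
  "pole_angle a b = arccos ((1 - a \<bullet> b) / sqrt ((a \<bullet> a - 1) * (b \<bullet> b - 1)))"

definition vert :: "real \<Rightarrow> nat \<Rightarrow> pt3" where
  "vert y i =
    (if i = 1 then vector [y, -y, -y]
     else if i = 2 then vector [y, y, -y]
     else if i = 3 then vector [-y, y, -y]
     else if i = 4 then vector [-y, -y, -y]
     else if i = 5 then vector [y, -y, y]
     else if i = 6 then vector [y, y, y]
     else if i = 7 then vector [-y, y, y]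
     else vector [-y, -y, y])"

text \<open>y(p): the cube faces x1 = y and x2 = y (poles (1/y,0,0), (0,1/y,0)) meet in H^3
  (y < 1/sqrt 2) with dihedral angle 2 pi / p; vertices outside (y > 1/sqrt 3).\<close>
definition ycube :: "real \<Rightarrow> real" where
  "ycube p = (THE y. 1 / sqrt 3 < y \<and> y < 1 / sqrt 2 \<and>
     pole_angle (vector [1 / y, 0, 0]) (vector [0, 1 / y, 0]) = 2 * pi / p)"

definition B :: "real \<Rightarrow> nat \<Rightarrow> pt3" where
  "B p i = vert (ycube p) i"

definition beta :: "real \<Rightarrow> nat \<Rightarrow> pt3 set" where
  "beta p i = polplane (B p i)"

definition Cr :: "real \<Rightarrow> pt3 set" where
  "Cr p = {x \<in> kball. (\<forall>k. \<bar>x $ k\<bar> \<le> ycube p) \<and> (\<forall>i\<in>{1..8}. x \<bullet> B p i \<le> 1)}"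

definition V0 :: "real \<Rightarrow> real" where
  "V0 p = hvol (Cr p)"

definition hyperball :: "real \<Rightarrow> nat \<Rightarrow> real \<Rightarrow> pt3 set" where
  "hyperball p i s = {x \<in> kball. hptdist x (beta p i) \<le> s}"

definition Vpiece :: "real \<Rightarrow> nat \<Rightarrow> real \<Rightarrow> real" where
  "Vpiece p i s = hvol (hyperball p i s \<inter> Cr p)"

text \<open>2h: distance of beta_1, beta_2 (B_1, B_2 joined by an edge).\<close>
definition hh :: "real \<Rightarrow> real" where
  "hh p = hsetdist (beta p 1) (beta p 2) / 2"

definition tt :: "real \<Rightarrow> real" where
  "tt p = hptdist 0 (beta p 6)"

text \<open>s: distance from beta_6 to the centre (y,0,0) of the cube face x1 = y containing B_6.\<close>
definition ss :: "real \<Rightarrow> real" where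
  "ss p = hptdist (vector [ycube p, 0, 0]) (beta p 6)"

text \<open>w: distance from beta_6 to the plane x1 = -y of a face not containing B_6.\<close>
definition ww :: "real \<Rightarrow> real" where
  "ww p = hsetdist (beta p 6) {x \<in> kball. x $ 1 = - ycube p}"

definition delta1 :: "real \<Rightarrow> real \<Rightarrow> real" where
  "delta1 p x = (\<Sum>i\<in>{1..8::nat}.
      Vpiece p i (if i \<in> {2, 8} then hh p + x else hh p - x)) / V0 p"

definition delta2 :: "real \<Rightarrow> real \<Rightarrow> real" where
  "delta2 p x = (\<Sum>i\<in>{1..8::nat}.
      Vpiece p i (if i = 2 then tt p + x
                  else if i = 8 then tt p - x
                  else if i \<in> {1, 3, 6} then 2 * hh p - tt p - x
                  else 2 * hh p - tt p + x)) / V0 p"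

definition delta3 :: "real \<Rightarrow> real \<Rightarrow> real" where
  "delta3 p x = (\<Sum>i\<in>{1..8::nat}.
      Vpiece p i (if i \<in> {1, 3, 6, 8} then hh p + x else hh p - x)) / V0 p"

end

theory Submission
  imports Defs
begin

text \<open>
  Put \<open>k = 2 cos (2 \<pi> / p) - 1\<close>, which increases from \<open>0\<close> with \<open>p\<close>, and \<open>A = \<pi> - 3 \<theta>\<close> with \<open>\<theta> = 2 \<pi> / p\<close>.
  A Lorentz map carrying the foot of an edge to the origin turns one of the 48 congruent pieces of the
  truncated cube into an affine prism. Integrating over it gives \<open>V(s) = A (sinh 2s + 2s) / 4\<close> for
  \<open>0 \<le> s \<le> w\<close> and, with \<open>L = 2h = arcosh (1 / k)\<close>, the volume \<open>V\<^sub>0 = 2 A L + J\<close>, where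
  \<open>V\<^sub>0' = 6 L / D\<close> (Schlaefli) and \<open>A' = 3 / D\<close>, \<open>D\<^sup>2 = (3 + k) (1 - k)\<close>.
  For fixed \<open>p\<close> the second and third density are \<open>cosh (2x)\<close> with a nonnegative factor plus a constant, and the
  first one is convex in \<open>x\<close> up to constants.
  Along the three optimal configurations the density is \<open>N / V\<^sub>0\<close> with \<open>N = A n\<close> and \<open>N' = R V\<^sub>0'\<close>. If \<open>R\<close> is
  antitone and \<open>R V\<^sub>0 - N\<close> changes sign between two points, then \<open>N / V\<^sub>0\<close> has its maximum at a zero \<open>q\<close> of that
  expression and the maximum is \<open>R q\<close>. Here \<open>R = 1 - M / (2 L)\<close>, and the monotonicity of \<open>M\<close> is verified by
  interval evaluation of second order Taylor jets on boxes covering all \<open>k\<close>; the signs at the two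
  points are verified in the same way, with bounds on \<open>A\<close>, \<open>J\<close> and logarithms.
\<close>

section \<open>Interval arithmetic and jets\<close>

text \<open>V0 is not elementary, but its derivative in k is; hence the extremal argument uses V0'
  everywhere and V0 itself only at two points. The obstacle is the end k = 0 (p = 6, ideal
  vertices): there A vanishes like sqrt 3 k and L diverges like ln (2 / k), while the boxes must
  reach k = 0. So logarithms are kept out of the jets. M is 2 L - c, where c is the distance part of
  n, plus a term without logarithms. For 2 L - c an integer lower bound and the sign of the
  derivative are proved directly, and only the other term is enclosed. There A enters through g = A
  D / (3 k) and H = (1 - g) / k, which stay regular at 0 and are enclosed by a Taylor polynomial and
  a bounded remainder. The end p = 7 matters geometrically: on this range p < 7 amounts to k (1 + k)
  (3 + k) < 1, which says w < 2 h. A hyperball of height at most w then crosses neither a face away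
  from its vertex nor another base plane, so its part inside the solid is a full layer over the
  triangle cut out of the base plane.\<close>

type_synonym ivl = "int \<times> int"

definition in_ivl :: "nat \<Rightarrow> real \<Rightarrow> ivl \<Rightarrow> bool" where
  "in_ivl n x I \<longleftrightarrow> of_int (fst I) \<le> x * 2 ^ n \<and> x * 2 ^ n \<le> of_int (snd I)"

definition iadd :: "ivl \<Rightarrow> ivl \<Rightarrow> ivl" where
  "iadd a b = (case a of (a1, a2) \<Rightarrow> case b of (b1, b2) \<Rightarrow> (a1 + b1, a2 + b2))"

definition ineg :: "ivl \<Rightarrow> ivl" where
  "ineg a = (case a of (a1, a2) \<Rightarrow> (- a2, - a1))"

text \<open>A product of two ends scaled by 2^n carries the factor 4^n and is divided back by 2^n,
  rounded down at the lower end and to floor plus one at the upper end. The first branch merely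
  saves products when both lower ends are nonnegative.\<close>

definition imul :: "nat \<Rightarrow> ivl \<Rightarrow> ivl \<Rightarrow> ivl" where
  "imul n a b = (case a of (a1, a2) \<Rightarrow> case b of (b1, b2) \<Rightarrow>
     if 0 \<le> a1 \<and> 0 \<le> b1 then (a1 * b1 div 2 ^ n, a2 * b2 div 2 ^ n + 1)
     else let p = a1 * b1; q = a1 * b2; r = a2 * b1; s = a2 * b2 in
      (min (min p q) (min r s) div 2 ^ n, max (max p q) (max r s) div 2 ^ n + 1))"

text \<open>The numerator is 4^n because the argument and its inverse are both scaled by 2^n. Only
  intervals to the right of 0 are inverted, so a result \<open>Some\<close> certifies a positive
  argument.\<close>

definition iinv :: "nat \<Rightarrow> ivl \<Rightarrow> ivl option" where
  "iinv n a = (case a of (a1, a2) \<Rightarrow>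
     if 0 < a1 then Some (4 ^ n div a2, 4 ^ n div a1 + 1) else None)"

text \<open>Integer Newton iteration for the square root of \<open>m\<close>. It only proposes a
  number: \<open>isqrt\<close> tests the squares, so soundness rests on that test and not on
  convergence within the given number of rounds.\<close>

fun newton_sqrt :: "nat \<Rightarrow> int \<Rightarrow> int \<Rightarrow> int" where
  "newton_sqrt 0 m x = x"
| "newton_sqrt (Suc i) m x = (let y = (x + m div x) div 2 in if x \<le> y then x else newton_sqrt i m y)"

text \<open>The start (a + 2^n) / 2 + 1 lies above sqrt (a 2^n) by the inequality of arithmetic and
  geometric means, and from above the iteration descends.\<close>

definition isqrt :: "nat \<Rightarrow> ivl \<Rightarrow> ivl option" where
  "isqrt n a = (case a of (a1, a2) \<Rightarrow>
     let l = newton_sqrt 9 (a1 * 2 ^ n) ((a1 + 2 ^ n) div 2 + 1); u = newton_sqrt 9 (a2 * 2 ^ n) ((a2 + 2 ^ n) div 2 + 1) + 1 in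
     if 0 < a1 \<and> 0 < l \<and> l * l \<le> a1 * 2 ^ n \<and> 0 < u \<and> a2 * 2 ^ n \<le> u * u then Some (l, u) else None)"

definition inum :: "nat \<Rightarrow> int \<Rightarrow> ivl" where
  "inum n c = (c * 2 ^ n, c * 2 ^ n)"

lemma in_iadd: "in_ivl n x a \<Longrightarrow> in_ivl n y b \<Longrightarrow> in_ivl n (x + y) (iadd a b)"
  by (auto simp: in_ivl_def iadd_def algebra_simps split: prod.splits)

lemma in_ineg: "in_ivl n x a \<Longrightarrow> in_ivl n (- x) (ineg a)"
  by (auto simp: in_ivl_def ineg_def split: prod.splits)

lemma in_inum: "in_ivl n (of_int c) (inum n c)"
  by (simp add: in_ivl_def inum_def)

lemma div_int_bounds:
  fixes p d :: int
  assumes "d > 0"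
  shows "p div d * d \<le> p" "p \<le> (p div d + 1) * d"
proof -
  have "p div d * d + p mod d = p" "0 \<le> p mod d" "p mod d < d" using assms by simp_all
  then show "p div d * d \<le> p" "p \<le> (p div d + 1) * d" by (simp_all only: distrib_right)
qed

lemma div_pow_bounds:
  fixes p :: int
  shows "of_int (p div 2 ^ n) * 2 ^ n \<le> (of_int p :: real)" "(of_int p :: real) \<le> of_int (p div 2 ^ n + 1) * 2 ^ n"
proof -
  have "p div 2 ^ n * 2 ^ n \<le> p" "p \<le> (p div 2 ^ n + 1) * 2 ^ n"
    using div_int_bounds[of "2 ^ n" p] by simp_all
  then show "of_int (p div 2 ^ n) * 2 ^ n \<le> (of_int p :: real)" "(of_int p :: real) \<le> of_int (p div 2 ^ n + 1) * 2 ^ n"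
    by (metis of_int_le_iff of_int_mult of_int_numeral of_int_power)+
qed

lemma of_int_min_max:
  fixes a b :: int
  shows "(of_int (min a b) :: real) = min (of_int a) (of_int b)" "(of_int (max a b) :: real) = max (of_int a) (of_int b)"
  by (simp_all add: min_def max_def)

text \<open>The product is affine in each factor, so its extremes lie at the corners of the
  rectangle: first in y for fixed a1 and a2, then in x for fixed y.\<close>

lemma mult_ivl_bounds:
  fixes x y :: real
  assumes "a1 \<le> x" "x \<le> a2" "b1 \<le> y" "y \<le> b2"
  shows "min (min (a1 * b1) (a1 * b2)) (min (a2 * b1) (a2 * b2)) \<le> x * y"
    "x * y \<le> max (max (a1 * b1) (a1 * b2)) (max (a2 * b1) (a2 * b2))"
proof -
  have A: "min (a * b1) (a * b2) \<le> a * y" "a * y \<le> max (a * b1) (a * b2)" for a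
    using assms(3,4) by (cases "0 \<le> a"; auto simp: min_le_iff_disj le_max_iff_disj mult_left_mono mult_left_mono_neg)+
  have B: "min (a1 * y) (a2 * y) \<le> x * y" "x * y \<le> max (a1 * y) (a2 * y)"
    using assms(1,2) by (cases "0 \<le> y"; auto simp: min_le_iff_disj le_max_iff_disj mult_right_mono mult_right_mono_neg)+
  show "min (min (a1 * b1) (a1 * b2)) (min (a2 * b1) (a2 * b2)) \<le> x * y"
    "x * y \<le> max (max (a1 * b1) (a1 * b2)) (max (a2 * b1) (a2 * b2))"
    using A[of a1] A[of a2] B by linarith+
qed

lemma in_imul:
  assumes "in_ivl n x a" "in_ivl n y b"
  shows "in_ivl n (x * y) (imul n a b)"
proof -
  obtain a1 a2 b1 b2 where ab: "a = (a1, a2)" "b = (b1, b2)" by (cases a, cases b)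
  define P where "P = (2 ^ n :: real)"
  have P: "P > 0" by (simp add: P_def)
  have x: "of_int a1 \<le> x * P" "x * P \<le> of_int a2" and y: "of_int b1 \<le> y * P" "y * P \<le> of_int b2"
    using assms by (auto simp: in_ivl_def ab P_def)
  have eq: "(x * P) * (y * P) = (x * y * P) * P" by simp
  have dv: "of_int (p div 2 ^ n) * P \<le> (of_int p :: real)" "(of_int p :: real) \<le> of_int (p div 2 ^ n + 1) * P" for p
    using div_pow_bounds[where p = p and n = n] by (simp_all add: P_def)
  have gen: "of_int (p div 2 ^ n) \<le> x * y * P" "x * y * P \<le> of_int (q div 2 ^ n + 1)"
    if "of_int p \<le> (x * P) * (y * P)" "(x * P) * (y * P) \<le> of_int q" for p q :: int
  proof -
    have "of_int (p div 2 ^ n) * P \<le> (x * y * P) * P" using dv(1)[of p] that(1) eq by linarith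
    then show "of_int (p div 2 ^ n) \<le> x * y * P" using P by simp
    have "(x * y * P) * P \<le> of_int (q div 2 ^ n + 1) * P" using dv(2)[of q] that(2) eq by linarith
    then show "x * y * P \<le> of_int (q div 2 ^ n + 1)" using P mult_le_cancel_right_pos by blast
  qed
  show ?thesis
  proof (cases "0 \<le> a1 \<and> 0 \<le> b1")
    case True
    then have "of_int (a1 * b1) \<le> (x * P) * (y * P)" "(x * P) * (y * P) \<le> of_int (a2 * b2)"
      using x y by (auto intro!: mult_mono)
    from gen[OF this] show ?thesis using True by (simp add: in_ivl_def imul_def ab P_def)
  next
    case False
    have "of_int (min (min (a1 * b1) (a1 * b2)) (min (a2 * b1) (a2 * b2))) \<le> (x * P) * (y * P)"
      "(x * P) * (y * P) \<le> of_int (max (max (a1 * b1) (a1 * b2)) (max (a2 * b1) (a2 * b2)))"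
      using mult_ivl_bounds[OF x y] by (simp_all only: of_int_min_max of_int_mult)
    from gen[OF this] show ?thesis using False by (simp only: in_ivl_def imul_def ab P_def Let_def prod.case if_False fst_conv snd_conv simp_thms)
  qed
qed

lemma in_iinv:
  assumes "in_ivl n x a" "iinv n a = Some b"
  shows "in_ivl n (inverse x) b" "x > 0"
proof -
  obtain a1 a2 where ab: "a = (a1, a2)" by (cases a)
  define P where "P = (2 ^ n :: real)"
  have P: "P > 0" by (simp add: P_def)
  have PP: "(4 ^ n :: real) = P * P" by (simp add: P_def flip: power_mult_distrib)
  have x: "of_int a1 \<le> x * P" "x * P \<le> of_int a2" 
    using assms by (auto simp: in_ivl_def ab P_def)
  have a1: "a1 > 0" and b: "b = (4 ^ n div a2, 4 ^ n div a1 + 1)"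
    using assms(2) by (auto simp: iinv_def ab split: if_splits)
  have "0 < x * P" using x a1 by (smt (verit) of_int_0_less_iff)
  then show x0: "x > 0" using P zero_less_mult_pos2 by blast
  have a2: "a2 > 0" using x a1 by (smt (verit) of_int_0_less_iff of_int_le_iff)
  have "4 ^ n div a2 * a2 \<le> 4 ^ n" "4 ^ n \<le> (4 ^ n div a1 + 1) * a1"
    using div_int_bounds[OF a2] div_int_bounds[OF a1] by blast+
  then have d: "of_int (4 ^ n div a2) * of_int a2 \<le> P * P" "P * P \<le> of_int (4 ^ n div a1 + 1) * of_int a1"
    unfolding PP[symmetric] by (metis of_int_le_iff of_int_mult of_int_numeral of_int_power)+
  have "of_int (4 ^ n div a2) * (x * P) \<le> P * P"
    using d(1) x(2) a2 by (smt (verit) mult_left_mono of_int_0_le_iff pos_imp_zdiv_nonneg_iff zero_le_power)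
  moreover have "P * P \<le> of_int (4 ^ n div a1 + 1) * (x * P)"
  proof -
    have "(0::real) \<le> of_int (4 ^ n div a1 + 1)" using a1 
      by (metis add.commute le_add_same_cancel1 of_int_0_le_iff order.trans pos_imp_zdiv_nonneg_iff zero_le_numeral zero_le_one zero_le_power add_increasing)
    then show ?thesis using d(2) x(1) by (smt (verit) mult_left_mono)
  qed
  ultimately have "of_int (4 ^ n div a2) * x \<le> P" "P \<le> of_int (4 ^ n div a1 + 1) * x"
    using P by (simp_all add: mult.assoc[symmetric])
  then show "in_ivl n (inverse x) b"
    using x0 by (simp add: in_ivl_def b P_def[symmetric] field_simps)
qed

lemma in_isqrt:
  assumes "in_ivl n x a" "isqrt n a = Some b"
  shows "in_ivl n (sqrt x) b" "x > 0"
proof -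
  obtain a1 a2 where ab: "a = (a1, a2)" by (cases a)
  obtain l u where b: "b = (l, u)" by (cases b)
  define P where "P = (2 ^ n :: real)"
  have P: "P > 0" by (simp add: P_def)
  have x: "of_int a1 \<le> x * P" "x * P \<le> of_int a2" 
    using assms by (auto simp: in_ivl_def ab P_def)
  have h: "0 < a1" "0 < l" "l * l \<le> a1 * 2 ^ n" "0 < u" "a2 * 2 ^ n \<le> u * u"
    using assms(2) by (auto simp: isqrt_def ab b Let_def split: if_splits)
  have r: "of_int l * of_int l \<le> of_int a1 * P" "of_int a2 * P \<le> of_int u * of_int u"
    using h(3,5) unfolding P_def by (metis of_int_le_iff of_int_mult of_int_numeral of_int_power)+
  have "0 < x * P" using x h(1) by (smt (verit) of_int_0_less_iff)
  then show x0: "x > 0" using P zero_less_mult_pos2 by blast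
  have sq: "sqrt x * P = sqrt (x * P * P)"
    using P by (simp add: real_sqrt_mult mult.assoc)
  have "(of_int l)\<^sup>2 \<le> x * P * P" using r(1) x(1) P by (smt (verit) mult_right_mono power2_eq_square)
  then have "of_int l \<le> sqrt x * P" unfolding sq by (rule real_le_rsqrt)
  moreover have "x * P * P \<le> (of_int u)\<^sup>2" using r(2) x(2) P by (smt (verit) mult_right_mono power2_eq_square)
  then have "sqrt x * P \<le> of_int u" unfolding sq using h(4) by (simp add: real_sqrt_le_iff real_le_lsqrt)
  ultimately show "in_ivl n (sqrt x) b" by (simp add: in_ivl_def b P_def)
qed

section \<open>Second order jets of algebraic expressions in one variable\<close>

datatype rterm = Num int | Var | Add rterm rterm | Neg rterm | Mul rterm rterm | Inv rterm | Sqrt rterm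

fun ev :: "rterm \<Rightarrow> real \<Rightarrow> real" where
  "ev (Num c) x = of_int c"
| "ev Var x = x"
| "ev (Add s t) x = ev s x + ev t x"
| "ev (Neg s) x = - ev s x"
| "ev (Mul s t) x = ev s x * ev t x"
| "ev (Inv s) x = inverse (ev s x)"
| "ev (Sqrt s) x = sqrt (ev s x)"

text \<open>Both derivatives follow the exact order of operations used by \<open>jet\<close>, for
  instance sqrt + sqrt in place of 2 sqrt, so that the enclosure can be proved operation by
  operation.\<close>

fun ev1 :: "rterm \<Rightarrow> real \<Rightarrow> real" where
  "ev1 (Num c) x = 0"
| "ev1 Var x = 1"
| "ev1 (Add s t) x = ev1 s x + ev1 t x"
| "ev1 (Neg s) x = - ev1 s x"
| "ev1 (Mul s t) x = ev1 s x * ev t x + ev s x * ev1 t x"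
| "ev1 (Inv s) x = - (ev1 s x * (inverse (ev s x) * inverse (ev s x)))"
| "ev1 (Sqrt s) x = ev1 s x * inverse (sqrt (ev s x) + sqrt (ev s x))"

fun ev2 :: "rterm \<Rightarrow> real \<Rightarrow> real" where
  "ev2 (Num c) x = 0"
| "ev2 Var x = 0"
| "ev2 (Add s t) x = ev2 s x + ev2 t x"
| "ev2 (Neg s) x = - ev2 s x"
| "ev2 (Mul s t) x = (ev2 s x * ev t x + ev s x * ev2 t x) + (ev1 s x * ev1 t x + ev1 s x * ev1 t x)"
| "ev2 (Inv s) x = (let f = inverse (ev s x); f1 = ev1 s x * (f * f) in
     - (ev2 s x * (f * f)) + (f1 * (ev1 s x * f) + f1 * (ev1 s x * f)))"
| "ev2 (Sqrt s) x = (let f = sqrt (ev s x); f1 = ev1 s x * inverse (f + f) in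
     (ev2 s x + - (f1 * f1 + f1 * f1)) * inverse (f + f))"

fun jet :: "nat \<Rightarrow> ivl \<Rightarrow> rterm \<Rightarrow> (ivl \<times> ivl \<times> ivl) option" where
  "jet n X (Num c) = Some (inum n c, (0, 0), (0, 0))"
| "jet n X Var = Some (X, inum n 1, (0, 0))"
| "jet n X (Add s t) = (case jet n X s of None \<Rightarrow> None | Some (a0, a1, a2) \<Rightarrow>
     case jet n X t of None \<Rightarrow> None | Some (b0, b1, b2) \<Rightarrow> Some (iadd a0 b0, iadd a1 b1, iadd a2 b2))"
| "jet n X (Neg s) = (case jet n X s of None \<Rightarrow> None | Some (a0, a1, a2) \<Rightarrow> Some (ineg a0, ineg a1, ineg a2))"
| "jet n X (Mul s t) = (case jet n X s of None \<Rightarrow> None | Some (a0, a1, a2) \<Rightarrow>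
     case jet n X t of None \<Rightarrow> None | Some (b0, b1, b2) \<Rightarrow>
     let c = imul n a1 b1 in
     Some (imul n a0 b0, iadd (imul n a1 b0) (imul n a0 b1),
       iadd (iadd (imul n a2 b0) (imul n a0 b2)) (iadd c c)))"
| "jet n X (Inv s) = (case jet n X s of None \<Rightarrow> None | Some (a0, a1, a2) \<Rightarrow>
     case iinv n a0 of None \<Rightarrow> None | Some f \<Rightarrow>
     let g = imul n f f; f1 = imul n a1 g; c = imul n f1 (imul n a1 f) in
     Some (f, ineg f1, iadd (ineg (imul n a2 g)) (iadd c c)))"
| "jet n X (Sqrt s) = (case jet n X s of None \<Rightarrow> None | Some (a0, a1, a2) \<Rightarrow>
     case isqrt n a0 of None \<Rightarrow> None | Some f \<Rightarrow>
     case iinv n (iadd f f) of None \<Rightarrow> None | Some g \<Rightarrow>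
     let f1 = imul n a1 g; c = imul n f1 f1 in
     Some (f, f1, imul n (iadd a2 (ineg (iadd c c))) g))"

lemma in_zero: "in_ivl n 0 (0, 0)" by (simp add: in_ivl_def)

text \<open>Differentiability is a conclusion, not an assumption: a successful evaluation has
  enclosed every argument of an inverse or a square root in a positive interval.\<close>

lemma jet_sound:
  assumes "jet n X e = Some (a0, a1, a2)" "in_ivl n x X"
  shows "in_ivl n (ev e x) a0 \<and> in_ivl n (ev1 e x) a1 \<and> in_ivl n (ev2 e x) a2
    \<and> (ev e has_real_derivative ev1 e x) (at x) \<and> (ev1 e has_real_derivative ev2 e x) (at x)"
  using assms(1)
proof (induction e arbitrary: a0 a1 a2)
  case (Num c)
  have 1: "ev (Num c) = (\<lambda>x. of_int c)" "ev1 (Num c) = (\<lambda>x. 0)" by auto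
  show ?case unfolding 1 using Num by (auto simp: in_inum in_zero)
next
  case Var
  have 1: "ev Var = (\<lambda>x. x)" "ev1 Var = (\<lambda>x. 1)" by auto
  show ?case unfolding 1 using Var assms(2) in_inum[of n 1] by (auto simp: in_zero)
next
  case (Add s t)
  have 1: "ev (Add s t) = (\<lambda>x. ev s x + ev t x)" "ev1 (Add s t) = (\<lambda>x. ev1 s x + ev1 t x)" by auto
  show ?case unfolding 1 using Add.prems Add.IH
    by (auto split: option.splits prod.splits intro!: in_iadd derivative_eq_intros)
next
  case (Neg s)
  have 1: "ev (Neg s) = (\<lambda>x. - ev s x)" "ev1 (Neg s) = (\<lambda>x. - ev1 s x)" by auto
  show ?case unfolding 1 using Neg.prems Neg.IH
    by (auto split: option.splits prod.splits intro!: in_ineg derivative_eq_intros)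
next
  case (Mul s t)
  have 1: "ev (Mul s t) = (\<lambda>x. ev s x * ev t x)" "ev1 (Mul s t) = (\<lambda>x. ev1 s x * ev t x + ev s x * ev1 t x)" by auto
  obtain b0 b1 b2 c0 c1 c2 where b: "jet n X s = Some (b0, b1, b2)" "jet n X t = Some (c0, c1, c2)"
    using Mul.prems by (auto split: option.splits prod.splits)
  note ih = Mul.IH(1)[OF b(1)] Mul.IH(2)[OF b(2)]
  have a: "a0 = imul n b0 c0" "a1 = iadd (imul n b1 c0) (imul n b0 c1)"
    "a2 = iadd (iadd (imul n b2 c0) (imul n b0 c2)) (iadd (imul n b1 c1) (imul n b1 c1))"
    using Mul.prems by (auto simp: b Let_def)
  have "((\<lambda>x. ev1 s x * ev t x + ev s x * ev1 t x) has_real_derivative ev2 (Mul s t) x) (at x)"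
    using ih by (auto intro!: derivative_eq_intros)
  then show ?case unfolding 1 a ev2.simps using ih
    by (intro conjI in_iadd in_imul) (auto intro!: derivative_eq_intros)
next
  case (Inv s)
  have 1: "ev (Inv s) = (\<lambda>x. inverse (ev s x))" "ev1 (Inv s) = (\<lambda>x. - (ev1 s x * (inverse (ev s x) * inverse (ev s x))))" by auto
  obtain b0 b1 b2 f where b: "jet n X s = Some (b0, b1, b2)" "iinv n b0 = Some f"
    using Inv.prems by (auto split: option.splits prod.splits)
  note ih = Inv.IH[OF b(1)]
  have nz: "ev s x \<noteq> 0" using in_iinv(2)[OF _ b(2)] ih by force
  have iv: "in_ivl n (inverse (ev s x)) f" using in_iinv(1)[OF _ b(2)] ih by blast
  have D1: "((\<lambda>x. inverse (ev s x)) has_real_derivative ev1 (Inv s) x) (at x)"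
    using ih nz by (auto intro!: derivative_eq_intros)
  have D2: "(ev1 (Inv s) has_real_derivative ev2 (Inv s) x) (at x)"
    unfolding 1 using ih nz by (auto simp: Let_def field_simps intro!: derivative_eq_intros)
  have a: "a0 = f" "a1 = ineg (imul n b1 (imul n f f))"
    "a2 = iadd (ineg (imul n b2 (imul n f f))) (iadd (imul n (imul n b1 (imul n f f)) (imul n b1 f))
      (imul n (imul n b1 (imul n f f)) (imul n b1 f)))"
    using Inv.prems by (auto simp: b Let_def)
  show ?case using D1 D2 ih iv unfolding 1 a ev2.simps Let_def
    by (intro conjI in_iadd in_imul in_ineg) simp_all
next
  case (Sqrt s)
  have 1: "ev (Sqrt s) = (\<lambda>x. sqrt (ev s x))" "ev1 (Sqrt s) = (\<lambda>x. ev1 s x * inverse (sqrt (ev s x) + sqrt (ev s x)))" by auto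
  obtain b0 b1 b2 f g where b: "jet n X s = Some (b0, b1, b2)" "isqrt n b0 = Some f" "iinv n (iadd f f) = Some g"
    using Sqrt.prems by (auto split: option.splits prod.splits)
  note ih = Sqrt.IH[OF b(1)]
  have nz: "ev s x > 0" using in_isqrt(2)[OF _ b(2)] ih by force
  have iv: "in_ivl n (sqrt (ev s x)) f" using in_isqrt(1)[OF _ b(2)] ih by blast
  have gv: "in_ivl n (inverse (sqrt (ev s x) + sqrt (ev s x))) g" using in_iinv(1)[OF in_iadd[OF iv iv] b(3)] .
  have D1: "((\<lambda>x. sqrt (ev s x)) has_real_derivative ev1 (Sqrt s) x) (at x)"
    using ih nz by (auto intro!: derivative_eq_intros simp: field_simps)
  have D2: "(ev1 (Sqrt s) has_real_derivative ev2 (Sqrt s) x) (at x)"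
    unfolding 1 using ih nz by (auto simp: Let_def field_simps intro!: derivative_eq_intros)
  have a: "a0 = f" "a1 = imul n b1 g"
    "a2 = imul n (iadd b2 (ineg (iadd (imul n (imul n b1 g) (imul n b1 g)) (imul n (imul n b1 g) (imul n b1 g))))) g"
    using Sqrt.prems by (auto simp: b Let_def)
  show ?case using D1 D2 ih iv gv unfolding 1 a ev2.simps Let_def
    by (intro conjI in_iadd in_imul in_ineg) simp_all
qed

section \<open>Integration over the projective ball\<close>

text \<open>The Klein density (1 - |x|^2)^-2 of hyperbolic volume, extended by 0 outside the ball so
  that all integrals run over the whole line in each variable.\<close>

definition wt :: "real \<Rightarrow> real \<Rightarrow> real \<Rightarrow> ennreal" where
  "wt x y z = (if x\<^sup>2 + y\<^sup>2 + z\<^sup>2 < 1 then ennreal (1 / (1 - x\<^sup>2 - y\<^sup>2 - z\<^sup>2)\<^sup>2) else 0)"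

lemma wt_measurable [measurable]:
  assumes [measurable]: "f \<in> borel_measurable M" "g \<in> borel_measurable M" "h \<in> borel_measurable M"
  shows "(\<lambda>x. wt (f x) (g x) (h x)) \<in> borel_measurable M"
  unfolding wt_def by measurable

lemma wt_sym:
  "wt y x z = wt x y z" "wt x z y = wt x y z" "wt x y (- z) = wt x y z"
  by (simp_all add: wt_def diff_diff_eq add.commute add.left_commute)

abbreviation borel4 :: "(real \<times> real \<times> real \<times> real) measure" where
  "borel4 \<equiv> borel \<Otimes>\<^sub>M borel \<Otimes>\<^sub>M borel \<Otimes>\<^sub>M borel"

text \<open>The integrand is a function of four homogeneous coordinates, evaluated on the slice
  where the first one is 1. A Lorentz map then acts linearly on its argument, and for integrands
  that are constant on rays the value is the integral over hyperbolic space, invariant under such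
  maps.\<close>

definition H3 :: "(real \<times> real \<times> real \<times> real \<Rightarrow> ennreal) \<Rightarrow> ennreal" where
  "H3 F = (\<integral>\<^sup>+x. \<integral>\<^sup>+y. \<integral>\<^sup>+z. wt x y z * F (1, x, y, z) \<partial>lborel \<partial>lborel \<partial>lborel)"

interpretation lborel_pair: pair_sigma_finite "lborel :: real measure" "lborel :: real measure" ..

lemma nn_integral_swap:
  fixes f :: "real \<Rightarrow> real \<Rightarrow> ennreal"
  assumes [measurable]: "(\<lambda>(x, y). f x y) \<in> borel_measurable (borel \<Otimes>\<^sub>M borel)"
  shows "(\<integral>\<^sup>+x. \<integral>\<^sup>+y. f x y \<partial>lborel \<partial>lborel) = (\<integral>\<^sup>+y. \<integral>\<^sup>+x. f x y \<partial>lborel \<partial>lborel)"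
proof -
  have "(\<lambda>(x, y). f y x) \<in> borel_measurable (lborel \<Otimes>\<^sub>M lborel)"
  proof -
    have "(\<lambda>p. (\<lambda>(x, y). f x y) (snd p, fst p)) \<in> borel_measurable (lborel \<Otimes>\<^sub>M lborel)"
      by measurable
    then show ?thesis by (simp add: case_prod_beta')
  qed
  from lborel_pair.Fubini'[OF this] show ?thesis by simp
qed

lemma H3_swap12:
  assumes [measurable]: "F \<in> borel_measurable borel4"
  shows "H3 (\<lambda>(a, x, y, z). F (a, y, x, z)) = H3 F"
proof -
  have "H3 (\<lambda>(a, x, y, z). F (a, y, x, z)) = (\<integral>\<^sup>+x. \<integral>\<^sup>+y. \<integral>\<^sup>+z. wt y x z * F (1, y, x, z) \<partial>lborel \<partial>lborel \<partial>lborel)"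
    unfolding H3_def by (simp add: wt_sym(1))
  also have "\<dots> = H3 F"
    unfolding H3_def by (subst nn_integral_swap) simp_all
  finally show ?thesis .
qed

lemma H3_swap23:
  assumes [measurable]: "F \<in> borel_measurable borel4"
  shows "H3 (\<lambda>(a, x, y, z). F (a, x, z, y)) = H3 F"
proof -
  have "H3 (\<lambda>(a, x, y, z). F (a, x, z, y)) = (\<integral>\<^sup>+x. \<integral>\<^sup>+y. \<integral>\<^sup>+z. wt x z y * F (1, x, z, y) \<partial>lborel \<partial>lborel \<partial>lborel)"
    unfolding H3_def by (simp add: wt_sym(2))
  also have "\<dots> = H3 F"
    unfolding H3_def by (subst nn_integral_swap) simp_all
  finally show ?thesis .
qed

lemma H3_flip3:
  assumes [measurable]: "F \<in> borel_measurable borel4"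
  shows "H3 (\<lambda>(a, x, y, z). F (a, x, y, - z)) = H3 F"
proof -
  have "(\<integral>\<^sup>+z. wt x y z * F (1, x, y, z) \<partial>lborel) = (\<integral>\<^sup>+z. wt x y z * F (1, x, y, - z) \<partial>lborel)" for x y
    by (subst nn_integral_real_affine[where c = "-1" and t = 0]) (simp_all add: wt_sym(3))
  then show ?thesis unfolding H3_def by simp
qed

lemma nn_integral_shear:
  fixes f :: "real \<times> real \<Rightarrow> ennreal"
  assumes [measurable]: "f \<in> borel_measurable (borel \<Otimes>\<^sub>M borel)"
  shows "(\<integral>\<^sup>+x. \<integral>\<^sup>+y. f (x, y + t * x) \<partial>lborel \<partial>lborel) = (\<integral>\<^sup>+x. \<integral>\<^sup>+y. f (x, y) \<partial>lborel \<partial>lborel)"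
    and "(\<integral>\<^sup>+x. \<integral>\<^sup>+y. f (x + t * y, y) \<partial>lborel \<partial>lborel) = (\<integral>\<^sup>+x. \<integral>\<^sup>+y. f (x, y) \<partial>lborel \<partial>lborel)"
proof -
  have A: "(\<integral>\<^sup>+y. g (y + c) \<partial>lborel) = (\<integral>\<^sup>+y. g y \<partial>lborel)" if "g \<in> borel_measurable borel" for g :: "real \<Rightarrow> ennreal" and c
    using nn_integral_real_affine[OF that, of 1 c] by (simp add: add.commute)
  show "(\<integral>\<^sup>+x. \<integral>\<^sup>+y. f (x, y + t * x) \<partial>lborel \<partial>lborel) = (\<integral>\<^sup>+x. \<integral>\<^sup>+y. f (x, y) \<partial>lborel \<partial>lborel)"
    by (intro nn_integral_cong A) measurable
  have "(\<integral>\<^sup>+x. \<integral>\<^sup>+y. f (x + t * y, y) \<partial>lborel \<partial>lborel) = (\<integral>\<^sup>+y. \<integral>\<^sup>+x. f (x + t * y, y) \<partial>lborel \<partial>lborel)"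
    by (rule nn_integral_swap) measurable
  also have "\<dots> = (\<integral>\<^sup>+y. \<integral>\<^sup>+x. f (x, y) \<partial>lborel \<partial>lborel)"
    by (intro nn_integral_cong A[of "\<lambda>x. f (x, _)"]) measurable
  also have "\<dots> = (\<integral>\<^sup>+x. \<integral>\<^sup>+y. f (x, y) \<partial>lborel \<partial>lborel)"
    by (rule nn_integral_swap[symmetric]) measurable
  finally show "(\<integral>\<^sup>+x. \<integral>\<^sup>+y. f (x + t * y, y) \<partial>lborel \<partial>lborel) = (\<integral>\<^sup>+x. \<integral>\<^sup>+y. f (x, y) \<partial>lborel \<partial>lborel)" .
qed

text \<open>A plane rotation is a composition of three shears.\<close>
lemma nn_integral_rotate:
  fixes f :: "real \<times> real \<Rightarrow> ennreal" and c s :: real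
  assumes [measurable]: "f \<in> borel_measurable (borel \<Otimes>\<^sub>M borel)" and cs: "c\<^sup>2 + s\<^sup>2 = 1" "c \<noteq> -1"
  shows "(\<integral>\<^sup>+x. \<integral>\<^sup>+y. f (c * x - s * y, s * x + c * y) \<partial>lborel \<partial>lborel) = (\<integral>\<^sup>+x. \<integral>\<^sup>+y. f (x, y) \<partial>lborel \<partial>lborel)"
proof -
  \<comment> \<open>The tangent of half the rotation angle: a horizontal shear by -t, a vertical one
    by s and again a horizontal one by -t compose to the rotation. For c = -1 this tangent is
    infinite, which is why the half turn is excluded.\<close>
  define t where "t = s / (1 + c)"
  have c1: "1 + c \<noteq> 0" using cs(2) by linarith
  have t: "t * (1 + c) = s" using c1 by (simp add: t_def)
  have "s * s = (1 - c) * (1 + c)" using cs(1) by (simp add: power2_eq_square algebra_simps)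
  then have st: "s * t = 1 - c" using c1 by (simp add: t_def)
  define g1 where "g1 = (\<lambda>(x, y). f (x + (- t) * y, y))"
  define g2 where "g2 = (\<lambda>(x, y). g1 (x, y + s * x))"
  have [measurable]: "g1 \<in> borel_measurable (borel \<Otimes>\<^sub>M borel)" unfolding g1_def by measurable
  have [measurable]: "g2 \<in> borel_measurable (borel \<Otimes>\<^sub>M borel)" unfolding g2_def by measurable
  have e1: "x - t * y - t * (y + s * (x - t * y)) = c * x - s * y" for x y
  proof -
    have "x - t * y - t * (y + s * (x - t * y)) = x * (1 - s * t) - y * (t * (1 + (1 - s * t)))" by (simp add: algebra_simps)
    also have "\<dots> = c * x - s * y" using st t by (simp add: mult.commute)
    finally show ?thesis .
  qed
  have e2: "y + s * (x - t * y) = s * x + c * y" for x y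
  proof -
    have "y + s * (x - t * y) = s * x + (1 - s * t) * y" by (simp add: algebra_simps)
    then show ?thesis using st by simp
  qed
  have "f (c * x - s * y, s * x + c * y) = g2 (x + (- t) * y, y)" for x y
    unfolding g2_def g1_def using e1[of x y] e2[of y x] by simp
  then have "(\<integral>\<^sup>+x. \<integral>\<^sup>+y. f (c * x - s * y, s * x + c * y) \<partial>lborel \<partial>lborel)
    = (\<integral>\<^sup>+x. \<integral>\<^sup>+y. g2 (x + (- t) * y, y) \<partial>lborel \<partial>lborel)" by (simp only:)
  also have "\<dots> = (\<integral>\<^sup>+x. \<integral>\<^sup>+y. g2 (x, y) \<partial>lborel \<partial>lborel)" by (rule nn_integral_shear) measurable
  also have "\<dots> = (\<integral>\<^sup>+x. \<integral>\<^sup>+y. g1 (x, y) \<partial>lborel \<partial>lborel)"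
    unfolding g2_def prod.case by (rule nn_integral_shear) measurable
  also have "\<dots> = (\<integral>\<^sup>+x. \<integral>\<^sup>+y. f (x, y) \<partial>lborel \<partial>lborel)"
    unfolding g1_def prod.case by (rule nn_integral_shear) measurable
  finally show ?thesis .
qed

lemma H3_rotate12:
  assumes [measurable]: "F \<in> borel_measurable borel4" and cs: "c\<^sup>2 + s\<^sup>2 = 1" "c \<noteq> -1"
  shows "H3 (\<lambda>(a, x, y, z). F (a, c * x - s * y, s * x + c * y, z)) = H3 F"
proof -
  have "(c * x - s * y)\<^sup>2 + (s * x + c * y)\<^sup>2 = (c\<^sup>2 + s\<^sup>2) * (x\<^sup>2 + y\<^sup>2)" for x y
    by (simp add: power2_eq_square algebra_simps)
  then have sq: "(c * x - s * y)\<^sup>2 + (s * x + c * y)\<^sup>2 = x\<^sup>2 + y\<^sup>2" for x y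
    using cs(1) by simp
  have w: "wt (c * x - s * y) (s * x + c * y) z = wt x y z" for x y z
    using sq[of x y] unfolding wt_def by (simp add: diff_diff_eq)
  define f where "f = (\<lambda>(x, y). \<integral>\<^sup>+z. wt x y z * F (1, x, y, z) \<partial>lborel)"
  have [measurable]: "f \<in> borel_measurable (borel \<Otimes>\<^sub>M borel)" unfolding f_def by measurable
  have "H3 (\<lambda>(a, x, y, z). F (a, c * x - s * y, s * x + c * y, z))
    = (\<integral>\<^sup>+x. \<integral>\<^sup>+y. f (c * x - s * y, s * x + c * y) \<partial>lborel \<partial>lborel)"
    unfolding H3_def f_def by (simp add: w)
  also have "\<dots> = (\<integral>\<^sup>+x. \<integral>\<^sup>+y. f (x, y) \<partial>lborel \<partial>lborel)" by (rule nn_integral_rotate[OF _ cs]) measurable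
  finally show ?thesis unfolding H3_def f_def by simp
qed

definition homogeneous :: "(real \<times> real \<times> real \<times> real \<Rightarrow> ennreal) \<Rightarrow> bool" where
  "homogeneous F \<longleftrightarrow> (\<forall>r a b c d. r > 0 \<longrightarrow> F (r * a, r * b, r * c, r * d) = F (a, b, c, d))"

text \<open>After the boost the first coordinate is D = g (1 + v x), so rescaling to the slice
  replaces x by the Moebius map m x = (x + v) / (1 + v x) and divides y and z by D. The density
  contributes D^-4 and the two dilations contribute D^2; the remaining D^-2 equals m'(x), the
  Jacobian of the substitution in x.\<close>

lemma H3_boost1:
  assumes [measurable]: "F \<in> borel_measurable borel4" and hom: "homogeneous F"
    and g: "g\<^sup>2 * (1 - v\<^sup>2) = 1" "g > 0"
  shows "H3 (\<lambda>(a, x, y, z). F (g * (a + v * x), g * (x + v * a), y, z)) = H3 F"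
proof -
  have v1: "v\<^sup>2 < 1"
  proof (rule ccontr)
    assume "\<not> v\<^sup>2 < 1"
    then have "g\<^sup>2 * (1 - v\<^sup>2) \<le> 0" by (simp add: mult_nonneg_nonpos)
    then show False using g(1) by simp
  qed
  then have v: "\<bar>v\<bar> < 1" by (simp add: abs_square_less_1)
  define K where "K X = (\<integral>\<^sup>+y. \<integral>\<^sup>+z. wt X y z * F (1, X, y, z) \<partial>lborel \<partial>lborel)" for X
  have [measurable]: "K \<in> borel_measurable borel" unfolding K_def by measurable
  define m where "m x = (x + v) / (1 + v * x)" for x
  define m' where "m' x = (1 - v\<^sup>2) / (1 + v * x)\<^sup>2" for x
  have pos: "1 + v * x > 0" if "x \<in> {-1..1}" for x
  proof -
    have "\<bar>v * x\<bar> \<le> \<bar>v\<bar> * 1" using that unfolding abs_mult by (intro mult_left_mono) auto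
    then show ?thesis using v by linarith
  qed
  have key: "(\<integral>\<^sup>+y. \<integral>\<^sup>+z. wt x y z * F (g * (1 + v * x), g * (x + v), y, z) \<partial>lborel \<partial>lborel) = K (m x) * ennreal (m' x)"
    if x: "x \<in> {-1..1}" for x
  proof -
    define D where "D = g * (1 + v * x)"
    have D: "D > 0" using pos[OF x] g(2) by (simp add: D_def)
    have eqx: "1 - x\<^sup>2 = D\<^sup>2 * (1 - (m x)\<^sup>2)"
    proof -
      have "D\<^sup>2 * (1 - (m x)\<^sup>2) = g\<^sup>2 * ((1 + v * x)\<^sup>2 - (x + v)\<^sup>2)"
        using pos[OF x] by (simp add: D_def m_def power_divide power_mult_distrib right_diff_distrib)
      also have "\<dots> = g\<^sup>2 * (1 - v\<^sup>2) * (1 - x\<^sup>2)" by (simp add: power2_eq_square algebra_simps)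
      finally show ?thesis using g(1) by simp
    qed
    have W: "wt x (D * y) (D * z) = ennreal (1 / D ^ 4) * wt (m x) y z" for y z
    proof -
      have e: "1 - x\<^sup>2 - (D * y)\<^sup>2 - (D * z)\<^sup>2 = D\<^sup>2 * (1 - (m x)\<^sup>2 - y\<^sup>2 - z\<^sup>2)"
        using eqx by (simp add: power_mult_distrib algebra_simps)
      have iff: "x\<^sup>2 + (D * y)\<^sup>2 + (D * z)\<^sup>2 < 1 \<longleftrightarrow> (m x)\<^sup>2 + y\<^sup>2 + z\<^sup>2 < 1"
      proof -
        have "x\<^sup>2 + (D * y)\<^sup>2 + (D * z)\<^sup>2 < 1 \<longleftrightarrow> 0 < 1 - x\<^sup>2 - (D * y)\<^sup>2 - (D * z)\<^sup>2" by linarith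
        also have "\<dots> \<longleftrightarrow> 0 < 1 - (m x)\<^sup>2 - y\<^sup>2 - z\<^sup>2" unfolding e using D by (simp add: zero_less_mult_iff)
        finally show ?thesis by linarith
      qed
      have "(D\<^sup>2 * u)\<^sup>2 = D ^ 4 * u\<^sup>2" for u by (simp add: power_mult_distrib flip: power_mult)
      then show ?thesis unfolding wt_def iff e by (simp add: ennreal_mult'[symmetric])
    qed
    have Fh: "F (g * (1 + v * x), g * (x + v), D * y, D * z) = F (1, m x, y, z)" for y z
    proof -
      have "g * (x + v) = D * m x" using pos[OF x] by (simp add: D_def m_def)
      then show ?thesis using hom D unfolding homogeneous_def by (metis D_def mult.right_neutral)
    qed
    have in1: "(\<integral>\<^sup>+z. wt x y z * F (g * (1 + v * x), g * (x + v), y, z) \<partial>lborel)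
      = ennreal D * (\<integral>\<^sup>+z. wt x y (D * z) * F (g * (1 + v * x), g * (x + v), y, D * z) \<partial>lborel)" for y
      by (subst nn_integral_real_affine[where c = D and t = 0]) (use D in auto)
    have "(\<integral>\<^sup>+y. \<integral>\<^sup>+z. wt x y z * F (g * (1 + v * x), g * (x + v), y, z) \<partial>lborel \<partial>lborel)
      = ennreal D * (\<integral>\<^sup>+y. ennreal D * (\<integral>\<^sup>+z. wt x (D * y) (D * z) * F (g * (1 + v * x), g * (x + v), D * y, D * z) \<partial>lborel) \<partial>lborel)"
      unfolding in1 by (subst nn_integral_real_affine[where c = D and t = 0]) (use D in auto)
    also have "\<dots> = ennreal D * (ennreal D * (ennreal (1 / D ^ 4) * K (m x)))"
      unfolding W Fh K_def mult.assoc
      by ((subst nn_integral_cmult, measurable)+)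
    also have "\<dots> = ennreal (D * D * (1 / D ^ 4)) * K (m x)"
    proof -
      have "ennreal D * (ennreal D * (ennreal c * w)) = ennreal (D * D * c) * w" for c w
        using D by (simp only: ennreal_mult' mult.assoc less_imp_le mult_nonneg_nonneg)
      then show ?thesis .
    qed
    also have "D * D * (1 / D ^ 4) = m' x"
    proof -
      have "D * D * (1 / D ^ 4) = 1 / D\<^sup>2" using D by (simp add: power2_eq_square power4_eq_xxxx field_simps)
      also have "\<dots> = m' x"
      proof -
        have "1 - v\<^sup>2 = 1 / g\<^sup>2" using g by (simp add: eq_divide_eq mult.commute)
        then show ?thesis unfolding D_def m'_def by (simp add: power_mult_distrib)
      qed
      finally show ?thesis .
    qed
    finally show ?thesis by (simp add: mult.commute)
  qed
  have ind: "indicator {-1..1} x * wt x y z = wt x y z" for x y z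
  proof -
    have "x\<^sup>2 < 1" if "x\<^sup>2 + y\<^sup>2 + z\<^sup>2 < 1" using that zero_le_power2[of y] zero_le_power2[of z] by linarith
    then have "x\<^sup>2 + y\<^sup>2 + z\<^sup>2 < 1 \<Longrightarrow> \<bar>x\<bar> < 1" by (simp add: abs_square_less_1)
    then show ?thesis unfolding wt_def by (auto simp: indicator_def)
  qed
  have ind': "H3 G = (\<integral>\<^sup>+x. (\<integral>\<^sup>+y. \<integral>\<^sup>+z. wt x y z * G (1, x, y, z) \<partial>lborel \<partial>lborel) * indicator {-1..1} x \<partial>lborel)"
    if [measurable]: "G \<in> borel_measurable borel4" for G
  proof -
    have "H3 G = (\<integral>\<^sup>+x. \<integral>\<^sup>+y. \<integral>\<^sup>+z. indicator {-1..1} x * (wt x y z * G (1, x, y, z)) \<partial>lborel \<partial>lborel \<partial>lborel)"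
      unfolding H3_def by (simp add: mult.assoc[symmetric] ind)
    also have "\<dots> = (\<integral>\<^sup>+x. indicator {-1..1} x * (\<integral>\<^sup>+y. \<integral>\<^sup>+z. wt x y z * G (1, x, y, z) \<partial>lborel \<partial>lborel) \<partial>lborel)"
      by ((subst nn_integral_cmult, measurable)+; simp)
    finally show ?thesis by (simp add: mult.commute)
  qed
  have "H3 (\<lambda>(a, x, y, z). F (g * (a + v * x), g * (x + v * a), y, z))
    = (\<integral>\<^sup>+x. (\<integral>\<^sup>+y. \<integral>\<^sup>+z. wt x y z * F (g * (1 + v * x), g * (x + v), y, z) \<partial>lborel \<partial>lborel) * indicator {-1..1} x \<partial>lborel)"
    by (subst ind') simp_all
  also have "\<dots> = (\<integral>\<^sup>+x. K (m x) * ennreal (m' x) * indicator {-1..1} x \<partial>lborel)"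
    by (intro nn_integral_cong) (auto simp: indicator_def key)
  \<comment> \<open>Restriction to [-1, 1], outside of which the density vanishes, makes the
    substitution possible: there 1 + v x > 0, and m maps this interval onto itself.\<close>
  also have "\<dots> = (\<integral>\<^sup>+x. K x * indicator {m (-1)..m 1} x \<partial>lborel)"
  proof (rule nn_integral_substitution_aux[symmetric])
    show "(m has_real_derivative m' x) (at x)" if "x \<in> {-1..1}" for x
      unfolding m_def m'_def using pos[OF that]
      by (auto intro!: derivative_eq_intros simp: power2_eq_square field_simps)
    show "continuous_on {-1..1} m'" unfolding m'_def using pos
      by (intro continuous_intros) (auto simp: less_imp_neq[symmetric])
    show "0 \<le> m' x" for x unfolding m'_def using v1 by simp
  qed auto
  also have "m (-1) = -1" using v by (simp add: m_def field_simps)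
  also have "m 1 = 1" using v by (simp add: m_def field_simps)
  also have "(\<integral>\<^sup>+x. K x * indicator {-1..1} x \<partial>lborel) = H3 F"
    unfolding K_def by (rule ind'[symmetric]) measurable
  finally show ?thesis .
qed

text \<open>A boost along z combined with the reflection of z. The reflection is built in so that
  the coordinate r of \<open>frame\<close> grows from the truncating plane towards the middle of the
  edge.\<close>

lemma H3_boost3:
  assumes [measurable]: "F \<in> borel_measurable borel4" and hom: "homogeneous F"
    and g: "g\<^sup>2 * (1 - v\<^sup>2) = 1" "g > 0"
  shows "H3 (\<lambda>(a, x, y, z). F (g * (a - v * z), x, y, g * (v * a - z))) = H3 F"
proof -
  have rev: "H3 (\<lambda>(a, x, y, z). G (a, z, y, x)) = H3 G" if [measurable]: "G \<in> borel_measurable borel4" for G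
  proof -
    have "H3 (\<lambda>(a, x, y, z). G (a, z, y, x)) = H3 (\<lambda>(a, x, y, z). G (a, z, x, y))"
    proof -
      have "H3 (\<lambda>(a, x, y, z). (\<lambda>(a, x, y, z). G (a, z, x, y)) (a, y, x, z)) = H3 (\<lambda>(a, x, y, z). G (a, z, x, y))"
        by (rule H3_swap12) measurable
      then show ?thesis by (simp only: prod.case)
    qed
    also have "\<dots> = H3 (\<lambda>(a, x, y, z). G (a, y, x, z))"
    proof -
      have "H3 (\<lambda>(a, x, y, z). (\<lambda>(a, x, y, z). G (a, y, x, z)) (a, x, z, y)) = H3 (\<lambda>(a, x, y, z). G (a, y, x, z))"
        by (rule H3_swap23) measurable
      then show ?thesis by (simp only: prod.case)
    qed
    also have "\<dots> = H3 G" by (rule H3_swap12) measurable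
    finally show ?thesis .
  qed
  define G where "G = (\<lambda>(a, x, y, z). F (a, z, y, x))"
  have [measurable]: "G \<in> borel_measurable borel4" unfolding G_def by measurable
  have "homogeneous G" using hom unfolding homogeneous_def G_def by simp
  define G' where "G' = (\<lambda>(a, x, y, z). G (g * (a + v * x), g * (x + v * a), y, z))"
  have [measurable]: "G' \<in> borel_measurable borel4" unfolding G'_def by measurable
  define G'' where "G'' = (\<lambda>(a, x, y, z). G' (a, z, y, x))"
  have [measurable]: "G'' \<in> borel_measurable borel4" unfolding G''_def by measurable
  have "H3 (\<lambda>(a, x, y, z). F (g * (a - v * z), x, y, g * (v * a - z))) = H3 (\<lambda>(a, x, y, z). G'' (a, x, y, - z))"
    by (simp add: G''_def G'_def G_def algebra_simps)
  also have "\<dots> = H3 G''" by (rule H3_flip3) measurable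
  also have "\<dots> = H3 G'" unfolding G''_def by (rule rev) measurable
  also have "\<dots> = H3 G" unfolding G'_def by (rule H3_boost1[OF _ \<open>homogeneous G\<close> g]) measurable
  also have "\<dots> = H3 F" unfolding G_def by (rule rev) measurable
  finally show ?thesis .
qed

section \<open>The Lorentz frame at the foot of an edge\<close>

text \<open>Composed of a reflecting boost of velocity t along the edge, a rotation in the (p, q)
  plane, a boost of velocity sqrt 2 Y along the diagonal of the (x, y) plane, a rotation by 45
  degrees and a swap of two coordinates. The second boost takes the origin to the midpoint (Y, Y, 0)
  of an edge; with t = s / Y the whole map takes it to the point (Y, Y, s^2 / Y) where that edge
  meets the truncating plane.\<close>

definition frame :: "real \<Rightarrow> real \<Rightarrow> real \<Rightarrow> real \<Rightarrow> real \<Rightarrow> real \<times> real \<times> real \<times> real \<Rightarrow> real \<times> real \<times> real \<times> real" where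
  "frame Y s n t ch = (\<lambda>(a, p, q, r).
     let e = ch * (a - t * r); z = ch * (t * a - r); u = - (p + s * q) / n; w = (s * p - q) / n;
       d = (e + sqrt 2 * Y * u) / s; m = (u + sqrt 2 * Y * e) / s
     in (d, (m + w) / sqrt 2, (m - w) / sqrt 2, z))"

text \<open>The hypotheses are the normalisations of the factors: 1 / s is the Lorentz factor for
  velocity sqrt 2 Y, n^2 = 1 + s^2 makes (-1 / n, s / n) a unit vector, and \<open>ch\<close> is the
  Lorentz factor for velocity t.\<close>

lemma H3_frame:
  assumes [measurable]: "F \<in> borel_measurable borel4" and hom: "homogeneous F"
    and s: "s > 0" "s\<^sup>2 = 1 - 2 * Y\<^sup>2" and n: "n > 0" "n\<^sup>2 = 2 * (1 - Y\<^sup>2)"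
    and ch: "ch > 0" "ch\<^sup>2 * (1 - t\<^sup>2) = 1"
  shows "H3 F = H3 (\<lambda>X. F (frame Y s n t ch X))"
proof -
  define r2 where "r2 = sqrt (2::real)"
  have r2: "r2 > 0" "r2 * r2 = 2" by (simp_all add: r2_def)
  define F0 where "F0 = (\<lambda>(a, x, y, z). F (a, y, x, z))"
  define F1 where "F1 = (\<lambda>(a, x, y, z). F0 (a, 1 / r2 * x - 1 / r2 * y, 1 / r2 * x + 1 / r2 * y, z))"
  define F2 where "F2 = (\<lambda>(a, x, y, z). F1 (1 / s * (a + r2 * Y * x), 1 / s * (x + r2 * Y * a), y, z))"
  define F3 where "F3 = (\<lambda>(a, p, q, z). F2 (a, (- 1 / n) * p - (s / n) * q, (s / n) * p + (- 1 / n) * q, z))"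
  define F4 where "F4 = (\<lambda>(a, x, y, z). F3 (ch * (a - t * z), x, y, ch * (t * a - z)))"
  have [measurable]: "F0 \<in> borel_measurable borel4" unfolding F0_def by measurable
  have [measurable]: "F1 \<in> borel_measurable borel4" unfolding F1_def by measurable
  have [measurable]: "F2 \<in> borel_measurable borel4" unfolding F2_def by measurable
  have [measurable]: "F3 \<in> borel_measurable borel4" unfolding F3_def by measurable
  have h: "F (r * a, r * b, r * c, r * d) = F (a, b, c, d)" if "r > 0" for r a b c d
    using hom that unfolding homogeneous_def by blast
  have h0: "F0 (r * a, r * b, r * c, r * d) = F0 (a, b, c, d)" if "r > 0" for r a b c d
    unfolding F0_def using h[OF that] by simp
  have h1: "F1 (r * a, r * b, r * c, r * d) = F1 (a, b, c, d)" if "r > 0" for r a b c d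
  proof -
    have "1 / r2 * (r * b) - 1 / r2 * (r * c) = r * (1 / r2 * b - 1 / r2 * c)"
      "1 / r2 * (r * b) + 1 / r2 * (r * c) = r * (1 / r2 * b + 1 / r2 * c)" by (simp_all add: algebra_simps)
    then show ?thesis unfolding F1_def prod.case using h0[OF that] by simp
  qed
  have h2: "F2 (r * a, r * b, r * c, r * d) = F2 (a, b, c, d)" if "r > 0" for r a b c d
  proof -
    have "1 / s * (r * a + r2 * Y * (r * b)) = r * (1 / s * (a + r2 * Y * b))"
      "1 / s * (r * b + r2 * Y * (r * a)) = r * (1 / s * (b + r2 * Y * a))" by (simp_all add: algebra_simps)
    then show ?thesis unfolding F2_def prod.case using h1[OF that] by metis
  qed
  have h3: "F3 (r * a, r * b, r * c, r * d) = F3 (a, b, c, d)" if "r > 0" for r a b c d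
  proof -
    have "(- 1 / n) * (r * b) - (s / n) * (r * c) = r * ((- 1 / n) * b - (s / n) * c)"
      "(s / n) * (r * b) + (- 1 / n) * (r * c) = r * ((s / n) * b + (- 1 / n) * c)" by (simp_all add: algebra_simps)
    then show ?thesis unfolding F3_def prod.case using h2[OF that] by metis
  qed
  have "H3 (\<lambda>X. F (frame Y s n t ch X)) = H3 F4"
  proof -
    have "F (frame Y s n t ch (a, p, q, r)) = F4 (a, p, q, r)" for a p q r
    proof -
      have e: "(- 1 / n) * p - (s / n) * q = - (p + s * q) / n" "(s / n) * p + (- 1 / n) * q = (s * p - q) / n"
        "1 / s * b = b / s" "1 / r2 * b - 1 / r2 * c = (b - c) / r2" "1 / r2 * b + 1 / r2 * c = (b + c) / r2" for b c
        by (simp_all add: diff_divide_distrib add_divide_distrib)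
      show ?thesis unfolding frame_def F4_def F3_def F2_def F1_def F0_def Let_def r2_def[symmetric] prod.case e ..
    qed
    then have "F (frame Y s n t ch X) = F4 X" for X by (cases X) simp
    then show ?thesis by simp
  qed
  also have "\<dots> = H3 F3" unfolding F4_def
    by (rule H3_boost3[OF _ _ ch(2,1)]) (measurable, simp add: homogeneous_def h3)
  also have "\<dots> = H3 F2" unfolding F3_def
  proof (rule H3_rotate12)
    have "1 + s\<^sup>2 = n\<^sup>2" using s(2) n(2) by simp
    then show "(- 1 / n)\<^sup>2 + (s / n)\<^sup>2 = 1" using n(1) by (simp add: power_divide add_divide_distrib[symmetric])
    show "- 1 / n \<noteq> - 1"
    proof
      assume "- 1 / n = - 1"
      then have "n = 1" using n(1) by (simp add: field_simps)
      with \<open>1 + s\<^sup>2 = n\<^sup>2\<close> s(1) show False by simp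
    qed
  qed measurable
  also have "\<dots> = H3 F1" unfolding F2_def
  proof (rule H3_boost1)
    have "(r2 * Y)\<^sup>2 = 2 * Y\<^sup>2" using r2 by (simp add: power_mult_distrib power2_eq_square)
    then have "1 - (r2 * Y)\<^sup>2 = s\<^sup>2" using s(2) by simp
    then show "(1 / s)\<^sup>2 * (1 - (r2 * Y)\<^sup>2) = 1" using s(1) by (simp add: power_divide)
  qed (use s(1) in \<open>simp_all add: homogeneous_def h1\<close>)
  also have "\<dots> = H3 F0" unfolding F1_def
  proof (rule H3_rotate12)
    show "(1 / r2)\<^sup>2 + (1 / r2)\<^sup>2 = 1" using r2 by (simp add: power2_eq_square)
    show "1 / r2 \<noteq> - 1" using r2(1) by (smt (verit) divide_pos_pos)
  qed measurable
  also have "\<dots> = H3 F" unfolding F0_def by (rule H3_swap12) measurable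
  finally show ?thesis by simp
qed

text \<open>In the new coordinates the bounding planes of one of the 48 pieces are in simple
  position: the face x = Y is q = 0, the mirror x = y is q = s p, the mirror y = z is p = const, the
  truncating plane is r = 0 and the mirror z = 0 is r = t. The choice t = s / Y is what removes the
  mixed terms. The last statement says that the map preserves the Lorentz form.\<close>

lemma frame_forms:
  assumes s: "s > 0" "s\<^sup>2 = 1 - 2 * Y\<^sup>2" and n: "n > 0" "n\<^sup>2 = 2 * (1 - Y\<^sup>2)"
    and Y: "Y > 0" and t: "t = s / Y"
    and fr: "frame Y s n t ch (a, p, q, r) = (d, x, y, z)"
  shows "Y * d - x = n / sqrt 2 * q" "x - y = sqrt 2 / n * (s * p - q)"
    "y - z = n / (s * sqrt 2) * (ch * sqrt 2 * (Y\<^sup>2 - s\<^sup>2) / (Y * n) * a - p)"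
    "d - Y * (x + y + z) = (Y\<^sup>2 - s\<^sup>2) / Y * ch * r" "z = ch * (t * a - r)"
    "ch\<^sup>2 * (1 - t\<^sup>2) = 1 \<Longrightarrow> d\<^sup>2 - x\<^sup>2 - y\<^sup>2 - z\<^sup>2 = a\<^sup>2 - p\<^sup>2 - q\<^sup>2 - r\<^sup>2"
proof -
  define r2 where "r2 = sqrt (2::real)"
  have r2: "r2 > 0" "r2 * r2 = 2" by (simp_all add: r2_def)
  define e where "e = ch * (a - t * r)"
  define u where "u = - (p + s * q) / n"
  define w where "w = (s * p - q) / n"
  define m where "m = (u + r2 * Y * e) / s"
  have X: "d = (e + r2 * Y * u) / s" "x = (m + w) / r2" "y = (m - w) / r2" and z: "z = ch * (t * a - r)"
    using fr unfolding frame_def Let_def r2_def e_def u_def w_def m_def by auto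
  have sm: "s * m = u + r2 * Y * e" and sd: "s * d = e + r2 * Y * u" using s(1) by (simp_all add: m_def X)
  have nu: "n * u = - (p + s * q)" and nw: "n * w = s * p - q" using n(1) by (simp_all add: u_def w_def)
  have rx: "r2 * x = m + w" and ry: "r2 * y = m - w" using r2 by (simp_all add: X)
  have n2: "n * n = 1 + s * s" using n(2) s(2) by (simp add: power2_eq_square)
  have ss: "s * s = 1 - 2 * (Y * Y)" using s(2) by (simp add: power2_eq_square)
  \<comment> \<open>The identities are multiplied by s or n before they are compared, so that only
    the polynomial relations for s^2, n^2 and the square of sqrt 2 enter.\<close>
  have a1: "r2 * (Y * d - x) = n * q"
  proof -
    have "s * (r2 * (Y * d - x)) = r2 * Y * (s * d) - s * m - s * w" using rx by (simp add: algebra_simps)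
    also have "\<dots> = - (s * (s * u + w))" unfolding sd sm using ss r2(2) by algebra
    finally have "r2 * (Y * d - x) = - (s * u + w)" using s(1) by (metis mult_cancel_left less_irrefl minus_mult_right)
    moreover have "n * (s * u + w) = n * (- (n * q))" 
    proof -
      have "n * (s * u + w) = s * (n * u) + n * w" by (simp add: algebra_simps)
      also have "\<dots> = - (n * n) * q" unfolding nu nw n2 by (simp add: algebra_simps)
      finally show ?thesis by simp
    qed
    then have "s * u + w = - (n * q)" using n(1) by (metis mult_cancel_left less_irrefl)
    ultimately show ?thesis by simp
  qed
  then show "Y * d - x = n / sqrt 2 * q" unfolding r2_def[symmetric] using r2 by (simp add: field_simps)
  have a2: "r2 * (x - y) = 2 * w" using rx ry by (simp add: algebra_simps)
  have "r2 * (x - y) = r2 * (r2 / n * (s * p - q))" unfolding a2 w_def using r2(2) by (simp add: mult.assoc[symmetric])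
  then show "x - y = sqrt 2 / n * (s * p - q)" unfolding r2_def[symmetric] using r2(1) by (metis mult_cancel_left less_irrefl)
  have Yt: "Y * t = s" using t Y by simp
  show "z = ch * (t * a - r)" by (rule z)
  have e4: "Y * (d - Y * (x + y + z)) = (Y\<^sup>2 - s\<^sup>2) * ch * r"
  proof -
    have "r2 * (x + y) = 2 * m" using rx ry by (simp add: algebra_simps)
    then have xy: "x + y = r2 * m" using r2 by (metis mult.assoc mult_cancel_left less_irrefl)
    have "s * (d - Y * (x + y)) = s * (s * e)"
    proof -
      have "s * (d - Y * (x + y)) = s * d - Y * r2 * (s * m)" unfolding xy by (simp add: algebra_simps)
      also have "\<dots> = s * (s * e)" unfolding sd sm using ss r2(2) by algebra
      finally show ?thesis .
    qed
    then have "d - Y * (x + y) = s * e" using s(1) by simp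
    then have "d - Y * (x + y + z) = s * e - Y * z" by (simp add: algebra_simps)
    then have "Y * (d - Y * (x + y + z)) = Y * (s * e - Y * z)" by simp
    also have "\<dots> = (Y\<^sup>2 - s\<^sup>2) * ch * r" unfolding e_def z Yt[symmetric] by (simp add: power2_eq_square algebra_simps)
    finally show ?thesis .
  qed
  then show "d - Y * (x + y + z) = (Y\<^sup>2 - s\<^sup>2) / Y * ch * r" using Y by (simp add: field_simps)
  have nz: "r2 * s * Y * n \<noteq> 0" using s(1) r2(1) n(1) Y by simp
  have "r2 * s * Y * n * (y - z) = r2 * s * Y * n * (n / (s * r2) * (ch * r2 * (Y\<^sup>2 - s\<^sup>2) / (Y * n) * a - p))"
  proof -
    have "r2 * s * Y * n * (y - z) = Y * n * (s * m - s * w) - r2 * s * Y * n * z"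
      using ry by algebra
    also have "\<dots> = Y * (n * u) + r2 * Y * Y * n * e - Y * s * (n * w) - r2 * s * Y * n * z"
      unfolding sm by (simp add: algebra_simps)
    also have "\<dots> = - (Y * (n * n) * p) + r2 * Y * n * (Y * e - s * z)"
      unfolding nu nw n2 by (simp add: algebra_simps)
    also have "Y * e - s * z = ch * (Y - s * t) * a"
      unfolding e_def z Yt[symmetric] by (simp add: algebra_simps)
    also have "- (Y * (n * n) * p) + r2 * Y * n * (ch * (Y - s * t) * a) = Y * n * (r2 * ch * (Y - s * t) * a - n * p)"
      by (simp add: algebra_simps)
    also have "Y - s * t = (Y\<^sup>2 - s\<^sup>2) / Y" using Y by (simp add: t power2_eq_square field_simps)
    also have "Y * n * (r2 * ch * ((Y\<^sup>2 - s\<^sup>2) / Y) * a - n * p)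
      = r2 * s * Y * n * (n / (s * r2) * (ch * r2 * (Y\<^sup>2 - s\<^sup>2) / (Y * n) * a - p))"
      using s(1) r2(1) n(1) Y by (simp add: field_simps)
    finally show ?thesis .
  qed
  then show "y - z = n / (s * sqrt 2) * (ch * sqrt 2 * (Y\<^sup>2 - s\<^sup>2) / (Y * n) * a - p)"
    unfolding r2_def[symmetric] using mult_left_cancel[OF nz, of "y - z"] by blast
  assume c: "ch\<^sup>2 * (1 - t\<^sup>2) = 1"
  have uw: "u\<^sup>2 + w\<^sup>2 = p\<^sup>2 + q\<^sup>2"
  proof -
    have "n * n * (u\<^sup>2 + w\<^sup>2) = (n * u)\<^sup>2 + (n * w)\<^sup>2" by (simp add: power2_eq_square algebra_simps)
    also have "\<dots> = n * n * (p\<^sup>2 + q\<^sup>2)" unfolding nu nw n2 by (simp add: power2_eq_square algebra_simps)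
    finally show ?thesis using n(1) by simp
  qed
  have dm: "d\<^sup>2 - m\<^sup>2 = e\<^sup>2 - u\<^sup>2"
  proof -
    have "s * s * (d\<^sup>2 - m\<^sup>2) = (s * d)\<^sup>2 - (s * m)\<^sup>2" by (simp add: power2_eq_square algebra_simps)
    also have "\<dots> = (1 - r2 * r2 * (Y * Y)) * (e\<^sup>2 - u\<^sup>2)" unfolding sd sm by (simp add: power2_eq_square algebra_simps)
    also have "\<dots> = s * s * (e\<^sup>2 - u\<^sup>2)" unfolding r2(2) ss ..
    finally show ?thesis using s(1) by simp
  qed
  have xy: "x\<^sup>2 + y\<^sup>2 = m\<^sup>2 + w\<^sup>2"
  proof -
    have "r2 * r2 * (x\<^sup>2 + y\<^sup>2) = (r2 * x)\<^sup>2 + (r2 * y)\<^sup>2" by (simp add: power2_eq_square algebra_simps)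
    then have "2 * (x\<^sup>2 + y\<^sup>2) = (r2 * x)\<^sup>2 + (r2 * y)\<^sup>2" unfolding r2(2) .
    then show ?thesis unfolding rx ry by (simp add: power2_eq_square algebra_simps)
  qed
  have ez: "e\<^sup>2 - z\<^sup>2 = a\<^sup>2 - r\<^sup>2"
  proof -
    have "e\<^sup>2 - z\<^sup>2 = (ch\<^sup>2 * (1 - t\<^sup>2)) * (a\<^sup>2 - r\<^sup>2)" unfolding e_def z by (simp add: power2_eq_square algebra_simps)
    then show ?thesis using c by simp
  qed
  show "d\<^sup>2 - x\<^sup>2 - y\<^sup>2 - z\<^sup>2 = a\<^sup>2 - p\<^sup>2 - q\<^sup>2 - r\<^sup>2" using uw dm xy ez by linarith
qed

section \<open>Integration over a prism in slope coordinates\<close>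

text \<open>Replacing q by the slope T = q / p, with Jacobian p, turns the triangle 0 \<le> q \<le>
  s p, p \<le> c into a rectangle.\<close>

lemma nn_integral_polar:
  fixes f :: "real \<times> real \<Rightarrow> ennreal"
  assumes [measurable]: "f \<in> borel_measurable (borel \<Otimes>\<^sub>M borel)" and z: "\<And>p q. p < 0 \<Longrightarrow> f (p, q) = 0"
  shows "(\<integral>\<^sup>+p. \<integral>\<^sup>+q. f (p, q) \<partial>lborel \<partial>lborel) = (\<integral>\<^sup>+T. \<integral>\<^sup>+p. ennreal p * f (p, p * T) \<partial>lborel \<partial>lborel)"
proof -
  have "(\<integral>\<^sup>+p. \<integral>\<^sup>+q. f (p, q) \<partial>lborel \<partial>lborel) = (\<integral>\<^sup>+p. \<integral>\<^sup>+T. ennreal p * f (p, p * T) \<partial>lborel \<partial>lborel)"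
  proof (rule nn_integral_cong_AE, rule AE_mp[OF AE_lborel_singleton[of 0]], intro AE_I2 impI)
    fix p :: real assume "p \<noteq> 0"
    show "(\<integral>\<^sup>+q. f (p, q) \<partial>lborel) = (\<integral>\<^sup>+T. ennreal p * f (p, p * T) \<partial>lborel)"
    proof (cases "p < 0")
      case True
      then show ?thesis using z by (simp add: ennreal_neg)
    next
      case False
      with \<open>p \<noteq> 0\<close> have "p > 0" by simp
      have "(\<integral>\<^sup>+q. f (p, q) \<partial>lborel) = ennreal \<bar>p\<bar> * (\<integral>\<^sup>+T. f (p, 0 + p * T) \<partial>lborel)"
        by (rule nn_integral_real_affine) (measurable, use \<open>p > 0\<close> in simp)
      also have "\<dots> = (\<integral>\<^sup>+T. ennreal \<bar>p\<bar> * f (p, 0 + p * T) \<partial>lborel)"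
        by (rule nn_integral_cmult[symmetric]) measurable
      finally show ?thesis using \<open>p > 0\<close> by simp
    qed
  qed
  also have "\<dots> = (\<integral>\<^sup>+T. \<integral>\<^sup>+p. ennreal p * f (p, p * T) \<partial>lborel \<partial>lborel)"
    by (rule nn_integral_swap) measurable
  finally show ?thesis .
qed

lemma DERIV_artanh_scaled:
  fixes g r :: real
  assumes "\<bar>r\<bar> < g"
  shows "((\<lambda>r. artanh (r / g)) has_real_derivative g / (g\<^sup>2 - r\<^sup>2)) (at r)"
proof -
  have g: "g > 0" using assms by linarith
  have "r\<^sup>2 < g\<^sup>2" using assms g abs_le_square_iff[of g r] by linarith
  have "\<bar>r / g\<bar> < 1" using assms g by simp
  then have "((\<lambda>r. artanh (r / g)) has_real_derivative 1 / (1 - (r / g)\<^sup>2) * (1 / g)) (at r)"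
    by (intro DERIV_chain2[OF artanh_real_has_field_derivative] DERIV_cdivide DERIV_ident)
  also have "1 / (1 - (r / g)\<^sup>2) * (1 / g) = g / (g\<^sup>2 - r\<^sup>2)"
    using g \<open>r\<^sup>2 < g\<^sup>2\<close> by (simp add: power_divide field_simps power2_eq_square)
  finally show ?thesis .
qed

text \<open>With M = 1 + T^2 the integrand p / (1 - r^2 - M p^2)^2 has an elementary primitive in p,
  and the subsequent integral in r is a difference of two artanh. The integral over the slope T is
  left as it stands. The hypothesis \<open>lt\<close> places the farthest corner (c, s c, t) inside
  the ball.\<close>

lemma H3_prism:
  assumes F: "\<And>p q r. F (1, p, q, r) = (if 0 \<le> q \<and> q \<le> s * p \<and> p \<le> c \<and> 0 \<le> r \<and> r \<le> t then 1 else 0)"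
    and s: "0 < s" and c: "0 < c" and t: "0 < t" and lt: "t\<^sup>2 + c\<^sup>2 * (1 + s\<^sup>2) < 1"
  shows "H3 F = (\<integral>\<^sup>+T. ennreal (1 / (2 * (1 + T\<^sup>2)) *
     (artanh (t / sqrt (1 - (1 + T\<^sup>2) * c\<^sup>2)) / sqrt (1 - (1 + T\<^sup>2) * c\<^sup>2) - artanh t)) * indicator {0..s} T \<partial>lborel)"
proof -
  define f where "f = (\<lambda>(p, q). \<integral>\<^sup>+r. wt p q r * (if 0 \<le> q \<and> q \<le> s * p \<and> p \<le> c \<and> 0 \<le> r \<and> r \<le> t then 1 else 0) \<partial>lborel)"
  have [measurable]: "f \<in> borel_measurable (borel \<Otimes>\<^sub>M borel)" unfolding f_def by measurable
  have f0: "f (p, q) = 0" if "p < 0" for p q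
  proof -
    have "\<not> (0 \<le> q \<and> q \<le> s * p)" using that s by (smt (verit) mult_pos_neg)
    then have "f (p, q) = (\<integral>\<^sup>+r. 0 \<partial>(lborel :: real measure))" unfolding f_def prod.case
      by (intro nn_integral_cong) auto
    then show ?thesis by simp
  qed
  have "H3 F = (\<integral>\<^sup>+p. \<integral>\<^sup>+q. f (p, q) \<partial>lborel \<partial>lborel)" unfolding H3_def f_def F by simp
  also have "\<dots> = (\<integral>\<^sup>+T. \<integral>\<^sup>+p. ennreal p * f (p, p * T) \<partial>lborel \<partial>lborel)" by (rule nn_integral_polar) (measurable, rule f0)
  also have "\<dots> = (\<integral>\<^sup>+T. ennreal (1 / (2 * (1 + T\<^sup>2)) *
     (artanh (t / sqrt (1 - (1 + T\<^sup>2) * c\<^sup>2)) / sqrt (1 - (1 + T\<^sup>2) * c\<^sup>2) - artanh t)) * indicator {0..s} T \<partial>lborel)"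
  proof (rule nn_integral_cong)
    fix T :: real
    show "(\<integral>\<^sup>+p. ennreal p * f (p, p * T) \<partial>lborel) = ennreal (1 / (2 * (1 + T\<^sup>2)) *
     (artanh (t / sqrt (1 - (1 + T\<^sup>2) * c\<^sup>2)) / sqrt (1 - (1 + T\<^sup>2) * c\<^sup>2) - artanh t)) * indicator {0..s} T"
    proof (cases "T \<in> {0..s}")
      case False
      have "ennreal p * f (p, p * T) = 0" for p
      proof (cases "p > 0")
        case True
        have "\<not> (0 \<le> p * T \<and> p * T \<le> s * p)" using False True by (auto simp: zero_le_mult_iff mult.commute)
        then have "f (p, p * T) = (\<integral>\<^sup>+r. 0 \<partial>(lborel :: real measure))" unfolding f_def prod.case
          by (intro nn_integral_cong) auto
        then show ?thesis by simp
      qed (simp add: ennreal_neg)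
      then show ?thesis using False by (simp only: nn_integral_const) simp
    next
      case True
      define M where "M = 1 + T\<^sup>2"
      have M: "1 \<le> M" "M \<le> 1 + s\<^sup>2" using True by (simp_all add: M_def power_mono)
      have Mc: "t\<^sup>2 + c\<^sup>2 * M < 1" using lt M(2) c by (smt (verit) mult_left_mono zero_le_power2)
      define g where "g = sqrt (1 - M * c\<^sup>2)"
      have g2: "g\<^sup>2 = 1 - M * c\<^sup>2" unfolding g_def using Mc by (simp add: mult.commute) (smt (verit) zero_le_power2 mult.commute)
      have tg: "t\<^sup>2 < g\<^sup>2" using Mc g2 by (simp add: mult.commute)
      have g0: "g > 0" unfolding g_def using tg g2 t by (smt (verit) real_sqrt_gt_0_iff zero_le_power2)
      have tg': "t < g" using tg g0 t by (simp add: power2_less_imp_less)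
      have g1: "g \<le> 1" using g2 M by (smt (verit) mult_nonneg_nonneg power2_le_imp_le zero_le_power2 one_power2)
      have step1: "(\<integral>\<^sup>+p. ennreal p * f (p, p * T) \<partial>lborel) =
        (\<integral>\<^sup>+p. \<integral>\<^sup>+r. ennreal (p / (1 - r\<^sup>2 - M * p\<^sup>2)\<^sup>2) * indicator {0..c} p * indicator {0..t} r \<partial>lborel \<partial>lborel)"
      proof (rule nn_integral_cong)
        fix p
        have "ennreal p * f (p, p * T) = (\<integral>\<^sup>+r. ennreal p * (wt p (p * T) r * (if 0 \<le> p * T \<and> p * T \<le> s * p \<and> p \<le> c \<and> 0 \<le> r \<and> r \<le> t then 1 else 0)) \<partial>lborel)"
          unfolding f_def prod.case by (rule nn_integral_cmult[symmetric]) measurable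
        also have "\<dots> = (\<integral>\<^sup>+r. ennreal (p / (1 - r\<^sup>2 - M * p\<^sup>2)\<^sup>2) * indicator {0..c} p * indicator {0..t} r \<partial>lborel)"
        proof (rule nn_integral_cong)
          fix r
          show "ennreal p * (wt p (p * T) r * (if 0 \<le> p * T \<and> p * T \<le> s * p \<and> p \<le> c \<and> 0 \<le> r \<and> r \<le> t then 1 else 0))
            = ennreal (p / (1 - r\<^sup>2 - M * p\<^sup>2)\<^sup>2) * indicator {0..c} p * indicator {0..t} r"
          proof (cases "p > 0 \<and> p \<le> c \<and> 0 \<le> r \<and> r \<le> t")
            case T: True
            have eq: "1 - p\<^sup>2 - (p * T)\<^sup>2 - r\<^sup>2 = 1 - r\<^sup>2 - M * p\<^sup>2" by (simp add: M_def power_mult_distrib algebra_simps)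
            have "r\<^sup>2 \<le> t\<^sup>2" "p\<^sup>2 \<le> c\<^sup>2" using T by (simp_all add: power_mono)
            then have pos: "1 - r\<^sup>2 - M * p\<^sup>2 > 0" using Mc M(1)
              by (smt (verit) mult.commute mult_left_mono)
            then have ball: "p\<^sup>2 + (p * T)\<^sup>2 + r\<^sup>2 < 1" using eq by linarith
            have "wt p (p * T) r = ennreal (1 / (1 - r\<^sup>2 - M * p\<^sup>2)\<^sup>2)" unfolding wt_def eq using ball by simp
            moreover have "0 \<le> p * T \<and> p * T \<le> s * p" using T True by (simp add: mult.commute)
            ultimately show ?thesis using T by (simp add: ennreal_mult'[symmetric])
          next
            case F: False
            show ?thesis
            proof (cases "p > 0")
              case True
              with F show ?thesis by (auto simp: indicator_def)
            next
              case False
              then show ?thesis by (simp add: ennreal_neg divide_nonpos_nonneg)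
            qed
          qed
        qed
        finally show "ennreal p * f (p, p * T) = (\<integral>\<^sup>+r. ennreal (p / (1 - r\<^sup>2 - M * p\<^sup>2)\<^sup>2) * indicator {0..c} p * indicator {0..t} r \<partial>lborel)" .
      qed
      also have "\<dots> = (\<integral>\<^sup>+r. \<integral>\<^sup>+p. ennreal (p / (1 - r\<^sup>2 - M * p\<^sup>2)\<^sup>2) * indicator {0..c} p * indicator {0..t} r \<partial>lborel \<partial>lborel)"
        by (rule nn_integral_swap) measurable
      also have "\<dots> = (\<integral>\<^sup>+r. ennreal (1 / (2 * M) * (1 / (g\<^sup>2 - r\<^sup>2) - 1 / (1 - r\<^sup>2))) * indicator {0..t} r \<partial>lborel)"
      proof (rule nn_integral_cong)
        fix r
        show "(\<integral>\<^sup>+p. ennreal (p / (1 - r\<^sup>2 - M * p\<^sup>2)\<^sup>2) * indicator {0..c} p * indicator {0..t} r \<partial>lborel)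
          = ennreal (1 / (2 * M) * (1 / (g\<^sup>2 - r\<^sup>2) - 1 / (1 - r\<^sup>2))) * indicator {0..t} r"
        proof (cases "r \<in> {0..t}")
          case r: True
          have pos: "1 - r\<^sup>2 - M * p\<^sup>2 > 0" if "p \<in> {0..c}" for p
          proof -
            have "r\<^sup>2 \<le> t\<^sup>2" "p\<^sup>2 \<le> c\<^sup>2" using r that by (simp_all add: power_mono)
            then show ?thesis using Mc M(1) by (smt (verit) mult.commute mult_left_mono)
          qed
          have "(\<integral>\<^sup>+p. ennreal (p / (1 - r\<^sup>2 - M * p\<^sup>2)\<^sup>2) * indicator {0..c} p \<partial>lborel)
            = ennreal (1 / (2 * M * (1 - r\<^sup>2 - M * c\<^sup>2)) - 1 / (2 * M * (1 - r\<^sup>2 - M * 0\<^sup>2)))"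
          proof (rule nn_integral_FTC_Icc)
            fix p assume p: "p \<in> {0..c}"
            show "((\<lambda>p. 1 / (2 * M * (1 - r\<^sup>2 - M * p\<^sup>2))) has_real_derivative p / (1 - r\<^sup>2 - M * p\<^sup>2)\<^sup>2) (at p)"
              using pos[OF p] M(1)
              by (auto intro!: derivative_eq_intros) (simp add: power2_eq_square divide_simps)
            show "0 \<le> p / (1 - r\<^sup>2 - M * p\<^sup>2)\<^sup>2" using p by simp
          qed (use c in auto)
          also have "1 / (2 * M * (1 - r\<^sup>2 - M * c\<^sup>2)) - 1 / (2 * M * (1 - r\<^sup>2 - M * 0\<^sup>2)) = 1 / (2 * M) * (1 / (g\<^sup>2 - r\<^sup>2) - 1 / (1 - r\<^sup>2))"
            unfolding g2 by (simp add: right_diff_distrib algebra_simps)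
          finally show ?thesis using r by simp
        qed simp
      qed
      also have "\<dots> = ennreal (1 / (2 * M) * (artanh (t / g) / g - artanh t) - 1 / (2 * M) * (artanh (0 / g) / g - artanh 0))"
      proof (rule nn_integral_FTC_Icc)
        fix r assume r: "r \<in> {0..t}"
        have rg: "r\<^sup>2 < g\<^sup>2" using r tg by (smt (verit) atLeastAtMost_iff power_mono)
        have r1: "r\<^sup>2 < 1" using rg g1 g0 by (smt (verit) power_le_one)
        have ab: "\<bar>r / g\<bar> < 1" "\<bar>r\<bar> < 1" using r tg' g0 g1 by auto
        have D: "((\<lambda>r. artanh (r / g)) has_real_derivative g / (g\<^sup>2 - r\<^sup>2)) (at r)"
          "(artanh has_real_derivative 1 / (1 - r\<^sup>2)) (at r)"
          using ab g0 by (intro DERIV_artanh_scaled artanh_real_has_field_derivative; simp)+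
        show "((\<lambda>r. 1 / (2 * M) * (artanh (r / g) / g - artanh r)) has_real_derivative
          1 / (2 * M) * (1 / (g\<^sup>2 - r\<^sup>2) - 1 / (1 - r\<^sup>2))) (at r)"
          using DERIV_cmult[OF DERIV_diff[OF DERIV_cdivide[OF D(1), of g] D(2)], of "1 / (2 * M)"] g0 by simp
        have "1 / (1 - r\<^sup>2) \<le> 1 / (g\<^sup>2 - r\<^sup>2)" using rg g1 g0 
          by (intro divide_left_mono) (auto simp: power_le_one r1)
        then show "0 \<le> 1 / (2 * M) * (1 / (g\<^sup>2 - r\<^sup>2) - 1 / (1 - r\<^sup>2))" using M(1) by simp
      qed (use t in auto)
      finally show ?thesis using True by (simp add: M_def[symmetric] g_def)
    qed
  qed
  finally show ?thesis .
qed

section \<open>Distances to points and planes\<close>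

text \<open>The Cauchy-Schwarz inequality for two vectors (c, u), (d, v) that are not spacelike,
  with its direction reversed. It reduces to the Euclidean one by the identity (|c| |d| - |u| |v|)^2
  - (c^2 - |u|^2) (d^2 - |v|^2) = (|c| |v| - |u| |d|)^2.\<close>

lemma reverse_cauchy_schwarz:
  fixes u v :: "'a :: real_inner" and c d :: real
  assumes "u \<bullet> u \<le> c\<^sup>2" "v \<bullet> v \<le> d\<^sup>2"
  shows "(c\<^sup>2 - u \<bullet> u) * (d\<^sup>2 - v \<bullet> v) \<le> (c * d - u \<bullet> v)\<^sup>2"
proof -
  have nu: "norm u \<le> \<bar>c\<bar>" and nv: "norm v \<le> \<bar>d\<bar>"
    using assms by (metis norm_eq_sqrt_inner real_sqrt_abs real_sqrt_le_mono)+
  have uv: "\<bar>u \<bullet> v\<bar> \<le> norm u * norm v" by (rule Cauchy_Schwarz_ineq2)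
  have "norm u * norm v \<le> \<bar>c\<bar> * \<bar>d\<bar>" using nu nv by (intro mult_mono) auto
  then have 0: "0 \<le> \<bar>c\<bar> * \<bar>d\<bar> - norm u * norm v" by simp
  have "\<bar>c\<bar> * \<bar>d\<bar> - norm u * norm v \<le> \<bar>c * d - u \<bullet> v\<bar>" using uv abs_mult[of c d] by linarith
  then have "(\<bar>c\<bar> * \<bar>d\<bar> - norm u * norm v)\<^sup>2 \<le> (c * d - u \<bullet> v)\<^sup>2"
    using 0 by (metis abs_le_square_iff abs_of_nonneg)
  moreover have "(c\<^sup>2 - u \<bullet> u) * (d\<^sup>2 - v \<bullet> v) \<le> (\<bar>c\<bar> * \<bar>d\<bar> - norm u * norm v)\<^sup>2"
  proof -
    have "(\<bar>c\<bar> * \<bar>d\<bar> - norm u * norm v)\<^sup>2 - (\<bar>c\<bar>\<^sup>2 - (norm u)\<^sup>2) * (\<bar>d\<bar>\<^sup>2 - (norm v)\<^sup>2)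
      = (\<bar>c\<bar> * norm v - norm u * \<bar>d\<bar>)\<^sup>2" by (simp add: power2_eq_square algebra_simps)
    then have "(\<bar>c\<bar>\<^sup>2 - (norm u)\<^sup>2) * (\<bar>d\<bar>\<^sup>2 - (norm v)\<^sup>2) \<le> (\<bar>c\<bar> * \<bar>d\<bar> - norm u * norm v)\<^sup>2"
      by (smt (verit) zero_le_power2)
    then show ?thesis by (simp add: power2_norm_eq_inner)
  qed
  ultimately show ?thesis by linarith
qed

lemma reverse_cauchy_schwarz_pos:
  fixes u v :: "'a :: real_inner" and c d :: real
  assumes "u \<bullet> u \<le> c\<^sup>2" "v \<bullet> v \<le> d\<^sup>2" "0 \<le> c" "0 \<le> d"
  shows "sqrt ((c\<^sup>2 - u \<bullet> u) * (d\<^sup>2 - v \<bullet> v)) \<le> c * d - u \<bullet> v"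
proof -
  have "norm u \<le> c" "norm v \<le> d"
    using assms by (metis norm_eq_sqrt_inner real_sqrt_abs real_sqrt_le_mono abs_of_nonneg)+
  then have "norm u * norm v \<le> c * d" using assms by (intro mult_mono) auto
  then have "0 \<le> c * d - u \<bullet> v" using norm_cauchy_schwarz[of u v] by linarith
  then show ?thesis using reverse_cauchy_schwarz[OF assms(1,2)] by (simp add: real_le_lsqrt)
qed

lemma inner_lt_1:
  fixes x z :: "'a :: real_inner"
  assumes "x \<bullet> x < 1" "z \<bullet> z < 1"
  shows "x \<bullet> z < 1"
proof -
  have "sqrt (x \<bullet> x) < 1" "sqrt (z \<bullet> z) < 1" using assms by simp_all
  then have "norm x < 1" "norm z < 1" by (simp_all add: norm_eq_sqrt_inner)
  then have "norm x * norm z < 1" by (metis mult_left_le norm_ge_zero less_imp_le le_less_trans)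
  then show ?thesis using norm_cauchy_schwarz[of x z] by linarith
qed

lemma mem_kball: "x \<in> kball \<longleftrightarrow> x \<bullet> x < 1"
  by (simp add: kball_def norm_eq_sqrt_inner dist_norm)

text \<open>Subtracting from \<open>(1, x)\<close> its Lorentz component along the pole \<open>(1, b)\<close>.\<close>
lemma polar_projection:
  fixes x b :: pt3
  assumes b: "b \<bullet> b > 1"
  defines "k \<equiv> (x \<bullet> b - 1) / (b \<bullet> b - 1)"
  defines "N \<equiv> (1 - x \<bullet> x) + (x \<bullet> b - 1)\<^sup>2 / (b \<bullet> b - 1)"
  assumes N: "N > 0"
  defines "z \<equiv> (1 / (1 - k)) *\<^sub>R (x - k *\<^sub>R b)"
  shows "(1 - k)\<^sup>2 - (x - k *\<^sub>R b) \<bullet> (x - k *\<^sub>R b) = N" "1 - k \<noteq> 0" "z \<in> polplane b"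
    "1 - z \<bullet> z = N / (1 - k)\<^sup>2" "1 - x \<bullet> z = N / (1 - k)"
proof -
  have k: "k * (b \<bullet> b - 1) = x \<bullet> b - 1" using b by (simp add: k_def)
  have N': "N = (1 - x \<bullet> x) + k * (x \<bullet> b - 1)" by (simp add: N_def k_def power2_eq_square)
  show e: "(1 - k)\<^sup>2 - (x - k *\<^sub>R b) \<bullet> (x - k *\<^sub>R b) = N"
  proof -
    have "(1 - k)\<^sup>2 - (x - k *\<^sub>R b) \<bullet> (x - k *\<^sub>R b) = 1 - x \<bullet> x + 2 * k * (x \<bullet> b - 1) - k * (k * (b \<bullet> b - 1))"
      by (simp add: inner_diff_left inner_diff_right power2_eq_square algebra_simps inner_commute)
    then show ?thesis unfolding k N' by (simp add: algebra_simps)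
  qed
  show k1: "1 - k \<noteq> 0"
  proof
    assume "1 - k = 0"
    then have "- ((x - k *\<^sub>R b) \<bullet> (x - k *\<^sub>R b)) = N" using e by simp
    then show False using N inner_ge_zero[of "x - k *\<^sub>R b"] by linarith
  qed
  have "(1 - k)\<^sup>2 * (1 - z \<bullet> z) = (1 - k)\<^sup>2 - (x - k *\<^sub>R b) \<bullet> (x - k *\<^sub>R b)"
  proof -
    have "z \<bullet> z = (x - k *\<^sub>R b) \<bullet> (x - k *\<^sub>R b) / (1 - k)\<^sup>2" by (simp add: z_def power2_eq_square)
    then show ?thesis using k1 by (simp add: right_diff_distrib)
  qed
  then have zz: "(1 - k)\<^sup>2 * (1 - z \<bullet> z) = N" using e by simp
  then show z2: "1 - z \<bullet> z = N / (1 - k)\<^sup>2" using k1 by (simp add: eq_divide_eq mult.commute)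
  have "1 - z \<bullet> z > 0" unfolding z2 using N k1 by simp
  then have zb: "z \<in> kball" by (simp add: mem_kball)
  have "(1 - k) * (z \<bullet> b) = x \<bullet> b - k * (b \<bullet> b)" using k1 by (simp add: z_def inner_diff_left)
  also have "\<dots> = 1 - k" using k by (simp add: algebra_simps)
  finally have "z \<bullet> b = 1" using k1 by simp
  then show "z \<in> polplane b" using zb by (simp add: polplane_def)
  have "(1 - k) * (1 - x \<bullet> z) = (1 - k) - x \<bullet> (x - k *\<^sub>R b)"
    unfolding z_def inner_scaleR_right right_diff_distrib using k1 by simp
  also have "\<dots> = N" unfolding N' by (simp add: inner_diff_right algebra_simps)
  finally show "1 - x \<bullet> z = N / (1 - k)" using k1 by (simp add: eq_divide_eq mult.commute)
qed

lemma arcosh_sqrt: "arcosh (sqrt (1 + s\<^sup>2)) = arsinh \<bar>s\<bar>" for s :: real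
proof -
  have "sqrt (1 + s\<^sup>2) = cosh (arsinh \<bar>s\<bar>)" by (simp add: cosh_arsinh_real add.commute)
  then show ?thesis 
    using arcosh_cosh_real[of "arsinh \<bar>s\<bar>"] arsinh_real_neg_iff[of "\<bar>s\<bar>"] by (metis abs_ge_zero not_less)
qed

text \<open>Points of a polar plane are Lorentz-orthogonal to its pole, so removing the pole
  component from (1, x) does not change the product with (1, z). What remains has norm N > 0, and
  the reversed Cauchy-Schwarz inequality applies.\<close>

lemma polplane_lower_bound:
  fixes x b z :: pt3
  assumes x: "x \<bullet> x < 1" and b: "b \<bullet> b > 1" and z: "z \<in> polplane b"
  shows "((1 - x \<bullet> x) + (x \<bullet> b - 1)\<^sup>2 / (b \<bullet> b - 1)) * (1 - z \<bullet> z) \<le> (1 - x \<bullet> z)\<^sup>2"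
proof -
  define k where "k = (x \<bullet> b - 1) / (b \<bullet> b - 1)"
  define N where "N = (1 - x \<bullet> x) + (x \<bullet> b - 1)\<^sup>2 / (b \<bullet> b - 1)"
  have N: "N > 0" unfolding N_def using x b by (simp add: add_pos_nonneg)
  have e: "(1 - k)\<^sup>2 - (x - k *\<^sub>R b) \<bullet> (x - k *\<^sub>R b) = N"
    unfolding k_def N_def by (rule polar_projection(1)[OF b N[unfolded N_def]])
  have z1: "z \<bullet> z < 1" "z \<bullet> b = 1" using z by (simp_all add: polplane_def mem_kball)
  have "((1 - k)\<^sup>2 - (x - k *\<^sub>R b) \<bullet> (x - k *\<^sub>R b)) * (1\<^sup>2 - z \<bullet> z) \<le> ((1 - k) * 1 - (x - k *\<^sub>R b) \<bullet> z)\<^sup>2"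
    by (rule reverse_cauchy_schwarz) (use e N z1 in auto)
  moreover have "(1 - k) * 1 - (x - k *\<^sub>R b) \<bullet> z = 1 - x \<bullet> z"
    using z1(2) by (simp add: inner_diff_left inner_commute[of b z])
  ultimately show ?thesis unfolding e N_def by (simp only: power_one)
qed

text \<open>The infimum is a minimum, attained at the projection of x to the plane. There cosh^2 of
  the distance is N / (1 - |x|^2) = 1 + s^2, so the normalised product with the pole is sinh of the
  distance.\<close>

lemma hptdist_polplane:
  fixes x b :: pt3
  assumes x: "x \<bullet> x < 1" and b: "b \<bullet> b > 1"
  shows "hptdist x (polplane b) = arsinh (\<bar>1 - x \<bullet> b\<bar> / sqrt ((1 - x \<bullet> x) * (b \<bullet> b - 1)))"
proof -
  define k where "k = (x \<bullet> b - 1) / (b \<bullet> b - 1)"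
  define N where "N = (1 - x \<bullet> x) + (x \<bullet> b - 1)\<^sup>2 / (b \<bullet> b - 1)"
  define s where "s = \<bar>1 - x \<bullet> b\<bar> / sqrt ((1 - x \<bullet> x) * (b \<bullet> b - 1))"
  have N: "N > 0" unfolding N_def using x b by (simp add: add_pos_nonneg)
  define z where "z = (1 / (1 - k)) *\<^sub>R (x - k *\<^sub>R b)"
  note pp = polar_projection[OF b N[unfolded N_def], folded k_def N_def, folded z_def]
  have s2: "1 + s\<^sup>2 = N / (1 - x \<bullet> x)"
    using x b by (simp add: s_def N_def power_divide add_divide_distrib power2_commute)
  have lower: "sqrt (1 + s\<^sup>2) \<le> (1 - x \<bullet> y) / sqrt ((1 - x \<bullet> x) * (1 - y \<bullet> y))" if y: "y \<in> polplane b" for y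
  proof -
    have y1: "y \<bullet> y < 1" using y by (simp add: polplane_def mem_kball)
    have "N * (1 - y \<bullet> y) \<le> (1 - x \<bullet> y)\<^sup>2" unfolding N_def by (rule polplane_lower_bound[OF x b y])
    then have "sqrt (N * (1 - y \<bullet> y)) \<le> 1 - x \<bullet> y" using inner_lt_1[OF x y1] by (simp add: real_le_lsqrt)
    then have "sqrt (N * (1 - y \<bullet> y)) / sqrt ((1 - x \<bullet> x) * (1 - y \<bullet> y)) \<le> (1 - x \<bullet> y) / sqrt ((1 - x \<bullet> x) * (1 - y \<bullet> y))"
      using x y1 by (intro divide_right_mono) auto
    moreover have "sqrt (N * (1 - y \<bullet> y)) / sqrt ((1 - x \<bullet> x) * (1 - y \<bullet> y)) = sqrt (1 + s\<^sup>2)"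
      unfolding s2 using y1 by (simp add: real_sqrt_mult real_sqrt_divide)
    ultimately show ?thesis by simp
  qed
  have zz: "z \<bullet> z < 1" using pp(3) by (simp add: polplane_def mem_kball)
  have "0 < N / (1 - k)" using inner_lt_1[OF x zz] pp(5) by simp
  then have k1: "1 - k > 0" using N by (simp add: zero_less_divide_iff)
  have att: "(1 - x \<bullet> z) / sqrt ((1 - x \<bullet> x) * (1 - z \<bullet> z)) = sqrt (1 + s\<^sup>2)"
  proof -
    have 1: "N / sqrt N = sqrt N" using N by (simp add: real_div_sqrt)
    have "(1 - x \<bullet> z) / sqrt ((1 - x \<bullet> x) * (1 - z \<bullet> z)) = (N / sqrt N) / sqrt (1 - x \<bullet> x)"
      unfolding pp(4,5) using k1 N by (simp add: real_sqrt_mult real_sqrt_divide)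
    then show ?thesis unfolding 1 s2 by (simp add: real_sqrt_divide)
  qed
  have s1: "1 \<le> sqrt (1 + s\<^sup>2)" by simp
  have "hptdist x (polplane b) = arcosh (sqrt (1 + s\<^sup>2))"
    unfolding hptdist_def
  proof (rule cInf_eq_minimum)
    show "arcosh (sqrt (1 + s\<^sup>2)) \<in> hdist x ` polplane b"
      using pp(3) by (auto simp: hdist_def att[symmetric] intro!: image_eqI[where x = z])
    show "arcosh (sqrt (1 + s\<^sup>2)) \<le> d" if "d \<in> hdist x ` polplane b" for d
    proof -
      obtain y where y: "y \<in> polplane b" "d = hdist x y" using \<open>d \<in> hdist x ` polplane b\<close> by auto
      show ?thesis unfolding y(2) hdist_def
        using lower[OF y(1)] s1 arcosh_less_iff_real[of "(1 - x \<bullet> y) / sqrt ((1 - x \<bullet> x) * (1 - y \<bullet> y))" "sqrt (1 + s\<^sup>2)"]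
        by linarith
    qed
  qed
  moreover have "\<bar>s\<bar> = s" using x b by (simp add: s_def)
  ultimately show ?thesis unfolding arcosh_sqrt by (simp only: s_def)
qed

lemma arsinh_le: "x \<le> y \<Longrightarrow> arsinh x \<le> arsinh y" for x y :: real
  using arsinh_less_iff_real[of y x] by linarith

text \<open>The hypothesis \<open>ab\<close> says that the two planes are ultraparallel. It gives N
  > 0, so the projection z of the pole b to the plane of a is a point of the ball: the foot of the
  common perpendicular, where the minimum is attained.\<close>

lemma hsetdist_polplane:
  fixes a b :: pt3
  assumes a: "a \<bullet> a > 1" and b: "b \<bullet> b > 1" and ab: "(a \<bullet> a - 1) * (b \<bullet> b - 1) < (1 - a \<bullet> b)\<^sup>2"
  shows "hsetdist (polplane a) (polplane b) = arcosh (\<bar>1 - a \<bullet> b\<bar> / sqrt ((a \<bullet> a - 1) * (b \<bullet> b - 1)))"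
proof -
  define k where "k = (b \<bullet> a - 1) / (a \<bullet> a - 1)"
  define N where "N = (1 - b \<bullet> b) + (b \<bullet> a - 1)\<^sup>2 / (a \<bullet> a - 1)"
  define s where "s = sqrt (N / (b \<bullet> b - 1))"
  have "(b \<bullet> b - 1) < (1 - a \<bullet> b)\<^sup>2 / (a \<bullet> a - 1)" using ab a by (simp add: pos_less_divide_eq mult.commute)
  then have N: "N > 0" unfolding N_def by (simp add: inner_commute power2_commute)
  define z where "z = (1 / (1 - k)) *\<^sub>R (b - k *\<^sub>R a)"
  note pp = polar_projection[OF a N[unfolded N_def], folded k_def N_def, folded z_def]
  have s0: "s \<ge> 0" unfolding s_def using N b by simp
  have lower: "s \<le> \<bar>1 - y \<bullet> b\<bar> / sqrt ((1 - y \<bullet> y) * (b \<bullet> b - 1))" if y: "y \<in> polplane a" for y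
  proof -
    have y1: "y \<bullet> y < 1" "y \<bullet> a = 1" using y by (simp_all add: polplane_def mem_kball)
    have "((1 - k)\<^sup>2 - (b - k *\<^sub>R a) \<bullet> (b - k *\<^sub>R a)) * (1\<^sup>2 - y \<bullet> y) \<le> ((1 - k) * 1 - (b - k *\<^sub>R a) \<bullet> y)\<^sup>2"
      by (rule reverse_cauchy_schwarz) (use pp(1) N y1 in auto)
    moreover have "(1 - k) * 1 - (b - k *\<^sub>R a) \<bullet> y = 1 - y \<bullet> b"
      using y1(2) by (simp add: inner_diff_left inner_commute[of a y] inner_commute[of b y])
    ultimately have "N * (1 - y \<bullet> y) \<le> (1 - y \<bullet> b)\<^sup>2" unfolding pp(1) by (simp only: power_one)
    then have "N / (b \<bullet> b - 1) \<le> (1 - y \<bullet> b)\<^sup>2 / ((1 - y \<bullet> y) * (b \<bullet> b - 1))"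
    proof -
      have p: "1 - y \<bullet> y > 0" using y1 by simp
      have "N \<le> (1 - y \<bullet> b)\<^sup>2 / (1 - y \<bullet> y)" using \<open>N * (1 - y \<bullet> y) \<le> (1 - y \<bullet> b)\<^sup>2\<close> p by (simp add: pos_le_divide_eq)
      from divide_right_mono[OF this, of "b \<bullet> b - 1"] show ?thesis using b by simp
    qed
    then have "s \<le> sqrt ((1 - y \<bullet> b)\<^sup>2 / ((1 - y \<bullet> y) * (b \<bullet> b - 1)))"
      unfolding s_def by (rule real_sqrt_le_mono)
    then show ?thesis by (simp add: real_sqrt_divide)
  qed
  have zz: "z \<bullet> z < 1" using pp(3) by (simp add: polplane_def mem_kball)
  have att: "\<bar>1 - z \<bullet> b\<bar> / sqrt ((1 - z \<bullet> z) * (b \<bullet> b - 1)) = s"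
  proof -
    have "1 - z \<bullet> b = N / (1 - k)" using pp(5) by (simp add: inner_commute)
    then have "(\<bar>1 - z \<bullet> b\<bar> / sqrt ((1 - z \<bullet> z) * (b \<bullet> b - 1)))\<^sup>2 = N / (b \<bullet> b - 1)"
    proof -
      have gen: "(\<bar>y\<bar> / sqrt q)\<^sup>2 = y\<^sup>2 / q" if "q > 0" for y q :: real using that by (simp add: power_divide)
      have p: "N / (1 - k)\<^sup>2 * (b \<bullet> b - 1) > 0" using N b pp(2) by simp
      have "(\<bar>N / (1 - k)\<bar> / sqrt (N / (1 - k)\<^sup>2 * (b \<bullet> b - 1)))\<^sup>2 = (N / (1 - k))\<^sup>2 / (N / (1 - k)\<^sup>2 * (b \<bullet> b - 1))"
        by (rule gen[OF p])
      also have "(N / (1 - k))\<^sup>2 = N * (N / (1 - k)\<^sup>2)" by (simp add: power2_eq_square)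
      also have "N * (N / (1 - k)\<^sup>2) / (N / (1 - k)\<^sup>2 * (b \<bullet> b - 1)) = N / (b \<bullet> b - 1)"
      proof -
        have "N * d / (d * e) = N / e" if "d \<noteq> 0" for d e :: real using that by simp
        then show ?thesis using N pp(2) by simp
      qed
      finally show ?thesis unfolding pp(4) \<open>1 - z \<bullet> b = N / (1 - k)\<close> .
    qed
    then show ?thesis unfolding s_def using b zz by (metis abs_ge_zero divide_nonneg_nonneg real_sqrt_ge_zero real_sqrt_unique mult_nonneg_nonneg diff_ge_0_iff_ge less_imp_le)
  qed
  have "hsetdist (polplane a) (polplane b) = arsinh s"
    unfolding hsetdist_def
  proof (rule cInf_eq_minimum)
    have "hptdist z (polplane b) = arsinh s" unfolding hptdist_polplane[OF zz b] att ..
    then show "arsinh s \<in> (\<lambda>z. hptdist z (polplane b)) ` polplane a"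
      using pp(3) by (metis imageI)
    show "arsinh s \<le> d" if "d \<in> (\<lambda>z. hptdist z (polplane b)) ` polplane a" for d
    proof -
      obtain y where y: "y \<in> polplane a" "d = hptdist y (polplane b)" using \<open>d \<in> (\<lambda>z. hptdist z (polplane b)) ` polplane a\<close> by auto
      have "y \<bullet> y < 1" using y(1) by (simp add: polplane_def mem_kball)
      show ?thesis unfolding y(2) hptdist_polplane[OF \<open>y \<bullet> y < 1\<close> b]
        using lower[OF y(1)] by (rule arsinh_le)
    qed
  qed
  also have "arsinh s = arcosh (sqrt (1 + s\<^sup>2))" using s0 by (simp add: arcosh_sqrt)
  also have "1 + s\<^sup>2 = (1 - a \<bullet> b)\<^sup>2 / ((a \<bullet> a - 1) * (b \<bullet> b - 1))"
  proof -
    have "s\<^sup>2 = N / (b \<bullet> b - 1)" unfolding s_def using N b by simp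
    moreover have "N = (1 - a \<bullet> b)\<^sup>2 / (a \<bullet> a - 1) - (b \<bullet> b - 1)"
      unfolding N_def by (simp add: inner_commute power2_commute)
    moreover have "b \<bullet> b - 1 \<noteq> 0" using b by simp
    ultimately show ?thesis by (simp add: diff_divide_distrib)
  qed
  finally show ?thesis by (simp add: real_sqrt_divide)
qed

text \<open>With S = sinh^2 eta, hypothesis \<open>d\<close> says that x lies within eta of the
  plane of a, and the bound on S + 1 says that the planes of a and b are at distance at least eta;
  then x cannot have crossed the plane of b. Both (1, x) and (1, b) are split into a component along
  (1, a) and an orthogonal rest, and the reversed Cauchy-Schwarz inequality is applied to the
  rests.\<close>

lemma same_side:
  fixes a b x :: pt3
  assumes a: "a \<bullet> a > 1" and ab: "a \<bullet> b < 1" and x: "x \<bullet> x < 1" and xa: "x \<bullet> a \<le> 1"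
    and d: "(1 - x \<bullet> a)\<^sup>2 \<le> S * ((1 - x \<bullet> x) * (a \<bullet> a - 1))"
    and S: "0 \<le> S" "(S + 1) * ((a \<bullet> a - 1) * (b \<bullet> b - 1)) \<le> (1 - a \<bullet> b)\<^sup>2" and b: "b \<bullet> b > 1"
  shows "x \<bullet> b \<le> 1"
proof -
  define A where "A = a \<bullet> a - 1"
  define B where "B = b \<bullet> b - 1"
  define k where "k = (x \<bullet> a - 1) / A"
  define g where "g = (b \<bullet> a - 1) / A"
  define P where "P = 1 - x \<bullet> a"
  define Q where "Q = 1 - a \<bullet> b"
  define X where "X = 1 - x \<bullet> x"
  have pos: "A > 0" "B > 0" "Q > 0" "X > 0" "P \<ge> 0" using a b ab x xa by (simp_all add: A_def B_def Q_def X_def P_def)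
  have kP: "k = - P / A" and gQ: "g = - Q / A" by (simp_all add: k_def g_def P_def Q_def inner_commute)
  have kA: "k * A = x \<bullet> a - 1" and gA: "g * A = b \<bullet> a - 1" using pos(1) by (simp_all add: k_def g_def)
  have N: "(1 - k)\<^sup>2 - (x - k *\<^sub>R a) \<bullet> (x - k *\<^sub>R a) = X + P\<^sup>2 / A"
  proof -
    have "(1 - k)\<^sup>2 - (x - k *\<^sub>R a) \<bullet> (x - k *\<^sub>R a) = X + 2 * k * (x \<bullet> a - 1) - k * (k * A)"
      by (simp add: X_def A_def inner_diff_left inner_diff_right power2_eq_square algebra_simps inner_commute)
    also have "\<dots> = X + k * (x \<bullet> a - 1)" unfolding kA by simp
    finally show ?thesis unfolding k_def by (simp add: P_def power2_eq_square algebra_simps)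
  qed
  have m: "(1 - g)\<^sup>2 - (b - g *\<^sub>R a) \<bullet> (b - g *\<^sub>R a) = Q\<^sup>2 / A - B"
  proof -
    have "(1 - g)\<^sup>2 - (b - g *\<^sub>R a) \<bullet> (b - g *\<^sub>R a) = 2 * g * (b \<bullet> a - 1) - g * (g * A) - B"
      by (simp add: B_def A_def inner_diff_left inner_diff_right power2_eq_square algebra_simps inner_commute)
    also have "\<dots> = g * (b \<bullet> a - 1) - B" unfolding gA by simp
    finally show ?thesis unfolding g_def by (simp add: Q_def power2_eq_square algebra_simps inner_commute)
  qed
  have mS: "S * B \<le> Q\<^sup>2 / A - B"
  proof -
    have "(S + 1) * B \<le> Q\<^sup>2 / A" using S(2) pos(1) by (simp add: A_def[symmetric] B_def[symmetric] Q_def[symmetric] pos_le_divide_eq mult_ac)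
    then show ?thesis by (simp add: algebra_simps)
  qed
  have m0: "Q\<^sup>2 / A - B \<ge> 0" using mS S(1) pos by (smt (verit) mult_nonneg_nonneg)
  have N0: "X + P\<^sup>2 / A \<ge> 0" using pos by simp
  have "sqrt (((1 - k)\<^sup>2 - (x - k *\<^sub>R a) \<bullet> (x - k *\<^sub>R a)) * ((1 - g)\<^sup>2 - (b - g *\<^sub>R a) \<bullet> (b - g *\<^sub>R a)))
    \<le> (1 - k) * (1 - g) - (x - k *\<^sub>R a) \<bullet> (b - g *\<^sub>R a)"
  proof (rule reverse_cauchy_schwarz_pos)
    show "(x - k *\<^sub>R a) \<bullet> (x - k *\<^sub>R a) \<le> (1 - k)\<^sup>2" using N N0 by linarith
    show "(b - g *\<^sub>R a) \<bullet> (b - g *\<^sub>R a) \<le> (1 - g)\<^sup>2" using m m0 by linarith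
    show "0 \<le> 1 - k" "0 \<le> 1 - g" unfolding kP gQ using pos by (simp_all add: divide_nonpos_pos)
  qed
  also have "(1 - k) * (1 - g) - (x - k *\<^sub>R a) \<bullet> (b - g *\<^sub>R a) = (1 - x \<bullet> b) + k * (a \<bullet> b - 1) + g * (x \<bullet> a - 1 - k * A)"
    by (simp add: A_def inner_diff_left inner_diff_right algebra_simps inner_commute)
  also have "\<dots> = (1 - x \<bullet> b) + P * Q / A" unfolding kA by (simp add: kP Q_def algebra_simps diff_divide_distrib)
  finally have main: "sqrt ((X + P\<^sup>2 / A) * (Q\<^sup>2 / A - B)) \<le> (1 - x \<bullet> b) + P * Q / A" unfolding N m .
  \<comment> \<open>Here the two distance hypotheses meet: the first bounds P^2 / A by S X, the
    second bounds S B by the norm of the rest of b, so the product of the components along a is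
    dominated by the rests.\<close>
  have "(P * Q / A)\<^sup>2 \<le> (X + P\<^sup>2 / A) * (Q\<^sup>2 / A - B)"
  proof -
    have "P\<^sup>2 \<le> S * (X * A)" using d by (simp add: P_def X_def A_def)
    then have "P\<^sup>2 / A \<le> S * X" using pos(1) by (simp add: pos_divide_le_eq mult.assoc)
    then have "P\<^sup>2 / A * B \<le> S * X * B" using pos by (intro mult_right_mono) auto
    also have "\<dots> \<le> X * (Q\<^sup>2 / A - B)" using mult_left_mono[OF mS, of X] pos by (simp add: mult_ac)
    finally have "P\<^sup>2 / A * (Q\<^sup>2 / A) \<le> (X + P\<^sup>2 / A) * (Q\<^sup>2 / A - B)" by (simp add: algebra_simps)
    then show ?thesis by (simp add: power_divide power_mult_distrib power2_eq_square[of A])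
  qed
  then have "P * Q / A \<le> sqrt ((X + P\<^sup>2 / A) * (Q\<^sup>2 / A - B))" by (rule real_le_rsqrt)
  then show ?thesis using main by simp
qed

section \<open>Volumes of the truncated cube and of the hyperball pieces\<close>

lemma DERIV_scaled_inverse:
  fixes f :: "real \<Rightarrow> real"
  assumes "(f has_real_derivative f') (at p)" "f p \<noteq> 0" "M \<noteq> 0"
  shows "((\<lambda>p. K / (M * f p)) has_real_derivative - K * f' / (M * (f p)\<^sup>2)) (at p)"
  using assms by (auto intro!: derivative_eq_intros simp: power2_eq_square field_simps)

text \<open>The condition on r says that the point is within eta of the plane r = 0. Integrating
  along r leaves K w^-3, where w^-3 dp dq is the area element of the Klein disc; the rest is the
  area of a right triangle. By Gauss-Bonnet this area is the complement of the third angle minus the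
  angle arctan s at the origin, which is the difference of arctangents in the result.\<close>

lemma H3_hyperprism:
  fixes eta :: real
  assumes F: "\<And>p q r. p\<^sup>2 + q\<^sup>2 + r\<^sup>2 < 1 \<Longrightarrow> F (1, p, q, r) = (if 0 \<le> q \<and> q \<le> s * p \<and> p \<le> c \<and> 0 \<le> r
       \<and> r\<^sup>2 \<le> (sinh eta)\<^sup>2 * (1 - p\<^sup>2 - q\<^sup>2 - r\<^sup>2) then 1 else 0)"
    and s: "0 < s" and c: "0 < c" and eta: "0 \<le> eta" and lt: "c\<^sup>2 * (1 + s\<^sup>2) < 1"
  shows "H3 F = ennreal ((sinh (2 * eta) + 2 * eta) / 4 * (arctan (s / sqrt (1 - (1 + s\<^sup>2) * c\<^sup>2)) - arctan s))"
proof -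
  define th where "th = tanh eta"
  \<comment> \<open>The integral of cosh^2 from 0 to eta: the volume over a unit of area on one side
    of the plane.\<close>
  define K where "K = (sinh (2 * eta) + 2 * eta) / 4"
  have K0: "K \<ge> 0" using eta by (simp add: K_def)
  have th: "0 \<le> th" "th < 1" using eta tanh_real_lt_1 by (simp_all add: th_def)
  have th2: "th\<^sup>2 < 1" using th by (simp add: abs_square_less_1)
  have chsh: "(cosh eta)\<^sup>2 = 1 + (sinh eta)\<^sup>2" by (simp add: cosh_square_eq)
  have K: "th / (1 - th\<^sup>2) + artanh th = 2 * K"
  proof -
    have "th * cosh eta = sinh eta" by (simp add: th_def tanh_def)
    then have "th\<^sup>2 * (cosh eta)\<^sup>2 = (sinh eta)\<^sup>2" by (metis power_mult_distrib)
    then have "(1 - th\<^sup>2) * (cosh eta)\<^sup>2 = 1" using chsh by (simp add: algebra_simps)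
    then have "th * (cosh eta)\<^sup>2 * (1 - th\<^sup>2) = th" by algebra
    then have "th / (1 - th\<^sup>2) = th * (cosh eta)\<^sup>2" using th2 by (simp add: divide_eq_eq)
    then have "th / (1 - th\<^sup>2) = sinh eta * cosh eta"
      using \<open>th * cosh eta = sinh eta\<close> by (simp add: power2_eq_square mult.assoc[symmetric])
    then show ?thesis unfolding K_def th_def artanh_tanh_real by (simp add: sinh_double)
  qed
  define f where "f = (\<lambda>(p, q). if 0 \<le> q \<and> q \<le> s * p \<and> p \<le> c then ennreal (K / (sqrt (1 - p\<^sup>2 - q\<^sup>2)) ^ 3) else 0)"
  have [measurable]: "f \<in> borel_measurable (borel \<Otimes>\<^sub>M borel)" unfolding f_def by measurable
  have inner: "(\<integral>\<^sup>+r. wt p q r * F (1, p, q, r) \<partial>lborel) = f (p, q)" for p q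
  proof (cases "0 \<le> q \<and> q \<le> s * p \<and> p \<le> c")
    case False
    have "wt p q r * F (1, p, q, r) = 0" for r
      using False F[of p q r] by (auto simp: wt_def)
    then show ?thesis using False by (simp only: nn_integral_const) (auto simp: f_def)
  next
    case True
    have "0 \<le> s * p" using True by linarith
    then have p0: "0 \<le> p" using s by (simp add: zero_le_mult_iff)
    have "q\<^sup>2 \<le> (s * p)\<^sup>2" using True by (simp add: power_mono)
    moreover have "p\<^sup>2 \<le> c\<^sup>2" using True p0 by (simp add: power_mono)
    ultimately have "p\<^sup>2 + q\<^sup>2 \<le> c\<^sup>2 * (1 + s\<^sup>2)"
      using mult_left_mono[of "p\<^sup>2" "c\<^sup>2" "s\<^sup>2"] by (simp add: power_mult_distrib algebra_simps)
    then have pq: "1 - p\<^sup>2 - q\<^sup>2 > 0" using lt by linarith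
    define w where "w = sqrt (1 - p\<^sup>2 - q\<^sup>2)"
    have w: "w > 0" "w\<^sup>2 = 1 - p\<^sup>2 - q\<^sup>2" using pq by (simp_all add: w_def)
    have iff: "(0 \<le> r \<and> r\<^sup>2 \<le> (sinh eta)\<^sup>2 * (1 - p\<^sup>2 - q\<^sup>2 - r\<^sup>2)) \<longleftrightarrow> r \<in> {0..th * w}" for r
    proof -
      have "r\<^sup>2 \<le> (sinh eta)\<^sup>2 * (1 - p\<^sup>2 - q\<^sup>2 - r\<^sup>2) \<longleftrightarrow> r\<^sup>2 * (cosh eta)\<^sup>2 \<le> (sinh eta)\<^sup>2 * w\<^sup>2"
        unfolding chsh w(2) by (simp add: algebra_simps)
      also have "\<dots> \<longleftrightarrow> r\<^sup>2 \<le> (th * w)\<^sup>2"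
        unfolding th_def tanh_def by (simp add: power_mult_distrib power_divide pos_le_divide_eq)
      finally show ?thesis using th w(1) by (auto intro: power2_le_imp_le power_mono)
    qed
    have rw: "r\<^sup>2 < w\<^sup>2" "\<bar>r / w\<bar> < 1" if "r \<in> {0..th * w}" for r
    proof -
      have "th * w < 1 * w" using th(2) w(1) by (rule mult_strict_right_mono)
      then have "r < w" using that by simp
      then show "r\<^sup>2 < w\<^sup>2" "\<bar>r / w\<bar> < 1" using that w(1) by (auto intro: power_strict_mono)
    qed
    have "(\<integral>\<^sup>+r. wt p q r * F (1, p, q, r) \<partial>lborel) = (\<integral>\<^sup>+r. ennreal (1 / (w\<^sup>2 - r\<^sup>2)\<^sup>2) * indicator {0..th * w} r \<partial>lborel)"
    proof (rule nn_integral_cong)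
      fix r
      show "wt p q r * F (1, p, q, r) = ennreal (1 / (w\<^sup>2 - r\<^sup>2)\<^sup>2) * indicator {0..th * w} r"
      proof (cases "p\<^sup>2 + q\<^sup>2 + r\<^sup>2 < 1")
        case b: True
        show ?thesis unfolding F[OF b] using True iff[of r] b by (auto simp: wt_def w(2))
      next
        case False
        then have "\<not> r\<^sup>2 < w\<^sup>2" using w(2) by simp
        then have "r \<notin> {0..th * w}" using rw(1) by blast
        then show ?thesis using False by (simp add: wt_def)
      qed
    qed
    also have "\<dots> = ennreal (1 / (2 * w\<^sup>2) * ((th * w) / (w\<^sup>2 - (th * w)\<^sup>2) + artanh (th * w / w) / w)
       - 1 / (2 * w\<^sup>2) * (0 / (w\<^sup>2 - 0\<^sup>2) + artanh (0 / w) / w))"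
    proof (rule nn_integral_FTC_Icc)
      fix r assume r: "r \<in> {0..th * w}"
      have ne: "w\<^sup>2 - r\<^sup>2 \<noteq> 0" using rw(1)[OF r] by simp
      have "\<bar>r\<bar> < w" using rw(2)[OF r] w(1) by simp
      note D = DERIV_artanh_scaled[OF this]
      have D2: "((\<lambda>r. r / (w\<^sup>2 - r\<^sup>2)) has_real_derivative (w\<^sup>2 + r\<^sup>2) / (w\<^sup>2 - r\<^sup>2)\<^sup>2) (at r)"
        using ne by (auto intro!: derivative_eq_intros simp: power2_eq_square)
      have "1 / (2 * w\<^sup>2) * ((w\<^sup>2 + r\<^sup>2) / (w\<^sup>2 - r\<^sup>2)\<^sup>2 + w / (w\<^sup>2 - r\<^sup>2) / w) = 1 / (w\<^sup>2 - r\<^sup>2)\<^sup>2"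
      proof -
        define v where "v = w\<^sup>2 - r\<^sup>2"
        have v: "v \<noteq> 0" "w\<^sup>2 + r\<^sup>2 = 2 * w\<^sup>2 - v" using ne by (simp_all add: v_def)
        show ?thesis unfolding v_def[symmetric] v(2) using v(1) w(1) by (simp add: field_simps power2_eq_square)
      qed
      then show "((\<lambda>r. 1 / (2 * w\<^sup>2) * (r / (w\<^sup>2 - r\<^sup>2) + artanh (r / w) / w)) has_real_derivative 1 / (w\<^sup>2 - r\<^sup>2)\<^sup>2) (at r)"
        using DERIV_cmult[OF DERIV_add[OF D2 DERIV_cdivide[OF D, of w]], of "1 / (2 * w\<^sup>2)"] by simp
    qed (use th w(1) in auto)
    also have "1 / (2 * w\<^sup>2) * ((th * w) / (w\<^sup>2 - (th * w)\<^sup>2) + artanh (th * w / w) / w)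
       - 1 / (2 * w\<^sup>2) * (0 / (w\<^sup>2 - 0\<^sup>2) + artanh (0 / w) / w) = K / w ^ 3"
    proof -
      have "(th * w) / (w\<^sup>2 - (th * w)\<^sup>2) = th / (1 - th\<^sup>2) / w"
      proof -
        have "w\<^sup>2 - (th * w)\<^sup>2 = w * w * (1 - th\<^sup>2)" by (simp add: power2_eq_square algebra_simps)
        then show ?thesis using w(1) by simp
      qed
      then have "1 / (2 * w\<^sup>2) * ((th * w) / (w\<^sup>2 - (th * w)\<^sup>2) + artanh (th * w / w) / w)
        = 1 / (2 * w\<^sup>2) * ((th / (1 - th\<^sup>2) + artanh th) / w)" using w(1) by (simp add: add_divide_distrib)
      then show ?thesis unfolding K using w(1) by (simp add: power2_eq_square power3_eq_cube)
    qed
    finally show ?thesis using True by (simp add: f_def w_def)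
  qed
  have f0: "f (p, q) = 0" if "p < 0" for p q
  proof -
    have "\<not> (0 \<le> q \<and> q \<le> s * p)" using that s by (smt (verit) mult_pos_neg)
    then show ?thesis by (auto simp: f_def)
  qed
  have lin: "1 - c\<^sup>2 - c\<^sup>2 * T\<^sup>2 > 0" if "T \<in> {0..s}" for T
  proof -
    have "T\<^sup>2 \<le> s\<^sup>2" using that by (simp add: power_mono)
    then have "c\<^sup>2 * T\<^sup>2 \<le> c\<^sup>2 * s\<^sup>2" by (simp add: mult_left_mono)
    then show ?thesis using lt by (simp add: algebra_simps)
  qed
  have "H3 F = (\<integral>\<^sup>+p. \<integral>\<^sup>+q. f (p, q) \<partial>lborel \<partial>lborel)" unfolding H3_def inner by simp
  also have "\<dots> = (\<integral>\<^sup>+T. \<integral>\<^sup>+p. ennreal p * f (p, p * T) \<partial>lborel \<partial>lborel)" by (rule nn_integral_polar) (measurable, rule f0)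
  also have "\<dots> = (\<integral>\<^sup>+T. ennreal (K / (1 + T\<^sup>2) * (1 / sqrt (1 - c\<^sup>2 - c\<^sup>2 * T\<^sup>2) - 1)) * indicator {0..s} T \<partial>lborel)"
  proof (rule nn_integral_cong)
    fix T :: real
    show "(\<integral>\<^sup>+p. ennreal p * f (p, p * T) \<partial>lborel)
      = ennreal (K / (1 + T\<^sup>2) * (1 / sqrt (1 - c\<^sup>2 - c\<^sup>2 * T\<^sup>2) - 1)) * indicator {0..s} T"
    proof (cases "T \<in> {0..s}")
      case False
      have "ennreal p * f (p, p * T) = 0" for p
      proof (cases "p > 0")
        case True
        have "\<not> (0 \<le> p * T \<and> p * T \<le> s * p)" using False True by (auto simp: zero_le_mult_iff mult.commute)
        then show ?thesis by (auto simp: f_def)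
      qed (simp add: ennreal_neg)
      then show ?thesis using False by (simp only: nn_integral_const) simp
    next
      case True
      define M where "M = 1 + T\<^sup>2"
      have M: "1 \<le> M" by (simp add: M_def)
      have pos: "1 - M * p\<^sup>2 > 0" if "p \<in> {0..c}" for p
      proof -
        have "p\<^sup>2 \<le> c\<^sup>2" using that by (simp add: power_mono)
        then have "M * p\<^sup>2 \<le> M * c\<^sup>2" using M by (simp add: mult_left_mono)
        then show ?thesis using lin[OF True] by (simp add: M_def algebra_simps)
      qed
      have "(\<integral>\<^sup>+p. ennreal p * f (p, p * T) \<partial>lborel)
        = (\<integral>\<^sup>+p. ennreal (K * p / sqrt (1 - M * p\<^sup>2) ^ 3) * indicator {0..c} p \<partial>lborel)"
      proof (rule nn_integral_cong)
        fix p
        have eq: "1 - p\<^sup>2 - (p * T)\<^sup>2 = 1 - M * p\<^sup>2" by (simp add: M_def power_mult_distrib algebra_simps)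
        show "ennreal p * f (p, p * T) = ennreal (K * p / sqrt (1 - M * p\<^sup>2) ^ 3) * indicator {0..c} p"
        proof (cases "p > 0")
          case p: True
          then have "0 \<le> p * T \<and> p * T \<le> s * p" using True by (simp add: mult.commute)
          then show ?thesis using p unfolding f_def prod.case eq
            by (simp add: indicator_def ennreal_mult'[symmetric] mult.commute)
        next
          case False
          then show ?thesis by (cases "p = 0") (simp_all add: ennreal_neg)
        qed
      qed
      also have "\<dots> = ennreal (K / (M * sqrt (1 - M * c\<^sup>2)) - K / (M * sqrt (1 - M * 0\<^sup>2)))"
      proof (rule nn_integral_FTC_Icc)
        fix p assume p: "p \<in> {0..c}"
        define v where "v = sqrt (1 - M * p\<^sup>2)"
        have v: "v > 0" using pos[OF p] by (simp add: v_def)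
        have v2: "1 - M * p\<^sup>2 = v\<^sup>2" using pos[OF p] by (simp add: v_def)
        have "((\<lambda>p. sqrt (1 - M * p\<^sup>2)) has_real_derivative - (M * p) / v) (at p)"
          using pos[OF p] by (auto intro!: derivative_eq_intros simp: v_def field_simps)
        from DERIV_scaled_inverse[OF this, of M K] M v
        have "((\<lambda>p. K / (M * sqrt (1 - M * p\<^sup>2))) has_real_derivative - K * (- (M * p) / v) / (M * v\<^sup>2)) (at p)"
          by (simp add: v_def)
        also have "- K * (- (M * p) / v) / (M * v\<^sup>2) = K * p / v ^ 3"
          using v M by (simp add: field_simps power2_eq_square power3_eq_cube)
        finally show "((\<lambda>p. K / (M * sqrt (1 - M * p\<^sup>2))) has_real_derivative K * p / sqrt (1 - M * p\<^sup>2) ^ 3) (at p)"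
          by (simp add: v_def)
        show "0 \<le> K * p / sqrt (1 - M * p\<^sup>2) ^ 3" using p K0 v by (simp add: v_def)
      qed (use c in auto)
      also have "K / (M * sqrt (1 - M * c\<^sup>2)) - K / (M * sqrt (1 - M * 0\<^sup>2)) = K / (1 + T\<^sup>2) * (1 / sqrt (1 - c\<^sup>2 - c\<^sup>2 * T\<^sup>2) - 1)"
      proof -
        have "1 - M * c\<^sup>2 = 1 - c\<^sup>2 - c\<^sup>2 * T\<^sup>2" by (simp add: M_def algebra_simps)
        then show ?thesis by (simp add: M_def[symmetric] right_diff_distrib)
      qed
      finally show ?thesis using True by simp
    qed
  qed
  also have "\<dots> = ennreal (K * (arctan (s / sqrt (1 - c\<^sup>2 - c\<^sup>2 * s\<^sup>2)) - arctan s) - K * (arctan (0 / sqrt (1 - c\<^sup>2 - c\<^sup>2 * 0\<^sup>2)) - arctan 0))"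
  proof (rule nn_integral_FTC_Icc)
    fix T assume T: "T \<in> {0..s}"
    define R where "R = sqrt (1 - c\<^sup>2 - c\<^sup>2 * T\<^sup>2)"
    have R: "R > 0" "R\<^sup>2 = 1 - c\<^sup>2 - c\<^sup>2 * T\<^sup>2" using lin[OF T] by (simp_all add: R_def)
    have T1: "1 + T\<^sup>2 > 0" by (smt (verit) zero_le_power2)
    have c1: "1 - c\<^sup>2 > 0" using lin[OF T] by (smt (verit) mult_nonneg_nonneg zero_le_power2)
    have RT: "R\<^sup>2 + T\<^sup>2 = (1 - c\<^sup>2) * (1 + T\<^sup>2)" using R(2) by (simp add: algebra_simps)
    have D1: "((\<lambda>T. T / sqrt (1 - c\<^sup>2 - c\<^sup>2 * T\<^sup>2)) has_real_derivative (1 - c\<^sup>2) / R ^ 3) (at T)"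
    proof -
      have "((\<lambda>T. T / sqrt (1 - c\<^sup>2 - c\<^sup>2 * T\<^sup>2)) has_real_derivative
         (1 * R - T * ((0 - c\<^sup>2 * (2 * T)) * (inverse R / 2))) / (R * R)) (at T)"
        using lin[OF T] R(1) by (auto intro!: derivative_eq_intros simp: R_def[symmetric])
      also have "(1 * R - T * ((0 - c\<^sup>2 * (2 * T)) * (inverse R / 2))) / (R * R) = (R\<^sup>2 + c\<^sup>2 * T\<^sup>2) / R ^ 3"
        using R(1) by (simp add: field_simps power2_eq_square power3_eq_cube)
      finally show ?thesis unfolding R(2) by simp
    qed
    have "((\<lambda>T. K * (arctan (T / sqrt (1 - c\<^sup>2 - c\<^sup>2 * T\<^sup>2)) - arctan T)) has_real_derivative
       K * ((1 - c\<^sup>2) / R ^ 3 * inverse (1 + (T / R)\<^sup>2) - inverse (1 + T\<^sup>2))) (at T)"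
      using DERIV_cmult[OF DERIV_diff[OF DERIV_chain2[OF DERIV_arctan D1] DERIV_arctan], of K]
      by (simp add: R_def mult.commute)
    also have "(1 - c\<^sup>2) / R ^ 3 * inverse (1 + (T / R)\<^sup>2) = 1 / (R * (1 + T\<^sup>2))"
    proof -
      have "1 + (T / R)\<^sup>2 = (1 - c\<^sup>2) * (1 + T\<^sup>2) / R\<^sup>2" using R(1) unfolding RT[symmetric] by (simp add: power_divide field_simps)
      then show ?thesis using R(1) T1 c1 by (simp add: power2_eq_square power3_eq_cube)
    qed
    also have "K * (1 / (R * (1 + T\<^sup>2)) - inverse (1 + T\<^sup>2)) = K / (1 + T\<^sup>2) * (1 / R - 1)"
    proof -
      have "K * (1 / (R * m) - inverse m) = K / m * (1 / R - 1)" for m by (simp add: divide_inverse algebra_simps)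
      then show ?thesis .
    qed
    finally show "((\<lambda>T. K * (arctan (T / sqrt (1 - c\<^sup>2 - c\<^sup>2 * T\<^sup>2)) - arctan T)) has_real_derivative
       K / (1 + T\<^sup>2) * (1 / sqrt (1 - c\<^sup>2 - c\<^sup>2 * T\<^sup>2) - 1)) (at T)" by (simp add: R_def)
    have "0 \<le> c\<^sup>2 * T\<^sup>2" by simp
    then have "R\<^sup>2 \<le> 1" unfolding R(2) using zero_le_power2[of c] by linarith
    then have "R \<le> 1" using R(1) by (simp add: power2_le_imp_le)
    then show "0 \<le> K / (1 + T\<^sup>2) * (1 / sqrt (1 - c\<^sup>2 - c\<^sup>2 * T\<^sup>2) - 1)"
      using K0 R(1) T1 by (simp add: R_def[symmetric])
  qed (use s in auto)
  also have "1 - c\<^sup>2 - c\<^sup>2 * s\<^sup>2 = 1 - (1 + s\<^sup>2) * c\<^sup>2" by (simp add: algebra_simps)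
  finally show ?thesis by (simp add: K_def)
qed

section \<open>From Lebesgue measure on space to iterated integrals, and symmetry reductions\<close>

text \<open>Lebesgue measure is determined by its values on boxes, and both sides give a box the
  product of its three side lengths. This connects the vector type of the definitions with iterated
  integrals over the line.\<close>

lemma lborel_real3:
  "(lborel :: (real ^ 3) measure) = distr (lborel \<Otimes>\<^sub>M (lborel \<Otimes>\<^sub>M lborel)) borel (\<lambda>(x, y, z). vector [x, y, z])"
    (is "_ = distr ?M borel ?f")
proof -
  have f: "?f = (\<lambda>p. fst p *\<^sub>R axis 1 1 + fst (snd p) *\<^sub>R axis 2 1 + snd (snd p) *\<^sub>R axis 3 1)"
    by (auto simp: vec_eq_iff forall_3 axis_def)
  have [measurable]: "?f \<in> borel_measurable ?M" unfolding f by measurable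
  have B: "(Basis :: (real ^ 3) set) = (\<lambda>i. axis i 1) ` UNIV" by (simp add: Basis_vec_def UNION_singleton_eq_range)
  have inj: "inj (\<lambda>i. axis i (1 :: real) :: real ^ 3)" by (auto simp: inj_on_def axis_eq_axis)
  have prod: "(\<Prod>b\<in>Basis. v \<bullet> b) = v $ 1 * (v $ 2 * v $ 3)" for v :: "real ^ 3"
  proof -
    have "(\<Prod>b\<in>Basis. v \<bullet> b) = (\<Prod>i\<in>UNIV. v $ i)"
      unfolding B by (simp only: prod.reindex[OF inj] o_def inner_axis) simp
    also have "\<dots> = (\<Prod>i\<in>{1, 2, 3}. v $ i)" by (simp only: UNIV_3)
    finally show ?thesis by simp
  qed
  show ?thesis
  proof (rule lborel_eqI)
    fix l u :: "real ^ 3"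
    assume le: "\<And>b. b \<in> Basis \<Longrightarrow> l \<bullet> b \<le> u \<bullet> b"
    have le': "l $ i \<le> u $ i" for i using le[of "axis i 1"] by (simp add: B inner_axis)
    have vim: "?f -` box l u \<inter> space ?M = {l $ 1<..<u $ 1} \<times> ({l $ 2<..<u $ 2} \<times> {l $ 3<..<u $ 3})"
      by (auto simp: mem_box_cart forall_3 space_pair_measure)
    define C where "C = {l $ 2<..<u $ 2} \<times> {l $ 3<..<u $ 3}"
    have C: "C \<in> sets borel" unfolding C_def by (intro borel_open open_Times) simp_all
    have "emeasure (distr ?M borel ?f) (box l u) = emeasure ?M ({l $ 1<..<u $ 1} \<times> C)"
      by (subst emeasure_distr) (simp_all add: vim C_def)
    also have "\<dots> = emeasure (lborel \<Otimes>\<^sub>M (lborel :: (real \<times> real) measure)) ({l $ 1<..<u $ 1} \<times> C)"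
      by (simp only: lborel_prod)
    also have "\<dots> = emeasure lborel {l $ 1<..<u $ 1} * emeasure lborel C"
      using C by (intro lborel.emeasure_pair_measure_Times) simp_all
    also have "emeasure lborel C = emeasure (lborel \<Otimes>\<^sub>M lborel) C" by (simp only: lborel_prod)
    also have "\<dots> = emeasure lborel {l $ 2<..<u $ 2} * emeasure lborel {l $ 3<..<u $ 3}"
      unfolding C_def by (intro lborel.emeasure_pair_measure_Times) simp_all
    also have "emeasure lborel {l $ 1<..<u $ 1} * (emeasure lborel {l $ 2<..<u $ 2} * emeasure lborel {l $ 3<..<u $ 3})
      = ennreal (u $ 1 - l $ 1) * (ennreal (u $ 2 - l $ 2) * ennreal (u $ 3 - l $ 3))"
      using le' by simp
    also have "\<dots> = ennreal (\<Prod>b\<in>Basis. (u - l) \<bullet> b)"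
      unfolding prod using le' by (simp add: ennreal_mult)
    finally show "emeasure (distr ?M borel ?f) (box l u) = ennreal (\<Prod>b\<in>Basis. (u - l) \<bullet> b)" .
  qed simp
qed

lemma nn_integral_real3:
  fixes f :: "real ^ 3 \<Rightarrow> ennreal"
  assumes [measurable]: "f \<in> borel_measurable borel"
  shows "(\<integral>\<^sup>+v. f v \<partial>lborel) = (\<integral>\<^sup>+x. \<integral>\<^sup>+y. \<integral>\<^sup>+z. f (vector [x, y, z]) \<partial>lborel \<partial>lborel \<partial>lborel)"
proof -
  let ?f = "\<lambda>(x :: real, y :: real, z :: real). vector [x, y, z] :: real ^ 3"
  have e: "?f = (\<lambda>p. fst p *\<^sub>R axis 1 1 + fst (snd p) *\<^sub>R axis 2 1 + snd (snd p) *\<^sub>R axis 3 1)"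
    by (auto simp: vec_eq_iff forall_3 axis_def)
  have [measurable]: "?f \<in> borel_measurable (borel \<Otimes>\<^sub>M (borel \<Otimes>\<^sub>M borel))" unfolding e by measurable
  define g where "g = (\<lambda>p. f (?f p))"
  have g [measurable]: "g \<in> borel_measurable (borel \<Otimes>\<^sub>M (borel \<Otimes>\<^sub>M borel))" unfolding g_def by measurable
  have "(\<integral>\<^sup>+v. f v \<partial>lborel) = (\<integral>\<^sup>+p. g p \<partial>(lborel \<Otimes>\<^sub>M (lborel \<Otimes>\<^sub>M lborel)))"
    unfolding g_def by (subst lborel_real3, subst nn_integral_distr) simp_all
  also have "\<dots> = (\<integral>\<^sup>+p. g p \<partial>(lborel \<Otimes>\<^sub>M (lborel :: (real \<times> real) measure)))" by (simp only: lborel_prod)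
  also have "\<dots> = (\<integral>\<^sup>+x. \<integral>\<^sup>+q. g (x, q) \<partial>(lborel :: (real \<times> real) measure) \<partial>lborel)"
  proof (rule lborel.nn_integral_fst[symmetric])
    have "sets ((lborel :: real measure) \<Otimes>\<^sub>M (lborel :: (real \<times> real) measure)) = sets (borel \<Otimes>\<^sub>M borel)"
      by (rule sets_pair_measure_cong) simp_all
    note sets = this
    show "g \<in> borel_measurable ((lborel :: real measure) \<Otimes>\<^sub>M (lborel :: (real \<times> real) measure))"
      using g unfolding measurable_cong_sets[OF sets refl] borel_prod by simp
  qed
  also have "\<dots> = (\<integral>\<^sup>+x. \<integral>\<^sup>+q. g (x, q) \<partial>(lborel \<Otimes>\<^sub>M lborel) \<partial>lborel)" by (simp only: lborel_prod)
  also have "\<dots> = (\<integral>\<^sup>+x. \<integral>\<^sup>+y. \<integral>\<^sup>+z. g (x, y, z) \<partial>lborel \<partial>lborel \<partial>lborel)"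
  proof (rule nn_integral_cong)
    fix x
    show "(\<integral>\<^sup>+q. g (x, q) \<partial>(lborel \<Otimes>\<^sub>M lborel)) = (\<integral>\<^sup>+y. \<integral>\<^sup>+z. g (x, y, z) \<partial>lborel \<partial>lborel)"
      by (subst lborel.nn_integral_fst) simp_all
  qed
  finally show ?thesis by (simp add: g_def)
qed

lemma hvol_eq_H3:
  assumes Q: "\<And>x y z. x\<^sup>2 + y\<^sup>2 + z\<^sup>2 < 1 \<Longrightarrow> F (1, x, y, z) = indicator S (vector [x, y, z])"
    and S: "S \<in> sets borel" "S \<subseteq> kball"
  shows "hvol S = enn2real (H3 F)"
proof -
  have n: "(norm (vector [x, y, z] :: pt3))\<^sup>2 = x\<^sup>2 + y\<^sup>2 + z\<^sup>2" for x y z :: real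
    unfolding power2_norm_eq_inner by (simp add: inner_vec_def sum_3 power2_eq_square)
  have ball: "vector [x, y, z] \<in> kball \<longleftrightarrow> x\<^sup>2 + y\<^sup>2 + z\<^sup>2 < 1" for x y z :: real
    unfolding n[symmetric] kball_def by (simp add: abs_square_less_1)
  have "emeasure (density lborel (\<lambda>x::pt3. ennreal (1 / (1 - (norm x)\<^sup>2)\<^sup>2))) S
    = (\<integral>\<^sup>+x. ennreal (1 / (1 - (norm x)\<^sup>2)\<^sup>2) * indicator S x \<partial>(lborel :: pt3 measure))"
    using S by (subst emeasure_density) simp_all
  also have "\<dots> = (\<integral>\<^sup>+x. \<integral>\<^sup>+y. \<integral>\<^sup>+z. ennreal (1 / (1 - (norm (vector [x, y, z] :: pt3))\<^sup>2)\<^sup>2) * indicator S (vector [x, y, z]) \<partial>lborel \<partial>lborel \<partial>lborel)"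
    using S by (subst nn_integral_real3) simp_all
  also have "\<dots> = H3 F" unfolding H3_def
  proof (intro nn_integral_cong)
    fix x y z :: real
    show "ennreal (1 / (1 - (norm (vector [x, y, z] :: pt3))\<^sup>2)\<^sup>2) * indicator S (vector [x, y, z]) = wt x y z * F (1, x, y, z)"
    proof (cases "x\<^sup>2 + y\<^sup>2 + z\<^sup>2 < 1")
      case True
      then show ?thesis unfolding n Q[OF True] by (simp add: wt_def diff_diff_eq)
    next
      case False
      then have "vector [x, y, z] \<notin> S" using S(2) ball by blast
      then show ?thesis using False by (simp add: wt_def)
    qed
  qed
  finally show ?thesis unfolding hvol_def measure_def by simp
qed

text \<open>Coordinate planes and diagonal planes are null sets. Ignoring them lets closed octants
  and closed chambers, which overlap in their walls, be added up as if they were disjoint.\<close>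

lemma H3_cong_AE:
  assumes "\<And>x y z. \<lbrakk>x\<^sup>2 + y\<^sup>2 + z\<^sup>2 < 1; x \<noteq> 0; y \<noteq> 0; z \<noteq> 0; x \<noteq> y; x \<noteq> z; y \<noteq> z\<rbrakk> \<Longrightarrow> F (1, x, y, z) = G (1, x, y, z)"
  shows "H3 F = H3 G"
  unfolding H3_def
proof (rule nn_integral_cong_AE, rule AE_mp[OF AE_lborel_singleton[of 0]], intro AE_I2 impI)
  fix x :: real assume x: "x \<noteq> 0"
  show "(\<integral>\<^sup>+y. \<integral>\<^sup>+z. wt x y z * F (1, x, y, z) \<partial>lborel \<partial>lborel) = (\<integral>\<^sup>+y. \<integral>\<^sup>+z. wt x y z * G (1, x, y, z) \<partial>lborel \<partial>lborel)"
  proof (rule nn_integral_cong_AE, rule AE_mp[OF AE_lborel_singleton[of 0]], rule AE_mp[OF AE_lborel_singleton[of x]], intro AE_I2 impI)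
    fix y :: real assume y: "y \<noteq> x" "y \<noteq> 0"
    show "(\<integral>\<^sup>+z. wt x y z * F (1, x, y, z) \<partial>lborel) = (\<integral>\<^sup>+z. wt x y z * G (1, x, y, z) \<partial>lborel)"
    proof (rule nn_integral_cong_AE, rule AE_mp[OF AE_lborel_singleton[of 0]], rule AE_mp[OF AE_lborel_singleton[of x]],
        rule AE_mp[OF AE_lborel_singleton[of y]], intro AE_I2 impI)
      fix z :: real assume "z \<noteq> y" "z \<noteq> x" "z \<noteq> 0"
      then show "wt x y z * F (1, x, y, z) = wt x y z * G (1, x, y, z)"
        using x y assms[of x y z] by (cases "x\<^sup>2 + y\<^sup>2 + z\<^sup>2 < 1") (auto simp: wt_def)
    qed
  qed
qed

lemma H3_add:
  assumes [measurable]: "F \<in> borel_measurable borel4" "G \<in> borel_measurable borel4"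
  shows "H3 (\<lambda>X. F X + G X) = H3 F + H3 G"
  unfolding H3_def distrib_left
  by ((subst nn_integral_add, measurable)+; simp)

lemma H3_flip2:
  assumes [measurable]: "F \<in> borel_measurable borel4"
  shows "H3 (\<lambda>(a, x, y, z). F (a, x, - y, z)) = H3 F"
proof -
  define G where "G = (\<lambda>(a, x, y, z). F (a, x, z, y))"
  have [measurable]: "G \<in> borel_measurable borel4" unfolding G_def by measurable
  define G' where "G' = (\<lambda>(a, x, y, z). G (a, x, y, - z))"
  have [measurable]: "G' \<in> borel_measurable borel4" unfolding G'_def by measurable
  have "H3 (\<lambda>(a, x, y, z). F (a, x, - y, z)) = H3 (\<lambda>(a, x, y, z). G' (a, x, z, y))" by (simp add: G'_def G_def)
  also have "\<dots> = H3 G'" by (rule H3_swap23) measurable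
  also have "\<dots> = H3 G" unfolding G'_def by (rule H3_flip3) measurable
  also have "\<dots> = H3 F" unfolding G_def by (rule H3_swap23) measurable
  finally show ?thesis .
qed

lemma H3_flip1:
  assumes [measurable]: "F \<in> borel_measurable borel4"
  shows "H3 (\<lambda>(a, x, y, z). F (a, - x, y, z)) = H3 F"
proof -
  define G where "G = (\<lambda>(a, x, y, z). F (a, y, x, z))"
  have [measurable]: "G \<in> borel_measurable borel4" unfolding G_def by measurable
  define G' where "G' = (\<lambda>(a, x, y, z). G (a, x, - y, z))"
  have [measurable]: "G' \<in> borel_measurable borel4" unfolding G'_def by measurable
  have "H3 (\<lambda>(a, x, y, z). F (a, - x, y, z)) = H3 (\<lambda>(a, x, y, z). G' (a, y, x, z))" by (simp add: G'_def G_def)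
  also have "\<dots> = H3 G'" by (rule H3_swap12) measurable
  also have "\<dots> = H3 G" unfolding G'_def by (rule H3_flip2) measurable
  also have "\<dots> = H3 F" unfolding G_def by (rule H3_swap12) measurable
  finally show ?thesis .
qed

lemma H3_octant:
  assumes [measurable]: "F \<in> borel_measurable borel4"
    and inv: "\<And>a x y z. F (a, - x, y, z) = F (a, x, y, z)" "\<And>a x y z. F (a, x, - y, z) = F (a, x, y, z)" "\<And>a x y z. F (a, x, y, - z) = F (a, x, y, z)"
  shows "H3 F = 8 * H3 (\<lambda>(a, x, y, z). if 0 \<le> x \<and> 0 \<le> y \<and> 0 \<le> z then F (a, x, y, z) else 0)"
proof -
  define G1 where "G1 = (\<lambda>(a :: real, x :: real, y :: real, z :: real). if 0 \<le> x then F (a, x, y, z) else 0)"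
  define G2 where "G2 = (\<lambda>(a, x, y, z). if 0 \<le> y then G1 (a, x, y, z) else 0)"
  define G3 where "G3 = (\<lambda>(a, x, y, z). if 0 \<le> z then G2 (a, x, y, z) else 0)"
  have [measurable]: "G1 \<in> borel_measurable borel4" unfolding G1_def by measurable
  have [measurable]: "G2 \<in> borel_measurable borel4" unfolding G2_def by measurable
  have [measurable]: "G3 \<in> borel_measurable borel4" unfolding G3_def by measurable
  have "H3 F = H3 (\<lambda>X. G1 X + (\<lambda>(a, x, y, z). G1 (a, - x, y, z)) X)"
    by (rule H3_cong_AE) (auto simp: G1_def inv)
  also have "\<dots> = H3 G1 + H3 G1" by (subst H3_add, measurable) (subst H3_flip1, simp_all)
  also have "H3 G1 = H3 (\<lambda>X. G2 X + (\<lambda>(a, x, y, z). G2 (a, x, - y, z)) X)"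
    by (rule H3_cong_AE) (auto simp: G2_def G1_def inv)
  also have "\<dots> = H3 G2 + H3 G2" by (subst H3_add, measurable) (subst H3_flip2, simp_all)
  also have "H3 G2 = H3 (\<lambda>X. G3 X + (\<lambda>(a, x, y, z). G3 (a, x, y, - z)) X)"
    by (rule H3_cong_AE) (auto simp: G3_def G2_def G1_def inv)
  also have "\<dots> = H3 G3 + H3 G3" by (subst H3_add, measurable) (subst H3_flip3, simp_all)
  also have "G3 = (\<lambda>(a, x, y, z). if 0 \<le> x \<and> 0 \<le> y \<and> 0 \<le> z then F (a, x, y, z) else 0)"
    by (auto simp: G3_def G2_def G1_def fun_eq_iff)
  finally have e: "H3 F = (let h = H3 (\<lambda>(a, x, y, z). if 0 \<le> x \<and> 0 \<le> y \<and> 0 \<le> z then F (a, x, y, z) else 0) in h + h + (h + h) + (h + h + (h + h)))" by (simp add: Let_def)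
  have "8 * h = (1 + 1 + (1 + 1) + (1 + 1 + (1 + 1))) * h" for h :: ennreal by (rule arg_cong[where f = "\<lambda>c. c * h"]) simp
  then have "h + h + (h + h) + (h + h + (h + h)) = 8 * h" for h :: ennreal by (simp only: distrib_right mult_1)
  then show ?thesis unfolding e Let_def .
qed

lemma H3_chamber:
  assumes [measurable]: "F \<in> borel_measurable borel4"
    and inv: "\<And>a x y z. F (a, y, x, z) = F (a, x, y, z)" "\<And>a x y z. F (a, x, z, y) = F (a, x, y, z)"
  shows "H3 F = 6 * H3 (\<lambda>(a, x, y, z). if z \<le> y \<and> y \<le> x then F (a, x, y, z) else 0)"
proof -
  define G where "G = (\<lambda>(a :: real, x :: real, y :: real, z :: real). if z \<le> y \<and> y \<le> x then F (a, x, y, z) else 0)"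
  have [measurable]: "G \<in> borel_measurable borel4" unfolding G_def by measurable
  define s1 :: "real \<times> real \<times> real \<times> real \<Rightarrow> real \<times> real \<times> real \<times> real" where "s1 = (\<lambda>(a, x, y, z). (a, y, x, z))"
  define s2 :: "real \<times> real \<times> real \<times> real \<Rightarrow> real \<times> real \<times> real \<times> real" where "s2 = (\<lambda>(a, x, y, z). (a, x, z, y))"
  have [measurable]: "s1 \<in> borel4 \<rightarrow>\<^sub>M borel4" "s2 \<in> borel4 \<rightarrow>\<^sub>M borel4" unfolding s1_def s2_def by measurable
  have i1: "H3 (\<lambda>X. K (s1 X)) = H3 K" if "K \<in> borel_measurable borel4" for K
    using H3_swap12[OF that] by (simp add: s1_def case_prod_beta')
  have i2: "H3 (\<lambda>X. K (s2 X)) = H3 K" if "K \<in> borel_measurable borel4" for K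
    using H3_swap23[OF that] by (simp add: s2_def case_prod_beta')
  \<comment> \<open>The images of the chamber z \<le> y \<le> x under the five remaining
    permutations, built as words in two transpositions so that only the two swap rules are
    applied.\<close>
  define G1 where "G1 = (\<lambda>X. G (s1 X))"
  define G2 where "G2 = (\<lambda>X. G (s2 X))"
  define G3 where "G3 = (\<lambda>X. G1 (s2 X))"
  define G4 where "G4 = (\<lambda>X. G2 (s1 X))"
  define G5 where "G5 = (\<lambda>X. G3 (s1 X))"
  have [measurable]: "G1 \<in> borel_measurable borel4" "G2 \<in> borel_measurable borel4" unfolding G1_def G2_def by measurable
  have [measurable]: "G3 \<in> borel_measurable borel4" "G4 \<in> borel_measurable borel4" unfolding G3_def G4_def by measurable
  have [measurable]: "G5 \<in> borel_measurable borel4" unfolding G5_def by measurable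
  have e1: "H3 G1 = H3 G" unfolding G1_def by (rule i1[of G]) measurable
  have e2: "H3 G2 = H3 G" unfolding G2_def by (rule i2[of G]) measurable
  have e3: "H3 G3 = H3 G1" unfolding G3_def by (rule i2[of G1]) measurable
  have e4: "H3 G4 = H3 G2" unfolding G4_def by (rule i1[of G2]) measurable
  have e5: "H3 G5 = H3 G3" unfolding G5_def by (rule i1[of G3]) measurable
  note eq = e1 e2 e3 e4 e5
  have "H3 F = H3 (\<lambda>X. (G X + (G1 X + G2 X)) + (G3 X + (G4 X + G5 X)))"
  proof (rule H3_cong_AE)
    fix x y z :: real assume d: "x \<noteq> y" "x \<noteq> z" "y \<noteq> z"
    have p1: "F (1, y, x, z) = F (1, x, y, z)" by (rule inv(1))
    have p2: "F (1, x, z, y) = F (1, x, y, z)" by (rule inv(2))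
    have p3: "F (1, y, z, x) = F (1, x, y, z)" by (rule trans[OF inv(2) p1])
    have p4: "F (1, z, x, y) = F (1, x, y, z)" by (rule trans[OF inv(1) p2])
    have p5: "F (1, z, y, x) = F (1, x, y, z)" by (rule trans[OF inv(1) p3])
    show "F (1, x, y, z) = (G (1, x, y, z) + (G1 (1, x, y, z) + G2 (1, x, y, z))) + (G3 (1, x, y, z) + (G4 (1, x, y, z) + G5 (1, x, y, z)))"
      unfolding G1_def G2_def G3_def G4_def G5_def s1_def s2_def G_def prod.case p1 p2 p3 p4 p5
      using d by (cases "x < y"; cases "y < z"; cases "x < z") auto
  qed
  also have "\<dots> = (H3 G + (H3 G + H3 G)) + (H3 G + (H3 G + H3 G))"
    by ((subst H3_add, measurable)+) (simp only: eq)
  also have "\<dots> = 6 * H3 G"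
  proof -
    have "6 * h = (1 + (1 + 1) + (1 + (1 + 1))) * h" for h :: ennreal by (rule arg_cong[where f = "\<lambda>c. c * h"]) simp
    then show ?thesis by (simp only: distrib_right mult_1)
  qed
  finally show ?thesis unfolding G_def .
qed

lemma hvol_region:
  assumes [measurable]: "F \<in> borel_measurable borel4"
    and S: "\<And>v. v \<in> S \<longleftrightarrow> v \<bullet> v < 1 \<and> F (1, v $ 1, v $ 2, v $ 3) = 1"
    and F: "\<And>X. F X = 0 \<or> F X = 1"
  shows "hvol S = enn2real (H3 F)"
proof (rule hvol_eq_H3)
  have n: "vector [x, y, z] \<bullet> (vector [x, y, z] :: pt3) = x\<^sup>2 + y\<^sup>2 + z\<^sup>2" for x y z :: real
    by (simp add: inner_vec_def sum_3 power2_eq_square)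
  show "F (1, x, y, z) = indicator S (vector [x, y, z])" if "x\<^sup>2 + y\<^sup>2 + z\<^sup>2 < 1" for x y z
    using that F[of "(1, x, y, z)"] by (auto simp: indicator_def S n)
  have [measurable]: "(\<lambda>v :: pt3. v $ i) \<in> borel_measurable borel" for i
    by (intro borel_measurable_continuous_onI continuous_intros)
  have "S = {v \<in> space borel. v \<bullet> v < 1 \<and> F (1, v $ 1, v $ 2, v $ 3) = 1}" using S by auto
  also have "\<dots> \<in> sets borel" by measurable
  finally show "S \<in> sets borel" .
  show "S \<subseteq> kball" using S by (auto simp: mem_kball)
qed

section \<open>The truncated cube in terms of k\<close>

definition ypar :: "real \<Rightarrow> real" where "ypar k = sqrt ((1 + k) / (3 + k))"
definition kpar :: "real \<Rightarrow> real" where "kpar p = 2 * cos (2 * pi / p) - 1"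
definition theta :: "real \<Rightarrow> real" where "theta k = arccos ((1 + k) / 2)"

lemma ypar: 
  assumes "0 < k" "k < 1"
  shows "ypar k > 0" "(ypar k)\<^sup>2 = (1 + k) / (3 + k)" "3 * (ypar k)\<^sup>2 - 1 = 2 * k / (3 + k)"
    "1 - (ypar k)\<^sup>2 = 2 / (3 + k)" "1 - 2 * (ypar k)\<^sup>2 = (1 - k) / (3 + k)"
proof -
  show "ypar k > 0" using assms by (simp add: ypar_def)
  show e: "(ypar k)\<^sup>2 = (1 + k) / (3 + k)" using assms by (simp add: ypar_def)
  show "3 * (ypar k)\<^sup>2 - 1 = 2 * k / (3 + k)" "1 - (ypar k)\<^sup>2 = 2 / (3 + k)" "1 - 2 * (ypar k)\<^sup>2 = (1 - k) / (3 + k)"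
    unfolding e using assms by (simp_all add: field_simps)
qed

text \<open>The bound k (1 + k) (3 + k) < 1 is the condition p < 7 in algebraic form: 2 pi / 7 < t <
  pi / 3 makes sin (7 t / 2) negative, hence cos (4 t) > cos (3 t), and this difference factors into
  cos t - 1 and a cubic in cos t.\<close>

lemma kpar_bounds:
  assumes "6 < p" "p < 7"
  shows "0 < kpar p" "kpar p < 247 / 1000" "kpar p * (1 + kpar p) * (3 + kpar p) < 1" "theta (kpar p) = 2 * pi / p"
proof -
  define t where "t = 2 * pi / p"
  have t: "2 * pi / 7 < t" "t < pi / 3" using assms by (simp_all add: t_def field_simps)
  have t0: "0 < t" "t < pi" using t pi_gt_zero by (linarith, linarith)
  have c1: "cos t > 1 / 2" using cos_monotone_0_pi[of t "pi / 3"] t t0 by (simp add: cos_60)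
  have c2: "cos t < 1" using cos_monotone_0_pi[of 0 t] t0 by simp
  show k0: "0 < kpar p" using c1 by (simp add: kpar_def t_def)
  show "theta (kpar p) = 2 * pi / p" using t0 by (simp add: theta_def kpar_def t_def[symmetric] arccos_cos)
  have "sin (7 * t / 2) < 0"
  proof -
    have "sin (7 * t / 2 - pi) > 0" using t by (intro sin_gt_zero) auto
    then show ?thesis by (simp add: sin_diff)
  qed
  moreover have "sin (t / 2) > 0" using t0 by (intro sin_gt_zero) auto
  ultimately have "0 < - (2 * sin (7 * t / 2) * sin (t / 2))" by (simp add: mult_neg_pos)
  also have "- (2 * sin (7 * t / 2) * sin (t / 2)) = cos (4 * t) - cos (3 * t)"
  proof -
    have e: "(4 * t + 3 * t) / 2 = 7 * t / 2" "(3 * t - 4 * t) / 2 = - (t / 2)" by simp_all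
    show ?thesis unfolding cos_diff_cos e sin_minus by simp
  qed
  \<comment> \<open>The cubic is, up to scaling, the minimal polynomial of cos (2 pi / 7).
    Substituting cos t = (1 + k) / 2 turns it into k (1 + k) (3 + k) - 1.\<close>
  also have "cos (4 * t) - cos (3 * t) = (cos t - 1) * (8 * cos t ^ 3 + 4 * (cos t)\<^sup>2 - 4 * cos t - 1)"
  proof -
    have "cos (4 * t) = 2 * (2 * (cos t)\<^sup>2 - 1)\<^sup>2 - 1"
      using cos_double_cos[of "2 * t"] cos_double_cos[of t] by simp
    moreover have "cos (3 * t) = 4 * cos t ^ 3 - 3 * cos t" by (rule cos_treble_cos)
    ultimately show ?thesis by (simp add: power2_eq_square power3_eq_cube algebra_simps)
  qed
  finally have "8 * cos t ^ 3 + 4 * (cos t)\<^sup>2 - 4 * cos t - 1 < 0" using c2 by (simp add: zero_less_mult_iff)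
  then show k1: "kpar p * (1 + kpar p) * (3 + kpar p) < 1"
    unfolding kpar_def t_def[symmetric] by (simp add: power2_eq_square power3_eq_cube algebra_simps)
  show "kpar p < 247 / 1000"
  proof (rule ccontr)
    \<comment> \<open>The value 0.247 is slightly above 2 cos (2 pi / 7) - 1, the positive root of k
      (1 + k) (3 + k) = 1.\<close>
    assume "\<not> kpar p < 247 / 1000"
    then have "247 / 1000 * (1 + 247 / 1000) * (3 + 247 / 1000) \<le> kpar p * (1 + kpar p) * (3 + kpar p)"
      by (intro mult_mono) auto
    then show False using k1 by simp
  qed
qed

text \<open>On the prescribed range the dihedral angle is arccos (y^2 / (1 - y^2)). Setting the
  cosine equal to (1 + k) / 2 is a linear equation in y^2, which gives existence and uniqueness
  together.\<close>

lemma ycube_eq: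
  assumes "6 < p" "p < 7"
  shows "ycube p = ypar (kpar p)"
proof -
  define k where "k = kpar p"
  note kb = kpar_bounds[OF assms, folded k_def]
  have k: "0 < k" "k < 1" using kb by auto
  have cs: "cos (2 * pi / p) = (1 + k) / 2" by (simp add: k_def kpar_def)
  have p: "0 \<le> 2 * pi / p" "2 * pi / p \<le> pi" using assms by (simp_all add: field_simps)
  have pa: "pole_angle (vector [1 / y, 0, 0]) (vector [0, 1 / y, 0]) = arccos (y\<^sup>2 / (1 - y\<^sup>2))"
    if "1 / sqrt 3 < y" "y < 1 / sqrt 2" for y
  proof -
    have y0: "y > 0" using that(1) by (smt (verit) divide_pos_pos real_sqrt_gt_zero)
    have "y\<^sup>2 < (1 / sqrt 2)\<^sup>2" using that y0 by (intro power_strict_mono) auto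
    then have y2: "y\<^sup>2 < 1 / 2" by (simp add: power_divide)
    have "1 / y * (1 / y) = 1 / y\<^sup>2" by (simp add: power2_eq_square)
    moreover have "1 / y\<^sup>2 > 1" using y2 y0 by (simp add: pos_less_divide_eq)
    ultimately have "pole_angle (vector [1 / y, 0, 0]) (vector [0, 1 / y, 0]) = arccos (1 / (1 / y\<^sup>2 - 1))"
      by (simp add: pole_angle_def inner_vec_def sum_3 power2_eq_square[symmetric])
    also have "1 / (1 / y\<^sup>2 - 1) = y\<^sup>2 / (1 - y\<^sup>2)" using y0 y2 by (simp add: field_simps)
    finally show ?thesis .
  qed
  show ?thesis unfolding ycube_def k_def[symmetric]
  proof (rule the_equality)
    have "1 / 3 < (1 + k) / (3 + k)" "(1 + k) / (3 + k) < 1 / 2" using k by (simp_all add: field_simps)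
    then have "sqrt (1 / 3) < ypar k" "ypar k < sqrt (1 / 2)" unfolding ypar_def by (simp_all only: real_sqrt_less_iff)
    then have b: "1 / sqrt 3 < ypar k" "ypar k < 1 / sqrt 2" by (simp_all add: real_sqrt_divide)
    have "(ypar k)\<^sup>2 / (1 - (ypar k)\<^sup>2) = (1 + k) / 2" unfolding ypar(4)[OF k] ypar(2)[OF k] using k by (simp add: field_simps)
    then have "pole_angle (vector [1 / ypar k, 0, 0]) (vector [0, 1 / ypar k, 0]) = 2 * pi / p"
      unfolding pa[OF b] using p by (simp only: cs[symmetric] arccos_cos)
    with b show "1 / sqrt 3 < ypar k \<and> ypar k < 1 / sqrt 2 \<and> pole_angle (vector [1 / ypar k, 0, 0]) (vector [0, 1 / ypar k, 0]) = 2 * pi / p"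
      by blast
  next
    fix y assume y: "1 / sqrt 3 < y \<and> y < 1 / sqrt 2 \<and> pole_angle (vector [1 / y, 0, 0]) (vector [0, 1 / y, 0]) = 2 * pi / p"
    then have y0: "y > 0" by (smt (verit) divide_pos_pos real_sqrt_gt_zero)
    have "y\<^sup>2 < (1 / sqrt 2)\<^sup>2" using y y0 by (intro power_strict_mono) auto
    then have y2: "y\<^sup>2 < 1 / 2" by (simp add: power_divide)
    have "arccos (y\<^sup>2 / (1 - y\<^sup>2)) = 2 * pi / p" using y pa by metis
    then have "cos (arccos (y\<^sup>2 / (1 - y\<^sup>2))) = (1 + k) / 2" using cs by simp
    moreover have "y\<^sup>2 / (1 - y\<^sup>2) \<le> 1" "- 1 \<le> y\<^sup>2 / (1 - y\<^sup>2)" using y2 by (simp_all add: divide_le_eq le_divide_eq)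
    ultimately have "y\<^sup>2 / (1 - y\<^sup>2) = (1 + k) / 2" by simp
    then have "y\<^sup>2 = (1 + k) / (3 + k)" using y2 k by (simp add: field_simps)
    then have "y\<^sup>2 = (ypar k)\<^sup>2" by (simp add: ypar(2)[OF k])
    then show "y = ypar k" using y0 ypar(1)[OF k] by (simp add: power2_eq_iff)
  qed
qed

text \<open>Written with a factor a on the constants so that it is meaningful on rays and can be
  transported by a Lorentz map. The eight truncations are merged into one condition, since the
  maximum over the eight sign patterns is the sum of absolute values.\<close>

definition cube_fun :: "real \<Rightarrow> real \<times> real \<times> real \<times> real \<Rightarrow> ennreal" where
  "cube_fun Y = (\<lambda>(a, x, y, z). if \<bar>x\<bar> \<le> Y * a \<and> \<bar>y\<bar> \<le> Y * a \<and> \<bar>z\<bar> \<le> Y * a \<and> Y * (\<bar>x\<bar> + \<bar>y\<bar> + \<bar>z\<bar>) \<le> a then 1 else 0)"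

definition sgx :: "nat \<Rightarrow> real" where "sgx i = (if i \<in> {1, 2, 5, 6} then 1 else - 1)"
definition sgy :: "nat \<Rightarrow> real" where "sgy i = (if i \<in> {2, 3, 6, 7} then 1 else - 1)"
definition sgz :: "nat \<Rightarrow> real" where "sgz i = (if i \<in> {5, 6, 7, 8} then 1 else - 1)"

lemma range18: "{1..8 :: nat} = {1, 2, 3, 4, 5, 6, 7, 8}" by auto

lemma inner_vert:
  assumes "i \<in> {1..8}"
  shows "v \<bullet> vert Y i = Y * (sgx i * v $ 1 + sgy i * v $ 2 + sgz i * v $ 3)"
  using assms unfolding range18
  by (auto simp: vert_def sgx_def sgy_def sgz_def inner_vec_def sum_3 algebra_simps)

lemma vert_inner:
  assumes "i \<in> {1..8}"
  shows "vert Y i \<bullet> vert Y i = 3 * Y\<^sup>2"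
  using assms unfolding range18
  by (auto simp: vert_def inner_vec_def sum_3 power2_eq_square)

lemma all_vertices:
  fixes x y z c :: real
  assumes "Y > 0"
  shows "(\<forall>i\<in>{1..8}. Y * (sgx i * x + sgy i * y + sgz i * z) \<le> c) \<longleftrightarrow> Y * (\<bar>x\<bar> + \<bar>y\<bar> + \<bar>z\<bar>) \<le> c"
proof -
  have e: "Y * w \<le> c \<longleftrightarrow> w \<le> c / Y" for w using assms by (simp add: pos_le_divide_eq mult.commute)
  show ?thesis unfolding e range18 by (simp add: sgx_def sgy_def sgz_def abs_if) auto
qed

lemma mem_Cr:
  assumes "6 < p" "p < 7"
  shows "v \<in> Cr p \<longleftrightarrow> v \<bullet> v < 1 \<and> cube_fun (ypar (kpar p)) (1, v $ 1, v $ 2, v $ 3) = 1"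
proof -
  have k: "0 < kpar p" "kpar p < 1" using kpar_bounds[OF assms] by auto
  have "v \<in> Cr p \<longleftrightarrow> v \<bullet> v < 1 \<and> (\<forall>j. \<bar>v $ j\<bar> \<le> ypar (kpar p)) \<and> (\<forall>i\<in>{1..8}. v \<bullet> vert (ypar (kpar p)) i \<le> 1)"
    unfolding Cr_def B_def ycube_eq[OF assms] by (auto simp: mem_kball)
  also have "(\<forall>i\<in>{1..8}. v \<bullet> vert (ypar (kpar p)) i \<le> 1) \<longleftrightarrow> ypar (kpar p) * (\<bar>v $ 1\<bar> + \<bar>v $ 2\<bar> + \<bar>v $ 3\<bar>) \<le> 1"
    using all_vertices[OF ypar(1)[OF k]] by (simp add: inner_vert)
  finally show ?thesis by (simp add: cube_fun_def forall_3)
qed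

lemma cube_fun_measurable [measurable]: "cube_fun Y \<in> borel_measurable borel4"
  unfolding cube_fun_def by measurable

text \<open>Geometrically s = tan (pi / p) belongs to half the dihedral angle, t = tanh h to half
  the truncated edge, and sqrt k is tanh of half a side of the triangle that the solid cuts out of a
  truncating plane.\<close>

lemma frame_parameters:
  assumes k: "0 < k" "k < 1"
  defines "Y \<equiv> ypar k" and "s \<equiv> sqrt ((1 - k) / (3 + k))" and "n \<equiv> sqrt (4 / (3 + k))"
  defines "t \<equiv> s / Y" and "ch \<equiv> Y / sqrt (Y\<^sup>2 - s\<^sup>2)"
  shows "s > 0" "s\<^sup>2 = 1 - 2 * Y\<^sup>2" "n > 0" "n\<^sup>2 = 2 * (1 - Y\<^sup>2)" "ch > 0" "ch\<^sup>2 * (1 - t\<^sup>2) = 1"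
    "t = sqrt ((1 - k) / (1 + k))" "ch * sqrt 2 * (Y\<^sup>2 - s\<^sup>2) / (Y * n) = sqrt k"
    "((Y\<^sup>2 - s\<^sup>2) / Y * ch)\<^sup>2 = 3 * Y\<^sup>2 - 1" "(Y\<^sup>2 - s\<^sup>2) / Y * ch > 0" "s\<^sup>2 = (1 - k) / (3 + k)"
proof -
  note y = ypar[OF k, folded Y_def]
  show "s > 0" "n > 0" using k by (simp_all add: s_def n_def)
  show s2': "s\<^sup>2 = (1 - k) / (3 + k)" using k by (simp add: s_def)
  then show s2: "s\<^sup>2 = 1 - 2 * Y\<^sup>2" using y(5) by simp
  have n2': "n\<^sup>2 = 4 / (3 + k)" using k by (simp add: n_def)
  then show "n\<^sup>2 = 2 * (1 - Y\<^sup>2)" unfolding y(4) by simp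
  have d: "Y\<^sup>2 - s\<^sup>2 = 2 * k / (3 + k)" unfolding y(2) s2' by (simp add: diff_divide_distrib[symmetric])
  have d0: "Y\<^sup>2 - s\<^sup>2 > 0" unfolding d using k by simp
  show ch0: "ch > 0" using y(1) d0 by (simp add: ch_def)
  have ch2: "ch\<^sup>2 = Y\<^sup>2 / (Y\<^sup>2 - s\<^sup>2)" using d0 by (simp add: ch_def power_divide)
  show "ch\<^sup>2 * (1 - t\<^sup>2) = 1" 
  proof -
    have "1 - t\<^sup>2 = (Y\<^sup>2 - s\<^sup>2) / Y\<^sup>2" using y(1) by (simp add: t_def power_divide diff_divide_distrib)
    then show ?thesis unfolding ch2 using y(1) d0 by simp
  qed
  show "t = sqrt ((1 - k) / (1 + k))" unfolding t_def s_def Y_def ypar_def using k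
    by (simp add: real_sqrt_divide[symmetric])
  have pos: "ch * sqrt 2 * (Y\<^sup>2 - s\<^sup>2) / (Y * n) \<ge> 0" using ch0 d0 y(1) \<open>n > 0\<close> by simp
  have "(ch * sqrt 2 * (Y\<^sup>2 - s\<^sup>2) / (Y * n))\<^sup>2 = 2 * (Y\<^sup>2 - s\<^sup>2) / n\<^sup>2"
    using y(1) d0 \<open>n > 0\<close> by (simp add: power_mult_distrib power_divide ch2 power2_eq_square[of "Y\<^sup>2 - s\<^sup>2"])
  also have "\<dots> = k" unfolding d n2' using k by simp
  finally show "ch * sqrt 2 * (Y\<^sup>2 - s\<^sup>2) / (Y * n) = sqrt k" using pos by (metis real_sqrt_abs abs_of_nonneg)
  have "((Y\<^sup>2 - s\<^sup>2) / Y * ch)\<^sup>2 = Y\<^sup>2 - s\<^sup>2" using y(1) d0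
    by (simp add: power_mult_distrib power_divide ch2 power2_eq_square[of "Y\<^sup>2 - s\<^sup>2"])
  then show "((Y\<^sup>2 - s\<^sup>2) / Y * ch)\<^sup>2 = 3 * Y\<^sup>2 - 1" unfolding d y(3) .
  show "(Y\<^sup>2 - s\<^sup>2) / Y * ch > 0" using d0 y(1) ch0 by simp
qed

lemma if_homogeneous:
  assumes "\<And>r a b c d. r > 0 \<Longrightarrow> P (r * a) (r * b) (r * c) (r * d) \<longleftrightarrow> P a b c d"
  shows "homogeneous (\<lambda>(a, b, c, d). if P a b c d then 1 else 0)"
  using assms unfolding homogeneous_def by simp

lemma nonneg_mult_pos: "0 < c \<Longrightarrow> 0 \<le> c * x \<longleftrightarrow> 0 \<le> x" for c x :: real
  by (simp add: zero_le_mult_iff)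

text \<open>The factor 48 comes from 8 octants and 6 orders of the coordinates; the remaining piece
  is carried by \<open>frame\<close> to the prism 0 \<le> q \<le> s p, p \<le> sqrt k, 0 \<le> r
  \<le> t.\<close>

lemma H3_cube_fun:
  assumes k: "0 < k" "k < 1"
  shows "H3 (cube_fun (ypar k)) = 48 * (\<integral>\<^sup>+T. ennreal (1 / (2 * (1 + T\<^sup>2)) *
     (artanh (sqrt ((1 - k) / (1 + k)) / sqrt (1 - (1 + T\<^sup>2) * k)) / sqrt (1 - (1 + T\<^sup>2) * k)
       - artanh (sqrt ((1 - k) / (1 + k))))) * indicator {0..sqrt ((1 - k) / (3 + k))} T \<partial>lborel)"
proof -
  define Y where "Y = ypar k"
  define s where "s = sqrt ((1 - k) / (3 + k))"
  define n where "n = sqrt (4 / (3 + k))"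
  define t where "t = s / Y"
  define ch where "ch = Y / sqrt (Y\<^sup>2 - s\<^sup>2)"
  note fp = frame_parameters[OF k, folded Y_def s_def n_def, folded t_def ch_def]
  have Y: "Y > 0" using ypar(1)[OF k] by (simp add: Y_def)
  define D where "D = (\<lambda>(a, x, y, z). if 0 \<le> z \<and> z \<le> y \<and> y \<le> x \<and> x \<le> Y * a \<and> Y * (x + y + z) \<le> a then 1 else 0 :: ennreal)"
  have [measurable]: "D \<in> borel_measurable borel4" unfolding D_def by measurable
  have homD: "homogeneous D" unfolding D_def
  proof (rule if_homogeneous)
    fix r a b c d :: real assume r: "r > 0"
    have "0 \<le> r * d \<longleftrightarrow> 0 \<le> d" "r * d \<le> r * c \<longleftrightarrow> d \<le> c" "r * c \<le> r * b \<longleftrightarrow> c \<le> b"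
      "r * b \<le> Y * (r * a) \<longleftrightarrow> b \<le> Y * a" "Y * (r * b + r * c + r * d) \<le> r * a \<longleftrightarrow> Y * (b + c + d) \<le> a"
      using r mult_le_cancel_left_pos[OF r, of b "Y * a"] mult_le_cancel_left_pos[OF r, of "Y * (b + c + d)" a]
      by (simp_all add: zero_le_mult_iff algebra_simps)
    then show "(0 \<le> r * d \<and> r * d \<le> r * c \<and> r * c \<le> r * b \<and> r * b \<le> Y * (r * a) \<and> Y * (r * b + r * c + r * d) \<le> r * a)
      \<longleftrightarrow> (0 \<le> d \<and> d \<le> c \<and> c \<le> b \<and> b \<le> Y * a \<and> Y * (b + c + d) \<le> a)" by blast
  qed
  define O8 where "O8 = (\<lambda>(a, x, y, z). if 0 \<le> x \<and> 0 \<le> y \<and> 0 \<le> z then cube_fun Y (a, x, y, z) else 0)"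
  have [measurable]: "O8 \<in> borel_measurable borel4" unfolding O8_def by measurable
  have "H3 (cube_fun Y) = 8 * H3 O8" unfolding O8_def
    by (rule H3_octant) (measurable, simp_all add: cube_fun_def)
  also have "H3 O8 = 6 * H3 (\<lambda>(a, x, y, z). if z \<le> y \<and> y \<le> x then O8 (a, x, y, z) else 0)"
    by (rule H3_chamber) (measurable, auto simp: O8_def cube_fun_def add_ac)
  also have "(\<lambda>(a, x, y, z). if z \<le> y \<and> y \<le> x then O8 (a, x, y, z) else 0) = D"
    by (auto simp: fun_eq_iff O8_def D_def cube_fun_def)
  also have "H3 D = H3 (\<lambda>X. D (frame Y s n t ch X))"
    by (rule H3_frame[OF _ homD fp(1,2,3,4,5,6)]) measurable
  also have "\<dots> = (\<integral>\<^sup>+T. ennreal (1 / (2 * (1 + T\<^sup>2)) *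
     (artanh (t / sqrt (1 - (1 + T\<^sup>2) * (sqrt k)\<^sup>2)) / sqrt (1 - (1 + T\<^sup>2) * (sqrt k)\<^sup>2) - artanh t)) * indicator {0..s} T \<partial>lborel)"
  proof (rule H3_prism)
    fix p q r
    obtain d x y z where fr: "frame Y s n t ch (1, p, q, r) = (d, x, y, z)" by (metis prod_cases4)
    note ff = frame_forms[OF fp(1,2,3,4) Y t_def fr]
    have "x \<le> Y * d \<longleftrightarrow> 0 \<le> n / sqrt 2 * q" using ff(1) by linarith
    then have 1: "x \<le> Y * d \<longleftrightarrow> 0 \<le> q" using fp(3) by (simp add: zero_le_mult_iff zero_le_divide_iff)
    have "y \<le> x \<longleftrightarrow> 0 \<le> sqrt 2 / n * (s * p - q)" using ff(2) by linarith
    then have 2: "y \<le> x \<longleftrightarrow> q \<le> s * p" using fp(3) by (simp add: zero_le_mult_iff zero_le_divide_iff)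
    have "z \<le> y \<longleftrightarrow> 0 \<le> n / (s * sqrt 2) * (sqrt k - p)" using ff(3) unfolding fp(8) mult_1_right by linarith
    moreover have "n / (s * sqrt 2) > 0" using fp(1,3) by simp
    ultimately have 3: "z \<le> y \<longleftrightarrow> p \<le> sqrt k" using nonneg_mult_pos by (metis diff_ge_0_iff_ge)
    have "Y * (x + y + z) \<le> d \<longleftrightarrow> 0 \<le> (Y\<^sup>2 - s\<^sup>2) / Y * ch * r" using ff(4) by linarith
    then have 4: "Y * (x + y + z) \<le> d \<longleftrightarrow> 0 \<le> r" unfolding nonneg_mult_pos[OF fp(10)] .
    have 5: "0 \<le> z \<longleftrightarrow> r \<le> t" using ff(5) fp(5) by (simp add: zero_le_mult_iff)
    show "D (frame Y s n t ch (1, p, q, r)) = (if 0 \<le> q \<and> q \<le> s * p \<and> p \<le> sqrt k \<and> 0 \<le> r \<and> r \<le> t then 1 else 0)"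
      unfolding fr D_def prod.case 1 2 3 4 5 by auto
  next
    show "t > 0" using fp(1) Y by (simp add: t_def)
    have "t\<^sup>2 = (1 - k) / (1 + k)" unfolding fp(7) using k by simp
    moreover have "(sqrt k)\<^sup>2 * (1 + s\<^sup>2) = 4 * k / (3 + k)" unfolding fp(11) using k by (simp add: field_simps)
    moreover have "(1 - k) / (1 + k) + 4 * k / (3 + k) < 1"
    proof -
      \<comment> \<open>The corner of the prism farthest from the origin is the image of the centre
        of the cube; this inequality, valid for k < 1, places it inside the ball.\<close>
      have "4 * k / (3 + k) < 2 * k / (1 + k)" using k by (simp add: field_simps)
      moreover have "(1 - k) / (1 + k) = 1 - 2 * k / (1 + k)" using k by (simp add: field_simps)
      ultimately show ?thesis by simp
    qed
    ultimately show "t\<^sup>2 + (sqrt k)\<^sup>2 * (1 + s\<^sup>2) < 1" by simp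
  qed (use fp(1) k in auto)
  finally show ?thesis unfolding fp(7) Y_def[symmetric] s_def[symmetric] using k
    by (simp add: mult.assoc[symmetric])
qed

lemma arctan_half_theta:
  assumes k: "0 < k" "k < 1"
  shows "arctan (sqrt ((1 - k) / (3 + k))) = theta k / 2"
proof -
  define th where "th = theta k"
  have c: "cos th = (1 + k) / 2" unfolding th_def theta_def using k by (simp add: cos_arccos)
  have b: "0 < th" "th < pi" unfolding th_def theta_def using k arccos_lt_bounded[of "(1 + k) / 2"] by auto
  have ch: "cos (th / 2) > 0" using b by (intro cos_gt_zero_pi) auto
  have sh: "sin (th / 2) > 0" using b by (intro sin_gt_zero) auto
  have sc: "(sin (th / 2))\<^sup>2 = (1 - k) / 4" "(cos (th / 2))\<^sup>2 = (3 + k) / 4"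
    using c cos_double_sin[of "th / 2"] cos_double_cos[of "th / 2"] by simp_all
  have "(tan (th / 2))\<^sup>2 = (1 - k) / (3 + k)" unfolding tan_def power_divide sc using k by (simp add: field_simps)
  moreover have "tan (th / 2) > 0" using ch sh by (simp add: tan_def)
  ultimately have "sqrt ((1 - k) / (3 + k)) = tan (th / 2)" by (metis real_sqrt_abs abs_of_pos)
  then show ?thesis using b by (simp add: arctan_tan th_def)
qed

lemma H3_signs:
  assumes [measurable]: "F \<in> borel_measurable borel4" and e: "e1 \<in> {1, - 1}" "e2 \<in> {1, - 1}" "e3 \<in> {1, - 1 :: real}"
  shows "H3 (\<lambda>(a, x, y, z). F (a, e1 * x, e2 * y, e3 * z)) = H3 F"
proof -
  define F1 where "F1 = (\<lambda>(a, x, y, z). F (a, e1 * x, y, z))"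
  define F2 where "F2 = (\<lambda>(a, x, y, z). F1 (a, x, e2 * y, z))"
  have [measurable]: "F1 \<in> borel_measurable borel4" unfolding F1_def by measurable
  have [measurable]: "F2 \<in> borel_measurable borel4" unfolding F2_def by measurable
  have "H3 (\<lambda>(a, x, y, z). F (a, e1 * x, e2 * y, e3 * z)) = H3 (\<lambda>(a, x, y, z). F2 (a, x, y, e3 * z))"
    by (simp add: F2_def F1_def)
  also have "\<dots> = H3 F2" using e(3) H3_flip3[of F2] by auto
  also have "\<dots> = H3 F1" using e(2) H3_flip2[of F1] unfolding F2_def by auto
  also have "\<dots> = H3 F" using e(1) H3_flip1[of F] unfolding F1_def by auto
  finally show ?thesis .
qed

section \<open>Volume of a hyperball piece\<close>

text \<open>The distance condition in squared form is an inequality between two quadratic forms in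
  homogeneous coordinates, hence compatible with Lorentz maps. The height enters only through sinh^2
  eta.\<close>

lemma mem_hyperball:
  assumes p: "6 < p" "p < 7" and i: "i \<in> {1..8}" and eta: "0 \<le> eta" and v: "v \<bullet> v < 1"
  defines "Y \<equiv> ypar (kpar p)"
  shows "v \<in> hyperball p i eta \<longleftrightarrow>
    (1 - Y * (sgx i * v $ 1 + sgy i * v $ 2 + sgz i * v $ 3))\<^sup>2 \<le> (sinh eta)\<^sup>2 * (3 * Y\<^sup>2 - 1) * (1 - v \<bullet> v)"
proof -
  have k: "0 < kpar p" "kpar p < 1" using kpar_bounds[OF p] by auto
  have B: "B p i = vert Y i" by (simp add: B_def ycube_eq[OF p] Y_def)
  have b1: "B p i \<bullet> B p i > 1" unfolding B vert_inner[OF i]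
  proof -
    have "2 * kpar p / (3 + kpar p) > 0" using k by simp
    then show "1 < 3 * Y\<^sup>2" using ypar(3)[OF k] unfolding Y_def by linarith
  qed
  define W where "W = (1 - v \<bullet> v) * (3 * Y\<^sup>2 - 1)"
  have W: "W > 0" unfolding W_def using v b1 unfolding B vert_inner[OF i] by simp
  define P where "P = 1 - v \<bullet> B p i"
  have "v \<in> hyperball p i eta \<longleftrightarrow> arsinh (\<bar>P\<bar> / sqrt W) \<le> eta"
    using v hptdist_polplane[OF v b1] unfolding hyperball_def beta_def P_def W_def B vert_inner[OF i]
    by (simp add: mem_kball)
  also have "\<dots> \<longleftrightarrow> \<bar>P\<bar> / sqrt W \<le> sinh eta"
    using arsinh_less_iff_real[of "sinh eta" "\<bar>P\<bar> / sqrt W"] arsinh_sinh_real[of eta] by linarith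
  also have "\<dots> \<longleftrightarrow> \<bar>P\<bar> \<le> sinh eta * sqrt W" using W by (simp add: pos_divide_le_eq)
  also have "\<dots> \<longleftrightarrow> P\<^sup>2 \<le> (sinh eta * sqrt W)\<^sup>2"
    using eta W by (metis abs_le_square_iff abs_of_nonneg mult_nonneg_nonneg sinh_real_nonneg_iff real_sqrt_ge_zero less_imp_le)
  also have "(sinh eta * sqrt W)\<^sup>2 = (sinh eta)\<^sup>2 * W" using W by (simp add: power_mult_distrib)
  finally show ?thesis unfolding P_def W_def B inner_vert[OF i] by (simp add: mult_ac)
qed

lemma vec3_inner: "vector [x, y, z] \<bullet> (vector [a, b, c] :: pt3) = x * a + y * b + z * c" for x y z a b c :: real
  by (simp add: inner_vec_def sum_3)

text \<open>The bound on cosh^2 eta says eta \<le> w. The three faces away from the vertex are the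
  polar planes of (-1 / Y, 0, 0) and its permutations, at distance w, so \<open>same_side\<close>
  applies. The other truncating planes are at distance at least 2 h, since the inner product of the
  poles is at most Y^2, the value for neighbouring vertices; and k (1 + k) (3 + k) \<le> 1 gives w
  \<le> 2 h.\<close>

lemma hyperball_inside:
  assumes k: "0 < k" "k < 1" "k * (1 + k) * (3 + k) \<le> 1" and eta: "(cosh eta)\<^sup>2 \<le> (1 + k) * (3 + k) / k"
    and ball: "x\<^sup>2 + y\<^sup>2 + z\<^sup>2 < 1"
  defines "Y \<equiv> ypar k"
  assumes c: "x \<le> Y" "y \<le> Y" "z \<le> Y" "Y * (x + y + z) \<le> 1"
    and d: "(1 - Y * (x + y + z))\<^sup>2 \<le> (sinh eta)\<^sup>2 * (3 * Y\<^sup>2 - 1) * (1 - (x\<^sup>2 + y\<^sup>2 + z\<^sup>2))"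
  shows "cube_fun Y (1, x, y, z) = 1"
proof -
  note yy = ypar[OF k(1,2), folded Y_def]
  define v :: pt3 where "v = vector [x, y, z]"
  define a :: pt3 where "a = vector [Y, Y, Y]"
  have vv: "v \<bullet> v < 1" using ball by (simp add: v_def vec3_inner power2_eq_square)
  have va: "v \<bullet> a = Y * (x + y + z)" by (simp add: v_def a_def vec3_inner algebra_simps)
  have aa: "a \<bullet> a - 1 = 2 * k / (3 + k)" using yy(3) by (simp add: a_def vec3_inner power2_eq_square)
  have a1: "a \<bullet> a > 1" using aa k by (smt (verit) divide_pos_pos)
  have S0: "(0::real) \<le> (sinh eta)\<^sup>2" by simp
  have S1: "(sinh eta)\<^sup>2 + 1 = (cosh eta)\<^sup>2" by (simp add: cosh_square_eq)
  have dd: "(1 - v \<bullet> a)\<^sup>2 \<le> (sinh eta)\<^sup>2 * ((1 - v \<bullet> v) * (a \<bullet> a - 1))"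
  proof -
    have "v \<bullet> v = x\<^sup>2 + y\<^sup>2 + z\<^sup>2" by (simp add: v_def vec3_inner power2_eq_square)
    moreover have "a \<bullet> a - 1 = 3 * Y\<^sup>2 - 1" unfolding aa yy(3) ..
    ultimately show ?thesis using d unfolding va by (simp add: mult_ac)
  qed
  have face: "v \<bullet> b \<le> 1" if b: "b \<bullet> b = 1 / Y\<^sup>2" "a \<bullet> b = - 1" for b
  proof -
    have bb: "b \<bullet> b - 1 = 2 / (1 + k)" unfolding b yy(2) using k by (simp add: field_simps)
    then have b1: "b \<bullet> b > 1" using k by (smt (verit) divide_pos_pos)
    have "((sinh eta)\<^sup>2 + 1) * ((a \<bullet> a - 1) * (b \<bullet> b - 1)) \<le> (1 + k) * (3 + k) / k * ((a \<bullet> a - 1) * (b \<bullet> b - 1))"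
      unfolding S1 using eta a1 b1 by (intro mult_right_mono) auto
    also have "\<dots> = (1 - a \<bullet> b)\<^sup>2"
    proof -
      have "A * C / k * ((2 * k / C) * (2 / A)) = 4" if "A \<noteq> 0" "C \<noteq> 0" for A C :: real using that k by simp
      from this[of "1 + k" "3 + k"] show ?thesis unfolding aa bb b(2) using k by simp
    qed
    finally show ?thesis
      using same_side[OF a1 _ vv _ dd S0 _ b1] b(2) c(4) va by simp
  qed
  have vertex: "v \<bullet> vert Y i \<le> 1" if i: "i \<in> {1..8}" for i
  proof (cases "i = 6")
    case True
    then show ?thesis using c(4) by (simp add: inner_vert sgx_def sgy_def sgz_def v_def)
  next
    case False
    have ab: "a \<bullet> vert Y i \<le> Y\<^sup>2"
      using i False unfolding range18 by (auto simp: a_def vert_def vec3_inner power2_eq_square)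
    have bb: "vert Y i \<bullet> vert Y i - 1 = 2 * k / (3 + k)" using vert_inner[OF i, of Y] yy(3) by simp
    have b1: "vert Y i \<bullet> vert Y i > 1" using bb k by (smt (verit) divide_pos_pos)
    have Y1: "1 - Y\<^sup>2 > 0" unfolding yy(4) using k by simp
    have "(cosh eta)\<^sup>2 \<le> 1 / k\<^sup>2"
    proof -
      have "(1 + k) * (3 + k) / k = k * (1 + k) * (3 + k) / k\<^sup>2" using k by (simp add: power2_eq_square)
      also have "\<dots> \<le> 1 / k\<^sup>2" using k by (intro divide_right_mono) auto
      finally show ?thesis using eta by linarith
    qed
    then have "((sinh eta)\<^sup>2 + 1) * ((a \<bullet> a - 1) * (vert Y i \<bullet> vert Y i - 1)) \<le> 1 / k\<^sup>2 * ((a \<bullet> a - 1) * (vert Y i \<bullet> vert Y i - 1))"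
      unfolding S1 using a1 b1 by (intro mult_right_mono) auto
    also have "\<dots> = (1 - Y\<^sup>2)\<^sup>2" unfolding aa bb yy(4) using k by (simp add: power2_eq_square)
    also have "\<dots> \<le> (1 - a \<bullet> vert Y i)\<^sup>2" using ab Y1 by (intro power_mono) auto
    finally show ?thesis
      using same_side[OF a1 _ vv _ dd S0 _ b1] ab Y1 c(4) va by simp
  qed
  have "\<bar>x\<bar> \<le> Y" "\<bar>y\<bar> \<le> Y" "\<bar>z\<bar> \<le> Y"
  proof -
    have "v \<bullet> vector [- 1 / Y, 0, 0] \<le> 1" "v \<bullet> vector [0, - 1 / Y, 0] \<le> 1" "v \<bullet> vector [0, 0, - 1 / Y] \<le> 1"
      by (rule face; use yy(1) in \<open>simp add: a_def vec3_inner power2_eq_square\<close>)+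
    then have "x * (- 1 / Y) \<le> 1" "y * (- 1 / Y) \<le> 1" "z * (- 1 / Y) \<le> 1" by (simp_all add: v_def vec3_inner)
    then have "x * (- 1 / Y) * Y \<le> 1 * Y" "y * (- 1 / Y) * Y \<le> 1 * Y" "z * (- 1 / Y) * Y \<le> 1 * Y"
      using yy(1) by (auto intro!: mult_right_mono simp del: mult_minus_right divide_minus_left times_divide_eq_right mult_cancel_right)
    then have "- x \<le> Y" "- y \<le> Y" "- z \<le> Y" using yy(1) by simp_all
    then show "\<bar>x\<bar> \<le> Y" "\<bar>y\<bar> \<le> Y" "\<bar>z\<bar> \<le> Y" using c by auto
  qed
  moreover have "Y * (\<bar>x\<bar> + \<bar>y\<bar> + \<bar>z\<bar>) \<le> 1"
    using vertex all_vertices[OF yy(1), of x y z 1] by (simp add: inner_vert v_def)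
  ultimately show ?thesis by (simp add: cube_fun_def)
qed

definition ball_fun :: "real \<Rightarrow> real \<Rightarrow> real \<times> real \<times> real \<times> real \<Rightarrow> ennreal" where
  "ball_fun Y S = (\<lambda>(a, x, y, z). if cube_fun Y (a, x, y, z) = 1 \<and>
     (a - Y * (x + y + z))\<^sup>2 \<le> S * (3 * Y\<^sup>2 - 1) * (a\<^sup>2 - (x\<^sup>2 + y\<^sup>2 + z\<^sup>2)) then 1 else 0)"

text \<open>One sixth of the hyperball piece at the vertex (Y, Y, Y), with only the conditions that
  actually bound it. In contrast to the piece used for the solid itself there is no condition 0
  \<le> z, because the hyperball may extend beyond the mirror z = 0.\<close>

definition prism_fun :: "real \<Rightarrow> real \<Rightarrow> real \<times> real \<times> real \<times> real \<Rightarrow> ennreal" where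
  "prism_fun Y S = (\<lambda>(a, x, y, z). if z \<le> y \<and> y \<le> x \<and> x \<le> Y * a \<and> Y * (x + y + z) \<le> a \<and>
     (a - Y * (x + y + z))\<^sup>2 \<le> S * (3 * Y\<^sup>2 - 1) * (a\<^sup>2 - (x\<^sup>2 + y\<^sup>2 + z\<^sup>2)) then 1 else 0)"

lemma ball_fun_measurable [measurable]: "ball_fun Y S \<in> borel_measurable borel4"
  unfolding ball_fun_def by measurable

lemma prism_fun_measurable [measurable]: "prism_fun Y S \<in> borel_measurable borel4"
  unfolding prism_fun_def by measurable

lemma cube_fun_swap: "cube_fun Y (a, y, x, z) = cube_fun Y (a, x, y, z)" "cube_fun Y (a, x, z, y) = cube_fun Y (a, x, y, z)"
  by (auto simp: cube_fun_def add_ac)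

lemma ball_fun_swap: "ball_fun Y S (a, y, x, z) = ball_fun Y S (a, x, y, z)" "ball_fun Y S (a, x, z, y) = ball_fun Y S (a, x, y, z)"
proof -
  have e: "y + x + z = x + y + z" "x + z + y = x + y + z" "y\<^sup>2 + x\<^sup>2 + z\<^sup>2 = x\<^sup>2 + y\<^sup>2 + z\<^sup>2" "x\<^sup>2 + z\<^sup>2 + y\<^sup>2 = x\<^sup>2 + y\<^sup>2 + z\<^sup>2"
    by simp_all
  show "ball_fun Y S (a, y, x, z) = ball_fun Y S (a, x, y, z)"
    unfolding ball_fun_def prod.case cube_fun_swap(1)[of Y a y x z] e(1,3) ..
  show "ball_fun Y S (a, x, z, y) = ball_fun Y S (a, x, y, z)"
    unfolding ball_fun_def prod.case cube_fun_swap(2)[of Y a x z y] e(2,4) ..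
qed

lemma prism_fun_homogeneous: "homogeneous (prism_fun Y S)"
  unfolding prism_fun_def
proof (rule if_homogeneous)
  fix r a b c d :: real assume r: "r > 0"
  have e: "r * a - Y * (r * b + r * c + r * d) = r * (a - Y * (b + c + d))"
    "(r * a)\<^sup>2 - ((r * b)\<^sup>2 + (r * c)\<^sup>2 + (r * d)\<^sup>2) = r\<^sup>2 * (a\<^sup>2 - (b\<^sup>2 + c\<^sup>2 + d\<^sup>2))" by (simp_all add: power2_eq_square algebra_simps)
  have "(r * a - Y * (r * b + r * c + r * d))\<^sup>2 \<le> S * (3 * Y\<^sup>2 - 1) * ((r * a)\<^sup>2 - ((r * b)\<^sup>2 + (r * c)\<^sup>2 + (r * d)\<^sup>2))
    \<longleftrightarrow> r\<^sup>2 * (a - Y * (b + c + d))\<^sup>2 \<le> r\<^sup>2 * (S * (3 * Y\<^sup>2 - 1) * (a\<^sup>2 - (b\<^sup>2 + c\<^sup>2 + d\<^sup>2)))"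
    unfolding e unfolding power_mult_distrib by (simp only: mult.left_commute[of _ "r\<^sup>2"])
  also have "\<dots> \<longleftrightarrow> (a - Y * (b + c + d))\<^sup>2 \<le> S * (3 * Y\<^sup>2 - 1) * (a\<^sup>2 - (b\<^sup>2 + c\<^sup>2 + d\<^sup>2))"
    using r by (intro mult_le_cancel_left_pos) simp
  finally have q: "(r * a - Y * (r * b + r * c + r * d))\<^sup>2 \<le> S * (3 * Y\<^sup>2 - 1) * ((r * a)\<^sup>2 - ((r * b)\<^sup>2 + (r * c)\<^sup>2 + (r * d)\<^sup>2))
    \<longleftrightarrow> (a - Y * (b + c + d))\<^sup>2 \<le> S * (3 * Y\<^sup>2 - 1) * (a\<^sup>2 - (b\<^sup>2 + c\<^sup>2 + d\<^sup>2))" .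
  have "r * d \<le> r * c \<longleftrightarrow> d \<le> c" "r * c \<le> r * b \<longleftrightarrow> c \<le> b"
    "r * b \<le> Y * (r * a) \<longleftrightarrow> b \<le> Y * a" "Y * (r * b + r * c + r * d) \<le> r * a \<longleftrightarrow> Y * (b + c + d) \<le> a"
    using r mult_le_cancel_left_pos[OF r, of b "Y * a"] mult_le_cancel_left_pos[OF r, of "Y * (b + c + d)" a]
    by (simp_all add: algebra_simps)
  then show "(r * d \<le> r * c \<and> r * c \<le> r * b \<and> r * b \<le> Y * (r * a) \<and> Y * (r * b + r * c + r * d) \<le> r * a \<and>
     (r * a - Y * (r * b + r * c + r * d))\<^sup>2 \<le> S * (3 * Y\<^sup>2 - 1) * ((r * a)\<^sup>2 - ((r * b)\<^sup>2 + (r * c)\<^sup>2 + (r * d)\<^sup>2)))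
    \<longleftrightarrow> (d \<le> c \<and> c \<le> b \<and> b \<le> Y * a \<and> Y * (b + c + d) \<le> a \<and>
     (a - Y * (b + c + d))\<^sup>2 \<le> S * (3 * Y\<^sup>2 - 1) * (a\<^sup>2 - (b\<^sup>2 + c\<^sup>2 + d\<^sup>2)))" using q by blast
qed

text \<open>Sign changes move the vertex to (Y, Y, Y), whose stabiliser permutes the coordinates, so
  six sectors remain. By \<open>hyperball_inside\<close> each sector is a full layer over a right
  triangle with further angles theta / 2 and pi / 3. The six triangles have total area pi - 3
  theta.\<close>

lemma Vpiece_eq:
  assumes p: "6 < p" "p < 7" and i: "i \<in> {1..8}" and eta: "0 \<le> eta"
  defines "k \<equiv> kpar p"
  assumes w: "(cosh eta)\<^sup>2 \<le> (1 + k) * (3 + k) / k"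
  shows "Vpiece p i eta = (pi - 3 * theta k) / 4 * (sinh (2 * eta) + 2 * eta)"
proof -
  note kb = kpar_bounds[OF p, folded k_def]
  have k: "0 < k" "k < 1" using kb by auto
  define Y where "Y = ypar k"
  define s where "s = sqrt ((1 - k) / (3 + k))"
  define n where "n = sqrt (4 / (3 + k))"
  define t where "t = s / Y"
  define ch where "ch = Y / sqrt (Y\<^sup>2 - s\<^sup>2)"
  note fp = frame_parameters[OF k, folded Y_def s_def n_def, folded t_def ch_def]
  have Y: "Y > 0" using ypar(1)[OF k] by (simp add: Y_def)
  have y31: "3 * Y\<^sup>2 - 1 > 0" unfolding Y_def ypar(3)[OF k] using k by simp
  define S where "S = (sinh eta)\<^sup>2"
  define F where "F = ball_fun Y S"
  have F [measurable]: "F \<in> borel_measurable borel4" unfolding F_def by measurable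
  define D where "D = prism_fun Y S"
  have [measurable]: "D \<in> borel_measurable borel4" unfolding D_def by measurable
  have homD: "homogeneous D" unfolding D_def by (rule prism_fun_homogeneous)
  define Fi where "Fi = (\<lambda>(a, x, y, z). F (a, sgx i * x, sgy i * y, sgz i * z))"
  have [measurable]: "Fi \<in> borel_measurable borel4" unfolding Fi_def by measurable
  have sg: "\<bar>sgx i * u\<bar> = \<bar>u\<bar>" "\<bar>sgy i * u\<bar> = \<bar>u\<bar>" "\<bar>sgz i * u\<bar> = \<bar>u\<bar>"
    "(sgx i * u)\<^sup>2 = u\<^sup>2" "(sgy i * u)\<^sup>2 = u\<^sup>2" "(sgz i * u)\<^sup>2 = u\<^sup>2" for u
    by (simp_all add: sgx_def sgy_def sgz_def)
  have "Vpiece p i eta = enn2real (H3 Fi)" unfolding Vpiece_def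
  proof (rule hvol_region)
    fix v :: pt3
    have vv: "v \<bullet> v = (v $ 1)\<^sup>2 + (v $ 2)\<^sup>2 + (v $ 3)\<^sup>2" by (simp add: inner_vec_def sum_3 power2_eq_square)
    show "v \<in> hyperball p i eta \<inter> Cr p \<longleftrightarrow> v \<bullet> v < 1 \<and> Fi (1, v $ 1, v $ 2, v $ 3) = 1"
    proof (cases "v \<bullet> v < 1")
      case True
      have "cube_fun Y (1, sgx i * v $ 1, sgy i * v $ 2, sgz i * v $ 3) = cube_fun Y (1, v $ 1, v $ 2, v $ 3)"
        by (simp add: cube_fun_def sg)
      then show ?thesis using True mem_hyperball[OF p i eta True] mem_Cr[OF p, of v]
        unfolding Fi_def F_def ball_fun_def prod.case sg S_def Y_def k_def[symmetric] vv by auto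
    next
      case False
      then show ?thesis using mem_Cr[OF p, of v] by blast
    qed
    show "Fi X = 0 \<or> Fi X = 1" for X unfolding Fi_def F_def ball_fun_def by (cases X) auto
  qed measurable
  also have "H3 Fi = H3 F" unfolding Fi_def
    by (rule H3_signs) (use F in \<open>auto simp: sgx_def sgy_def sgz_def\<close>)
  also have "H3 F = 6 * H3 (\<lambda>(a, x, y, z). if z \<le> y \<and> y \<le> x then F (a, x, y, z) else 0)"
    by (rule H3_chamber) (measurable, simp_all only: F_def ball_fun_swap)
  also have "H3 (\<lambda>(a, x, y, z). if z \<le> y \<and> y \<le> x then F (a, x, y, z) else 0) = H3 D"
  proof (rule H3_cong_AE)
    fix x y z :: real assume ball: "x\<^sup>2 + y\<^sup>2 + z\<^sup>2 < 1"
    have "cube_fun Y (1, x, y, z) = 1 \<and> (1 - Y * (x + y + z))\<^sup>2 \<le> S * (3 * Y\<^sup>2 - 1) * (1 - (x\<^sup>2 + y\<^sup>2 + z\<^sup>2))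
      \<longleftrightarrow> x \<le> Y \<and> Y * (x + y + z) \<le> 1 \<and> (1 - Y * (x + y + z))\<^sup>2 \<le> S * (3 * Y\<^sup>2 - 1) * (1 - (x\<^sup>2 + y\<^sup>2 + z\<^sup>2))"
      if zyx: "z \<le> y" "y \<le> x"
    proof
      assume l: "cube_fun Y (1, x, y, z) = 1 \<and> (1 - Y * (x + y + z))\<^sup>2 \<le> S * (3 * Y\<^sup>2 - 1) * (1 - (x\<^sup>2 + y\<^sup>2 + z\<^sup>2))"
      have "Y * (x + y + z) \<le> Y * (\<bar>x\<bar> + \<bar>y\<bar> + \<bar>z\<bar>)" using Y by (intro mult_left_mono) auto
      then show "x \<le> Y \<and> Y * (x + y + z) \<le> 1 \<and> (1 - Y * (x + y + z))\<^sup>2 \<le> S * (3 * Y\<^sup>2 - 1) * (1 - (x\<^sup>2 + y\<^sup>2 + z\<^sup>2))"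
        using l by (auto simp: cube_fun_def split: if_splits)
    next
      assume r: "x \<le> Y \<and> Y * (x + y + z) \<le> 1 \<and> (1 - Y * (x + y + z))\<^sup>2 \<le> S * (3 * Y\<^sup>2 - 1) * (1 - (x\<^sup>2 + y\<^sup>2 + z\<^sup>2))"
      have "cube_fun (ypar k) (1, x, y, z) = 1"
        by (rule hyperball_inside[OF k less_imp_le[OF kb(3)] w ball])
          (use r zyx in \<open>auto simp: S_def Y_def\<close>)
      then show "cube_fun Y (1, x, y, z) = 1 \<and> (1 - Y * (x + y + z))\<^sup>2 \<le> S * (3 * Y\<^sup>2 - 1) * (1 - (x\<^sup>2 + y\<^sup>2 + z\<^sup>2))"
        using r by (simp add: Y_def)
    qed
    then show "(case (1, x, y, z) of (a, x, y, z) \<Rightarrow> if z \<le> y \<and> y \<le> x then F (a, x, y, z) else 0) = D (1, x, y, z)"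
      unfolding F_def D_def ball_fun_def prism_fun_def by auto
  qed
  also have "H3 D = H3 (\<lambda>X. D (frame Y s n t ch X))"
    by (rule H3_frame[OF _ homD fp(1,2,3,4,5,6)]) measurable
  also have "\<dots> = ennreal ((sinh (2 * eta) + 2 * eta) / 4 * (arctan (s / sqrt (1 - (1 + s\<^sup>2) * (sqrt k)\<^sup>2)) - arctan s))"
  proof (rule H3_hyperprism)
    fix p q r
    obtain d x y z where fr: "frame Y s n t ch (1, p, q, r) = (d, x, y, z)" by (metis prod_cases4)
    note ff = frame_forms[OF fp(1,2,3,4) Y t_def fr]
    have "x \<le> Y * d \<longleftrightarrow> 0 \<le> n / sqrt 2 * q" using ff(1) by linarith
    then have 1: "x \<le> Y * d \<longleftrightarrow> 0 \<le> q" using fp(3) by (simp add: zero_le_mult_iff zero_le_divide_iff)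
    have "y \<le> x \<longleftrightarrow> 0 \<le> sqrt 2 / n * (s * p - q)" using ff(2) by linarith
    then have 2: "y \<le> x \<longleftrightarrow> q \<le> s * p" using fp(3) by (simp add: zero_le_mult_iff zero_le_divide_iff)
    have "z \<le> y \<longleftrightarrow> 0 \<le> n / (s * sqrt 2) * (sqrt k - p)" using ff(3) unfolding fp(8) mult_1_right by linarith
    moreover have "n / (s * sqrt 2) > 0" using fp(1,3) by simp
    ultimately have 3: "z \<le> y \<longleftrightarrow> p \<le> sqrt k" using nonneg_mult_pos by (metis diff_ge_0_iff_ge)
    have "Y * (x + y + z) \<le> d \<longleftrightarrow> 0 \<le> (Y\<^sup>2 - s\<^sup>2) / Y * ch * r" using ff(4) by linarith
    then have 4: "Y * (x + y + z) \<le> d \<longleftrightarrow> 0 \<le> r" unfolding nonneg_mult_pos[OF fp(10)] .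
    have "(d - Y * (x + y + z))\<^sup>2 = (3 * Y\<^sup>2 - 1) * r\<^sup>2" unfolding ff(4) fp(9)[symmetric] by (rule power_mult_distrib)
    moreover have "d\<^sup>2 - (x\<^sup>2 + y\<^sup>2 + z\<^sup>2) = 1 - p\<^sup>2 - q\<^sup>2 - r\<^sup>2" using ff(6)[OF fp(6)] by simp
    ultimately have "(d - Y * (x + y + z))\<^sup>2 \<le> S * (3 * Y\<^sup>2 - 1) * (d\<^sup>2 - (x\<^sup>2 + y\<^sup>2 + z\<^sup>2)) \<longleftrightarrow>
       (3 * Y\<^sup>2 - 1) * r\<^sup>2 \<le> (3 * Y\<^sup>2 - 1) * (S * (1 - p\<^sup>2 - q\<^sup>2 - r\<^sup>2))" by (simp add: mult_ac)
    also have "\<dots> \<longleftrightarrow> r\<^sup>2 \<le> S * (1 - p\<^sup>2 - q\<^sup>2 - r\<^sup>2)" using y31 by (rule mult_le_cancel_left_pos)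
    finally have 5: "(d - Y * (x + y + z))\<^sup>2 \<le> S * (3 * Y\<^sup>2 - 1) * (d\<^sup>2 - (x\<^sup>2 + y\<^sup>2 + z\<^sup>2)) \<longleftrightarrow> r\<^sup>2 \<le> S * (1 - p\<^sup>2 - q\<^sup>2 - r\<^sup>2)" .
    show "D (frame Y s n t ch (1, p, q, r)) = (if 0 \<le> q \<and> q \<le> s * p \<and> p \<le> sqrt k \<and> 0 \<le> r
       \<and> r\<^sup>2 \<le> (sinh eta)\<^sup>2 * (1 - p\<^sup>2 - q\<^sup>2 - r\<^sup>2) then 1 else 0)"
      unfolding fr D_def prism_fun_def prod.case 1 2 3 4 5 unfolding S_def by auto
  next
    show "(sqrt k)\<^sup>2 * (1 + s\<^sup>2) < 1" unfolding fp(11) using k by (simp add: field_simps)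
  qed (use fp(1) k eta in auto)
  \<comment> \<open>Hence the first arctangent is arctan (1 / sqrt 3) = pi / 6 for every k: six
    sectors meet at the centre of the triangle.\<close>
  also have "1 - (1 + s\<^sup>2) * (sqrt k)\<^sup>2 = 3 * s\<^sup>2" unfolding fp(11) using k by (simp add: field_simps)
  also have "sqrt (3 * s\<^sup>2) = sqrt 3 * s" using fp(1) by (simp add: real_sqrt_mult)
  also have "s / (sqrt 3 * s) = tan (pi / 6)" using fp(1) by (simp add: tan_30)
  also have "arctan (tan (pi / 6)) = pi / 6" using pi_gt_zero by (intro arctan_tan) linarith+
  also have "arctan s = theta k / 2" unfolding s_def by (rule arctan_half_theta[OF k])
  also have "enn2real (6 * ennreal ((sinh (2 * eta) + 2 * eta) / 4 * (pi / 6 - theta k / 2)))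
    = 6 * ((sinh (2 * eta) + 2 * eta) / 4 * (pi / 6 - theta k / 2))"
  proof -
    have "theta k \<le> pi / 3" 
    proof -
      have "theta k = 2 * pi / p" using kb(4) .
      also have "\<dots> \<le> pi / 3" using p by (simp add: field_simps)
      finally show ?thesis .
    qed
    then have "0 \<le> (sinh (2 * eta) + 2 * eta) / 4 * (pi / 6 - theta k / 2)" using eta by simp
    then show ?thesis by (simp add: enn2real_mult)
  qed
  finally show ?thesis by (simp add: algebra_simps)
qed

section \<open>The volume of the truncated cube as an integral over a fixed interval\<close>

definition wfun :: "real \<Rightarrow> real \<Rightarrow> real" where "wfun k u = (1 + k * u\<^sup>2) / (1 + k)"
text \<open>The inverse of T |-> T / sqrt (1 - (1 + T^2) k), that is, of the passage from the angle
  at the vertex of the right triangle to the complement of its third angle. It maps the fixed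
  interval from 0 to 1 / sqrt 3 onto the range of slopes 0 to s, so that k disappears from the
  limits of integration.\<close>

definition tfun :: "real \<Rightarrow> real \<Rightarrow> real" where "tfun k u = u * (sqrt (1 - k) / sqrt (1 + k * u\<^sup>2))"
definition b3 :: real where "b3 = 1 / sqrt 3"
definition tau :: "real \<Rightarrow> real" where "tau k = sqrt ((1 - k) / (1 + k))"

lemma b3: "b3 > 0" "b3\<^sup>2 = 1 / 3" "b3 < 1"
  by (simp_all add: b3_def power_divide)

lemma u_bounds: "u \<in> {0..b3} \<Longrightarrow> 0 \<le> u \<and> u\<^sup>2 \<le> 1 / 3"
  using b3 by (metis atLeastAtMost_iff power_mono)

lemma DERIV_tfun:
  assumes k: "0 < k" "k < 1"
  shows "(tfun k has_real_derivative sqrt (1 - k) / sqrt (1 + k * u\<^sup>2) ^ 3) (at u)"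
proof -
  define v where "v = sqrt (1 + k * u\<^sup>2)"
  have p: "1 + k * u\<^sup>2 > 0" using k by (simp add: add_pos_nonneg)
  have v: "v > 0" "v\<^sup>2 = 1 + k * u\<^sup>2" using p by (simp_all add: v_def)
  have Dv: "((\<lambda>u. sqrt (1 + k * u\<^sup>2)) has_real_derivative k * u / v) (at u)"
    using p by (auto intro!: derivative_eq_intros simp: v_def field_simps)
  have q: "((\<lambda>u. f u / h u) has_real_derivative (f' * h u - f u * h') / (h u)\<^sup>2) (at u)"
    if "(f has_real_derivative f') (at u)" "(h has_real_derivative h') (at u)" "h u \<noteq> 0" for f h :: "real \<Rightarrow> real" and f' h'
    using that by (auto intro!: derivative_eq_intros simp: power2_eq_square)
  have "((\<lambda>u. (sqrt (1 - k) * u) / sqrt (1 + k * u\<^sup>2)) has_real_derivative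
     (sqrt (1 - k) * v - sqrt (1 - k) * u * (k * u / v)) / v\<^sup>2) (at u)"
    using q[of "\<lambda>u. sqrt (1 - k) * u" "sqrt (1 - k)", OF _ Dv] v(1) unfolding v_def[symmetric]
    using DERIV_cmult_Id[of "sqrt (1 - k)"] by simp
  also have "(sqrt (1 - k) * v - sqrt (1 - k) * u * (k * u / v)) / v\<^sup>2 = sqrt (1 - k) * (v\<^sup>2 - k * u\<^sup>2) / v ^ 3"
    using v(1) by (simp add: field_simps power2_eq_square power3_eq_cube)
  also have "v\<^sup>2 - k * u\<^sup>2 = 1" using v(2) by simp
  finally show ?thesis unfolding tfun_def v_def by (simp add: mult.commute)
qed

lemma tfun_eqs:
  assumes k: "0 < k" "k < 1"
  shows "1 + (tfun k u)\<^sup>2 = (1 + u\<^sup>2) / (1 + k * u\<^sup>2)"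
    "1 - (1 + (tfun k u)\<^sup>2) * k = (1 - k) / (1 + k * u\<^sup>2)"
    "tau k / sqrt (1 - (1 + (tfun k u)\<^sup>2) * k) = sqrt (wfun k u)"
    "tfun k 0 = 0" "tfun k b3 = sqrt ((1 - k) / (3 + k))"
proof -
  have p: "1 + k * u\<^sup>2 > 0" using k by (simp add: add_pos_nonneg)
  have t2: "(tfun k u)\<^sup>2 = u\<^sup>2 * (1 - k) / (1 + k * u\<^sup>2)" unfolding tfun_def using p k by (simp add: power_mult_distrib power_divide)
  show e1: "1 + (tfun k u)\<^sup>2 = (1 + u\<^sup>2) / (1 + k * u\<^sup>2)" unfolding t2 using p by (simp add: field_simps)
  show e2: "1 - (1 + (tfun k u)\<^sup>2) * k = (1 - k) / (1 + k * u\<^sup>2)" unfolding e1 using p by (simp add: field_simps)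
  show "tau k / sqrt (1 - (1 + (tfun k u)\<^sup>2) * k) = sqrt (wfun k u)"
  proof -
    have "a / b / (a / c) = c / b" if "a \<noteq> 0" for a b c :: real using that by simp
    from this[of "1 - k" "1 + k" "1 + k * u\<^sup>2"] show ?thesis
      unfolding e2 tau_def wfun_def real_sqrt_divide[symmetric] using k by simp
  qed
  show "tfun k 0 = 0" by (simp add: tfun_def)
  have b: "1 + k * b3\<^sup>2 = (3 + k) / 3" using b3(2) by simp
  show "tfun k b3 = sqrt ((1 - k) / (3 + k))" unfolding tfun_def b unfolding b3_def using k by (simp add: real_sqrt_divide)
qed

lemma artanh_mono: "0 \<le> x \<Longrightarrow> x \<le> y \<Longrightarrow> y < 1 \<Longrightarrow> artanh x \<le> artanh (y :: real)"
  unfolding artanh_def by (intro divide_right_mono ln_mono frac_le divide_pos_pos) auto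

lemma wfun_bounds:
  assumes k: "0 < k" "k < 1" and u: "u \<in> {0..b3}"
  shows "0 < wfun k u" "wfun k u < 1" "1 - wfun k u = k * (1 - u\<^sup>2) / (1 + k)" "tau k \<le> sqrt (wfun k u)"
proof -
  have u2: "0 \<le> u\<^sup>2" "u\<^sup>2 \<le> 1 / 3" using u_bounds[OF u] by auto
  have "1 + k * u\<^sup>2 > 0" using k by (simp add: add_pos_nonneg)
  then show "0 < wfun k u" using k by (simp add: wfun_def)
  show e: "1 - wfun k u = k * (1 - u\<^sup>2) / (1 + k)" using k by (simp add: wfun_def field_simps)
  have "k * (1 - u\<^sup>2) / (1 + k) > 0" using k u2 by (intro divide_pos_pos mult_pos_pos) auto
  then show "wfun k u < 1" using e by linarith
  have "0 \<le> k * u\<^sup>2" using k by simp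
  then have "(1 - k) / (1 + k) \<le> wfun k u" unfolding wfun_def by (intro divide_right_mono) (use k \<open>0 \<le> k * u\<^sup>2\<close> in linarith)+
  then show "tau k \<le> sqrt (wfun k u)" unfolding tau_def by (rule real_sqrt_le_mono)
qed

lemma continuous_wfun: "0 < k \<Longrightarrow> continuous_on A (\<lambda>u. wfun k u)"
  unfolding wfun_def by (intro continuous_intros) auto

definition W1 :: "real \<Rightarrow> real" where "W1 k = integral {0..b3} (\<lambda>u. artanh (sqrt (wfun k u)) / (1 + u\<^sup>2))"

lemma one_plus_sq_pos: "1 + u\<^sup>2 > (0::real)" by (simp add: add_pos_nonneg)

lemma cube_quotient: "v \<noteq> 0 \<Longrightarrow> g / v ^ 3 / (M / v\<^sup>2) = g / v / (M :: real)"
  by (simp add: power2_eq_square power3_eq_cube)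

lemma density_transform:
  fixes A B M v g :: real
  assumes "v \<noteq> 0" "g \<noteq> 0" "M \<noteq> 0"
  shows "1 / (2 * (M / v\<^sup>2)) * (A / (g / v) - B) * (g / v ^ 3) = 1 / 2 * (A / M - B * (g / v ^ 3 / (M / v\<^sup>2)))"
proof -
  have "1 / (2 * (M / v\<^sup>2)) * (g / v ^ 3) = 1 / 2 * (g / v / M)"
    using assms by (simp add: power2_eq_square power3_eq_cube)
  then have "1 / (2 * (M / v\<^sup>2)) * (A / (g / v) - B) * (g / v ^ 3) = (A / (g / v) - B) * (1 / 2 * (g / v / M))"
    by (simp only: mult.assoc mult.commute mult.left_commute)
  also have "\<dots> = 1 / 2 * (A / M - B * (g / v / M))"
  proof -
    have e: "A / (g / v) * (g / v / M) = A / M" using assms by simp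
    have "(X - B) * (1 / 2 * Y) = 1 / 2 * (X * Y - B * Y)" for X Y :: real
      by (simp only: left_diff_distrib right_diff_distrib mult.left_commute[of _ "1 / 2"])
    from this[of "A / (g / v)" "g / v / M"] show ?thesis unfolding e .
  qed
  finally show ?thesis unfolding cube_quotient[OF assms(1)] .
qed

text \<open>Under T = \<open>tfun k u\<close> the factor dT / ((1 + T^2) sqrt (1 - (1 + T^2) k))
  becomes du / (1 + u^2), and the argument of artanh becomes the square root of
  \<open>wfun k u\<close>. The subtracted term is a constant times dT / (1 + T^2) and integrates to
  arctan s = theta / 2. Nonnegativity of the integrand is needed to pass from the extended to the
  ordinary integral.\<close>

lemma V0_eq_W1:
  assumes p: "6 < p" "p < 7"
  defines "k \<equiv> kpar p"
  shows "V0 p = 24 * W1 k - 12 * artanh (tau k) * theta k"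
proof -
  have k: "0 < k" "k < 1" using kpar_bounds[OF p] by (simp_all add: k_def)
  define phi where "phi T = 1 / (2 * (1 + T\<^sup>2)) * (artanh (tau k / sqrt (1 - (1 + T\<^sup>2) * k)) / sqrt (1 - (1 + T\<^sup>2) * k) - artanh (tau k))" for T
  have [measurable]: "phi \<in> borel_measurable borel" unfolding phi_def artanh_def by measurable
  define dt where "dt u = sqrt (1 - k) / sqrt (1 + k * u\<^sup>2) ^ 3" for u
  define psi where "psi u = 1 / 2 * (artanh (sqrt (wfun k u)) / (1 + u\<^sup>2) - artanh (tau k) * (dt u / (1 + (tfun k u)\<^sup>2)))" for u
  have pos: "1 + k * u\<^sup>2 > 0" for u using k by (simp add: add_pos_nonneg)
  have dt0: "dt u \<ge> 0" for u using k pos[of u] by (simp add: dt_def)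
  have phipsi: "phi (tfun k u) * dt u = psi u" for u
  proof -
    define v where "v = sqrt (1 + k * u\<^sup>2)"
    have v: "v > 0" "v\<^sup>2 = 1 + k * u\<^sup>2" using pos[of u] by (simp_all add: v_def)
    define g where "g = sqrt (1 - k)"
    have g: "g > 0" using k by (simp add: g_def)
    have sq: "sqrt (1 - (1 + (tfun k u)\<^sup>2) * k) = g / v" unfolding tfun_eqs(2)[OF k] by (simp add: real_sqrt_divide g_def v_def)
    define A where "A = artanh (sqrt (wfun k u))"
    define B where "B = artanh (tau k)"
    have o: "1 + u\<^sup>2 \<noteq> 0" using one_plus_sq_pos[of u] by simp
    have "phi (tfun k u) = 1 / (2 * ((1 + u\<^sup>2) / v\<^sup>2)) * (A / (g / v) - B)"
      unfolding phi_def unfolding tfun_eqs(3)[OF k] unfolding sq unfolding tfun_eqs(1)[OF k] A_def B_def v(2) ..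
    then have "phi (tfun k u) * dt u = 1 / (2 * ((1 + u\<^sup>2) / v\<^sup>2)) * (A / (g / v) - B) * (g / v ^ 3)"
      by (simp add: dt_def g_def v_def)
    also have "\<dots> = 1 / 2 * (A / (1 + u\<^sup>2) - B * (g / v ^ 3 / ((1 + u\<^sup>2) / v\<^sup>2)))"
      using v(1) g o by (intro density_transform) auto
    also have "\<dots> = psi u" unfolding psi_def tfun_eqs(1)[OF k] A_def B_def dt_def g_def unfolding v_def[symmetric] unfolding v(2)[symmetric] ..
    finally show ?thesis .
  qed
  have psi0: "0 \<le> psi u" if u: "u \<in> {0..b3}" for u
  proof -
    have "tau k \<ge> 0" using k by (simp add: tau_def)
    have "sqrt (wfun k u) < 1" using wfun_bounds[OF k u] by simp
    then have "artanh (tau k) \<le> artanh (sqrt (wfun k u))" using wfun_bounds(4)[OF k u] \<open>tau k \<ge> 0\<close> by (intro artanh_mono) auto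
    moreover have "artanh (tau k) \<ge> 0" using artanh_mono[of 0 "tau k"] \<open>tau k \<ge> 0\<close> \<open>sqrt (wfun k u) < 1\<close> wfun_bounds(4)[OF k u] by simp
    moreover have "dt u / (1 + (tfun k u)\<^sup>2) \<le> 1 / (1 + u\<^sup>2)"
    proof -
      define v where "v = sqrt (1 + k * u\<^sup>2)"
      have v: "v \<ge> 1" "v\<^sup>2 = 1 + k * u\<^sup>2" using pos[of u] k by (simp_all add: v_def)
      have "dt u / (1 + (tfun k u)\<^sup>2) = sqrt (1 - k) / v / (1 + u\<^sup>2)"
        unfolding tfun_eqs(1)[OF k] dt_def unfolding v_def[symmetric] unfolding v(2)[symmetric] using v(1) by (intro cube_quotient) simp
      also have "\<dots> \<le> 1 / (1 + u\<^sup>2)"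
      proof (rule divide_right_mono)
        have "sqrt (1 - k) \<le> 1" using k by simp
        then have "sqrt (1 - k) \<le> v" using v(1) by linarith
        then show "sqrt (1 - k) / v \<le> 1" using v(1) by (simp add: divide_le_eq)
      qed (use one_plus_sq_pos[of u] in simp)
      finally show ?thesis .
    qed
    ultimately have "artanh (tau k) * (dt u / (1 + (tfun k u)\<^sup>2)) \<le> artanh (sqrt (wfun k u)) * (1 / (1 + u\<^sup>2))"
      using dt0[of u] one_plus_sq_pos[of "tfun k u"] by (intro mult_mono) auto
    then show ?thesis by (simp add: psi_def)
  qed
  have Dt: "(tfun k has_real_derivative dt u) (at u)" for u unfolding dt_def by (rule DERIV_tfun[OF k])
  have cdt: "continuous_on A dt" for A unfolding dt_def using pos
    by (intro continuous_intros) (auto simp: less_imp_neq[symmetric])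
  have "(psi has_integral (W1 k / 2 - artanh (tau k) * (theta k / 2) / 2)) {0..b3}"
  proof -
    have "((\<lambda>u. artanh (sqrt (wfun k u)) / (1 + u\<^sup>2)) has_integral W1 k) {0..b3}"
      unfolding W1_def
    proof (rule integrable_integral, rule integrable_continuous_real, intro continuous_intros continuous_wfun k)
      show "sqrt (wfun k x) \<in> {-1<..<1}" if "x \<in> {0..b3}" for x
      proof -
        have "0 < sqrt (wfun k x)" "sqrt (wfun k x) < 1" using wfun_bounds[OF k that] by simp_all
        moreover from this have "- 1 < sqrt (wfun k x)" by linarith
        ultimately show ?thesis by (simp only: greaterThanLessThan_iff)
      qed
      show "\<forall>x\<in>{0..b3}. 1 + x\<^sup>2 \<noteq> 0" using one_plus_sq_pos by (metis less_irrefl)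
    qed
    moreover have "((\<lambda>u. dt u / (1 + (tfun k u)\<^sup>2)) has_integral (arctan (tfun k b3) - arctan (tfun k 0))) {0..b3}"
    proof (rule fundamental_theorem_of_calculus)
      show "((\<lambda>u. arctan (tfun k u)) has_vector_derivative dt u / (1 + (tfun k u)\<^sup>2)) (at u within {0..b3})" for u
        using DERIV_chain2[OF DERIV_arctan Dt, of u] 
        by (auto simp: has_real_derivative_iff_has_vector_derivative[symmetric] divide_inverse mult.commute intro: DERIV_subset)
    qed (use b3 in simp)
    ultimately have "((\<lambda>u. 1 / 2 * (artanh (sqrt (wfun k u)) / (1 + u\<^sup>2) - artanh (tau k) * (dt u / (1 + (tfun k u)\<^sup>2))))
      has_integral 1 / 2 * (W1 k - artanh (tau k) * (arctan (tfun k b3) - arctan (tfun k 0)))) {0..b3}"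
      by (intro has_integral_mult_right has_integral_diff)
    then show ?thesis unfolding tfun_eqs(4,5)[OF k] arctan_half_theta[OF k] psi_def by (simp add: algebra_simps)
  qed
  then have hi: "((\<lambda>u. if u \<in> {0..b3} then psi u else 0) has_integral (W1 k / 2 - artanh (tau k) * (theta k / 2) / 2)) UNIV"
    by (simp only: has_integral_restrict_UNIV)
  have [measurable]: "psi \<in> borel_measurable borel" 
    unfolding psi_def dt_def tfun_def wfun_def artanh_def by measurable
  have nn: "(\<integral>\<^sup>+u. ennreal (if u \<in> {0..b3} then psi u else 0) \<partial>lborel) = ennreal (W1 k / 2 - artanh (tau k) * (theta k / 2) / 2)"
    by (rule nn_integral_has_integral_lborel[OF _ _ hi]) (measurable, use psi0 in auto)
  have val0: "W1 k / 2 - artanh (tau k) * (theta k / 2) / 2 \<ge> 0"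
    by (rule has_integral_nonneg[OF hi]) (use psi0 in auto)
  have "H3 (cube_fun (ypar k)) = 48 * (\<integral>\<^sup>+T. ennreal (phi T) * indicator {tfun k 0..tfun k b3} T \<partial>lborel)"
    unfolding tfun_eqs(4,5)[OF k] phi_def tau_def by (rule H3_cube_fun[OF k])
  also have "(\<integral>\<^sup>+T. ennreal (phi T) * indicator {tfun k 0..tfun k b3} T \<partial>lborel)
    = (\<integral>\<^sup>+u. ennreal (phi (tfun k u)) * ennreal (dt u) * indicator {0..b3} u \<partial>lborel)"
    by (rule nn_integral_substitution_aux) (use Dt cdt dt0 b3 in auto)
  also have "\<dots> = (\<integral>\<^sup>+u. ennreal (if u \<in> {0..b3} then psi u else 0) \<partial>lborel)"
  proof (rule nn_integral_cong)
    fix u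
    have "ennreal (phi (tfun k u)) * ennreal (dt u) = ennreal (psi u)"
      unfolding phipsi[symmetric] using dt0 by (rule ennreal_mult''[symmetric])
    then show "ennreal (phi (tfun k u)) * ennreal (dt u) * indicator {0..b3} u = ennreal (if u \<in> {0..b3} then psi u else 0)"
      by (simp add: indicator_def)
  qed
  finally have H: "H3 (cube_fun (ypar k)) = 48 * ennreal (W1 k / 2 - artanh (tau k) * (theta k / 2) / 2)" unfolding nn .
  have "V0 p = enn2real (H3 (cube_fun (ypar k)))" unfolding V0_def k_def
    by (rule hvol_region) (measurable, simp_all add: mem_Cr[OF p], auto simp: cube_fun_def)
  also have "\<dots> = 48 * (W1 k / 2 - artanh (tau k) * (theta k / 2) / 2)"
    unfolding H using val0 by (simp add: enn2real_mult)
  finally show ?thesis by (simp add: algebra_simps)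
qed

section \<open>The distances h, t, s, w in terms of k\<close>

definition Lpar :: "real \<Rightarrow> real" where "Lpar k = arcosh (1 / k)"
definition tpar :: "real \<Rightarrow> real" where "tpar k = arsinh (sqrt ((3 + k) / (2 * k)))"
definition spar :: "real \<Rightarrow> real" where "spar k = arsinh (sqrt (1 / k))"
definition wpar :: "real \<Rightarrow> real" where "wpar k = arcosh (sqrt ((1 + k) * (3 + k) / k))"

lemma inner_vert66:
  "vert Y 1 \<bullet> vert Y 2 = Y\<^sup>2" "vert Y 6 = vector [Y, Y, Y]"
  by (simp_all add: vert_def inner_vec_def sum_3 power2_eq_square)

lemma abs_div_sqrt_power2: "0 < q \<Longrightarrow> (\<bar>a\<bar> / sqrt q)\<^sup>2 = a\<^sup>2 / (q :: real)"
  by (simp add: power_divide)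

context
  fixes p :: real
  assumes p: "6 < p" "p < 7"
begin

lemma B_gt_1: "i \<in> {1..8} \<Longrightarrow> B p i = vert (ypar (kpar p)) i \<and> B p i \<bullet> B p i - 1 = 2 * kpar p / (3 + kpar p) \<and> B p i \<bullet> B p i > 1"
proof -
  assume i: "i \<in> {1..8}"
  have k: "0 < kpar p" "kpar p < 1" using kpar_bounds[OF p] by auto
  have B: "B p i = vert (ypar (kpar p)) i" by (simp add: B_def ycube_eq[OF p])
  have e: "B p i \<bullet> B p i - 1 = 2 * kpar p / (3 + kpar p)" unfolding B vert_inner[OF i] by (rule ypar(3)[OF k])
  have "2 * kpar p / (3 + kpar p) > 0" using k by simp
  then show ?thesis using B e by simp
qed

lemma hh_eq: "hh p = Lpar (kpar p) / 2"
proof -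
  have k: "0 < kpar p" "kpar p < 1" using kpar_bounds[OF p] by auto
  define k where "k = kpar p"
  have k: "0 < k" "k < 1" using k by (simp_all add: k_def)
  have b: "B p 1 \<bullet> B p 1 - 1 = 2 * k / (3 + k)" "B p 1 \<bullet> B p 1 > 1" "B p 2 \<bullet> B p 2 - 1 = 2 * k / (3 + k)" "B p 2 \<bullet> B p 2 > 1"
    using B_gt_1[of 1] B_gt_1[of 2] by (auto simp: k_def)
  have B: "B p 1 = vert (ypar k) 1" "B p 2 = vert (ypar k) 2" by (simp_all only: B_def ycube_eq[OF p] k_def)
  have ab: "1 - B p 1 \<bullet> B p 2 = 2 / (3 + k)" unfolding B inner_vert66 by (rule ypar(4)[OF k])
  have "hsetdist (polplane (B p 1)) (polplane (B p 2)) = arcosh (\<bar>2 / (3 + k)\<bar> / sqrt (2 * k / (3 + k) * (2 * k / (3 + k))))"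
  proof -
    have "2 * k / (3 + k) < 2 / (3 + k)" using k by (intro divide_strict_right_mono) auto
    then have "(2 * k / (3 + k)) * (2 * k / (3 + k)) < (2 / (3 + k))\<^sup>2" unfolding power2_eq_square using k
      by (intro mult_strict_mono) auto
    then show ?thesis using hsetdist_polplane[OF b(2,4)] unfolding b(1,3) ab by blast
  qed
  also have "\<bar>2 / (3 + k)\<bar> / sqrt (2 * k / (3 + k) * (2 * k / (3 + k))) = 1 / k"
  proof -
    have sA: "sqrt (2 * k / (3 + k) * (2 * k / (3 + k))) = 2 * k / (3 + k)" unfolding real_sqrt_abs2 using k by simp
    have "2 / m / (2 * k / m) = 1 / k" if "m \<noteq> 0" for m using that by simp
    from this[of "3 + k"] show ?thesis unfolding sA using k by simp
  qed
  finally show ?thesis by (simp add: hh_def beta_def Lpar_def k_def)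
qed

lemma tt_eq: "tt p = tpar (kpar p)"
proof -
  define k where "k = kpar p"
  have k: "0 < k" "k < 1" using kpar_bounds[OF p] by (simp_all add: k_def)
  have b: "B p 6 \<bullet> B p 6 - 1 = 2 * k / (3 + k)" "B p 6 \<bullet> B p 6 > 1" using B_gt_1[of 6] by (auto simp: k_def)
  have "tt p = arsinh (\<bar>1 - 0 \<bullet> B p 6\<bar> / sqrt ((1 - 0 \<bullet> (0::pt3)) * (B p 6 \<bullet> B p 6 - 1)))"
    unfolding tt_def beta_def by (rule hptdist_polplane[OF _ b(2)]) simp
  also have "\<bar>1 - 0 \<bullet> B p 6\<bar> / sqrt ((1 - 0 \<bullet> (0::pt3)) * (B p 6 \<bullet> B p 6 - 1)) = sqrt ((3 + k) / (2 * k))"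
    unfolding b(1) by (simp add: real_sqrt_divide)
  finally show ?thesis by (simp add: tpar_def k_def)
qed

lemma ss_eq: "ss p = spar (kpar p)"
proof -
  define k where "k = kpar p"
  have k: "0 < k" "k < 1" using kpar_bounds[OF p] by (simp_all add: k_def)
  define Y where "Y = ypar k"
  note yy = ypar[OF k, folded Y_def]
  have b: "B p 6 = vector [Y, Y, Y]" "B p 6 \<bullet> B p 6 - 1 = 2 * k / (3 + k)" "B p 6 \<bullet> B p 6 > 1"
    using B_gt_1[of 6] by (auto simp: k_def Y_def inner_vert66)
  define c :: pt3 where "c = vector [ycube p, 0, 0]"
  have c: "c \<bullet> c = Y\<^sup>2" "c \<bullet> B p 6 = Y\<^sup>2" unfolding b(1) c_def ycube_eq[OF p] k_def[symmetric] Y_def[symmetric]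
    by (simp_all add: vec3_inner power2_eq_square)
  have m: "1 - Y\<^sup>2 > 0" unfolding yy(4) using k by simp
  have "ss p = arsinh (\<bar>1 - c \<bullet> B p 6\<bar> / sqrt ((1 - c \<bullet> c) * (B p 6 \<bullet> B p 6 - 1)))"
    unfolding ss_def beta_def c_def[symmetric] by (rule hptdist_polplane[OF _ b(3)]) (use c m in simp)
  also have "\<bar>1 - c \<bullet> B p 6\<bar> / sqrt ((1 - c \<bullet> c) * (B p 6 \<bullet> B p 6 - 1)) = sqrt (1 / k)"
  proof (rule power2_eq_imp_eq)
    have "(\<bar>1 - c \<bullet> B p 6\<bar> / sqrt ((1 - c \<bullet> c) * (B p 6 \<bullet> B p 6 - 1)))\<^sup>2 = (2 / (3 + k))\<^sup>2 / (2 / (3 + k) * (2 * k / (3 + k)))"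
      unfolding c b(2) yy(4) using k by (subst abs_div_sqrt_power2) simp_all
    also have "\<dots> = 1 / k" using k by (simp add: power2_eq_square)
    finally show "(\<bar>1 - c \<bullet> B p 6\<bar> / sqrt ((1 - c \<bullet> c) * (B p 6 \<bullet> B p 6 - 1)))\<^sup>2 = (sqrt (1 / k))\<^sup>2" using k by simp
    show "0 \<le> \<bar>1 - c \<bullet> B p 6\<bar> / sqrt ((1 - c \<bullet> c) * (B p 6 \<bullet> B p 6 - 1))"
      unfolding c b(2) yy(4) using k by simp
  qed (use k in simp)
  finally show ?thesis by (simp add: spar_def k_def)
qed

lemma ww_eq: "ww p = wpar (kpar p)"
proof -
  define k where "k = kpar p"
  have k: "0 < k" "k < 1" using kpar_bounds[OF p] by (simp_all add: k_def)
  define Y where "Y = ypar k"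
  note yy = ypar[OF k, folded Y_def]
  have b: "B p 6 = vector [Y, Y, Y]" "B p 6 \<bullet> B p 6 - 1 = 2 * k / (3 + k)" "B p 6 \<bullet> B p 6 > 1"
    using B_gt_1[of 6] by (auto simp: k_def Y_def inner_vert66)
  define f :: pt3 where "f = vector [- (1 / Y), 0, 0]"
  \<comment> \<open>The plane of the face x1 = -y is the polar plane of f, so w becomes a distance
    between two polar planes.\<close>
  have xf: "x \<bullet> f = - (x $ 1 / Y)" for x by (simp add: f_def inner_vec_def sum_3)
  have pl: "{x \<in> kball. x $ 1 = - ycube p} = polplane f"
    unfolding polplane_def xf ycube_eq[OF p] k_def[symmetric] Y_def[symmetric] using yy(1) by (auto simp: field_simps)
  have "f \<bullet> f = 1 / Y\<^sup>2" by (simp add: f_def vec3_inner power2_eq_square)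
  then have ff: "f \<bullet> f - 1 = 2 / (1 + k)" unfolding yy(2) using k by (simp add: field_simps)
  have "2 / (1 + k) > 0" using k by simp
  then have f1: "f \<bullet> f > 1" using ff by linarith
  have bf: "B p 6 \<bullet> f = - 1" unfolding b(1) f_def using yy(1) by (simp add: vec3_inner)
  have pr: "2 * k / (3 + k) * (2 / (1 + k)) = 4 * k / ((1 + k) * (3 + k))" by simp
  have k4: "4 * k / ((1 + k) * (3 + k)) < 4"
  proof -
    have "k < (1 + k) * (3 + k)" using k by (simp add: algebra_simps add_pos_nonneg)
    then show ?thesis using k by (simp add: divide_less_eq)
  qed
  have "ww p = arcosh (\<bar>1 - B p 6 \<bullet> f\<bar> / sqrt ((B p 6 \<bullet> B p 6 - 1) * (f \<bullet> f - 1)))"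
    unfolding ww_def beta_def pl by (rule hsetdist_polplane[OF b(3) f1]) (unfold b(2) ff bf pr, use k4 in simp)
  also have "\<bar>1 - B p 6 \<bullet> f\<bar> / sqrt ((B p 6 \<bullet> B p 6 - 1) * (f \<bullet> f - 1)) = sqrt ((1 + k) * (3 + k) / k)"
  proof (rule power2_eq_imp_eq)
    have "4 * k / ((1 + k) * (3 + k)) > 0" using k by simp
    then have "(\<bar>1 - B p 6 \<bullet> f\<bar> / sqrt ((B p 6 \<bullet> B p 6 - 1) * (f \<bullet> f - 1)))\<^sup>2 = 4 / (4 * k / ((1 + k) * (3 + k)))"
      unfolding b(2) ff bf pr by (simp add: power_divide)
    also have "\<dots> = (1 + k) * (3 + k) / k" using k by simp
    finally show "(\<bar>1 - B p 6 \<bullet> f\<bar> / sqrt ((B p 6 \<bullet> B p 6 - 1) * (f \<bullet> f - 1)))\<^sup>2 = (sqrt ((1 + k) * (3 + k) / k))\<^sup>2" using k by simp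
    show "0 \<le> \<bar>1 - B p 6 \<bullet> f\<bar> / sqrt ((B p 6 \<bullet> B p 6 - 1) * (f \<bullet> f - 1))"
      unfolding b(2) ff bf pr using k by simp
  qed (use k in simp)
  finally show ?thesis by (simp add: wpar_def k_def)
qed

end

lemma cosh_params:
  assumes k: "0 < k" "k < 1"
  shows "cosh (Lpar k) = 1 / k" "sinh (Lpar k) = sqrt (1 - k\<^sup>2) / k" "Lpar k > 0"
    "sinh (tpar k) = sqrt ((3 + k) / (2 * k))" "cosh (tpar k) = sqrt (3 * (1 + k) / (2 * k))" "tpar k > 0"
    "sinh (spar k) = sqrt (1 / k)" "cosh (spar k) = sqrt ((1 + k) / k)" "spar k > 0"
    "cosh (wpar k) = sqrt ((1 + k) * (3 + k) / k)" "sinh (wpar k) = sqrt ((3 + 3 * k + k\<^sup>2) / k)" "wpar k > 0"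
proof -
  have k1: "1 < 1 / k" using k by simp
  show "cosh (Lpar k) = 1 / k" unfolding Lpar_def using k1 by (simp add: cosh_arcosh_real)
  show "sinh (Lpar k) = sqrt (1 - k\<^sup>2) / k"
  proof -
    have "(1 / k)\<^sup>2 - 1 = (1 - k\<^sup>2) / k\<^sup>2" using k by (simp add: power_divide diff_divide_distrib)
    then show ?thesis unfolding Lpar_def using k1 k by (simp add: sinh_arcosh_real real_sqrt_divide)
  qed
  show "Lpar k > 0" unfolding Lpar_def using k1 k by (simp add: arcosh_real_gt_1_iff)
  show "sinh (tpar k) = sqrt ((3 + k) / (2 * k))" by (simp add: tpar_def sinh_arsinh_real)
  show "cosh (tpar k) = sqrt (3 * (1 + k) / (2 * k))"
  proof -
    have "(3 + k) / (2 * k) + 1 = 3 * (1 + k) / (2 * k)" using k by (simp add: field_simps)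
    then show ?thesis unfolding tpar_def cosh_arsinh_real using k by simp
  qed
  show "tpar k > 0" unfolding tpar_def using k by (simp add: arsinh_real_pos_iff)
  show "sinh (spar k) = sqrt (1 / k)" by (simp add: spar_def sinh_arsinh_real)
  show "cosh (spar k) = sqrt ((1 + k) / k)"
  proof -
    have "1 / k + 1 = (1 + k) / k" using k by (simp add: field_simps)
    then show ?thesis unfolding spar_def cosh_arsinh_real using k by simp
  qed
  show "spar k > 0" unfolding spar_def using k by (simp add: arsinh_real_pos_iff)
  have w1: "1 < (1 + k) * (3 + k) / k"
  proof -
    have "k < (1 + k) * (3 + k)" using k by (simp add: algebra_simps add_pos_nonneg)
    then show ?thesis using k by (simp add: less_divide_eq)
  qed
  then have w2: "1 < sqrt ((1 + k) * (3 + k) / k)" by simp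
  show "cosh (wpar k) = sqrt ((1 + k) * (3 + k) / k)" unfolding wpar_def using w2 by (intro cosh_arcosh_real) simp
  show "sinh (wpar k) = sqrt ((3 + 3 * k + k\<^sup>2) / k)"
  proof -
    have "(sqrt ((1 + k) * (3 + k) / k))\<^sup>2 - 1 = (3 + 3 * k + k\<^sup>2) / k"
      using k by (simp add: field_simps power2_eq_square)
    then show ?thesis unfolding wpar_def using w2 by (simp add: sinh_arcosh_real)
  qed
  show "wpar k > 0" unfolding wpar_def using w2 arcosh_real_gt_1_iff[of "sqrt ((1 + k) * (3 + k) / k)"] by (metis less_imp_le less_irrefl)
qed

section \<open>The volume as a function of one parameter\<close>

definition Dpar :: "real \<Rightarrow> real" where "Dpar k = sqrt ((3 + k) * (1 - k))"
definition Apar :: "real \<Rightarrow> real" where "Apar k = pi - 3 * theta k"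

lemma Dpar_pos: "0 \<le> k \<Longrightarrow> k < 1 \<Longrightarrow> Dpar k > 0" by (simp add: Dpar_def)

lemma DERIV_theta:
  assumes k: "0 \<le> k" "k < 1"
  shows "(theta has_real_derivative - 1 / Dpar k) (at k)"
proof -
  have "(theta has_real_derivative inverse (- sqrt (1 - ((1 + k) / 2)\<^sup>2)) * (1 / 2)) (at k)"
    unfolding theta_def by (rule DERIV_chain2[OF DERIV_arccos]) (use k in \<open>auto intro!: derivative_eq_intros\<close>)
  also have "sqrt (1 - ((1 + k) / 2)\<^sup>2) = Dpar k / 2"
  proof -
    have "4 * (1 - ((1 + k) / 2)\<^sup>2) = (3 + k) * (1 - k)" by (simp add: power_divide power2_eq_square) (simp add: algebra_simps)
    then have "1 - ((1 + k) / 2)\<^sup>2 = (3 + k) * (1 - k) / 4" by (metis nonzero_mult_div_cancel_left zero_neq_numeral)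
    note e = this
    show ?thesis unfolding e by (simp add: Dpar_def real_sqrt_divide)
  qed
  also have "inverse (- (Dpar k / 2)) * (1 / 2) = - 1 / Dpar k" by (simp add: inverse_eq_divide)
  finally show ?thesis .
qed

lemma DERIV_Apar:
  assumes k: "0 \<le> k" "k < 1"
  shows "(Apar has_real_derivative 3 / Dpar k) (at k)"
proof -
  have "((\<lambda>k. pi - 3 * theta k) has_real_derivative 0 - 3 * (- 1 / Dpar k)) (at k)"
    by (intro DERIV_diff DERIV_const DERIV_cmult DERIV_theta k)
  then show ?thesis unfolding Apar_def[abs_def] by simp
qed

lemma Apar_0: "Apar 0 = 0"
proof -
  have "theta 0 = arccos (cos (pi / 3))" by (simp add: theta_def cos_60)
  also have "\<dots> = pi / 3" using pi_gt_zero by (intro arccos_cos) linarith+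
  finally show ?thesis by (simp add: Apar_def)
qed

lemma DERIV_Lpar:
  assumes k: "0 < k" "k < 1"
  shows "(Lpar has_real_derivative - 1 / (k * sqrt (1 - k\<^sup>2))) (at k)"
proof -
  have k2: "k\<^sup>2 < 1" using k by (simp add: abs_square_less_1)
  have "((\<lambda>k. arcosh (1 / k)) has_real_derivative 1 / sqrt ((1 / k)\<^sup>2 - 1) * (- 1 / k\<^sup>2)) (at k)"
  proof (rule DERIV_chain2[OF arcosh_real_has_field_derivative])
    show "((\<lambda>k. 1 / k) has_real_derivative - 1 / k\<^sup>2) (at k)" using k
      by (auto intro!: derivative_eq_intros simp: power2_eq_square)
  qed (use k in simp)
  also have "sqrt ((1 / k)\<^sup>2 - 1) = sqrt (1 - k\<^sup>2) / k"
  proof -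
    have "(1 / k)\<^sup>2 - 1 = (1 - k\<^sup>2) / k\<^sup>2" using k by (simp add: power_divide diff_divide_distrib)
    then show ?thesis using k by (simp add: real_sqrt_divide)
  qed
  also have "1 / (sqrt (1 - k\<^sup>2) / k) * (- 1 / k\<^sup>2) = - 1 / (k * sqrt (1 - k\<^sup>2))"
    using k by (simp add: power2_eq_square)
  finally show ?thesis unfolding Lpar_def[abs_def] .
qed

lemma Lpar_ln:
  assumes k: "0 < k" "k < 1"
  shows "Lpar k = ln ((1 + sqrt (1 - k\<^sup>2)) / k)" "artanh (tau k) = Lpar k / 2"
proof -
  have k2: "k\<^sup>2 < 1" using k by (simp add: abs_square_less_1)
  have "exp (Lpar k) = cosh (Lpar k) + sinh (Lpar k)" by (simp add: cosh_plus_sinh)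
  also have "\<dots> = (1 + sqrt (1 - k\<^sup>2)) / k" unfolding cosh_params(1,2)[OF k] by (simp add: add_divide_distrib)
  finally have e: "exp (Lpar k) = (1 + sqrt (1 - k\<^sup>2)) / k" .
  then show "Lpar k = ln ((1 + sqrt (1 - k\<^sup>2)) / k)" by (metis ln_exp)
  have "tau k = tanh (Lpar k / 2)"
  proof (rule power2_eq_imp_eq)
    have c: "cosh (2 * (Lpar k / 2)) = 1 / k" using cosh_params(1)[OF k] by simp
    have c2: "2 * (cosh (Lpar k / 2))\<^sup>2 = 1 / k + 1" "2 * (sinh (Lpar k / 2))\<^sup>2 = 1 / k - 1"
      using c cosh_double_cosh[of "Lpar k / 2"] cosh_square_eq[of "Lpar k / 2"] by simp_all
    have "(tanh (Lpar k / 2))\<^sup>2 = (2 * (sinh (Lpar k / 2))\<^sup>2) / (2 * (cosh (Lpar k / 2))\<^sup>2)" by (simp add: tanh_def power_divide)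
    also have "\<dots> = (1 - k) / (1 + k)" 
    proof -
      have "1 / k - 1 = (1 - k) / k" "1 / k + 1 = (1 + k) / k" using k by (simp_all add: field_simps)
      then show ?thesis unfolding c2 using k by simp
    qed
    finally show "(tau k)\<^sup>2 = (tanh (Lpar k / 2))\<^sup>2" using k by (simp add: tau_def)
    show "0 \<le> tau k" using k by (simp add: tau_def)
    show "0 \<le> tanh (Lpar k / 2)" using cosh_params(3)[OF k] by simp
  qed
  then show "artanh (tau k) = Lpar k / 2" by (simp add: artanh_tanh_real)
qed

text \<open>The part of the volume that stays regular at the ideal cube (\<open>k = 0\<close>).\<close>
definition Ypar :: "real \<Rightarrow> real" where "Ypar k = integral {0..b3} (\<lambda>u. ln (1 + sqrt (wfun k u)) / (1 + u\<^sup>2))"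
definition Econst :: real where "Econst = integral {0..b3} (\<lambda>u. - ln (1 - u\<^sup>2) / (1 + u\<^sup>2))"
definition Jpar :: "real \<Rightarrow> real" where
  "Jpar k = 24 * Ypar k + 12 * Econst + 2 * pi * (ln (1 + k) - ln (1 + sqrt (1 - k\<^sup>2)))"
definition Vpar :: "real \<Rightarrow> real" where "Vpar k = 2 * Apar k * Lpar k + Jpar k"

lemma has_integral_inverse_quad: "((\<lambda>u. 1 / (1 + u\<^sup>2)) has_integral pi / 6) {0..b3}"
proof -
  have "((\<lambda>u. 1 / (1 + u\<^sup>2)) has_integral (arctan b3 - arctan 0)) {0..b3}"
  proof (rule fundamental_theorem_of_calculus)
    show "(arctan has_vector_derivative 1 / (1 + u\<^sup>2)) (at u within {0..b3})" for u
      using DERIV_arctan[of u] by (auto simp: has_real_derivative_iff_has_vector_derivative[symmetric] divide_inverse intro: DERIV_subset)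
  qed (use b3 in simp)
  moreover have "arctan b3 = pi / 6"
  proof -
    have "b3 = tan (pi / 6)" by (simp add: b3_def tan_30)
    moreover have "arctan (tan (pi / 6)) = pi / 6" using pi_gt_zero by (intro arctan_tan) linarith+
    ultimately show ?thesis by simp
  qed
  ultimately show ?thesis by simp
qed

lemma wfun_pos: "-1/2 < k \<Longrightarrow> k < 1 \<Longrightarrow> u \<in> {0..b3} \<Longrightarrow> wfun k u > 0"
proof -
  assume k: "-1/2 < k" "k < 1" and u: "u \<in> {0..b3}"
  have u2: "0 \<le> u\<^sup>2" "u\<^sup>2 \<le> 1 / 3" using u_bounds[OF u] by auto
  have "- (1 / 2) * u\<^sup>2 \<le> k * u\<^sup>2" using k u2 by (intro mult_right_mono) auto
  then have "1 + k * u\<^sup>2 > 0" using u2 by linarith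
  then show "wfun k u > 0" using k by (simp add: wfun_def)
qed

lemma u2_lt_1: "u \<in> {0..b3} \<Longrightarrow> u\<^sup>2 < 1"
  using u_bounds[of u] by linarith

lemma ln_square_quotient:
  fixes a b c :: real
  assumes "a > 0" "b > 0" "c > 0"
  shows "ln (a\<^sup>2 / (b / c)) = 2 * ln a - (ln b - ln c)"
proof -
  have "ln (a\<^sup>2 / (b / c)) = ln (a\<^sup>2) - ln (b / c)" using assms by (intro ln_divide_pos) auto
  moreover have "ln (b / c) = ln b - ln c" using assms by (intro ln_divide_pos)
  moreover have "ln (a\<^sup>2) = 2 * ln a" using ln_realpow[of a 2] by simp
  ultimately show ?thesis by simp
qed

text \<open>Writing (1 + r) / (1 - r) as (1 + r)^2 / (1 - r^2), with 1 - r^2 = k (1 - u^2) / (1 +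
  k), splits the artanh into ln (1 + r), a term independent of k and a term constant in u. The
  divergent - ln k has coefficient 2 pi there, and the remaining term of the volume turns this
  coefficient into 2 A on L.\<close>

lemma V0_eq_Vpar:
  assumes p: "6 < p" "p < 7"
  shows "V0 p = Vpar (kpar p)"
proof -
  define k where "k = kpar p"
  have k: "0 < k" "k < 1" using kpar_bounds[OF p] by (simp_all add: k_def)
  have o: "1 + u\<^sup>2 \<noteq> 0" for u :: real using one_plus_sq_pos[of u] by simp
  have iY: "((\<lambda>u. ln (1 + sqrt (wfun k u)) / (1 + u\<^sup>2)) has_integral Ypar k) {0..b3}"
    unfolding Ypar_def
  proof (rule integrable_integral, rule integrable_continuous_real, intro continuous_intros continuous_wfun k ballI)
    show "1 + sqrt (wfun k u) \<noteq> 0" if "u \<in> {0..b3}" for u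
      using wfun_bounds(1)[OF k that] by (smt (verit) real_sqrt_gt_zero)
  qed (rule o)
  have iE: "((\<lambda>u. - ln (1 - u\<^sup>2) / (1 + u\<^sup>2)) has_integral Econst) {0..b3}"
    unfolding Econst_def
    by (rule integrable_integral, rule integrable_continuous_real, intro continuous_intros ballI o) (use u2_lt_1 in force)
  have "((\<lambda>u. ln (1 + sqrt (wfun k u)) / (1 + u\<^sup>2) + (1 / 2 * (- ln (1 - u\<^sup>2) / (1 + u\<^sup>2)) + (ln ((1 + k) / k) / 2) * (1 / (1 + u\<^sup>2))))
     has_integral Ypar k + (1 / 2 * Econst + (ln ((1 + k) / k) / 2) * (pi / 6))) {0..b3}"
    by (intro has_integral_add has_integral_mult_right iY iE has_integral_inverse_quad)
  then have "((\<lambda>u. artanh (sqrt (wfun k u)) / (1 + u\<^sup>2)) has_integral Ypar k + (1 / 2 * Econst + (ln ((1 + k) / k) / 2) * (pi / 6))) {0..b3}"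
  proof (rule has_integral_eq[rotated])
    fix u assume u: "u \<in> {0..b3}"
    define r where "r = sqrt (wfun k u)"
    note w = wfun_bounds[OF k u]
    have r: "0 < r" "r < 1" "r\<^sup>2 = wfun k u" using w by (simp_all add: r_def)
    have "(1 + r) / (1 - r) = (1 + r)\<^sup>2 / ((1 + r) * (1 - r))" using r by (simp add: power2_eq_square)
    also have "(1 + r) * (1 - r) = 1 - wfun k u" unfolding r(3)[symmetric] by (simp add: power2_eq_square algebra_simps)
    also have "\<dots> = (1 - u\<^sup>2) / ((1 + k) / k)" unfolding w(3) using k by simp
    finally have q: "(1 + r) / (1 - r) = (1 + r)\<^sup>2 / ((1 - u\<^sup>2) / ((1 + k) / k))" .
    have p1: "1 - u\<^sup>2 > 0" using u2_lt_1[OF u] by simp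
    have "ln ((1 + r) / (1 - r)) = 2 * ln (1 + r) - (ln (1 - u\<^sup>2) - ln ((1 + k) / k))"
      unfolding q using r k p1 by (intro ln_square_quotient) auto
    then have "artanh r = ln (1 + r) + (- ln (1 - u\<^sup>2) / 2 + ln ((1 + k) / k) / 2)" by (simp add: artanh_def)
    then show "ln (1 + sqrt (wfun k u)) / (1 + u\<^sup>2) + (1 / 2 * (- ln (1 - u\<^sup>2) / (1 + u\<^sup>2)) + (ln ((1 + k) / k) / 2) * (1 / (1 + u\<^sup>2)))
      = artanh (sqrt (wfun k u)) / (1 + u\<^sup>2)" unfolding r_def[symmetric] by (simp add: add_divide_distrib diff_divide_distrib)
  qed
  then have W: "W1 k = Ypar k + (1 / 2 * Econst + (ln ((1 + k) / k) / 2) * (pi / 6))"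
    unfolding W1_def by (rule integral_unique)
  have k2: "k\<^sup>2 < 1" using k by (simp add: abs_square_less_1)
  have l: "ln ((1 + k) / k) = ln (1 + k) - ln k" "Lpar k = ln (1 + sqrt (1 - k\<^sup>2)) - ln k"
    proof -
    have "1 + sqrt (1 - k\<^sup>2) > 0" using k2 by (simp add: add_pos_nonneg)
    then show "ln ((1 + k) / k) = ln (1 + k) - ln k" "Lpar k = ln (1 + sqrt (1 - k\<^sup>2)) - ln k"
      unfolding Lpar_ln(1)[OF k] using k by (simp_all add: ln_div)
  qed
  have "V0 p = 24 * W1 k - 12 * (Lpar k / 2) * theta k" using V0_eq_W1[OF p] Lpar_ln(2)[OF k] by (simp add: k_def)
  also have "\<dots> = 24 * Ypar k + 12 * Econst + 2 * pi * ln ((1 + k) / k) - 6 * Lpar k * theta k" unfolding W by (simp add: algebra_simps)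
  also have "\<dots> = Vpar k"
  proof -
    have "2 * pi * ln ((1 + k) / k) = 2 * pi * (ln (1 + k) - ln (1 + sqrt (1 - k\<^sup>2))) + 2 * pi * Lpar k"
      unfolding l by (simp add: algebra_simps)
    then show ?thesis unfolding Vpar_def Jpar_def Apar_def by (simp add: algebra_simps)
  qed
  finally show ?thesis by (simp add: k_def)
qed

lemma quotient_regroup: "1 / A * (inverse S / 2 * (n / B)) / m = n / (B * (2 * S * A * m))" for A S n B m :: real
  by (simp add: inverse_eq_divide mult.commute mult.left_commute)

text \<open>Differentiation under the integral sign. The range starts at -1/2 so that k = 0 is an
  interior point; this yields continuity of the regular part of the volume at the ideal
  cube.\<close>

lemma DERIV_Ypar:
  assumes k: "-1/2 < k" "k < 1"
  shows "(Ypar has_real_derivative integral {0..b3} (\<lambda>u. (u\<^sup>2 - 1) / ((1 + k)\<^sup>2 * (2 * sqrt (wfun k u) * (1 + sqrt (wfun k u)) * (1 + u\<^sup>2))))) (at k)"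
proof -
  define U where "U = {-1/2<..<1::real}"
  have kU: "k \<in> U" "open U" "convex U" using k by (auto simp: U_def)
  have o: "1 + u\<^sup>2 \<noteq> 0" for u :: real using one_plus_sq_pos[of u] by simp
  define fx where "fx k u = (u\<^sup>2 - 1) / ((1 + k)\<^sup>2 * (2 * sqrt (wfun k u) * (1 + sqrt (wfun k u)) * (1 + u\<^sup>2)))" for k u :: real
  have "((\<lambda>k. integral (cbox 0 b3) (\<lambda>u. ln (1 + sqrt (wfun k u)) / (1 + u\<^sup>2))) has_field_derivative integral (cbox 0 b3) (fx k)) (at k within U)"
  proof (rule leibniz_rule_field_derivative)
    fix x u assume x: "x \<in> U" and u: "u \<in> cbox 0 b3"
    have w: "wfun x u > 0" using x u by (intro wfun_pos) (auto simp: U_def)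
    have x1: "1 + x \<noteq> 0" using x by (auto simp: U_def)
    have D1: "((\<lambda>x. wfun x u) has_real_derivative (u\<^sup>2 - 1) / (1 + x)\<^sup>2) (at x)"
    proof -
      have a: "((\<lambda>x. 1 + x * u\<^sup>2) has_real_derivative u\<^sup>2) (at x)" "((\<lambda>x. 1 + x) has_real_derivative 1) (at x)"
        by (auto intro!: derivative_eq_intros)
      have e: "u\<^sup>2 * (1 + x) - (1 + x * u\<^sup>2) * 1 = u\<^sup>2 - 1" by (simp add: algebra_simps)
      show ?thesis using DERIV_divide[OF a x1] unfolding wfun_def e power2_eq_square[of "1 + x"] .
    qed
    have D2: "((\<lambda>x. sqrt (wfun x u)) has_real_derivative inverse (sqrt (wfun x u)) / 2 * ((u\<^sup>2 - 1) / (1 + x)\<^sup>2)) (at x)"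
      by (rule DERIV_chain2[OF DERIV_real_sqrt[OF w] D1])
    have s: "1 + sqrt (wfun x u) > 0" using w by (simp add: add_pos_nonneg)
    have D3: "((\<lambda>x. ln (1 + sqrt (wfun x u))) has_real_derivative 1 / (1 + sqrt (wfun x u)) * (inverse (sqrt (wfun x u)) / 2 * ((u\<^sup>2 - 1) / (1 + x)\<^sup>2))) (at x)"
      using DERIV_chain2[OF DERIV_ln_divide[OF s] DERIV_add[OF DERIV_const[of 1] D2]] by simp
    have "((\<lambda>x. ln (1 + sqrt (wfun x u)) / (1 + u\<^sup>2)) has_real_derivative
       1 / (1 + sqrt (wfun x u)) * (inverse (sqrt (wfun x u)) / 2 * ((u\<^sup>2 - 1) / (1 + x)\<^sup>2)) / (1 + u\<^sup>2)) (at x)"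
      by (rule DERIV_cdivide[OF D3])
    also have "1 / (1 + sqrt (wfun x u)) * (inverse (sqrt (wfun x u)) / 2 * ((u\<^sup>2 - 1) / (1 + x)\<^sup>2)) / (1 + u\<^sup>2) = fx x u"
      unfolding fx_def by (rule quotient_regroup)
    finally show "((\<lambda>x. ln (1 + sqrt (wfun x u)) / (1 + u\<^sup>2)) has_field_derivative fx x u) (at x within U)"
      by (rule DERIV_subset) simp
  next
    fix x assume x: "x \<in> U"
    show "(\<lambda>u. ln (1 + sqrt (wfun x u)) / (1 + u\<^sup>2)) integrable_on cbox 0 b3"
    proof (rule integrable_continuous, intro continuous_intros ballI)
      have "1 + x \<noteq> 0" using x by (auto simp: U_def)
      then show "continuous_on (cbox 0 b3) (\<lambda>u. wfun x u)" unfolding wfun_def by (intro continuous_intros) auto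
      show "1 + sqrt (wfun x u) \<noteq> 0" if "u \<in> cbox 0 b3" for u
      proof -
        have "wfun x u > 0" using x that by (intro wfun_pos) (auto simp: U_def)
        then have "1 + sqrt (wfun x u) > 0" by (simp add: add_pos_nonneg)
        then show ?thesis by simp
      qed
    qed (rule o)
  next
    have c: "continuous_on (U \<times> cbox 0 b3) (\<lambda>q. wfun (fst q) (snd q))"
      unfolding wfun_def by (intro continuous_intros) (auto simp: U_def)
    have "continuous_on (U \<times> cbox 0 b3) (\<lambda>q. fx (fst q) (snd q))"
      unfolding fx_def
    proof (intro continuous_intros c ballI)
      fix q assume q: "q \<in> U \<times> cbox 0 b3"
      then have w: "wfun (fst q) (snd q) > 0" by (intro wfun_pos) (auto simp: U_def)
      then have "1 + sqrt (wfun (fst q) (snd q)) > 0" by (simp add: add_pos_nonneg)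
      moreover have "1 + fst q \<noteq> 0" using q by (auto simp: U_def)
      ultimately show "(1 + fst q)\<^sup>2 * (2 * sqrt (wfun (fst q) (snd q)) * (1 + sqrt (wfun (fst q) (snd q))) * (1 + (snd q)\<^sup>2)) \<noteq> 0"
        using w o[of "snd q"] by simp
    qed
    then show "continuous_on (U \<times> cbox 0 b3) (\<lambda>(x, t). fx x t)" by (simp add: case_prod_beta')
  qed (use kU in auto)
  then have "(Ypar has_field_derivative integral {0..b3} (fx k)) (at k within U)"
    unfolding Ypar_def[abs_def] by (simp only: cbox_interval)
  then show ?thesis unfolding at_within_open[OF kU(1,2)] fx_def[abs_def] .
qed

text \<open>The differentiated integrand is a combination of 1 / (1 + u^2), with integral pi / 6,
  and of dT / (1 + T^2) for T = \<open>tfun k u\<close>, with integral theta / 2. Hence the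
  derivative is elementary up to theta, and the coefficients assemble to pi - 3 theta.\<close>

lemma DERIV_Jpar:
  assumes k: "0 < k" "k < 1"
  shows "(Jpar has_real_derivative 2 * Apar k / (k * sqrt (1 - k\<^sup>2))) (at k)"
proof -
  have o: "1 + u\<^sup>2 \<noteq> 0" for u :: real using one_plus_sq_pos[of u] by simp
  define Rk where "Rk = sqrt (1 - k\<^sup>2)"
  have k2: "k\<^sup>2 < 1" using k by (simp add: abs_square_less_1)
  have Rk: "Rk > 0" "Rk\<^sup>2 = 1 - k\<^sup>2" using k2 by (simp_all add: Rk_def)
  have pos: "1 + k * u\<^sup>2 > 0" for u using k by (simp add: add_pos_nonneg)
  define dt where "dt u = sqrt (1 - k) / sqrt (1 + k * u\<^sup>2) ^ 3" for u
  have Dt: "(tfun k has_real_derivative dt u) (at u)" for u unfolding dt_def by (rule DERIV_tfun[OF k])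
  have "((\<lambda>u. dt u / (1 + (tfun k u)\<^sup>2)) has_integral (arctan (tfun k b3) - arctan (tfun k 0))) {0..b3}"
  proof (rule fundamental_theorem_of_calculus)
    show "((\<lambda>u. arctan (tfun k u)) has_vector_derivative dt u / (1 + (tfun k u)\<^sup>2)) (at u within {0..b3})" for u
      using DERIV_chain2[OF DERIV_arctan Dt, of u] 
      by (auto simp: has_real_derivative_iff_has_vector_derivative[symmetric] divide_inverse mult.commute intro: DERIV_subset)
  qed (use b3 in simp)
  then have i1: "((\<lambda>u. dt u / (1 + (tfun k u)\<^sup>2)) has_integral theta k / 2) {0..b3}"
    unfolding tfun_eqs(4,5)[OF k] arctan_half_theta[OF k] by simp
  define c where "c = 1 / (2 * k * (1 + k))"
  have "((\<lambda>u. c * (1 / (1 + u\<^sup>2)) - c * ((1 + k) / Rk) * (dt u / (1 + (tfun k u)\<^sup>2))) has_integral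
     c * (pi / 6) - c * ((1 + k) / Rk) * (theta k / 2)) {0..b3}"
    by (intro has_integral_diff has_integral_mult_right i1 has_integral_inverse_quad)
  then have "((\<lambda>u. (u\<^sup>2 - 1) / ((1 + k)\<^sup>2 * (2 * sqrt (wfun k u) * (1 + sqrt (wfun k u)) * (1 + u\<^sup>2)))) has_integral
     c * (pi / 6) - c * ((1 + k) / Rk) * (theta k / 2)) {0..b3}"
  proof (rule has_integral_eq[rotated])
    fix u assume u: "u \<in> {0..b3}"
    define r where "r = sqrt (wfun k u)"
    note w = wfun_bounds[OF k u]
    have r: "0 < r" "r < 1" "r\<^sup>2 = wfun k u" using w by (simp_all add: r_def)
    define v where "v = sqrt (1 + k * u\<^sup>2)"
    have v: "v > 0" "v\<^sup>2 = 1 + k * u\<^sup>2" using pos[of u] by (simp_all add: v_def)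
    have "dt u / (1 + (tfun k u)\<^sup>2) = sqrt (1 - k) / v / (1 + u\<^sup>2)"
      unfolding tfun_eqs(1)[OF k] dt_def unfolding v_def[symmetric] unfolding v(2)[symmetric] using v(1) by (intro cube_quotient) simp
    moreover have "(1 + k) / Rk * (sqrt (1 - k) / v) = 1 / r"
    proof -
      have a: "Rk = sqrt (1 - k) * sqrt (1 + k)" unfolding Rk_def real_sqrt_mult[symmetric] by (simp add: power2_eq_square algebra_simps)
      have b: "r = v / sqrt (1 + k)" unfolding r_def wfun_def v_def by (simp add: real_sqrt_divide)
      have c: "(1 + k) / sqrt (1 + k) = sqrt (1 + k)" using k by (simp add: real_div_sqrt)
      have "(1 + k) / Rk * (sqrt (1 - k) / v) = (1 + k) / sqrt (1 + k) / v" unfolding a using k by simp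
      then show ?thesis unfolding c b by simp
    qed
    ultimately have e: "c * ((1 + k) / Rk) * (dt u / (1 + (tfun k u)\<^sup>2)) = c * (1 / r) / (1 + u\<^sup>2)"
    proof -
      assume a: "dt u / (1 + (tfun k u)\<^sup>2) = sqrt (1 - k) / v / (1 + u\<^sup>2)" "(1 + k) / Rk * (sqrt (1 - k) / v) = 1 / r"
      have "c * P * (Q / M) = c * (P * Q) / M" for P Q M :: real by simp
      then show ?thesis unfolding a(1) by (metis a(2))
    qed
    have u1: "1 - u\<^sup>2 = (1 + k) * (1 - r\<^sup>2) / k" unfolding r(3) w(3) using k by simp
    have "(u\<^sup>2 - 1) / ((1 + k)\<^sup>2 * (2 * r * (1 + r) * (1 + u\<^sup>2))) = - (1 - u\<^sup>2) / ((1 + k)\<^sup>2 * (2 * r * (1 + r) * (1 + u\<^sup>2)))" by simp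
    also have "\<dots> = - ((1 + k) * ((1 - r) * (1 + r)) / k) / ((1 + k)\<^sup>2 * (2 * r * (1 + r) * (1 + u\<^sup>2)))"
      unfolding u1 by (simp add: power2_eq_square algebra_simps)
    also have "\<dots> = - (c * (1 - r) / r / (1 + u\<^sup>2))"
    proof -
      have "- (a * (b * d) / k) / (a\<^sup>2 * (2 * r * d * m)) = - (1 / (2 * k * a) * b / r / m)" if "a \<noteq> 0" "d \<noteq> 0" for a b d m :: real
        using that by (simp add: power2_eq_square mult_ac)
      from this[of "1 + k" "1 + r" "1 - r" "1 + u\<^sup>2"] show ?thesis unfolding c_def using k r by simp
    qed
    also have "\<dots> = c * (1 / (1 + u\<^sup>2)) - c * (1 / r) / (1 + u\<^sup>2)"
    proof -
      have "c * (1 - r) / r = c * (1 / r) - c" using r by (simp add: diff_divide_distrib right_diff_distrib)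
      then show ?thesis by (simp add: diff_divide_distrib)
    qed
    finally show "c * (1 / (1 + u\<^sup>2)) - c * ((1 + k) / Rk) * (dt u / (1 + (tfun k u)\<^sup>2)) = (u\<^sup>2 - 1) / ((1 + k)\<^sup>2 * (2 * sqrt (wfun k u) * (1 + sqrt (wfun k u)) * (1 + u\<^sup>2)))"
      unfolding e r_def[symmetric] by simp
  qed
  then have DY: "(Ypar has_real_derivative c * (pi / 6) - c * ((1 + k) / Rk) * (theta k / 2)) (at k)"
    using DERIV_Ypar[of k] k by (simp add: integral_unique)
  have Dl: "((\<lambda>k. ln (1 + k) - ln (1 + sqrt (1 - k\<^sup>2))) has_real_derivative 1 / (1 + k) + k / (Rk * (1 + Rk))) (at k)"
  proof -
    have "((\<lambda>k. sqrt (1 - k\<^sup>2)) has_real_derivative - k / Rk) (at k)"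
      using k2 by (auto intro!: derivative_eq_intros simp: Rk_def field_simps)
    note Ds = this
    have s: "1 + sqrt (1 - k\<^sup>2) > 0" using Rk(1) unfolding Rk_def by linarith
    have "((\<lambda>k. ln (1 + sqrt (1 - k\<^sup>2))) has_real_derivative 1 / (1 + Rk) * (- k / Rk)) (at k)"
      using DERIV_chain2[OF DERIV_ln_divide[OF s] DERIV_add[OF DERIV_const[of 1] Ds]] by (simp add: Rk_def)
    moreover have "((\<lambda>k. ln (1 + k)) has_real_derivative 1 / (1 + k)) (at k)"
      using k by (auto intro!: derivative_eq_intros)
    ultimately have "((\<lambda>k. ln (1 + k) - ln (1 + sqrt (1 - k\<^sup>2))) has_real_derivative 1 / (1 + k) - 1 / (1 + Rk) * (- k / Rk)) (at k)"
      by (intro DERIV_diff)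
    then show ?thesis by (simp add: mult.commute)
  qed
  have "(Jpar has_real_derivative 24 * (c * (pi / 6) - c * ((1 + k) / Rk) * (theta k / 2)) + 0
     + 2 * pi * (1 / (1 + k) + k / (Rk * (1 + Rk)))) (at k)"
    unfolding Jpar_def[abs_def] by (intro DERIV_add DERIV_cmult DY DERIV_const Dl)
  also have "24 * (c * (pi / 6) - c * ((1 + k) / Rk) * (theta k / 2)) + 0 + 2 * pi * (1 / (1 + k) + k / (Rk * (1 + Rk)))
    = 2 * Apar k / (k * Rk)"
  proof -
    have a: "c * ((1 + k) / Rk) = 1 / (2 * k * Rk)" using k by (simp add: c_def)
    have b: "k / (Rk * (1 + Rk)) = (1 - Rk) / (k * Rk)"
    proof -
      have "k * k = (1 - Rk) * (1 + Rk)" using Rk(2) by (simp add: power2_eq_square algebra_simps)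
      then show ?thesis using k Rk(1) by (simp add: frac_eq_eq mult_ac)
    qed
    have d: "1 / (1 + k) = 1 / k - 2 * c"
    proof -
      have "1 / k - 1 / (k * (1 + k)) = (1 + k - 1) / (k * (1 + k))" unfolding diff_divide_distrib using k by simp
      also have "\<dots> = 1 / (1 + k)" using k by simp
      finally show ?thesis by (simp add: c_def)
    qed
    have e: "(1 - Rk) / (k * Rk) = 1 / (k * Rk) - 1 / k" using k Rk(1) by (simp add: diff_divide_distrib)
    have f: "1 / (2 * k * Rk) = 1 / (k * Rk) / 2" by simp
    have g: "2 * Apar k / (k * Rk) = 2 * Apar k * (1 / (k * Rk))" by simp
    have "24 * (c * (pi / 6) - q / 2 * (t / 2)) + 0 + 2 * pi * (i - 2 * c + (q - i)) = 2 * (pi - 3 * t) * q" for q t i :: real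
      by (simp add: algebra_simps)
    then show ?thesis unfolding a b d e unfolding f unfolding g unfolding Apar_def .
  qed
  finally show ?thesis by (simp add: Rk_def)
qed

text \<open>The derivative of \<open>Jpar\<close> cancels 2 A L', so only 2 A' L survives. The 6 is
  the Schlaefli factor 1/2 times the 12 edges of length L at which the dihedral angle
  varies.\<close>

lemma DERIV_Vpar:
  assumes k: "0 < k" "k < 1"
  shows "(Vpar has_real_derivative 6 * Lpar k / Dpar k) (at k)"
proof -
  have "((\<lambda>k. 2 * Apar k) has_real_derivative 2 * (3 / Dpar k)) (at k)"
    using k by (intro DERIV_cmult DERIV_Apar) auto
  from DERIV_add[OF DERIV_mult[OF this DERIV_Lpar[OF k]] DERIV_Jpar[OF k]]
  show ?thesis unfolding Vpar_def[abs_def] by simp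
qed

text \<open>The formula for the derivative is 0 / 0 at k = 0, so continuity there is proved
  separately; it is what allows bounds for \<open>Jpar\<close> to be integrated from 0.\<close>

lemma isCont_Jpar_0: "isCont Jpar 0"
proof -
  have y: "isCont Ypar 0" by (rule DERIV_isCont[OF DERIV_Ypar]) simp_all
  have l: "isCont (\<lambda>k. ln (1 + k) - ln (1 + sqrt (1 - k\<^sup>2))) (0::real)"
    by (intro continuous_intros) auto
  show ?thesis unfolding Jpar_def[abs_def]
    by (rule isCont_add[OF isCont_add[OF isCont_mult[OF continuous_const y] continuous_const] isCont_mult[OF continuous_const l]])
qed

text \<open>The volume of the regular ideal cube: at k = 0 the square root of \<open>wfun\<close> is
  1 and the first integral is explicit.\<close>

lemma Jpar_0: "Jpar 0 = 2 * pi * ln 2 + 12 * Econst"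
proof -
  have "((\<lambda>u. ln 2 * (1 / (1 + u\<^sup>2))) has_integral ln 2 * (pi / 6)) {0..b3}"
    by (intro has_integral_mult_right has_integral_inverse_quad)
  then have "Ypar 0 = ln 2 * (pi / 6)" unfolding Ypar_def wfun_def by (subst integral_unique[symmetric]) auto
  then show ?thesis unfolding Jpar_def by (simp add: mult.commute)
qed

lemma Dpar_sq: "0 \<le> k \<Longrightarrow> k < 1 \<Longrightarrow> (Dpar k)\<^sup>2 = 3 - 2 * k - k\<^sup>2"
proof -
  assume "0 \<le> k" "k < 1"
  then have "(Dpar k)\<^sup>2 = (3 + k) * (1 - k)" by (simp add: Dpar_def)
  then show ?thesis by (simp add: power2_eq_square algebra_simps)
qed

lemma DERIV_Dpar:
  assumes k: "0 \<le> k" "k < 1"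
  shows "(Dpar has_real_derivative - (1 + k) / Dpar k) (at k)"
proof -
  have p: "(3 + k) * (1 - k) > 0" using k by simp
  have "((\<lambda>k. (3 + k) * (1 - k)) has_real_derivative - 2 * (1 + k)) (at k)"
    by (auto intro!: derivative_eq_intros)
  note D = DERIV_chain2[OF DERIV_real_sqrt[OF p] this]
  have "inverse s / 2 * (- 2 * m) = - m / s" for s m :: real by (simp add: inverse_eq_divide)
  note e = this[of "sqrt ((3 + k) * (1 - k))" "1 + k"]
  show ?thesis using D unfolding Dpar_def[abs_def] e .
qed

lemma Apar_pos: assumes k: "0 < k" "k < 1" shows "Apar k > 0"
proof -
  have "Apar 0 < Apar k"
  proof (rule DERIV_pos_imp_increasing_open[OF k(1)])
    show "\<exists>y. (Apar has_real_derivative y) (at x) \<and> 0 < y" if "0 < x" "x < k" for x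
      using DERIV_Apar[of x] Dpar_pos[of x] that k by (intro exI[of _ "3 / Dpar x"]) auto
    show "continuous_on {0..k} Apar"
      using k by (intro continuous_at_imp_continuous_on ballI DERIV_isCont[OF DERIV_Apar]) auto
  qed
  then show ?thesis by (simp add: Apar_0)
qed

section \<open>Polynomial bounds for A and for the regular part of the volume\<close>

text \<open>A itself contains an arccos, but A' = 3 / D and D' = -(1 + k) / D. Comparing A with 3 (k
  - P) / D therefore leaves, after a factor D^-3, an expression polynomial in k, P and P'.\<close>

lemma DERIV_Apar_compare:
  assumes k: "0 \<le> k" "k < 1" and P: "(P has_real_derivative P') (at k)"
  shows "((\<lambda>k. Apar k - 3 * (k - P k) / Dpar k) has_real_derivative
    3 / Dpar k ^ 3 * ((3 - 2 * k - k\<^sup>2) * P' - (k - P k) * (1 + k))) (at k)"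
proof -
  have d: "Dpar k > 0" using Dpar_pos[OF k] .
  have "((\<lambda>k. 3 * (k - P k)) has_real_derivative 3 * (1 - P')) (at k)"
    by (intro DERIV_cmult DERIV_diff DERIV_ident P)
  from DERIV_divide[OF this DERIV_Dpar[OF k]] d
  have "((\<lambda>k. Apar k - 3 * (k - P k) / Dpar k) has_real_derivative
    3 / Dpar k - (3 * (1 - P') * Dpar k - 3 * (k - P k) * (- (1 + k) / Dpar k)) / (Dpar k * Dpar k)) (at k)"
    by (intro DERIV_diff DERIV_Apar k) simp
  also have "3 / Dpar k - (3 * (1 - P') * Dpar k - 3 * (k - P k) * (- (1 + k) / Dpar k)) / (Dpar k * Dpar k)
    = 3 / Dpar k ^ 3 * ((Dpar k)\<^sup>2 * P' - (k - P k) * (1 + k))"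
    using d by (simp add: field_simps power3_eq_cube power2_eq_square)
  finally show ?thesis unfolding Dpar_sq[OF k] .
qed

lemma Apar_compare:
  assumes k: "0 \<le> k" "k < 1" and P0: "P 0 = 0"
    and P: "\<And>x. 0 \<le> x \<Longrightarrow> x \<le> k \<Longrightarrow> (P has_real_derivative P' x) (at x)"
  shows "(\<And>x. 0 \<le> x \<Longrightarrow> x \<le> k \<Longrightarrow> (3 - 2 * x - x\<^sup>2) * P' x \<le> (x - P x) * (1 + x)) \<Longrightarrow> P k \<le> k - Apar k * Dpar k / 3"
    and "(\<And>x. 0 \<le> x \<Longrightarrow> x \<le> k \<Longrightarrow> (x - P x) * (1 + x) \<le> (3 - 2 * x - x\<^sup>2) * P' x) \<Longrightarrow> k - Apar k * Dpar k / 3 \<le> P k"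
proof -
  define q where "q k = Apar k - 3 * (k - P k) / Dpar k" for k
  have d: "Dpar x > 0" if "0 \<le> x" "x \<le> k" for x using Dpar_pos that k by auto
  have q0: "q 0 = 0" by (simp add: q_def P0 Apar_0)
  have D: "(q has_real_derivative 3 / Dpar x ^ 3 * ((3 - 2 * x - x\<^sup>2) * P' x - (x - P x) * (1 + x))) (at x)"
    if "0 \<le> x" "x \<le> k" for x
    unfolding q_def[abs_def] by (rule DERIV_Apar_compare) (use that k P in auto)
  have e: "q k = 3 * (P k - (k - Apar k * Dpar k / 3)) / Dpar k"
    using d[of k] k by (simp add: q_def field_simps)
  {
    assume c: "\<And>x. 0 \<le> x \<Longrightarrow> x \<le> k \<Longrightarrow> (3 - 2 * x - x\<^sup>2) * P' x \<le> (x - P x) * (1 + x)"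
    have "q k \<le> q 0"
    proof (rule DERIV_nonpos_imp_nonincreasing[OF k(1)])
      show "\<exists>y. (q has_real_derivative y) (at x) \<and> y \<le> 0" if "0 \<le> x" "x \<le> k" for x
        by (intro exI conjI, rule D[OF that], rule mult_nonneg_nonpos) (use c[OF that] d[OF that] in auto)
    qed
    then show "P k \<le> k - Apar k * Dpar k / 3" unfolding q0 e using d[of k] k by (simp add: divide_le_0_iff)
  }
  {
    assume c: "\<And>x. 0 \<le> x \<Longrightarrow> x \<le> k \<Longrightarrow> (x - P x) * (1 + x) \<le> (3 - 2 * x - x\<^sup>2) * P' x"
    have "q 0 \<le> q k"
    proof (rule DERIV_nonneg_imp_nondecreasing[OF k(1)])
      show "\<exists>y. (q has_real_derivative y) (at x) \<and> 0 \<le> y" if "0 \<le> x" "x \<le> k" for x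
        by (intro exI conjI, rule D[OF that], rule mult_nonneg_nonneg) (use c[OF that] d[OF that] in auto)
    qed
    then show "k - Apar k * Dpar k / 3 \<le> P k" unfolding q0 e using d[of k] k by (simp add: zero_le_divide_iff)
  }
qed

text \<open>The polynomial k^2 (2 + 2 k + k^2) / 12 is the Taylor polynomial of k - A D / 3 up to
  order 4. The next coefficient is 11 / 180; taking 1 / 11 instead gives an upper bound on the whole
  interval up to 1 / 4.\<close>

lemma Apar_Dpar_bounds:
  assumes k: "0 \<le> k" "k \<le> 1 / 4"
  shows "k\<^sup>2 * ((2 + 2 * k + k\<^sup>2) / 12) \<le> k - Apar k * Dpar k / 3"
    and "k - Apar k * Dpar k / 3 \<le> k\<^sup>2 * ((2 + 2 * k + k\<^sup>2) / 12 + k ^ 3 / 11)"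
proof -
  show "k\<^sup>2 * ((2 + 2 * k + k\<^sup>2) / 12) \<le> k - Apar k * Dpar k / 3"
  proof (rule Apar_compare(1)[where P' = "\<lambda>x. (2 * x + 3 * x ^ 2 + 2 * x ^ 3) / 6"])
    fix x assume x: "0 \<le> x" "x \<le> k"
    show "((\<lambda>x. x\<^sup>2 * ((2 + 2 * x + x\<^sup>2) / 12)) has_real_derivative (2 * x + 3 * x ^ 2 + 2 * x ^ 3) / 6) (at x)"
      by (auto intro!: derivative_eq_intros simp: algebra_simps power2_eq_square power3_eq_cube)
    have "(x - x\<^sup>2 * ((2 + 2 * x + x\<^sup>2) / 12)) * (1 + x) - (3 - 2 * x - x\<^sup>2) * ((2 * x + 3 * x ^ 2 + 2 * x ^ 3) / 6)
      = x ^ 4 * (11 / 12 + x / 4)" by (simp add: field_simps power2_eq_square power3_eq_cube power4_eq_xxxx)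
    moreover have "x ^ 4 * (11 / 12 + x / 4) \<ge> 0" using x by simp
    ultimately show "(3 - 2 * x - x\<^sup>2) * ((2 * x + 3 * x ^ 2 + 2 * x ^ 3) / 6) \<le> (x - x\<^sup>2 * ((2 + 2 * x + x\<^sup>2) / 12)) * (1 + x)"
      by linarith
  qed (use k in auto)
  show "k - Apar k * Dpar k / 3 \<le> k\<^sup>2 * ((2 + 2 * k + k\<^sup>2) / 12 + k ^ 3 / 11)"
  proof (rule Apar_compare(2)[where P' = "\<lambda>x. (2 * x + 3 * x ^ 2 + 2 * x ^ 3) / 6 + 5 * x ^ 4 / 11"])
    fix x assume x: "0 \<le> x" "x \<le> k"
    show "((\<lambda>x. x\<^sup>2 * ((2 + 2 * x + x\<^sup>2) / 12 + x ^ 3 / 11)) has_real_derivative (2 * x + 3 * x ^ 2 + 2 * x ^ 3) / 6 + 5 * x ^ 4 / 11) (at x)"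
      by (auto intro!: derivative_eq_intros simp: algebra_simps power2_eq_square power3_eq_cube power4_eq_xxxx)
    have "(x - x\<^sup>2 * ((2 + 2 * x + x\<^sup>2) / 12 + x ^ 3 / 11)) * (1 + x) - (3 - 2 * x - x\<^sup>2) * ((2 * x + 3 * x ^ 2 + 2 * x ^ 3) / 6 + 5 * x ^ 4 / 11)
      = x ^ 4 * (x * (47 / 44 + x * 4 / 11) - 59 / 132)" by (simp add: field_simps power2_eq_square power3_eq_cube power4_eq_xxxx)
    moreover have "x * (47 / 44 + x * 4 / 11) \<le> 1 / 4 * (47 / 44 + 1 / 11)"
      using x k by (intro mult_mono) auto
    then have "x ^ 4 * (x * (47 / 44 + x * 4 / 11) - 59 / 132) \<le> 0" by (intro mult_nonneg_nonpos) auto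
    ultimately show "(x - x\<^sup>2 * ((2 + 2 * x + x\<^sup>2) / 12 + x ^ 3 / 11)) * (1 + x) \<le> (3 - 2 * x - x\<^sup>2) * ((2 * x + 3 * x ^ 2 + 2 * x ^ 3) / 6 + 5 * x ^ 4 / 11)"
      by linarith
  qed (use k in auto)
qed

text \<open>Both sides contain the factor (1 - x)^(-1/2). After squaring it cancels, and a
  polynomial inequality in x and Q is left.\<close>

lemma sqrt_compare_deriv:
  fixes x Q :: real
  assumes x: "0 \<le> x" "x < 1" and Q: "0 \<le> Q"
  shows "Q\<^sup>2 * (3 + x) \<le> 3 * (1 + x) \<Longrightarrow> sqrt 3 * (Q / sqrt (1 - x\<^sup>2)) \<le> 3 / Dpar x"
    and "3 * (1 + x) \<le> Q\<^sup>2 * (3 + x) \<Longrightarrow> 3 / Dpar x \<le> sqrt 3 * (Q / sqrt (1 - x\<^sup>2))"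
proof -
  have f: "1 - x\<^sup>2 = (1 - x) * (1 + x)" by (simp add: power2_eq_square algebra_simps)
  have pos: "1 - x > 0" "3 + x > 0" "1 + x > 0" using x by auto
  have l: "sqrt 3 * (Q / sqrt (1 - x\<^sup>2)) = sqrt (3 * (Q\<^sup>2 / ((1 - x) * (1 + x))))"
    unfolding f using Q by (simp add: real_sqrt_mult real_sqrt_divide)
  have r: "3 / Dpar x = sqrt (9 / ((3 + x) * (1 - x)))" 
  proof -
    have "sqrt 9 = (3::real)" by (rule real_sqrt_unique) auto
    then show ?thesis unfolding Dpar_def by (simp add: real_sqrt_divide)
  qed
  have e: "3 * (Q\<^sup>2 / ((1 - x) * (1 + x))) = 3 / (1 - x) * (Q\<^sup>2 / (1 + x))" "9 / ((3 + x) * (1 - x)) = 3 / (1 - x) * (3 / (3 + x))"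
    by simp_all
  show "sqrt 3 * (Q / sqrt (1 - x\<^sup>2)) \<le> 3 / Dpar x" if "Q\<^sup>2 * (3 + x) \<le> 3 * (1 + x)"
    unfolding l r real_sqrt_le_iff e by (rule mult_left_mono) (use that pos in \<open>simp_all add: field_simps\<close>)
  show "3 / Dpar x \<le> sqrt 3 * (Q / sqrt (1 - x\<^sup>2))" if "3 * (1 + x) \<le> Q\<^sup>2 * (3 + x)"
    unfolding l r real_sqrt_le_iff e by (rule mult_left_mono) (use that pos in \<open>simp_all add: field_simps\<close>)
qed

lemma DERIV_sqrt_poly:
  assumes x: "0 \<le> x" "x < 1" and P: "(P has_real_derivative P') (at x)"
  shows "((\<lambda>x. sqrt 3 * (x * sqrt (1 - x\<^sup>2) * P x)) has_real_derivative
    sqrt 3 * (((1 - x\<^sup>2) * (P x + x * P') - x\<^sup>2 * P x) / sqrt (1 - x\<^sup>2))) (at x)"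
proof -
  have x2: "1 - x\<^sup>2 > 0" using x by (simp add: abs_square_less_1)
  define r where "r = sqrt (1 - x\<^sup>2)"
  have r: "r > 0" "r\<^sup>2 = 1 - x\<^sup>2" using x2 by (simp_all add: r_def)
  have s: "((\<lambda>x. sqrt (1 - x\<^sup>2)) has_real_derivative - x / r) (at x)"
    using x2 by (auto intro!: derivative_eq_intros simp: r_def field_simps)
  have "((\<lambda>x. sqrt 3 * (x * sqrt (1 - x\<^sup>2) * P x)) has_real_derivative
    sqrt 3 * ((1 * r + - x / r * x) * P x + P' * (x * r))) (at x)"
    using DERIV_cmult[OF DERIV_mult[OF DERIV_mult[OF DERIV_ident s] P], of "sqrt 3"] by (simp add: r_def)
  also have "(1 * r + - x / r * x) * P x + P' * (x * r) = (r\<^sup>2 * (P x + x * P') - x\<^sup>2 * P x) / r"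
    using r(1) by (simp add: field_simps power2_eq_square)
  finally show ?thesis unfolding r(2) by (simp add: r_def)
qed

text \<open>The comparison function sqrt 3 k sqrt (1 - k^2) P(k) is chosen because
  \<open>Jpar\<close> has derivative 2 A / (k sqrt (1 - k^2)): a bound of this form for A is a
  polynomial bound for that derivative. Q is the polynomial for which the comparison function has
  derivative sqrt 3 Q / sqrt (1 - x^2).\<close>

lemma Apar_poly_bounds:
  assumes k: "0 \<le> k" "k < 1"
    and P: "\<And>x. 0 \<le> x \<Longrightarrow> x \<le> k \<Longrightarrow> (P has_real_derivative P' x) (at x)"
    and Q: "\<And>x. 0 \<le> x \<Longrightarrow> x \<le> k \<Longrightarrow> Q x = (1 - x\<^sup>2) * (P x + x * P' x) - x\<^sup>2 * P x \<and> 0 \<le> Q x"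
  shows "(\<And>x. 0 \<le> x \<Longrightarrow> x \<le> k \<Longrightarrow> (Q x)\<^sup>2 * (3 + x) \<le> 3 * (1 + x)) \<Longrightarrow> sqrt 3 * (k * sqrt (1 - k\<^sup>2) * P k) \<le> Apar k"
    and "(\<And>x. 0 \<le> x \<Longrightarrow> x \<le> k \<Longrightarrow> 3 * (1 + x) \<le> (Q x)\<^sup>2 * (3 + x)) \<Longrightarrow> Apar k \<le> sqrt 3 * (k * sqrt (1 - k\<^sup>2) * P k)"
proof -
  define q where "q x = Apar x - sqrt 3 * (x * sqrt (1 - x\<^sup>2) * P x)" for x
  have D: "(q has_real_derivative 3 / Dpar x - sqrt 3 * (Q x / sqrt (1 - x\<^sup>2))) (at x)" if "0 \<le> x" "x \<le> k" for x
    unfolding q_def[abs_def] conjunct1[OF Q[OF that]] by (intro DERIV_diff DERIV_Apar DERIV_sqrt_poly P) (use that k in auto)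
  have q0: "q 0 = 0" by (simp add: q_def Apar_0)
  show "sqrt 3 * (k * sqrt (1 - k\<^sup>2) * P k) \<le> Apar k" if c: "\<And>x. 0 \<le> x \<Longrightarrow> x \<le> k \<Longrightarrow> (Q x)\<^sup>2 * (3 + x) \<le> 3 * (1 + x)"
  proof -
    have "q 0 \<le> q k"
    proof (rule DERIV_nonneg_imp_nondecreasing[OF k(1)])
      show "\<exists>y. (q has_real_derivative y) (at x) \<and> 0 \<le> y" if "0 \<le> x" "x \<le> k" for x
        by (intro exI conjI, rule D[OF that]) (use sqrt_compare_deriv(1)[of x "Q x"] c[OF that] conjunct2[OF Q[OF that]] that k in linarith)
    qed
    then show ?thesis unfolding q0 by (simp add: q_def)
  qed
  show "Apar k \<le> sqrt 3 * (k * sqrt (1 - k\<^sup>2) * P k)" if c: "\<And>x. 0 \<le> x \<Longrightarrow> x \<le> k \<Longrightarrow> 3 * (1 + x) \<le> (Q x)\<^sup>2 * (3 + x)"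
  proof -
    have "q k \<le> q 0"
    proof (rule DERIV_nonpos_imp_nonincreasing[OF k(1)])
      show "\<exists>y. (q has_real_derivative y) (at x) \<and> y \<le> 0" if "0 \<le> x" "x \<le> k" for x
        by (intro exI conjI, rule D[OF that]) (use sqrt_compare_deriv(2)[of x "Q x"] c[OF that] conjunct2[OF Q[OF that]] that k in linarith)
    qed
    then show ?thesis unfolding q0 by (simp add: q_def)
  qed
qed

text \<open>The coefficients 1, 1/6, 11/18, 4/27 are those of the Taylor expansion, so in both
  comparisons the difference of the squares starts with x^4. Its leading coefficient is negative for
  the lower bound, and the extra 11/20 k^4 makes it positive for the upper bound, with enough room
  up to k = 1 / 10.\<close>

lemma Apar_bounds:
  assumes k: "0 \<le> k" "k \<le> 1 / 10"
  shows "sqrt 3 * (k * sqrt (1 - k\<^sup>2) * (1 + k / 6 + 11 / 18 * k ^ 2 + 4 / 27 * k ^ 3)) \<le> Apar k"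
    and "Apar k \<le> sqrt 3 * (k * sqrt (1 - k\<^sup>2) * (1 + k / 6 + 11 / 18 * k ^ 2 + 4 / 27 * k ^ 3 + 11 / 20 * k ^ 4))"
proof -
  show "sqrt 3 * (k * sqrt (1 - k\<^sup>2) * (1 + k / 6 + 11 / 18 * k ^ 2 + 4 / 27 * k ^ 3)) \<le> Apar k"
  proof (rule Apar_poly_bounds(1)[where P' = "\<lambda>x. 1 / 6 + 11 / 9 * x + 4 / 9 * x ^ 2"
      and Q = "\<lambda>x. 1 + x / 3 - x ^ 2 / 6 + 5 / 54 * x ^ 3 - 22 / 9 * x ^ 4 - 20 / 27 * x ^ 5"])
    fix x assume x: "0 \<le> x" "x \<le> k"
    show "((\<lambda>x. 1 + x / 6 + 11 / 18 * x ^ 2 + 4 / 27 * x ^ 3) has_real_derivative 1 / 6 + 11 / 9 * x + 4 / 9 * x ^ 2) (at x)"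
      by (auto intro!: derivative_eq_intros)
    have b: "x ^ n \<le> 1 / 10 ^ n" for n
      using power_mono[of x "1 / 10" n] x k by (simp add: power_one_over)
    have b: "x ^ 2 \<le> 1 / 100" "x ^ 4 \<le> 1 / 10000" "x ^ 5 \<le> 1 / 100000" "x ^ 6 \<le> 1 / 1000000" "x ^ 7 \<le> 1 / 10000000"
      using b[of 2] b[of 4] b[of 5] b[of 6] b[of 7] by simp_all
    have c: "0 \<le> x ^ n" for n using x by simp
    have c: "0 \<le> x ^ 2" "0 \<le> x ^ 3" by (rule c)+
    have "0 \<le> 1 + x / 3 - x ^ 2 / 6 + 5 / 54 * x ^ 3 - 22 / 9 * x ^ 4 - 20 / 27 * x ^ 5"
      using b c x k by linarith
    then show "1 + x / 3 - x\<^sup>2 / 6 + 5 / 54 * x ^ 3 - 22 / 9 * x ^ 4 - 20 / 27 * x ^ 5 =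
         (1 - x\<^sup>2) * (1 + x / 6 + 11 / 18 * x\<^sup>2 + 4 / 27 * x ^ 3 + x * (1 / 6 + 11 / 9 * x + 4 / 9 * x\<^sup>2)) -
         x\<^sup>2 * (1 + x / 6 + 11 / 18 * x\<^sup>2 + 4 / 27 * x ^ 3) \<and>
         0 \<le> 1 + x / 3 - x\<^sup>2 / 6 + 5 / 54 * x ^ 3 - 22 / 9 * x ^ 4 - 20 / 27 * x ^ 5"
      by (simp add: field_simps power_numeral_reduce)
    have "(1 + x / 3 - x ^ 2 / 6 + 5 / 54 * x ^ 3 - 22 / 9 * x ^ 4 - 20 / 27 * x ^ 5)\<^sup>2 * (3 + x) - 3 * (1 + x)
      = x ^ 4 * (- 1547 / 108 - 4609 / 324 * x - 2093 / 972 * x ^ 2 - 839 / 2916 * x ^ 3 + 1402 / 81 * x ^ 4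
         + 12176 / 729 * x ^ 5 + 1280 / 243 * x ^ 6 + 400 / 729 * x ^ 7)"
      by (simp add: field_simps power_numeral_reduce)
    moreover have "\<dots> \<le> 0" by (rule mult_nonneg_nonpos) (use b c x k in \<open>simp, linarith\<close>)
    ultimately show "(1 + x / 3 - x\<^sup>2 / 6 + 5 / 54 * x ^ 3 - 22 / 9 * x ^ 4 - 20 / 27 * x ^ 5)\<^sup>2 * (3 + x) \<le> 3 * (1 + x)" by linarith
  qed (use k in auto)
  show "Apar k \<le> sqrt 3 * (k * sqrt (1 - k\<^sup>2) * (1 + k / 6 + 11 / 18 * k ^ 2 + 4 / 27 * k ^ 3 + 11 / 20 * k ^ 4))"
  proof (rule Apar_poly_bounds(2)[where P' = "\<lambda>x. 1 / 6 + 11 / 9 * x + 4 / 9 * x ^ 2 + 11 / 5 * x ^ 3"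
      and Q = "\<lambda>x. 1 + x / 3 - x ^ 2 / 6 + 5 / 54 * x ^ 3 + 11 / 36 * x ^ 4 - 20 / 27 * x ^ 5 - 33 / 10 * x ^ 6"])
    fix x assume x: "0 \<le> x" "x \<le> k"
    show "((\<lambda>x. 1 + x / 6 + 11 / 18 * x ^ 2 + 4 / 27 * x ^ 3 + 11 / 20 * x ^ 4) has_real_derivative 1 / 6 + 11 / 9 * x + 4 / 9 * x ^ 2 + 11 / 5 * x ^ 3) (at x)"
      by (auto intro!: derivative_eq_intros)
    have b: "x ^ n \<le> 1 / 10 ^ n" for n
      using power_mono[of x "1 / 10" n] x k by (simp add: power_one_over)
    have b: "x ^ 2 \<le> 1 / 100" "x ^ 3 \<le> 1 / 1000" "x ^ 5 \<le> 1 / 100000" "x ^ 6 \<le> 1 / 1000000"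
      using b[of 2] b[of 3] b[of 5] b[of 6] by simp_all
    have c: "0 \<le> x ^ n" for n using x by simp
    have c: "0 \<le> x ^ 3" "0 \<le> x ^ 4" "0 \<le> x ^ 7" "0 \<le> x ^ 8" "0 \<le> x ^ 9" by (rule c)+
    have "0 \<le> 1 + x / 3 - x ^ 2 / 6 + 5 / 54 * x ^ 3 + 11 / 36 * x ^ 4 - 20 / 27 * x ^ 5 - 33 / 10 * x ^ 6"
      using b c x k by linarith
    then show "1 + x / 3 - x\<^sup>2 / 6 + 5 / 54 * x ^ 3 + 11 / 36 * x ^ 4 - 20 / 27 * x ^ 5 - 33 / 10 * x ^ 6 =
         (1 - x\<^sup>2) * (1 + x / 6 + 11 / 18 * x\<^sup>2 + 4 / 27 * x ^ 3 + 11 / 20 * x ^ 4 + x * (1 / 6 + 11 / 9 * x + 4 / 9 * x\<^sup>2 + 11 / 5 * x ^ 3)) -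
         x\<^sup>2 * (1 + x / 6 + 11 / 18 * x\<^sup>2 + 4 / 27 * x ^ 3 + 11 / 20 * x ^ 4) \<and>
         0 \<le> 1 + x / 3 - x\<^sup>2 / 6 + 5 / 54 * x ^ 3 + 11 / 36 * x ^ 4 - 20 / 27 * x ^ 5 - 33 / 10 * x ^ 6"
      by (simp add: field_simps power_numeral_reduce)
    have "(1 + x / 3 - x ^ 2 / 6 + 5 / 54 * x ^ 3 + 11 / 36 * x ^ 4 - 20 / 27 * x ^ 5 - 33 / 10 * x ^ 6)\<^sup>2 * (3 + x) - 3 * (1 + x)
      = x ^ 4 * (235 / 108 - 1045 / 324 * x - 27787 / 1215 * x ^ 2 - 187741 / 14580 * x ^ 3 + 8243 / 6480 * x ^ 4
         - 124523 / 58320 * x ^ 5 - 26573 / 4860 * x ^ 6 + 192437 / 14580 * x ^ 7 + 33803 / 900 * x ^ 8 + 1089 / 100 * x ^ 9)"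
      by (simp add: field_simps power_numeral_reduce)
    moreover have "\<dots> \<ge> 0" by (rule mult_nonneg_nonneg) (use b c x k in \<open>simp, linarith\<close>)
    ultimately show "3 * (1 + x) \<le> (1 + x / 3 - x\<^sup>2 / 6 + 5 / 54 * x ^ 3 + 11 / 36 * x ^ 4 - 20 / 27 * x ^ 5 - 33 / 10 * x ^ 6)\<^sup>2 * (3 + x)" by linarith
  qed (use k in auto)
qed

lemma scaled_le_divide:
  fixes y P A s :: real
  assumes "0 < y"
  shows "s * (y * P) \<le> A \<Longrightarrow> 2 * (s * P) \<le> 2 * A / y" "A \<le> s * (y * P) \<Longrightarrow> 2 * A / y \<le> 2 * (s * P)"
  using assms by (simp_all add: pos_le_divide_eq pos_divide_le_eq mult_ac)

text \<open>Termwise integration of \<open>Apar_bounds\<close> from 0, where \<open>Jpar\<close> is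
  continuous but has no usable derivative formula; hence monotonicity is used with derivatives in
  the open interval only.\<close>

lemma Jpar_bounds:
  assumes k: "0 \<le> k" "k \<le> 1 / 10"
  shows "Jpar 0 + 2 * sqrt 3 * (k + k ^ 2 / 12 + 11 / 54 * k ^ 3 + k ^ 4 / 27) \<le> Jpar k"
    and "Jpar k \<le> Jpar 0 + 2 * sqrt 3 * (k + k ^ 2 / 12 + 11 / 54 * k ^ 3 + k ^ 4 / 27 + 11 / 100 * k ^ 5)"
proof -
  have cJ: "continuous_on {0..k} Jpar"
  proof (rule continuous_at_imp_continuous_on, rule ballI)
    show "isCont Jpar x" if "x \<in> {0..k}" for x
      using isCont_Jpar_0 DERIV_isCont[OF DERIV_Jpar[of x]] that k by (cases "x = 0") auto
  qed
  have J': "(Jpar has_real_derivative 2 * Apar x / (x * sqrt (1 - x\<^sup>2))) (at x)" "x * sqrt (1 - x\<^sup>2) > 0" if "0 < x" "x < k" for x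
    using DERIV_Jpar[of x] that k by (simp_all add: abs_square_less_1)
  have "Jpar 0 - 2 * sqrt 3 * (0 + 0 ^ 2 / 12 + 11 / 54 * 0 ^ 3 + 0 ^ 4 / 27) \<le> Jpar k - 2 * sqrt 3 * (k + k ^ 2 / 12 + 11 / 54 * k ^ 3 + k ^ 4 / 27)"
  proof (rule DERIV_nonneg_imp_increasing_open[OF k(1)])
    fix x assume x: "0 < x" "x < k"
    have a: "2 * (sqrt 3 * (1 + x / 6 + 11 / 18 * x ^ 2 + 4 / 27 * x ^ 3)) \<le> 2 * Apar x / (x * sqrt (1 - x\<^sup>2))"
      using x k by (intro scaled_le_divide(1) J'(2) Apar_bounds(1)) auto
    have p: "((\<lambda>x. x + x ^ 2 / 12 + 11 / 54 * x ^ 3 + x ^ 4 / 27) has_real_derivative 1 + x / 6 + 11 / 18 * x ^ 2 + 4 / 27 * x ^ 3) (at x)"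
      by (auto intro!: derivative_eq_intros)
    have "((\<lambda>x. Jpar x - 2 * sqrt 3 * (x + x ^ 2 / 12 + 11 / 54 * x ^ 3 + x ^ 4 / 27)) has_real_derivative
      2 * Apar x / (x * sqrt (1 - x\<^sup>2)) - 2 * (sqrt 3 * (1 + x / 6 + 11 / 18 * x ^ 2 + 4 / 27 * x ^ 3))) (at x)"
      using DERIV_diff[OF J'(1)[OF x] DERIV_cmult[OF p, of "2 * sqrt 3"]] by (simp only: mult.assoc)
    then show "\<exists>y. ((\<lambda>x. Jpar x - 2 * sqrt 3 * (x + x ^ 2 / 12 + 11 / 54 * x ^ 3 + x ^ 4 / 27)) has_real_derivative y) (at x) \<and> 0 \<le> y"
      using a by (intro exI conjI) auto
  qed (intro continuous_intros cJ; simp)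
  then show "Jpar 0 + 2 * sqrt 3 * (k + k ^ 2 / 12 + 11 / 54 * k ^ 3 + k ^ 4 / 27) \<le> Jpar k" by simp
  have "2 * sqrt 3 * (0 + 0 ^ 2 / 12 + 11 / 54 * 0 ^ 3 + 0 ^ 4 / 27 + 11 / 100 * 0 ^ 5) - Jpar 0 \<le> 2 * sqrt 3 * (k + k ^ 2 / 12 + 11 / 54 * k ^ 3 + k ^ 4 / 27 + 11 / 100 * k ^ 5) - Jpar k"
  proof (rule DERIV_nonneg_imp_increasing_open[OF k(1)])
    fix x assume x: "0 < x" "x < k"
    have a: "2 * Apar x / (x * sqrt (1 - x\<^sup>2)) \<le> 2 * (sqrt 3 * (1 + x / 6 + 11 / 18 * x ^ 2 + 4 / 27 * x ^ 3 + 11 / 20 * x ^ 4))"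
      using x k by (intro scaled_le_divide(2) J'(2) Apar_bounds(2)) auto
    have p: "((\<lambda>x. x + x ^ 2 / 12 + 11 / 54 * x ^ 3 + x ^ 4 / 27 + 11 / 100 * x ^ 5) has_real_derivative 1 + x / 6 + 11 / 18 * x ^ 2 + 4 / 27 * x ^ 3 + 11 / 20 * x ^ 4) (at x)"
      by (auto intro!: derivative_eq_intros)
    have "((\<lambda>x. 2 * sqrt 3 * (x + x ^ 2 / 12 + 11 / 54 * x ^ 3 + x ^ 4 / 27 + 11 / 100 * x ^ 5) - Jpar x) has_real_derivative
      2 * (sqrt 3 * (1 + x / 6 + 11 / 18 * x ^ 2 + 4 / 27 * x ^ 3 + 11 / 20 * x ^ 4)) - 2 * Apar x / (x * sqrt (1 - x\<^sup>2))) (at x)"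
      using DERIV_diff[OF DERIV_cmult[OF p, of "2 * sqrt 3"] J'(1)[OF x]] by (simp only: mult.assoc)
    then show "\<exists>y. ((\<lambda>x. 2 * sqrt 3 * (x + x ^ 2 / 12 + 11 / 54 * x ^ 3 + x ^ 4 / 27 + 11 / 100 * x ^ 5) - Jpar x) has_real_derivative y) (at x) \<and> 0 \<le> y"
      using a by (intro exI conjI) auto
  qed (intro continuous_intros cJ; simp)
  then show "Jpar k \<le> Jpar 0 + 2 * sqrt 3 * (k + k ^ 2 / 12 + 11 / 54 * k ^ 3 + k ^ 4 / 27 + 11 / 100 * k ^ 5)" by simp
qed

section \<open>Numerical value of the volume of the ideal cube\<close>

text \<open>The power series coefficients of - ln (1 - y) / (1 + y); the recursion expresses
  multiplication by 1 + y. They alternate in sign, and their absolute values tend to ln 2.\<close>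

fun ecoef :: "nat \<Rightarrow> real" where
  "ecoef 0 = 0"
| "ecoef (Suc n) = 1 / (1 + real n) - ecoef n"

lemma ecoef_sum: "(1 + y) * (\<Sum>n\<le>m. ecoef n * y ^ n) = (\<Sum>n<m. y ^ Suc n / (1 + real n)) + ecoef m * y ^ Suc m"
  by (induction m) (simp_all add: algebra_simps add_divide_distrib)

lemma DERIV_log_partial:
  fixes y :: real
  assumes "y < 1"
  shows "((\<lambda>y. - ln (1 - y) - ((\<Sum>n<m. y ^ Suc n / (1 + real n)) + c * y ^ Suc m)) has_real_derivative
    y ^ m * (1 / (1 - y) - (1 + real m) * c)) (at y)"
proof -
  have a: "((\<lambda>y. \<Sum>n<m. y ^ Suc n / (1 + real n)) has_real_derivative (\<Sum>n<m. y ^ n)) (at y)"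
  proof (rule DERIV_sum)
    show "((\<lambda>y. y ^ Suc n / (1 + real n)) has_real_derivative y ^ n) (at y)" for n
      using DERIV_cdivide[OF DERIV_pow[of "Suc n" y], of "1 + real n"] by (simp add: add.commute)
  qed
  have b: "((\<lambda>y. c * y ^ Suc m) has_real_derivative c * ((1 + real m) * y ^ m)) (at y)"
    using DERIV_cmult[OF DERIV_pow[of "Suc m" y], of c] by (simp add: add.commute)
  have l: "((\<lambda>y. - ln (1 - y)) has_real_derivative 1 / (1 - y)) (at y)"
    using assms by (auto intro!: derivative_eq_intros)
  have g: "(\<Sum>n<m. y ^ n) = 1 / (1 - y) - y ^ m / (1 - y)"
    using assms by (simp add: sum_gp_strict diff_divide_distrib)
  have "((\<lambda>y. - ln (1 - y) - ((\<Sum>n<m. y ^ Suc n / (1 + real n)) + c * y ^ Suc m)) has_real_derivative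
    1 / (1 - y) - ((\<Sum>n<m. y ^ n) + c * ((1 + real m) * y ^ m))) (at y)"
    by (intro DERIV_diff DERIV_add a b l)
  then show ?thesis unfolding g by (simp add: algebra_simps)
qed

text \<open>After multiplication by 1 + y, the difference to the partial sum has derivative y^m (1 /
  (1 - y) - (1 + m) e_m). On [0, 1/3] the fraction lies between 1 and 3/2, so the two conditions on
  the last coefficient fix the sign.\<close>

lemma log_quotient_bounds:
  fixes y :: real
  assumes y: "0 \<le> y" "y \<le> 1 / 3"
  shows "(1 + real m) * ecoef m \<le> 1 \<Longrightarrow> (\<Sum>n\<le>m. ecoef n * y ^ n) \<le> - ln (1 - y) / (1 + y)"
    and "3 / 2 \<le> (1 + real m) * ecoef m \<Longrightarrow> - ln (1 - y) / (1 + y) \<le> (\<Sum>n\<le>m. ecoef n * y ^ n)"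
proof -
  define h where "h y = - ln (1 - y) - ((\<Sum>n<m. y ^ Suc n / (1 + real n)) + ecoef m * y ^ Suc m)" for y :: real
  have h0: "h 0 = 0" by (simp add: h_def)
  have D: "(h has_real_derivative x ^ m * (1 / (1 - x) - (1 + real m) * ecoef m)) (at x)" if "x \<le> y" for x
    unfolding h_def[abs_def] by (rule DERIV_log_partial) (use that y in simp)
  have hy: "h y = (1 + y) * (- ln (1 - y) / (1 + y) - (\<Sum>n\<le>m. ecoef n * y ^ n))"
    unfolding h_def ecoef_sum[symmetric] using y by (simp add: right_diff_distrib)
  show "(\<Sum>n\<le>m. ecoef n * y ^ n) \<le> - ln (1 - y) / (1 + y)" if c: "(1 + real m) * ecoef m \<le> 1"
  proof -
    have "h 0 \<le> h y"
    proof (rule DERIV_nonneg_imp_nondecreasing[OF y(1)])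
      fix x assume x: "0 \<le> x" "x \<le> y"
      have u: "1 \<le> 1 / (1 - x)" using x y by simp
      show "\<exists>z. (h has_real_derivative z) (at x) \<and> 0 \<le> z"
        by (intro exI conjI, rule D[OF x(2)], rule mult_nonneg_nonneg) (use c u x(1) in auto)
    qed
    then show ?thesis unfolding h0 hy using y by (simp add: zero_le_mult_iff)
  qed
  show "- ln (1 - y) / (1 + y) \<le> (\<Sum>n\<le>m. ecoef n * y ^ n)" if c: "3 / 2 \<le> (1 + real m) * ecoef m"
  proof -
    have "h y \<le> h 0"
    proof (rule DERIV_nonpos_imp_nonincreasing[OF y(1)])
      fix x assume x: "0 \<le> x" "x \<le> y"
      have u: "1 / (1 - x) \<le> 3 / 2" using x y by (simp add: divide_le_eq)
      show "\<exists>z. (h has_real_derivative z) (at x) \<and> z \<le> 0"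
        by (intro exI conjI, rule D[OF x(2)], rule mult_nonneg_nonpos) (use c u x(1) in auto)
    qed
    then show ?thesis unfolding h0 hy using y by (simp add: mult_le_0_iff)
  qed
qed

lemma has_integral_even_poly:
  "((\<lambda>u. \<Sum>n\<le>m. c n * (u\<^sup>2) ^ n) has_integral b3 * (\<Sum>n\<le>m. c n / ((2 * real n + 1) * 3 ^ n))) {0..b3}"
proof -
  have "((\<lambda>u. c n * (u\<^sup>2) ^ n) has_integral c n * (b3 * (1 / ((2 * real n + 1) * 3 ^ n)))) {0..b3}" for n
  proof (rule has_integral_mult_right)
    have "((\<lambda>u. u ^ (2 * n)) has_integral (b3 ^ Suc (2 * n) / Suc (2 * n) - 0 ^ Suc (2 * n) / Suc (2 * n))) {0..b3}"
    proof (rule fundamental_theorem_of_calculus)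
      show "((\<lambda>u. u ^ Suc (2 * n) / Suc (2 * n)) has_vector_derivative u ^ (2 * n)) (at u within {0..b3})" for u
        using DERIV_cdivide[OF DERIV_pow[of "Suc (2 * n)" u], of "real (Suc (2 * n))"]
        by (auto simp: has_real_derivative_iff_has_vector_derivative[symmetric] simp del: power_Suc of_nat_Suc intro: DERIV_subset)
    qed (use b3 in simp)
    moreover have "b3\<^sup>2 = 1 / 3" by (simp add: b3_def power_divide)
    note b = this
    have "b3 ^ Suc (2 * n) / Suc (2 * n) = b3 * (1 / ((2 * real n + 1) * 3 ^ n))"
      unfolding power_Suc power_mult b by (simp add: power_one_over add.commute)
    ultimately show "((\<lambda>u. (u\<^sup>2) ^ n) has_integral b3 * (1 / ((2 * real n + 1) * 3 ^ n))) {0..b3}"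
      by (simp add: power_mult)
  qed
  then have "((\<lambda>u. \<Sum>n\<le>m. c n * (u\<^sup>2) ^ n) has_integral (\<Sum>n\<le>m. c n * (b3 * (1 / ((2 * real n + 1) * 3 ^ n))))) {0..b3}"
    by (intro has_integral_sum) auto
  moreover have "c n * (b3 * (1 / d)) = b3 * (c n / d)" for n and d :: real by simp
  ultimately show ?thesis unfolding sum_distrib_left by (simp add: mult.commute[of b3])
qed

lemma Econst_bounds:
  shows "(1 + real m) * ecoef m \<le> 1 \<Longrightarrow> b3 * (\<Sum>n\<le>m. ecoef n / ((2 * real n + 1) * 3 ^ n)) \<le> Econst"
    and "3 / 2 \<le> (1 + real m) * ecoef m \<Longrightarrow> Econst \<le> b3 * (\<Sum>n\<le>m. ecoef n / ((2 * real n + 1) * 3 ^ n))"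
proof -
  have o: "1 + u\<^sup>2 \<noteq> 0" for u :: real using one_plus_sq_pos[of u] by simp
  have iE: "((\<lambda>u. - ln (1 - u\<^sup>2) / (1 + u\<^sup>2)) has_integral Econst) {0..b3}"
    unfolding Econst_def
    by (rule integrable_integral, rule integrable_continuous_real, intro continuous_intros ballI o) (use u2_lt_1 in force)
  note i = has_integral_even_poly[of ecoef m]
  have y: "0 \<le> u\<^sup>2" "u\<^sup>2 \<le> 1 / 3" if "u \<in> {0..b3}" for u using u_bounds[OF that] by auto
  show "b3 * (\<Sum>n\<le>m. ecoef n / ((2 * real n + 1) * 3 ^ n)) \<le> Econst" if c: "(1 + real m) * ecoef m \<le> 1"
    by (rule has_integral_le[OF i iE log_quotient_bounds(1)[OF y c]])
  show "Econst \<le> b3 * (\<Sum>n\<le>m. ecoef n / ((2 * real n + 1) * 3 ^ n))" if c: "3 / 2 \<le> (1 + real m) * ecoef m"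
    by (rule has_integral_le[OF iE i log_quotient_bounds(2)[OF y c]])
qed

lemma ln_2_bounds: "0.69314718055 \<le> ln (2::real)" "ln (2::real) \<le> 0.69314718057"
  using ln_approx_bounds[of 2 11] by (simp_all add: eval_nat_numeral)

text \<open>The partial sums with m = 10, whose last coefficient is negative, and m = 11, where 12
  times the last coefficient exceeds 3/2, enclose \<open>Econst\<close> after integration with y =
  u^2 \<le> 1/3.\<close>

lemma Jpar_0_bounds: "5.0747069 \<le> Jpar 0" "Jpar 0 \<le> 5.0747084"
proof -
  have s: "b3 \<le> 0.5773502693" "0.5773502691 \<le> b3"
    unfolding b3_def
  proof -
    have "sqrt 3 \<le> 1.7320508076" by (rule real_le_lsqrt) (simp_all add: power2_eq_square)
    moreover have "1.7320508075 \<le> sqrt 3" by (rule real_le_rsqrt) (simp_all add: power2_eq_square)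
    ultimately have "1 / sqrt 3 \<le> 1 / 1.7320508075" "1 / 1.7320508076 \<le> 1 / sqrt 3" by (intro divide_left_mono; simp)+
    moreover have "1 / 1.7320508075 \<le> (0.5773502693 :: real)" "(0.5773502691 :: real) \<le> 1 / 1.7320508076" by simp_all
    ultimately show "1 / sqrt 3 \<le> 0.5773502693" "0.5773502691 \<le> 1 / sqrt 3" by linarith+
  qed
  have "b3 * 0.103855909 \<le> b3 * (\<Sum>n\<le>10. ecoef n / ((2 * real n + 1) * 3 ^ n))"
    using s by (intro mult_left_mono) (simp_all add: eval_nat_numeral)
  also have "\<dots> \<le> Econst" by (rule Econst_bounds(1)) (simp add: eval_nat_numeral)
  finally have E1: "b3 * 0.103855909 \<le> Econst" .
  have "Econst \<le> b3 * (\<Sum>n\<le>11. ecoef n / ((2 * real n + 1) * 3 ^ n))" by (rule Econst_bounds(2)) (simp add: eval_nat_numeral)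
  also have "\<dots> \<le> b3 * 0.103856091"
    using s by (intro mult_left_mono) (simp_all add: eval_nat_numeral)
  finally have E2: "Econst \<le> b3 * 0.103856091" .
  have "2 * 3.141592653588 * 0.69314718055 \<le> 2 * pi * ln 2" 
    using pi_approx ln_2_bounds by (intro mult_mono) auto
  moreover have "2 * pi * ln 2 \<le> 2 * 3.1415926535899 * 0.69314718057"
    using pi_approx ln_2_bounds by (intro mult_mono) auto
  ultimately have l: "4.35517218 \<le> 2 * pi * ln 2" "2 * pi * ln 2 \<le> 4.35517219" by simp_all
  have e: "0.059961236 \<le> Econst" "Econst \<le> 0.059961343" using E1 E2 s by simp_all
  show "5.0747069 \<le> Jpar 0" unfolding Jpar_0 using l(1) e(1) by simp
  show "Jpar 0 \<le> 5.0747084" unfolding Jpar_0 using l(2) e(2) by simp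
qed

section \<open>Taylor bounds for k and for logarithms\<close>

lemma DERIV_nonneg_from_0:
  fixes f f' :: "real \<Rightarrow> real"
  assumes "\<And>x. (f has_real_derivative f' x) (at x)" "\<And>x. 0 \<le> x \<Longrightarrow> 0 \<le> f' x" "f 0 = 0" "0 \<le> x"
  shows "0 \<le> f x"
  using DERIV_nonneg_imp_nondecreasing[of 0 x f] assms by fastforce

text \<open>Each of the six differences has the preceding one as derivative and vanishes at 0, so
  nonnegativity passes up the chain.\<close>

lemma sin_cos_taylor:
  fixes y :: real
  assumes y: "0 \<le> y"
  shows "y - y ^ 3 / 6 \<le> sin y" "sin y \<le> y - y ^ 3 / 6 + y ^ 5 / 120"
    "1 - y ^ 2 / 2 + y ^ 4 / 24 - y ^ 6 / 720 \<le> cos y" "cos y \<le> 1 - y ^ 2 / 2 + y ^ 4 / 24"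
proof -
  have 1: "0 \<le> x - sin x" if "0 \<le> x" for x :: real
    by (rule DERIV_nonneg_from_0[of "\<lambda>x. x - sin x" "\<lambda>x. 1 - cos x"]) (use that in \<open>auto intro!: derivative_eq_intros\<close>)
  have 2: "0 \<le> cos x - (1 - x ^ 2 / 2)" if "0 \<le> x" for x :: real
    by (rule DERIV_nonneg_from_0[of "\<lambda>x. cos x - (1 - x ^ 2 / 2)" "\<lambda>x. x - sin x"]) (use that 1 in \<open>auto intro!: derivative_eq_intros\<close>)
  have 3: "0 \<le> sin x - (x - x ^ 3 / 6)" if "0 \<le> x" for x :: real
    by (rule DERIV_nonneg_from_0[of "\<lambda>x. sin x - (x - x ^ 3 / 6)" "\<lambda>x. cos x - (1 - x ^ 2 / 2)"]) (use that 2 in \<open>auto intro!: derivative_eq_intros\<close>)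
  have 4: "0 \<le> (1 - x ^ 2 / 2 + x ^ 4 / 24) - cos x" if "0 \<le> x" for x :: real
    by (rule DERIV_nonneg_from_0[of "\<lambda>x. (1 - x ^ 2 / 2 + x ^ 4 / 24) - cos x" "\<lambda>x. sin x - (x - x ^ 3 / 6)"]) (use that 3 in \<open>auto intro!: derivative_eq_intros\<close>)
  have 5: "0 \<le> (x - x ^ 3 / 6 + x ^ 5 / 120) - sin x" if "0 \<le> x" for x :: real
    by (rule DERIV_nonneg_from_0[of "\<lambda>x. (x - x ^ 3 / 6 + x ^ 5 / 120) - sin x" "\<lambda>x. (1 - x ^ 2 / 2 + x ^ 4 / 24) - cos x"]) (use that 4 in \<open>auto intro!: derivative_eq_intros\<close>)
  have 6: "0 \<le> cos x - (1 - x ^ 2 / 2 + x ^ 4 / 24 - x ^ 6 / 720)" if "0 \<le> x" for x :: real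
    by (rule DERIV_nonneg_from_0[of "\<lambda>x. cos x - (1 - x ^ 2 / 2 + x ^ 4 / 24 - x ^ 6 / 720)" "\<lambda>x. (x - x ^ 3 / 6 + x ^ 5 / 120) - sin x"]) (use that 5 in \<open>auto intro!: derivative_eq_intros\<close>)
  show "y - y ^ 3 / 6 \<le> sin y" "sin y \<le> y - y ^ 3 / 6 + y ^ 5 / 120"
    "1 - y ^ 2 / 2 + y ^ 4 / 24 - y ^ 6 / 720 \<le> cos y" "cos y \<le> 1 - y ^ 2 / 2 + y ^ 4 / 24"
    using 3[OF y] 4[OF y] 5[OF y] 6[OF y] by simp_all
qed

text \<open>With theta = pi / 3 - y the addition theorem gives k = cos y + sqrt 3 sin y - 1. Here y
  = A / 3 is small when p is near 6, which makes short Taylor polynomials accurate.\<close>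

lemma kpar_bounds_taylor:
  assumes y: "0 \<le> y" "2 * pi / p = pi / 3 - y"
  shows "(1 - y ^ 2 / 2 + y ^ 4 / 24 - y ^ 6 / 720) + sqrt 3 * (y - y ^ 3 / 6) - 1 \<le> kpar p"
    and "kpar p \<le> (1 - y ^ 2 / 2 + y ^ 4 / 24) + sqrt 3 * (y - y ^ 3 / 6 + y ^ 5 / 120) - 1"
proof -
  have "kpar p = cos y + sqrt 3 * sin y - 1"
    unfolding kpar_def y(2) by (simp add: cos_diff cos_60 sin_60 algebra_simps)
  then show "(1 - y ^ 2 / 2 + y ^ 4 / 24 - y ^ 6 / 720) + sqrt 3 * (y - y ^ 3 / 6) - 1 \<le> kpar p"
    and "kpar p \<le> (1 - y ^ 2 / 2 + y ^ 4 / 24) + sqrt 3 * (y - y ^ 3 / 6 + y ^ 5 / 120) - 1"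
    using sin_cos_taylor[OF y(1)] mult_left_mono[of _ _ "sqrt 3"] by (smt (verit) real_sqrt_ge_0_iff)+
qed

text \<open>The series ln z = 2 artanh v with six terms, in Horner form for evaluation. For z \<le>
  5/3 one has v \<le> 1/4, and the remainder, at most about 2 v^13 / 13, is below 10^-8.\<close>

lemma ln_atanh_bounds:
  fixes z v :: real
  assumes z: "1 < z" "z \<le> 5 / 3" and v: "v = (z - 1) / (z + 1)"
  shows "2 * v * (1 + v\<^sup>2 * (1 / 3 + v\<^sup>2 * (1 / 5 + v\<^sup>2 * (1 / 7 + v\<^sup>2 * (1 / 9 + v\<^sup>2 * (1 / 11)))))) \<le> ln z"
    and "ln z \<le> 2 * v * (1 + v\<^sup>2 * (1 / 3 + v\<^sup>2 * (1 / 5 + v\<^sup>2 * (1 / 7 + v\<^sup>2 * (1 / 9 + v\<^sup>2 * (1 / 11)))))) + 1 / 10 ^ 8"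
proof -
  have v0: "0 \<le> v" "v \<le> 1 / 4" using z unfolding v by (simp_all add: divide_le_eq)
  have e: "(\<Sum>k<6. 2 * v ^ (2 * k + 1) / of_nat (2 * k + 1)) = 2 * v * (1 + v\<^sup>2 * (1 / 3 + v\<^sup>2 * (1 / 5 + v\<^sup>2 * (1 / 7 + v\<^sup>2 * (1 / 9 + v\<^sup>2 * (1 / 11))))))"
    by (simp add: eval_nat_numeral algebra_simps)
  note b = ln_approx_bounds[OF z(1), of 6, folded v, unfolded e]
  show "2 * v * (1 + v\<^sup>2 * (1 / 3 + v\<^sup>2 * (1 / 5 + v\<^sup>2 * (1 / 7 + v\<^sup>2 * (1 / 9 + v\<^sup>2 * (1 / 11)))))) \<le> ln z"
    using b(1) by simp
  have p: "v ^ 13 \<le> (1 / 4) ^ 13" "v\<^sup>2 \<le> (1 / 4)\<^sup>2" using v0 by (intro power_mono; simp)+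
  then have "v ^ 13 / (1 - v\<^sup>2) \<le> (1 / 4) ^ 13 / (1 - (1 / 4)\<^sup>2)" using v0 by (intro frac_le) (simp_all add: power_divide)
  then have d: "2 * (v ^ 13 / (1 - v\<^sup>2) / 13) \<le> 2 * ((1 / 4) ^ 13 / (1 - (1 / 4)\<^sup>2) / 13)" by (intro mult_left_mono divide_right_mono) auto
  also have "\<dots> \<le> (1 / 10 ^ 8 :: real)" by (simp add: power_divide)
  finally have "2 * (v ^ 13 / (1 - v\<^sup>2) / 13) \<le> 1 / 10 ^ 8" .
  then show "ln z \<le> 2 * v * (1 + v\<^sup>2 * (1 / 3 + v\<^sup>2 * (1 / 5 + v\<^sup>2 * (1 / 7 + v\<^sup>2 * (1 / 9 + v\<^sup>2 * (1 / 11)))))) + 1 / 10 ^ 8"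
    using b(1) by simp
qed

section \<open>Monotonicity certificates\<close>

text \<open>\<open>None\<close> is the undefined enclosure: \<open>inO n x None\<close> holds for every \<open>x\<close>.\<close>
definition inO :: "nat \<Rightarrow> real \<Rightarrow> ivl option \<Rightarrow> bool" where
  "inO n x o1 \<longleftrightarrow> (\<forall>I. o1 = Some I \<longrightarrow> in_ivl n x I)"

definition oneg :: "ivl option \<Rightarrow> ivl option" where "oneg a = (case a of None \<Rightarrow> None | Some I \<Rightarrow> Some (ineg I))"
definition oadd :: "ivl option \<Rightarrow> ivl option \<Rightarrow> ivl option" where
  "oadd a b = (case a of None \<Rightarrow> None | Some I \<Rightarrow> (case b of None \<Rightarrow> None | Some J \<Rightarrow> Some (iadd I J)))"
definition omul :: "nat \<Rightarrow> ivl option \<Rightarrow> ivl option \<Rightarrow> ivl option" where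
  "omul n a b = (case a of None \<Rightarrow> None | Some I \<Rightarrow> (case b of None \<Rightarrow> None | Some J \<Rightarrow> Some (imul n I J)))"
text \<open>Takes the lower end of the first and the upper end of the second interval: it encloses
  every number lying between an element of the first and an element of the second.\<close>

definition ohull :: "ivl option \<Rightarrow> ivl option \<Rightarrow> ivl option" where
  "ohull a b = (case a of None \<Rightarrow> None | Some I \<Rightarrow> (case b of None \<Rightarrow> None | Some J \<Rightarrow> Some (fst I, snd J)))"
definition onum :: "nat \<Rightarrow> int \<Rightarrow> ivl option" where "onum n c = Some (inum n c)"
definition olit :: "int \<Rightarrow> int \<Rightarrow> ivl option" where "olit a b = Some (a, b)"
definition opos :: "ivl option \<Rightarrow> bool" where "opos a = (case a of None \<Rightarrow> False | Some I \<Rightarrow> 0 < fst I)"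

definition jet0 :: "(ivl \<times> ivl \<times> ivl) option \<Rightarrow> ivl option" where
  "jet0 j = (case j of None \<Rightarrow> None | Some (a, b, c) \<Rightarrow> Some a)"
definition jet1 :: "(ivl \<times> ivl \<times> ivl) option \<Rightarrow> ivl option" where
  "jet1 j = (case j of None \<Rightarrow> None | Some (a, b, c) \<Rightarrow> Some b)"
definition jet2 :: "(ivl \<times> ivl \<times> ivl) option \<Rightarrow> ivl option" where
  "jet2 j = (case j of None \<Rightarrow> None | Some (a, b, c) \<Rightarrow> Some c)"

lemma inO_oneg: "inO n x a \<Longrightarrow> inO n (- x) (oneg a)"
  by (cases a) (simp_all add: inO_def oneg_def in_ineg)
lemma inO_oadd: "inO n x a \<Longrightarrow> inO n y b \<Longrightarrow> inO n (x + y) (oadd a b)"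
  by (cases a; cases b) (simp_all add: inO_def oadd_def in_iadd)
lemma inO_omul: "inO n x a \<Longrightarrow> inO n y b \<Longrightarrow> inO n (x * y) (omul n a b)"
  by (cases a; cases b) (simp_all add: inO_def omul_def in_imul)
lemma inO_onum: "inO n (of_int c) (onum n c)"
  by (simp add: inO_def onum_def in_inum)
lemma inO_olit: "of_int a \<le> x * 2 ^ n \<Longrightarrow> x * 2 ^ n \<le> of_int b \<Longrightarrow> inO n x (olit a b)"
  by (simp add: inO_def olit_def in_ivl_def)
lemma inO_ohull:
  assumes "inO n x a" "inO n y b" "x \<le> z" "z \<le> y"
  shows "inO n z (ohull a b)"
proof -
  have "x * 2 ^ n \<le> z * 2 ^ n" "z * 2 ^ n \<le> y * 2 ^ n" using assms by simp_all
  note m = order_trans[OF _ this(1)] order_trans[OF this(2)]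
  show ?thesis
  proof (cases "a = None \<or> b = None")
    case False
    then obtain I J where "a = Some I" "b = Some J" by auto
    then show ?thesis using assms(1,2) unfolding inO_def ohull_def in_ivl_def by (simp add: m)
  qed (auto simp: inO_def ohull_def split: option.splits)
qed
lemma inO_jet:
  assumes "in_ivl n x X"
  shows "inO n (ev t x) (jet0 (jet n X t))" "inO n (ev1 t x) (jet1 (jet n X t))" "inO n (ev2 t x) (jet2 (jet n X t))"
  using jet_sound[OF _ assms, of t] by (auto simp: inO_def jet0_def jet1_def jet2_def split: option.splits)
lemma opos_pos: "inO n x a \<Longrightarrow> opos a \<Longrightarrow> x > 0"
proof -
  assume "inO n x a" "opos a"
  then obtain I where I: "in_ivl n x I" "0 < fst I" by (auto simp: inO_def opos_def split: option.splits)
  then have "0 < x * 2 ^ n" unfolding in_ivl_def by (smt (verit) of_int_0_less_iff)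
  then show "x > 0" by (simp add: zero_less_mult_iff)
qed
lemma jet_DERIV:
  assumes "in_ivl n x X" "jet n X t \<noteq> None"
  shows "(ev t has_real_derivative ev1 t x) (at x)" "(ev1 t has_real_derivative ev2 t x) (at x)"
proof -
  obtain a b c where "jet n X t = Some (a, b, c)" using assms(2) by (cases "jet n X t") auto
  from jet_sound[OF this assms(1)] show "(ev t has_real_derivative ev1 t x) (at x)" "(ev1 t has_real_derivative ev2 t x) (at x)" by auto
qed

definition "Sub s t = Add s (Neg t)"
definition "Div s t = Mul s (Inv t)"
lemma ev_Sub [simp]: "ev (Sub s t) x = ev s x - ev t x" by (simp add: Sub_def)
lemma ev_Div [simp]: "ev (Div s t) x = ev s x / ev t x" by (simp add: Div_def divide_inverse)

definition "t_r = Sqrt (Sub (Num 1) Var)"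
definition "t_q = Sqrt (Add (Num 1) Var)"
definition "t_m = Sqrt (Add (Num 1) (Div Var (Num 3)))"
definition "t_e = Sqrt (Add (Num 1) (Add Var (Div (Mul Var Var) (Num 3))))"
definition "t_S = Mul t_q t_m"
definition "t_z = Add (Mul (Add (Num 1) Var) t_r) t_m"
text \<open>This is k sinh (2 L - 2 t). In the form given by the addition theorem the numerator
  vanishes to second order at k = 0; multiplying by a conjugate and cancelling k^2 gives an
  expression that interval arithmetic can evaluate up to k = 0.\<close>

definition "t_T = Div (Mul t_q (Mul (Add (Num 2) Var) (Sub (Num 2) (Mul (Num 3) (Add Var (Mul Var Var))))))
   (Mul (Mul (Num 3) (Add (Num 1) (Mul t_r t_m))) t_z)"
definition "t_iv = Div (Add (Num 3) (Add Var Var)) (Add (Num 1) (Add Var t_e))"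
text \<open>This is cosh (2 w - 2 t), again rationalised: \<open>t_iv\<close> contains 1 + k + e in
  the denominator in place of (1 + k - e) / k, where e is the square root
  \<open>t_e\<close>.\<close>

definition "t_C = Sub (Mul (Div (Add (Num 3) Var) (Num 3)) (Mul t_iv t_iv)) (Num 1)"
text \<open>In the \<open>i\<close>-th configuration the hyperball volumes add up to \<open>A (t\<^sub>a\<^sub>i / k + c)\<close>, where \<open>c\<close> is a combination of
  distances with derivative \<open>- t\<^sub>b / k\<close>.\<close>
definition "t_a1 = Mul (Num 2) (Mul t_q t_r)"
definition "t_a2 = Mul (Div (Num 3) (Num 2)) (Mul t_C (Add t_S t_T))"
definition "t_a3 = Mul t_a1 (Div (Add (Num 5) (Mul (Num 4) Var))
  (Add (Add Var (Num 2)) (Mul (Num 2) (Mul (Add (Num 1) Var) t_r))))"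
definition "t_b1 = Div (Num 2) (Mul t_q t_r)"
definition "t_b2 = Sub (Div (Num 3) (Mul t_q t_r)) (Inv t_S)"

definition "t_D2 = Sub (Num 3) (Mul Var (Add (Num 2) Var))"
definition "t_H0 = Div (Add (Num 2) (Mul Var (Add (Num 2) Var))) (Num 12)"
definition "t_Q = Div (Add (Num 6) (Mul Var (Add (Num 2) (Mul Var (Add (Num 5) Var))))) (Num 12)"
definition "t_w = Sub (Num 6) (Mul Var (Add (Num 3) Var))"

text \<open>The remainder is treated as u x^2 with an unknown u between 0 and 1/11. The
  \<open>+ 1\<close> rounds the scaled 1/11 upwards.\<close>

definition enc_eta :: "nat \<Rightarrow> ivl \<Rightarrow> ivl option" where
  "enc_eta n X = omul n (olit 0 (2 ^ n div 11 + 1)) (omul n (Some X) (Some X))"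
definition enc_H :: "nat \<Rightarrow> ivl \<Rightarrow> ivl option \<Rightarrow> ivl option" where
  "enc_H n X eta = oadd (jet0 (jet n X t_H0)) (omul n (Some X) eta)"
text \<open>The derivative of H written through the remainder eta itself: D^2 H' is a polynomial in
  k minus eta times \<open>t_w\<close>. Thus H' is enclosed without any bound on the derivative of
  the remainder.\<close>

definition enc_H1 :: "nat \<Rightarrow> ivl \<Rightarrow> ivl option \<Rightarrow> ivl option" where
  "enc_H1 n X eta = omul n (oadd (jet0 (jet n X t_Q)) (oneg (omul n eta (jet0 (jet n X t_w))))) (jet0 (jet n X (Inv t_D2)))"
definition enc_g :: "nat \<Rightarrow> ivl \<Rightarrow> ivl option \<Rightarrow> ivl option" where
  "enc_g n X H = oadd (onum n 1) (oneg (omul n (Some X) H))"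
definition enc_g1 :: "nat \<Rightarrow> ivl \<Rightarrow> ivl option \<Rightarrow> ivl option \<Rightarrow> ivl option" where
  "enc_g1 n X H H1 = oneg (oadd H (omul n (Some X) H1))"
text \<open>The algebraic part of M is g (b - a') - a H, where a and b are the terms
  \<open>ta\<close> and \<open>tb\<close> and \<open>d0\<close> is b - a'. The first test says that
  this part plus \<open>e\<close> is positive, the second that its derivative is positive; the
  latter involves a'', which is why second order jets are computed.\<close>

definition mchk :: "nat \<Rightarrow> ivl option \<Rightarrow> ivl option \<Rightarrow> ivl option \<Rightarrow> ivl option \<Rightarrow> int \<Rightarrow>
    ivl option \<Rightarrow> ivl option \<Rightarrow> ivl option \<Rightarrow> ivl option \<Rightarrow> ivl option \<Rightarrow> bool" where
  "mchk n H H1 g g1 e a0 a1 a2 d0 d1 \<longleftrightarrow>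
     opos (oadd (onum n e) (oadd (omul n g d0) (oneg (omul n a0 H)))) \<and>
     opos (oadd (oadd (omul n g1 d0) (omul n g d1)) (oneg (oadd (omul n a1 H) (omul n a0 H1))))"
definition mchk_jets :: "nat \<Rightarrow> ivl option \<Rightarrow> ivl option \<Rightarrow> ivl option \<Rightarrow> ivl option \<Rightarrow> int \<Rightarrow>
    (ivl \<times> ivl \<times> ivl) option \<Rightarrow> (ivl \<times> ivl \<times> ivl) option \<Rightarrow> bool" where
  "mchk_jets n H H1 g g1 e ja jb = mchk n H H1 g g1 e (jet0 ja) (jet1 ja) (jet2 ja)
     (oadd (jet0 jb) (oneg (jet1 ja))) (oadd (jet1 jb) (oneg (jet2 ja)))"
definition mchk_g :: "nat \<Rightarrow> ivl \<Rightarrow> ivl option \<Rightarrow> ivl option \<Rightarrow> int \<Rightarrow> rterm \<Rightarrow> rterm \<Rightarrow> bool" where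
  "mchk_g n X H H1 e ta tb = mchk_jets n H H1 (enc_g n X H) (enc_g1 n X H H1) e (jet n X ta) (jet n X tb)"
definition mchk_eta :: "nat \<Rightarrow> ivl \<Rightarrow> ivl option \<Rightarrow> int \<Rightarrow> rterm \<Rightarrow> rterm \<Rightarrow> bool" where
  "mchk_eta n X eta e ta tb = mchk_g n X (enc_H n X eta) (enc_H1 n X eta) e ta tb"
definition mcheck :: "nat \<Rightarrow> int \<Rightarrow> rterm \<Rightarrow> rterm \<Rightarrow> int \<times> int \<Rightarrow> bool" where
  "mcheck n e ta tb X = mchk_eta n X (enc_eta n X) e ta tb"

lemma inO_Some: "in_ivl n x X \<Longrightarrow> inO n x (Some X)" by (simp add: inO_def)

text \<open>g, H and H' are passed as numbers given by formulas in x and eta, so the statement is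
  purely algebraic and also covers x = 0. The differentiability claims come for free, since the
  tests can only succeed if the jets are defined.\<close>

lemma mcheck_sound:
  assumes x: "in_ivl n x X" and c: "mcheck n e ta tb X"
    and eta: "0 \<le> eta" "eta \<le> x\<^sup>2 / 11"
    and H: "H = (2 + 2 * x + x\<^sup>2) / 12 + x * eta"
    and H1: "H1 = ((6 + 2 * x + 5 * x\<^sup>2 + x ^ 3) / 12 - eta * (6 - 3 * x - x\<^sup>2)) / (3 - 2 * x - x\<^sup>2)"
    and g: "g = 1 - x * H" and g1: "g1 = - (H + x * H1)"
  shows "0 < of_int e + g * (ev tb x - ev1 ta x) - ev ta x * H"
    and "0 < g1 * (ev tb x - ev1 ta x) + g * (ev1 tb x - ev2 ta x) - (ev1 ta x * H + ev ta x * H1)"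
    and "(ev ta has_real_derivative ev1 ta x) (at x)" "(ev1 ta has_real_derivative ev2 ta x) (at x)"
    and "(ev tb has_real_derivative ev1 tb x) (at x)"
proof -
  note X = inO_Some[OF x]
  \<comment> \<open>At x = 0 the bound forces eta = 0 and any u serves; this keeps the first box,
    which contains 0, within reach.\<close>
  have "\<exists>u. 0 \<le> u \<and> u \<le> 1 / 11 \<and> eta = u * (x * x)"
  proof (cases "x = 0")
    case True
    then show ?thesis using eta by (intro exI[of _ 0]) auto
  next
    case False
    then have "0 < x * x" by (metis not_real_square_gt_zero)
    then show ?thesis using eta by (intro exI[of _ "eta / (x * x)"]) (auto simp: pos_divide_le_eq power2_eq_square)
  qed
  then obtain u where u: "0 \<le> u" "u \<le> 1 / 11" "eta = u * (x * x)" by auto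
  have "inO n u (olit 0 (2 ^ n div 11 + 1))"
  proof (rule inO_olit)
    have "(2 ^ n :: int) \<le> (2 ^ n div 11 + 1) * 11" by simp
    then have p: "(2 ^ n :: real) \<le> of_int (2 ^ n div 11 + 1) * 11"
      by (metis of_int_le_iff of_int_mult of_int_numeral of_int_power)
    have "u * p \<le> q" if "p \<le> q * 11" "0 \<le> p" for p q :: real
      using mult_right_mono[OF u(2) that(2)] that(1) by linarith
    from this[OF p] show "u * 2 ^ n \<le> of_int (2 ^ n div 11 + 1)" by simp
  qed (use u in simp)
  then have E: "inO n eta (enc_eta n X)" unfolding u(3) enc_eta_def by (intro inO_omul X)
  define oH where "oH = enc_H n X (enc_eta n X)"
  define oH1 where "oH1 = enc_H1 n X (enc_eta n X)"
  have "inO n (ev t_H0 x + x * eta) oH" unfolding oH_def enc_H_def by (intro inO_oadd inO_omul X E inO_jet x)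
  moreover have "ev t_H0 x + x * eta = H" unfolding H by (simp add: t_H0_def algebra_simps power2_eq_square)
  ultimately have oH: "inO n H oH" by simp
  have "inO n ((ev t_Q x + - (eta * ev t_w x)) * ev (Inv t_D2) x) oH1"
    unfolding oH1_def enc_H1_def by (intro inO_oadd inO_omul inO_oneg E inO_jet x)
  moreover have "(ev t_Q x + - (eta * ev t_w x)) * ev (Inv t_D2) x = H1"
  proof -
    have "ev t_Q x = (6 + 2 * x + 5 * x\<^sup>2 + x ^ 3) / 12" "ev t_w x = 6 - 3 * x - x\<^sup>2" "ev (Inv t_D2) x = inverse (3 - 2 * x - x\<^sup>2)"
      by (simp_all add: t_Q_def t_w_def t_D2_def algebra_simps power2_eq_square power3_eq_cube)
    note ev = this
    have "(a + - b) * inverse d = (a - b) / d" for a b d :: real by (simp add: divide_inverse)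
    then show ?thesis unfolding ev H1 .
  qed
  ultimately have oH1: "inO n H1 oH1" by simp
  have "inO n (of_int 1 + - (x * H)) (enc_g n X oH)" unfolding enc_g_def by (intro inO_oadd inO_omul inO_oneg inO_onum X oH)
  then have og: "inO n g (enc_g n X oH)" unfolding g by simp
  have og1: "inO n g1 (enc_g1 n X oH oH1)" unfolding enc_g1_def g1 by (intro inO_oadd inO_omul inO_oneg X oH oH1)
  note a = inO_jet[OF x, of ta] and b = inO_jet[OF x, of tb]
  have d0: "inO n (ev tb x + - ev1 ta x) (oadd (jet0 (jet n X tb)) (oneg (jet1 (jet n X ta))))"
    and d1: "inO n (ev1 tb x + - ev2 ta x) (oadd (jet1 (jet n X tb)) (oneg (jet2 (jet n X ta))))"
    by (intro inO_oadd inO_oneg a b)+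
  have c': "mchk n oH oH1 (enc_g n X oH) (enc_g1 n X oH oH1) e (jet0 (jet n X ta)) (jet1 (jet n X ta)) (jet2 (jet n X ta))
      (oadd (jet0 (jet n X tb)) (oneg (jet1 (jet n X ta)))) (oadd (jet1 (jet n X tb)) (oneg (jet2 (jet n X ta))))"
    using c unfolding mcheck_def mchk_eta_def mchk_g_def mchk_jets_def oH_def oH1_def .
  note c1 = conjunct1[OF c'[unfolded mchk_def]] and c2 = conjunct2[OF c'[unfolded mchk_def]]
  have "0 < of_int e + (g * (ev tb x + - ev1 ta x) + - (ev ta x * H))"
    by (rule opos_pos[of n, OF _ c1]) (intro inO_oadd inO_omul inO_oneg inO_onum og d0 a oH)
  then show "0 < of_int e + g * (ev tb x - ev1 ta x) - ev ta x * H" by simp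
  have "0 < g1 * (ev tb x + - ev1 ta x) + g * (ev1 tb x + - ev2 ta x) + - (ev1 ta x * H + ev ta x * H1)"
    by (rule opos_pos[of n, OF _ c2]) (intro inO_oadd inO_omul inO_oneg og og1 d0 d1 a oH oH1)
  then show "0 < g1 * (ev tb x - ev1 ta x) + g * (ev1 tb x - ev2 ta x) - (ev1 ta x * H + ev ta x * H1)" by simp
  have "jet n X ta \<noteq> None" "jet n X tb \<noteq> None"
    using c2 by (auto simp: opos_def oadd_def omul_def oneg_def jet2_def jet1_def split: option.splits)
  then show "(ev ta has_real_derivative ev1 ta x) (at x)" "(ev1 ta has_real_derivative ev2 ta x) (at x)"
    "(ev tb has_real_derivative ev1 tb x) (at x)" using jet_DERIV[OF x] by auto
qed

fun box_chain :: "(ivl \<Rightarrow> bool) \<Rightarrow> int \<Rightarrow> int list \<Rightarrow> bool" where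
  "box_chain P a [] = True"
| "box_chain P a (b # bs) = (P (a, b) \<and> box_chain P b bs)"

lemma box_chain_append: "box_chain P a (xs @ ys) \<longleftrightarrow> box_chain P a xs \<and> box_chain P (last (a # xs)) ys"
  by (induction xs arbitrary: a) auto

lemma box_chain_cover:
  assumes "box_chain P a bs" "of_int a \<le> x * 2 ^ n" "x * 2 ^ n \<le> of_int (last (a # bs))" "bs \<noteq> []"
  shows "\<exists>X. P X \<and> in_ivl n x X"
  using assms
proof (induction bs arbitrary: a)
  case (Cons b bs)
  show ?case
  proof (cases "x * 2 ^ n \<le> of_int b")
    case True
    then show ?thesis using Cons.prems by (intro exI[of _ "(a, b)"]) (simp add: in_ivl_def)
  next
    case False
    then have "bs \<noteq> []" using Cons.prems by auto
    then show ?thesis using Cons.IH[of b] Cons.prems False by auto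
  qed
qed simp

section \<open>The extremal argument\<close>

lemma Lpar_pos: "0 < k \<Longrightarrow> k < 1 \<Longrightarrow> Lpar k > 0"
  using cosh_params(3) by simp

lemma Lpar_antimono: assumes "0 < x" "x \<le> y" "y < 1" shows "Lpar y \<le> Lpar x"
proof (rule DERIV_nonpos_imp_nonincreasing[OF assms(2)])
  show "\<exists>d. (Lpar has_real_derivative d) (at z) \<and> d \<le> 0" if "x \<le> z" "z \<le> y" for z
    by (intro exI conjI, rule DERIV_Lpar) (use that assms in \<open>auto simp: abs_square_le_1\<close>)
qed

lemma Jpar_ge: assumes "0 \<le> k" "k < 1" shows "Jpar 0 \<le> Jpar k"
proof (rule DERIV_nonneg_imp_increasing_open[OF assms(1)])
  fix x assume x: "0 < x" "x < k"
  show "\<exists>y. (Jpar has_real_derivative y) (at x) \<and> 0 \<le> y"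
    by (intro exI conjI, rule DERIV_Jpar) (use x assms Apar_pos[of x] in \<open>auto simp: abs_square_le_1 intro!: divide_nonneg_nonneg\<close>)
next
  show "continuous_on {0..k} Jpar"
  proof (rule continuous_at_imp_continuous_on, rule ballI)
    show "isCont Jpar x" if "x \<in> {0..k}" for x
      using isCont_Jpar_0 DERIV_isCont[OF DERIV_Jpar[of x]] that assms by (cases "x = 0") auto
  qed
qed

lemma Vpar_pos: assumes k: "0 < k" "k < 1" shows "Vpar k > 0"
proof -
  have "Jpar k > 0" using Jpar_ge[of k] k Jpar_0_bounds by simp
  moreover have "2 * Apar k * Lpar k > 0" using Apar_pos[OF k] Lpar_pos[OF k] by simp
  ultimately show ?thesis unfolding Vpar_def by (intro add_pos_pos)
qed

text \<open>The intermediate value theorem gives q with N q = R q V q. The function N - (R q) V has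
  derivative (R - R q) V', which is nonnegative before q and nonpositive after it, and vanishes at
  q; so it is at most 0 everywhere. The two signs serve only to locate q.\<close>

lemma antitone_quotient_max:
  fixes N R V V' :: "real \<Rightarrow> real"
  assumes k: "0 < k1" "k1 < k2" "k2 < K"
    and N: "\<And>x. 0 < x \<Longrightarrow> x < K \<Longrightarrow> (N has_real_derivative R x * V' x) (at x)"
    and V: "\<And>x. 0 < x \<Longrightarrow> x < K \<Longrightarrow> (V has_real_derivative V' x) (at x)"
    and V': "\<And>x. 0 < x \<Longrightarrow> x < K \<Longrightarrow> 0 \<le> V' x"
    and R: "\<And>x. 0 < x \<Longrightarrow> x < K \<Longrightarrow> isCont R x"
    and anti: "\<And>x y. 0 < x \<Longrightarrow> x \<le> y \<Longrightarrow> y < K \<Longrightarrow> R y \<le> R x"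
    and sgn: "N k1 < R k1 * V k1" "R k2 * V k2 < N k2"
  shows "\<exists>q. k1 < q \<and> q < k2 \<and> N q = R q * V q \<and> (\<forall>x. 0 < x \<and> x < K \<longrightarrow> N x \<le> R q * V x)"
proof -
  have cont: "isCont (\<lambda>x. N x - R x * V x) x" if "k1 \<le> x \<and> x \<le> k2" for x
    using that k by (intro continuous_intros DERIV_isCont[OF N] R DERIV_isCont[OF V]) auto
  have "\<exists>q\<ge>k1. q \<le> k2 \<and> N q - R q * V q = 0"
    by (rule IVT) (use sgn k cont in auto)
  then obtain q where q: "k1 \<le> q" "q \<le> k2" "N q = R q * V q" by auto
  have q': "k1 < q" "q < k2" using q sgn by (metis less_eq_real_def less_irrefl)+
  have "N x \<le> R q * V x" if x: "0 < x" "x < K" for x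
  proof -
    have D: "((\<lambda>x. N x - R q * V x) has_real_derivative (R z - R q) * V' z) (at z)" if "0 < z" "z < K" for z
      using DERIV_diff[OF N[OF that] DERIV_cmult[OF V[OF that], of "R q"]] by (simp add: left_diff_distrib)
    have "N x - R q * V x \<le> N q - R q * V q"
    proof (cases "x \<le> q")
      case True
      show ?thesis
      proof (rule DERIV_nonneg_imp_nondecreasing[OF True])
        show "\<exists>y. ((\<lambda>x. N x - R q * V x) has_real_derivative y) (at z) \<and> 0 \<le> y" if "x \<le> z" "z \<le> q" for z
          by (intro exI conjI, rule D) (use that x q q' k V'[of z] anti[of z q] in auto)
      qed
    next
      case False
      then have "q \<le> x" by simp
      then show ?thesis
      proof (rule DERIV_nonpos_imp_nonincreasing)
        show "\<exists>y. ((\<lambda>x. N x - R q * V x) has_real_derivative y) (at z) \<and> y \<le> 0" if "q \<le> z" "z \<le> x" for z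
          by (intro exI conjI, rule D)
            (use that x q q' k V'[of z] anti[of q z] in \<open>auto intro!: mult_nonpos_nonneg\<close>)
      qed
    qed
    then show ?thesis using q(3) by simp
  qed
  then show ?thesis using q(3) q' by blast
qed

text \<open>A is of order k, so this quotient tends to 1 at k = 0. It is the form in which A enters
  N', namely multiplied by D and by a factor 1 / k.\<close>

definition gfun :: "real \<Rightarrow> real" where "gfun k = Apar k * Dpar k / (3 * k)"
definition Hfun :: "real \<Rightarrow> real" where "Hfun k = (1 - gfun k) / k"
text \<open>The Taylor remainder of H divided by k. Dividing it out also makes H' expressible
  through it, with no further singularity.\<close>

definition etaf :: "real \<Rightarrow> real" where "etaf k = (Hfun k - (2 + 2 * k + k\<^sup>2) / 12) / k"

lemma etaf_bounds:
  assumes k: "0 < k" "k \<le> 1 / 4"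
  shows "0 \<le> etaf k" "etaf k \<le> k\<^sup>2 / 11"
    "Hfun k = (2 + 2 * k + k\<^sup>2) / 12 + k * etaf k" "gfun k = 1 - k * Hfun k"
proof -
  show e: "Hfun k = (2 + 2 * k + k\<^sup>2) / 12 + k * etaf k" unfolding etaf_def using k by simp
  show g: "gfun k = 1 - k * Hfun k" unfolding Hfun_def using k by simp
  have "k - Apar k * Dpar k / 3 = k * (1 - gfun k)" unfolding gfun_def using k by (simp add: right_diff_distrib)
  also have "\<dots> = k\<^sup>2 * Hfun k" unfolding Hfun_def using k by (simp add: power2_eq_square)
  finally have F: "k - Apar k * Dpar k / 3 = k\<^sup>2 * Hfun k" .
  have k2: "k\<^sup>2 > 0" using k by simp
  have b: "(2 + 2 * k + k\<^sup>2) / 12 \<le> Hfun k" "Hfun k \<le> (2 + 2 * k + k\<^sup>2) / 12 + k ^ 3 / 11"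
    using Apar_Dpar_bounds[of k] k unfolding F mult_le_cancel_left_pos[OF k2] by simp_all
  show "0 \<le> etaf k" unfolding etaf_def using b k by simp
  have "k * etaf k \<le> k * (k\<^sup>2 / 11)" using b(2) unfolding e by (simp add: power2_eq_square power3_eq_cube)
  then show "etaf k \<le> k\<^sup>2 / 11" using k by (simp add: mult_le_cancel_left_pos)
qed

text \<open>The quotient rule produces divisions by k. The identity \<open>key\<close> shows that
  the critical numerator carries a factor k once g and H are rewritten through eta, and this factor
  cancels.\<close>

lemma DERIV_gfun_Hfun:
  assumes k: "0 < k" "k \<le> 1 / 4"
  defines "H1 \<equiv> ((6 + 2 * k + 5 * k\<^sup>2 + k ^ 3) / 12 - etaf k * (6 - 3 * k - k\<^sup>2)) / (3 - 2 * k - k\<^sup>2)"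
  shows "(gfun has_real_derivative - (Hfun k + k * H1)) (at k)" "(Hfun has_real_derivative H1) (at k)"
proof -
  have k1: "0 \<le> k" "k < 1" using k by auto
  have D: "Dpar k > 0" "(Dpar k)\<^sup>2 = 3 - 2 * k - k\<^sup>2" using Dpar_pos[OF k1] Dpar_sq[OF k1] .
  then have D2: "3 - 2 * k - k\<^sup>2 > 0" by (metis zero_less_power)
  note e = etaf_bounds[OF k]
  have "((\<lambda>k. Apar k * Dpar k) has_real_derivative 3 / Dpar k * Dpar k + - (1 + k) / Dpar k * Apar k) (at k)"
    by (rule DERIV_mult[OF DERIV_Apar[OF k1] DERIV_Dpar[OF k1]])
  moreover have "((\<lambda>k. 3 * k) has_real_derivative 3) (at k)" by (auto intro!: derivative_eq_intros)
  ultimately have "((\<lambda>k. Apar k * Dpar k / (3 * k)) has_real_derivative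
    ((3 / Dpar k * Dpar k + - (1 + k) / Dpar k * Apar k) * (3 * k) - Apar k * Dpar k * 3) / (3 * k * (3 * k))) (at k)"
    by (rule DERIV_divide) (use k in simp)
  also have "((3 / Dpar k * Dpar k + - (1 + k) / Dpar k * Apar k) * (3 * k) - Apar k * Dpar k * 3) / (3 * k * (3 * k))
    = Hfun k - gfun k * (1 + k) / (Dpar k)\<^sup>2"
    unfolding Hfun_def gfun_def using D(1) k by (simp add: field_simps power2_eq_square)
  finally have g': "(gfun has_real_derivative Hfun k - gfun k * (1 + k) / (3 - 2 * k - k\<^sup>2)) (at k)"
    unfolding gfun_def[abs_def] D(2) .
  have key: "gfun k * (1 + k) - 2 * Hfun k * (3 - 2 * k - k\<^sup>2) = k * ((6 + 2 * k + 5 * k\<^sup>2 + k ^ 3) / 12 - etaf k * (6 - 3 * k - k\<^sup>2))"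
    unfolding e(4) unfolding e(3) by (simp add: field_simps power2_eq_square power3_eq_cube)
  have "k * H1 = (gfun k * (1 + k) - 2 * Hfun k * (3 - 2 * k - k\<^sup>2)) / (3 - 2 * k - k\<^sup>2)"
    unfolding key H1_def by simp
  also have "\<dots> = gfun k * (1 + k) / (3 - 2 * k - k\<^sup>2) - 2 * Hfun k" using D2 by (simp add: diff_divide_distrib)
  finally have kH1: "k * H1 = gfun k * (1 + k) / (3 - 2 * k - k\<^sup>2) - 2 * Hfun k" .
  have "Hfun k - gfun k * (1 + k) / (3 - 2 * k - k\<^sup>2) = - (Hfun k + k * H1)" unfolding kH1 by simp
  note e2 = this
  from g'[unfolded e2] show g'': "(gfun has_real_derivative - (Hfun k + k * H1)) (at k)" .
  have "((\<lambda>k. (1 - gfun k) / k) has_real_derivative ((0 - - (Hfun k + k * H1)) * k - (1 - gfun k) * 1) / (k * k)) (at k)"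
    by (rule DERIV_divide[OF DERIV_diff[OF DERIV_const g''] DERIV_ident]) (use k in simp)
  also have "((0 - - (Hfun k + k * H1)) * k - (1 - gfun k) * 1) / (k * k) = H1"
    unfolding e(4) using k by (simp add: field_simps)
  finally show "(Hfun has_real_derivative H1) (at k)" unfolding Hfun_def[abs_def] .
qed

text \<open>One optimal configuration: the volumes of the hyperball pieces add up to A (a / k + c),
  with a = \<open>ta\<close>, c' = -b / k and b = \<open>tb\<close>. The logarithms are confined to
  c. The last two assumptions treat 2 L - c: it is at least the integer \<open>e\<close>, and its
  derivative (b - 2 / sqrt (1 - k^2)) / k is nonnegative.\<close>

locale packing =
  fixes n :: nat and ta tb :: rterm and e :: int and c :: "real \<Rightarrow> real"
  assumes box: "\<And>x. 0 \<le> x \<Longrightarrow> x \<le> 247 / 1000 \<Longrightarrow> \<exists>X. mcheck n e ta tb X \<and> in_ivl n x X"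
    and DERIV_c: "\<And>x. 0 < x \<Longrightarrow> x < 247 / 1000 \<Longrightarrow> (c has_real_derivative - ev tb x / x) (at x)"
    and c_le: "\<And>x. 0 < x \<Longrightarrow> x < 247 / 1000 \<Longrightarrow> of_int e \<le> 2 * Lpar x - c x"
    and tb_ge: "\<And>x. 0 < x \<Longrightarrow> x < 247 / 1000 \<Longrightarrow> 2 / sqrt (1 - x\<^sup>2) \<le> ev tb x"
begin

definition nf :: "real \<Rightarrow> real" where "nf k = ev ta k / k + c k"
definition Nf :: "real \<Rightarrow> real" where "Nf k = Apar k * nf k"
definition n1f :: "real \<Rightarrow> real" where "n1f k = (ev1 ta k - ev ta k / k - ev tb k) / k"
text \<open>U = D N', hence U / (6 L) is the ratio of N' to the derivative of the volume.\<close>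

definition Uf :: "real \<Rightarrow> real" where "Uf k = 3 * nf k + Apar k * n1f k * Dpar k"
definition Rf :: "real \<Rightarrow> real" where "Rf k = Uf k / (6 * Lpar k)"
definition Mf :: "real \<Rightarrow> real" where
  "Mf k = (2 * Lpar k - c k) + (gfun k * (ev tb k - ev1 ta k) - ev ta k * Hfun k)"

context
  fixes k :: real
  assumes k: "0 < k" "k < 247 / 1000"
begin

text \<open>M is a sum of 2 L - c, controlled by the assumptions of the locale, and of the algebraic
  part, controlled by the box that contains k. Both are increasing, and their lower bounds add up to
  something positive.\<close>

lemma jets:
  "(ev ta has_real_derivative ev1 ta k) (at k)" "(ev1 ta has_real_derivative ev2 ta k) (at k)"
  "(ev tb has_real_derivative ev1 tb k) (at k)"
  and Mf_pos: "0 < Mf k"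
  and Mf_DERIV: "\<exists>d. (Mf has_real_derivative d) (at k) \<and> 0 \<le> d"
proof -
  have k4: "k \<le> 1 / 4" "k < 1" using k by auto
  obtain X where X: "mcheck n e ta tb X" "in_ivl n k X" using box[of k] k by auto
  define H1 where "H1 = ((6 + 2 * k + 5 * k\<^sup>2 + k ^ 3) / 12 - etaf k * (6 - 3 * k - k\<^sup>2)) / (3 - 2 * k - k\<^sup>2)"
  note eb = etaf_bounds[OF k(1) k4(1)]
  note s = mcheck_sound[OF X(2,1) eb(1,2,3) H1_def eb(4) refl]
  show j: "(ev ta has_real_derivative ev1 ta k) (at k)" "(ev1 ta has_real_derivative ev2 ta k) (at k)"
    "(ev tb has_real_derivative ev1 tb k) (at k)" using s(3,4,5) .
  show "0 < Mf k" using s(1) c_le[OF k] by (simp add: Mf_def)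
  note gH = DERIV_gfun_Hfun[OF k(1) k4(1), folded H1_def]
  have "((\<lambda>k. 2 * Lpar k - c k) has_real_derivative 2 * (- 1 / (k * sqrt (1 - k\<^sup>2))) - - ev tb k / k) (at k)"
    by (intro DERIV_diff DERIV_cmult DERIV_Lpar k(1) k4(2) DERIV_c k)
  also have "2 * (- 1 / (k * sqrt (1 - k\<^sup>2))) - - ev tb k / k = (ev tb k - 2 / sqrt (1 - k\<^sup>2)) / k"
    by (simp add: diff_divide_distrib mult.commute)
  finally have d1: "((\<lambda>k. 2 * Lpar k - c k) has_real_derivative (ev tb k - 2 / sqrt (1 - k\<^sup>2)) / k) (at k)" .
  have d2: "((\<lambda>k. gfun k * (ev tb k - ev1 ta k) - ev ta k * Hfun k) has_real_derivative
    (- (Hfun k + k * H1) * (ev tb k - ev1 ta k) + (ev1 tb k - ev2 ta k) * gfun k) - (ev1 ta k * Hfun k + H1 * ev ta k)) (at k)"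
    by (intro DERIV_diff DERIV_mult gH j)
  show "\<exists>d. (Mf has_real_derivative d) (at k) \<and> 0 \<le> d"
  proof (intro exI conjI)
    show "(Mf has_real_derivative (ev tb k - 2 / sqrt (1 - k\<^sup>2)) / k +
      ((- (Hfun k + k * H1) * (ev tb k - ev1 ta k) + (ev1 tb k - ev2 ta k) * gfun k) - (ev1 ta k * Hfun k + H1 * ev ta k))) (at k)"
      unfolding Mf_def[abs_def] by (rule DERIV_add[OF d1 d2])
    have "0 \<le> (ev tb k - 2 / sqrt (1 - k\<^sup>2)) / k" using tb_ge[OF k] k by simp
    then show "0 \<le> (ev tb k - 2 / sqrt (1 - k\<^sup>2)) / k +
      ((- (Hfun k + k * H1) * (ev tb k - ev1 ta k) + (ev1 tb k - ev2 ta k) * gfun k) - (ev1 ta k * Hfun k + H1 * ev ta k))"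
      using s(2) by (simp only: mult.commute[of "gfun k"] mult.commute[of H1])
  qed
qed

text \<open>The singular terms a / k and g a / k, coming from n and from n', combine to a H, because
  H = (1 - g) / k.\<close>

lemma Uf_eq: "Uf k = 6 * Lpar k - 3 * Mf k"
proof -
  have "Apar k * n1f k * Dpar k = 3 * (gfun k * (ev1 ta k - ev ta k / k - ev tb k))"
    unfolding n1f_def gfun_def using k by simp
  note a = this
  have "ev ta k * Hfun k = ev ta k / k - gfun k * (ev ta k / k)"
    unfolding Hfun_def using k by (simp add: diff_divide_distrib right_diff_distrib)
  note b = this
  show ?thesis unfolding Uf_def Mf_def nf_def a b by (simp add: algebra_simps)
qed

lemma Rf_eq: "Rf k = 1 - Mf k / (2 * Lpar k)"
proof -
  have "Lpar k > 0" using k by (intro Lpar_pos) auto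
  then show ?thesis unfolding Rf_def Uf_eq by (simp add: diff_divide_distrib)
qed

lemma DERIV_Nf: "(Nf has_real_derivative Rf k * (6 * Lpar k / Dpar k)) (at k)"
proof -
  have k1: "0 \<le> k" "k < 1" using k by auto
  have D: "Dpar k > 0" and L: "Lpar k > 0" using Dpar_pos[OF k1] Lpar_pos[OF k(1) k1(2)] .
  have "((\<lambda>k. ev ta k / k + c k) has_real_derivative (ev1 ta k * k - ev ta k * 1) / (k * k) + - ev tb k / k) (at k)"
    by (intro DERIV_add DERIV_divide jets DERIV_ident DERIV_c k) (use k in simp)
  also have "(ev1 ta k * k - ev ta k * 1) / (k * k) + - ev tb k / k = n1f k"
    unfolding n1f_def using k by (simp add: diff_divide_distrib)
  finally have n: "(nf has_real_derivative n1f k) (at k)" unfolding nf_def[abs_def] .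
  have "(Nf has_real_derivative 3 / Dpar k * nf k + n1f k * Apar k) (at k)"
    unfolding Nf_def[abs_def] by (rule DERIV_mult[OF DERIV_Apar[OF k1] n])
  also have "3 / Dpar k * nf k + n1f k * Apar k = Uf k / Dpar k" unfolding Uf_def using D by (simp add: field_simps)
  also have "\<dots> = Rf k * (6 * Lpar k / Dpar k)" unfolding Rf_def using L by simp
  finally show ?thesis .
qed

end

lemma isCont_Rf:
  assumes k: "0 < k" "k < 247 / 1000"
  shows "isCont Rf k"
proof -
  obtain d where d: "(Mf has_real_derivative d) (at k)" using Mf_DERIV[OF k] by auto
  have k1: "k < 1" using k by simp
  have L: "Lpar k > 0" using Lpar_pos[OF k(1) k1] .
  have C: "isCont (\<lambda>k. 1 - Mf k / (2 * Lpar k)) k"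
    using L by (intro continuous_intros DERIV_isCont[OF d] DERIV_isCont[OF DERIV_Lpar] k k1) auto
  have "\<forall>\<^sub>F x in nhds k. x \<in> {0<..<247/1000}" using k by (intro eventually_nhds_in_open) auto
  then have E: "\<forall>\<^sub>F x in nhds k. Rf x = 1 - Mf x / (2 * Lpar x)" by (rule eventually_mono) (simp add: Rf_eq)
  show ?thesis using C unfolding isCont_cong[OF E] .
qed

text \<open>In R = 1 - M / (2 L) the numerator M is positive and increasing and L is positive and
  decreasing.\<close>

lemma Rf_antimono: assumes "0 < x" "x \<le> y" "y < 247 / 1000" shows "Rf y \<le> Rf x"
proof -
  have "Mf x \<le> Mf y"
    by (rule DERIV_nonneg_imp_nondecreasing[OF assms(2)], rule Mf_DERIV) (use assms in auto)
  moreover have "Lpar y \<le> Lpar x" "0 < Lpar y" using Lpar_antimono[of x y] Lpar_pos[of y] assms by auto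
  moreover have "0 < Mf x" by (rule Mf_pos) (use assms in auto)
  ultimately have "Mf x / (2 * Lpar x) \<le> Mf y / (2 * Lpar y)" by (intro frac_le) auto
  then show ?thesis using Rf_eq[of x] Rf_eq[of y] assms by simp
qed

text \<open>The sign conditions are multiplied by 6 L so that they avoid division by an enclosed
  logarithm. As q lies between the two points and R is antitone, the maximum R q is enclosed by the
  values of R at these points.\<close>

lemma Nf_max:
  assumes k: "0 < k1" "k1 < k2" "k2 < 247 / 1000"
    and s: "6 * Lpar k1 * Nf k1 < Uf k1 * Vpar k1" "Uf k2 * Vpar k2 < 6 * Lpar k2 * Nf k2"
  shows "\<exists>q. k1 < q \<and> q < k2 \<and> (\<forall>x. 0 < x \<and> x < 247 / 1000 \<longrightarrow> Nf x / Vpar x \<le> Nf q / Vpar q)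
    \<and> Rf k2 \<le> Nf q / Vpar q \<and> Nf q / Vpar q \<le> Rf k1"
proof -
  have V: "Vpar x > 0" "Lpar x > 0" if "0 < x" "x < 247 / 1000" for x
    using Vpar_pos[of x] Lpar_pos[of x] that by auto
  have U: "Uf x = Rf x * (6 * Lpar x)" if "0 < x" "x < 247 / 1000" for x
    unfolding Rf_def using V[OF that] by simp
  have "\<exists>q. k1 < q \<and> q < k2 \<and> Nf q = Rf q * Vpar q \<and> (\<forall>x. 0 < x \<and> x < 247 / 1000 \<longrightarrow> Nf x \<le> Rf q * Vpar x)"
  proof (rule antitone_quotient_max[OF k])
    show "(Nf has_real_derivative Rf x * (6 * Lpar x / Dpar x)) (at x)" if "0 < x" "x < 247 / 1000" for x
      using DERIV_Nf[OF that] .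
    show "(Vpar has_real_derivative 6 * Lpar x / Dpar x) (at x)" if "0 < x" "x < 247 / 1000" for x
      using that by (intro DERIV_Vpar) auto
    show "0 \<le> 6 * Lpar x / Dpar x" if "0 < x" "x < 247 / 1000" for x
      using V(2)[OF that] Dpar_pos[of x] that by auto
    show "isCont Rf x" if "0 < x" "x < 247 / 1000" for x using isCont_Rf[OF that] .
    show "Rf y \<le> Rf x" if "0 < x" "x \<le> y" "y < 247 / 1000" for x y using Rf_antimono[OF that] .
    have "6 * Lpar k1 * Nf k1 < 6 * Lpar k1 * (Rf k1 * Vpar k1)" using s(1) U[of k1] k by (simp add: mult_ac)
    then show "Nf k1 < Rf k1 * Vpar k1" using V(2)[of k1] k by simp
    have "6 * Lpar k2 * (Rf k2 * Vpar k2) < 6 * Lpar k2 * Nf k2" using s(2) U[of k2] k by (simp add: mult_ac)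
    then show "Rf k2 * Vpar k2 < Nf k2" using V(2)[of k2] k by simp
  qed
  then obtain q where q: "k1 < q" "q < k2" "Nf q = Rf q * Vpar q" "\<And>x. 0 < x \<Longrightarrow> x < 247 / 1000 \<Longrightarrow> Nf x \<le> Rf q * Vpar x" by auto
  have Rq: "Nf q / Vpar q = Rf q" using q V[of q] k by simp
  show ?thesis unfolding Rq[symmetric]
  proof (intro exI[of _ q] conjI allI impI)
    show "Nf x / Vpar x \<le> Nf q / Vpar q" if "0 < x \<and> x < 247 / 1000" for x
      unfolding Rq using q(4)[of x] V(1)[of x] that by (simp add: divide_le_eq)
    show "Rf k2 \<le> Nf q / Vpar q" "Nf q / Vpar q \<le> Rf k1"
      unfolding Rq using Rf_antimono[of q k2] Rf_antimono[of k1 q] q k by auto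
  qed (use q in auto)
qed

end

text \<open>\<open>Tpar\<close> is twice the distance \<open>t\<close> from the base planes to the origin.\<close>
definition Tpar :: "real \<Rightarrow> real" where "Tpar k = arcosh ((3 + 2 * k) / k)"
definition Spar :: "real \<Rightarrow> real" where "Spar k = sqrt (1 + k) * sqrt (1 + k / 3)"

lemma Spar_sq: "0 \<le> k \<Longrightarrow> (Spar k)\<^sup>2 = (1 + k) * (1 + k / 3)"
  by (simp add: Spar_def power_mult_distrib)

lemma Spar_ge: assumes "0 \<le> k" "k < 1" shows "1 \<le> Spar k" "sqrt (1 - k\<^sup>2) \<le> Spar k"
proof -
  have "1 * 1 \<le> sqrt (1 + k) * sqrt (1 + k / 3)" using assms by (intro mult_mono) auto
  then show "1 \<le> Spar k" by (simp add: Spar_def)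
  moreover have "sqrt (1 - k\<^sup>2) \<le> 1" by simp
  ultimately show "sqrt (1 - k\<^sup>2) \<le> Spar k" by linarith
qed

lemma Tpar_aux:
  assumes k: "0 < k" "k < 1"
  shows "1 < (3 + 2 * k) / k" "sqrt (((3 + 2 * k) / k)\<^sup>2 - 1) = 3 * Spar k / k"
proof -
  show "1 < (3 + 2 * k) / k" using k by simp
  have "((3 + 2 * k) / k)\<^sup>2 - 1 = (3 * Spar k / k)\<^sup>2"
    using k Spar_sq[of k] by (simp add: power_divide power_mult_distrib field_simps power2_eq_square)
  then show "sqrt (((3 + 2 * k) / k)\<^sup>2 - 1) = 3 * Spar k / k"
    using k Spar_ge(1)[of k] by (simp add: real_sqrt_abs)
qed

lemma cosh_Tpar:
  assumes k: "0 < k" "k < 1"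
  shows "cosh (Tpar k) = (3 + 2 * k) / k" "sinh (Tpar k) = 3 * Spar k / k" "0 < Tpar k" "Tpar k = 2 * tpar k"
    "Tpar k = ln ((3 + 2 * k + 3 * Spar k) / k)"
proof -
  note a = Tpar_aux[OF k]
  show c: "cosh (Tpar k) = (3 + 2 * k) / k" unfolding Tpar_def using a(1) by (simp add: cosh_arcosh_real)
  show s: "sinh (Tpar k) = 3 * Spar k / k" unfolding Tpar_def using a by (simp add: sinh_arcosh_real)
  have "0 < sinh (Tpar k)" unfolding s using Spar_ge(1)[of k] k by auto
  then show p: "0 < Tpar k" by simp
  have "exp (Tpar k) = cosh (Tpar k) + sinh (Tpar k)" by (simp add: cosh_plus_sinh)
  also have "\<dots> = (3 + 2 * k + 3 * Spar k) / k" unfolding c s by (simp add: add_divide_distrib)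
  finally show "Tpar k = ln ((3 + 2 * k + 3 * Spar k) / k)" by (metis ln_exp)
  have "cosh (2 * tpar k) = 2 * (cosh (tpar k))\<^sup>2 - 1" by (rule cosh_double_cosh)
  also have "\<dots> = (3 + 2 * k) / k" unfolding cosh_params(5)[OF k] using k by (simp add: field_simps)
  finally show "Tpar k = 2 * tpar k" unfolding Tpar_def using cosh_params(6)[OF k]
    by (metis arcosh_cosh_real less_eq_real_def mult_nonneg_nonneg zero_le_numeral)
qed

lemma DERIV_Tpar:
  assumes k: "0 < k" "k < 1"
  shows "(Tpar has_real_derivative - 1 / (k * Spar k)) (at k)"
proof -
  note a = Tpar_aux[OF k]
  have "((\<lambda>k. (3 + 2 * k) / k) has_real_derivative - 3 / k\<^sup>2) (at k)"
    using k by (auto intro!: derivative_eq_intros simp: power2_eq_square field_simps)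
  from DERIV_chain2[OF arcosh_real_has_field_derivative[OF a(1)] this]
  have "(Tpar has_real_derivative 1 / (3 * Spar k / k) * (- 3 / k\<^sup>2)) (at k)" unfolding Tpar_def[abs_def] a(2) .
  moreover have "1 / (3 * Spar k / k) * (- 3 / k\<^sup>2) = - 1 / (k * Spar k)"
    using k Spar_ge(1)[of k] by (simp add: field_simps power2_eq_square)
  ultimately show ?thesis by simp
qed

text \<open>The ratio of the arguments of the logarithms is at least 6 / 2, since
  \<open>Spar\<close> is at least 1 and the root in L is at most 1; and the base e is at most
  3.\<close>

lemma Tpar_minus_Lpar_ge: assumes k: "0 < k" "k < 1" shows "1 \<le> Tpar k - Lpar k"
proof -
  have "exp 1 * ((1 + sqrt (1 - k\<^sup>2)) / k) \<le> 3 * (2 / k)"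
    using k exp_le by (intro mult_mono divide_right_mono) (auto simp: abs_square_le_1)
  also have "\<dots> = 6 / k" by simp
  also have "\<dots> \<le> (3 + 2 * k + 3 * Spar k) / k" using Spar_ge(1)[of k] k by (intro divide_right_mono) auto
  finally have "exp 1 * ((1 + sqrt (1 - k\<^sup>2)) / k) \<le> (3 + 2 * k + 3 * Spar k) / k" .
  moreover have pos: "(1 + sqrt (1 - k\<^sup>2)) / k > 0" using k by (intro divide_pos_pos add_pos_nonneg) (auto simp: abs_square_le_1)
  ultimately have "ln (exp 1 * ((1 + sqrt (1 - k\<^sup>2)) / k)) \<le> ln ((3 + 2 * k + 3 * Spar k) / k)"
    by (smt (verit) exp_gt_zero ln_le_cancel_iff mult_pos_pos)
  moreover have "ln (exp 1 * ((1 + sqrt (1 - k\<^sup>2)) / k)) = 1 + ln ((1 + sqrt (1 - k\<^sup>2)) / k)"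
    using ln_mult_pos[OF exp_gt_zero pos, of 1] by simp
  ultimately show ?thesis unfolding cosh_Tpar(5)[OF k] Lpar_ln(1)[OF k] by linarith
qed

lemma sqrt_one_minus_sq: "0 \<le> k \<Longrightarrow> k < 1 \<Longrightarrow> sqrt (1 + k) * sqrt (1 - k) = sqrt (1 - k\<^sup>2)"
  by (simp add: power2_eq_square algebra_simps flip: real_sqrt_mult)

lemma ev_t_b: assumes "0 \<le> k" "k < 1"
  shows "ev t_b1 k = 2 / sqrt (1 - k\<^sup>2)" "ev t_b2 k = 3 / sqrt (1 - k\<^sup>2) - 1 / Spar k"
    "ev t_S k = Spar k"
  using sqrt_one_minus_sq[OF assms]
  by (simp_all add: t_b1_def t_b2_def t_S_def t_q_def t_r_def t_m_def Spar_def inverse_eq_divide)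

section \<open>Evaluation on boxes covering all k\<close>

text \<open>Ends are in units of 2^-12, and each chain ends above 0.247 * 4096, which is less than
  1012. The two other configurations need narrower boxes; their chains are split into several lemmas
  and joined later by \<open>box_chain_append\<close>.\<close>

lemma boxes1: "box_chain (mcheck 12 0 t_a1 t_b1) 0 [253, 506, 759, 1012]" by code_simp
lemma boxes3a: "box_chain (mcheck 12 0 t_a3 t_b1) 0 [127, 254, 381, 508]" by code_simp
lemma boxes3b: "box_chain (mcheck 12 0 t_a3 t_b1) 508 [635, 762, 889, 1016]" by code_simp

lemma packing1: "packing 12 t_a1 t_b1 0 (\<lambda>k. 2 * Lpar k)"
proof
  show "\<exists>X. mcheck 12 0 t_a1 t_b1 X \<and> in_ivl 12 x X" if "0 \<le> x" "x \<le> 247 / 1000" for x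
    by (rule box_chain_cover[OF boxes1]) (use that in auto)
  show "((\<lambda>k. 2 * Lpar k) has_real_derivative - ev t_b1 x / x) (at x)" if "0 < x" "x < 247 / 1000" for x
    using DERIV_cmult[OF DERIV_Lpar[of x], of 2] ev_t_b(1)[of x] that by (simp add: mult.commute)
  show "2 / sqrt (1 - x\<^sup>2) \<le> ev t_b1 x" if "0 < x" "x < 247 / 1000" for x using ev_t_b(1)[of x] that by simp
qed auto

lemma packing3: "packing 12 t_a3 t_b1 0 (\<lambda>k. 2 * Lpar k)"
proof
  have c: "box_chain (mcheck 12 0 t_a3 t_b1) 0 ([127, 254, 381, 508] @ [635, 762, 889, 1016])"
    unfolding box_chain_append using boxes3a boxes3b by simp
  show "\<exists>X. mcheck 12 0 t_a3 t_b1 X \<and> in_ivl 12 x X" if "0 \<le> x" "x \<le> 247 / 1000" for x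
    by (rule box_chain_cover[OF c]) (use that in auto)
  show "((\<lambda>k. 2 * Lpar k) has_real_derivative - ev t_b1 x / x) (at x)" if "0 < x" "x < 247 / 1000" for x
    using DERIV_cmult[OF DERIV_Lpar[of x], of 2] ev_t_b(1)[of x] that by (simp add: mult.commute)
  show "2 / sqrt (1 - x\<^sup>2) \<le> ev t_b1 x" if "0 < x" "x < 247 / 1000" for x using ev_t_b(1)[of x] that by simp
qed auto

lemma boxes2a: "box_chain (mcheck 12 1 t_a2 t_b2) 0 [85, 170, 255]" by code_simp
lemma boxes2b: "box_chain (mcheck 12 1 t_a2 t_b2) 255 [340, 425, 510]" by code_simp
lemma boxes2c: "box_chain (mcheck 12 1 t_a2 t_b2) 510 [595, 680, 765]" by code_simp
lemma boxes2d: "box_chain (mcheck 12 1 t_a2 t_b2) 765 [850, 935, 1020]" by code_simp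

text \<open>Here 2 L - c = T - L \<ge> 1, and the test is run with \<open>e\<close> = 1.
  Monotonicity of 2 L - c uses that \<open>Spar\<close> dominates sqrt (1 - k^2).\<close>

lemma packing2: "packing 12 t_a2 t_b2 1 (\<lambda>k. 3 * Lpar k - Tpar k)"
proof
  have c: "box_chain (mcheck 12 1 t_a2 t_b2) 0 ([85, 170, 255] @ [340, 425, 510] @ [595, 680, 765] @ [850, 935, 1020])"
    unfolding box_chain_append using boxes2a boxes2b boxes2c boxes2d by simp
  show "\<exists>X. mcheck 12 1 t_a2 t_b2 X \<and> in_ivl 12 x X" if "0 \<le> x" "x \<le> 247 / 1000" for x
    by (rule box_chain_cover[OF c]) (use that in auto)
  fix x :: real
  assume x: "0 < x" "x < 247 / 1000"
  then have x1: "0 < x" "x < 1" by auto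
  have "((\<lambda>k. 3 * Lpar k - Tpar k) has_real_derivative 3 * (- 1 / (x * sqrt (1 - x\<^sup>2))) - - 1 / (x * Spar x)) (at x)"
    by (intro DERIV_diff DERIV_cmult DERIV_Lpar DERIV_Tpar x1)
  moreover have "3 * (- 1 / (x * r)) - - 1 / (x * s) = - (3 / r - 1 / s) / x" for r s :: real
    by (simp add: diff_divide_distrib mult.commute)
  ultimately show "((\<lambda>k. 3 * Lpar k - Tpar k) has_real_derivative - ev t_b2 x / x) (at x)"
    using ev_t_b(2)[of x] x1 by simp
  show "of_int 1 \<le> 2 * Lpar x - (3 * Lpar x - Tpar x)" using Tpar_minus_Lpar_ge[OF x1] by simp
  have "0 < sqrt (1 - x\<^sup>2)" using x1 by (simp add: abs_square_less_1)
  then have "1 / Spar x \<le> 1 / sqrt (1 - x\<^sup>2)" using Spar_ge[of x] x1 by (intro divide_left_mono mult_pos_pos) auto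
  then show "2 / sqrt (1 - x\<^sup>2) \<le> ev t_b2 x" using ev_t_b(2)[of x] x1 by simp
qed

text \<open>Half of k times the excess of 2 sinh T + 6 sinh (2 L - T) over 8 sinh L, with T = 2 t.
  It compares the two ends of the range of x for the first density.\<close>

definition t_st :: rterm where "t_st = Sub (Mul (Num 3) (Add t_S t_T)) (Mul (Num 2) t_a1)"
definition slope_check :: "ivl \<Rightarrow> bool" where
  "slope_check X = opos (oadd (onum 12 2) (oneg (jet1 (jet 12 X t_st))))"
lemma boxes_st: "box_chain slope_check 0 [253, 506, 759, 1012]" by code_simp

text \<open>The term vanishes at k = 0 and its derivative is below 2 on every box. The constant 2 is
  what T - L \<ge> 1 can compensate when the endpoints are compared.\<close>

lemma t_st_le: assumes k: "0 < k" "k < 247 / 1000" shows "ev t_st k \<le> 2 * k"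
proof -
  have "2 * 0 - ev t_st 0 \<le> 2 * k - ev t_st k"
  proof (rule DERIV_nonneg_imp_nondecreasing[where f = "\<lambda>x. 2 * x - ev t_st x"])
    fix x assume x: "0 \<le> x" "x \<le> k"
    obtain X where X: "slope_check X" "in_ivl 12 x X"
      using box_chain_cover[OF boxes_st, of x 12] x k by auto
    have "jet 12 X t_st \<noteq> None" using X(1) by (cases "jet 12 X t_st") (simp_all add: slope_check_def opos_def oadd_def oneg_def onum_def jet1_def)
    note D = jet_DERIV(1)[OF X(2) this]
    have "0 < of_int 2 + - ev1 t_st x"
      by (rule opos_pos[of 12, OF _ X(1)[unfolded slope_check_def]]) (intro inO_oadd inO_oneg inO_onum inO_jet X(2))
    then show "\<exists>y. ((\<lambda>x. 2 * x - ev t_st x) has_real_derivative y) (at x) \<and> 0 \<le> y"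
      by (intro exI[of _ "2 * 1 - ev1 t_st x"] conjI DERIV_diff DERIV_cmult DERIV_ident D) simp
  qed (use k in simp)
  moreover have "ev t_st 0 = 0"
    by (simp add: t_st_def t_S_def t_T_def t_a1_def t_q_def t_m_def t_r_def t_z_def)
  ultimately show ?thesis by simp
qed

definition oinv :: "nat \<Rightarrow> ivl option \<Rightarrow> ivl option" where "oinv n a = (case a of None \<Rightarrow> None | Some I \<Rightarrow> iinv n I)"
lemma inO_oinv: "inO n x a \<Longrightarrow> inO n (inverse x) (oinv n a)"
  by (cases a) (auto simp: inO_def oinv_def intro: in_iinv(1))

section \<open>Sign certificates at single points\<close>

definition "t_klo = Sub (Add (Sub (Add (Sub (Num 1) (Div (Mul Var Var) (Num 2))) (Div (Mul (Mul Var Var) (Mul Var Var)) (Num 24)))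
    (Div (Mul (Mul Var Var) (Mul (Mul Var Var) (Mul Var Var))) (Num 720)))
  (Mul (Sqrt (Num 3)) (Sub Var (Div (Mul Var (Mul Var Var)) (Num 6))))) (Num 1)"
definition "t_khi = Sub (Add (Add (Sub (Num 1) (Div (Mul Var Var) (Num 2))) (Div (Mul (Mul Var Var) (Mul Var Var)) (Num 24)))
  (Mul (Sqrt (Num 3)) (Add (Sub Var (Div (Mul Var (Mul Var Var)) (Num 6))) (Div (Mul Var (Mul (Mul Var Var) (Mul Var Var))) (Num 120))))) (Num 1)"
definition "t_Jlo = Mul (Mul (Num 2) (Sqrt (Num 3)))
  (Add (Add (Add Var (Div (Mul Var Var) (Num 12))) (Mul (Div (Num 11) (Num 54)) (Mul Var (Mul Var Var)))) (Div (Mul (Mul Var Var) (Mul Var Var)) (Num 27)))"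
definition "t_Jhi = Mul (Mul (Num 2) (Sqrt (Num 3)))
  (Add (Add (Add (Add Var (Div (Mul Var Var) (Num 12))) (Mul (Div (Num 11) (Num 54)) (Mul Var (Mul Var Var)))) (Div (Mul (Mul Var Var) (Mul Var Var)) (Num 27)))
    (Mul (Div (Num 11) (Num 100)) (Mul Var (Mul (Mul Var Var) (Mul Var Var)))))"
definition t_ln :: rterm where
  "t_ln = Mul (Mul (Num 2) Var) (Add (Num 1) (Mul (Mul Var Var) (Add (Div (Num 1) (Num 3)) (Mul (Mul Var Var) (Add (Div (Num 1) (Num 5)) (Mul (Mul Var Var) (Add (Div (Num 1) (Num 7)) (Mul (Mul Var Var) (Add (Div (Num 1) (Num 9)) (Mul (Mul Var Var) (Div (Num 1) (Num 11))))))))))))"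
text \<open>The argument of the logarithm in \<open>Lpar\<close> divided by 2^m; m is chosen so that
  the quotient falls between 1 and 5/3, where the artanh series is used.\<close>

definition t_zL :: "nat \<Rightarrow> rterm" where "t_zL m = Div (Add (Num 1) (Mul t_q t_r)) (Mul (Num (2 ^ m)) Var)"
definition t_zT :: "nat \<Rightarrow> rterm" where
  "t_zT m = Div (Add (Add (Num 3) (Mul (Num 2) Var)) (Mul (Num 3) t_S)) (Mul (Num (2 ^ m)) Var)"

text \<open>The literals are bounds for \<open>2\<^bsup>34\<^esup> ln 2\<close> and for \<open>2\<^bsup>34\<^esup> 10\<^bsup>-8\<^esup>\<close>. Here and below a definition is split
  into several functions only to make the evaluation share common subterms.\<close>
definition enc_ln_aux :: "nat \<Rightarrow> ivl option \<Rightarrow> ivl option \<Rightarrow> ivl option" where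
  "enc_ln_aux m oz ov = (case ov of None \<Rightarrow> None | Some V \<Rightarrow>
     if opos (oadd oz (onum 34 (- 1))) \<and> opos (oadd (onum 34 5) (oneg (omul 34 (onum 34 3) oz)))
     then oadd (omul 34 (onum 34 (int m)) (olit 11908177887 11908177888)) (oadd (jet0 (jet 34 V t_ln)) (olit 0 172))
     else None)"
definition enc_ln_z :: "nat \<Rightarrow> ivl option \<Rightarrow> ivl option" where
  "enc_ln_z m oz = enc_ln_aux m oz (omul 34 (oadd oz (onum 34 (- 1))) (oinv 34 (oadd oz (onum 34 1))))"
definition enc_ln :: "ivl \<Rightarrow> nat \<Rightarrow> rterm \<Rightarrow> ivl option" where
  "enc_ln X m z = enc_ln_z m (jet0 (jet 34 X z))"
definition enc_c :: "ivl \<Rightarrow> ivl option \<Rightarrow> nat option \<Rightarrow> ivl option" where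
  "enc_c X L mt = (case mt of None \<Rightarrow> omul 34 (onum 34 2) L
     | Some m \<Rightarrow> oadd (omul 34 (onum 34 3) L) (oneg (enc_ln X m (t_zT m))))"
text \<open>The literals are bounds for \<open>2\<^bsup>34\<^esup> J(0)\<close>.\<close>
definition enc_J :: "ivl \<Rightarrow> ivl option" where
  "enc_J X = oadd (olit 87182800689 87182826459) (ohull (jet0 (jet 34 X t_Jlo)) (jet0 (jet 34 X t_Jhi)))"
text \<open>With sg = 1 the tests say R V > N and R < r / 10^5, as required at the left point; with
  sg = -1 both are reversed, for the right point. Here R = U / (6 L), and all denominators are
  cleared.\<close>

definition check_U :: "int \<Rightarrow> int \<Rightarrow> ivl option \<Rightarrow> ivl option \<Rightarrow> ivl option \<Rightarrow> ivl option \<Rightarrow> ivl option \<Rightarrow> bool" where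
  "check_U sg r U V A L N \<longleftrightarrow>
     opos (omul 34 (onum 34 sg) (oadd (omul 34 U V) (oneg (omul 34 (onum 34 6) (omul 34 L (omul 34 A N)))))) \<and>
     opos (omul 34 (onum 34 sg) (oadd (omul 34 (onum 34 (6 * r)) L) (oneg (omul 34 (onum 34 100000) U))))"
definition check_N :: "int \<Rightarrow> int \<Rightarrow> ivl option \<Rightarrow> ivl option \<Rightarrow> ivl option \<Rightarrow> ivl option \<Rightarrow> ivl option \<Rightarrow> ivl option \<Rightarrow> bool" where
  "check_N sg r A L D J N N1 = check_U sg r (oadd (omul 34 (onum 34 3) N) (omul 34 A (omul 34 N1 D)))
     (oadd (omul 34 (onum 34 2) (omul 34 A L)) J) A L N"
definition check_a :: "int \<Rightarrow> int \<Rightarrow> ivl option \<Rightarrow> ivl option \<Rightarrow> ivl option \<Rightarrow> ivl option \<Rightarrow> ivl option \<Rightarrow> ivl option \<Rightarrow> ivl option \<Rightarrow> ivl option \<Rightarrow> ivl option \<Rightarrow> bool" where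
  "check_a sg r A L D J c iX a0 a1 b0 = check_N sg r A L D J (oadd (omul 34 a0 iX) c)
     (omul 34 (oadd a1 (oneg (oadd (omul 34 a0 iX) b0))) iX)"
definition check_j :: "int \<Rightarrow> int \<Rightarrow> ivl option \<Rightarrow> ivl option \<Rightarrow> ivl option \<Rightarrow> ivl option \<Rightarrow> ivl option \<Rightarrow> ivl option \<Rightarrow> (ivl \<times> ivl \<times> ivl) option \<Rightarrow> ivl option \<Rightarrow> bool" where
  "check_j sg r A L D J c iX ja b0 = check_a sg r A L D J c iX (jet0 ja) (jet1 ja) b0"
definition check_L :: "int \<Rightarrow> int \<Rightarrow> nat option \<Rightarrow> rterm \<Rightarrow> rterm \<Rightarrow> ivl option \<Rightarrow> ivl \<Rightarrow> ivl option \<Rightarrow> bool" where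
  "check_L sg r mt ta tb A X L = check_j sg r A L (jet0 (jet 34 X (Sqrt t_D2))) (enc_J X) (enc_c X L mt)
     (jet0 (jet 34 X (Inv Var))) (jet 34 X ta) (jet0 (jet 34 X tb))"
definition check_X :: "int \<Rightarrow> int \<Rightarrow> nat \<Rightarrow> nat option \<Rightarrow> rterm \<Rightarrow> rterm \<Rightarrow> ivl option \<Rightarrow> ivl option \<Rightarrow> bool" where
  "check_X sg r m mt ta tb A oX = (case oX of None \<Rightarrow> False | Some X \<Rightarrow>
     opos (oadd (onum 34 1) (oneg (omul 34 (onum 34 10) (Some X)))) \<and> check_L sg r mt ta tb A X (enc_ln X m (t_zL m)))"
text \<open>The only input is an enclosure of y = A / 3. From it A is obtained by multiplication and
  k by the Taylor bounds in y, so no trigonometric function has to be evaluated.\<close>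

definition point_check :: "int \<Rightarrow> int \<Rightarrow> nat \<Rightarrow> nat option \<Rightarrow> rterm \<Rightarrow> rterm \<Rightarrow> ivl \<Rightarrow> bool" where
  "point_check sg r m mt ta tb Y = check_X sg r m mt ta tb (omul 34 (onum 34 3) (Some Y))
     (ohull (jet0 (jet 34 Y t_klo)) (jet0 (jet 34 Y t_khi)))"

lemma enc_ln_sound:
  assumes k: "in_ivl 34 k X" and z: "w = ev z k * 2 ^ m" "0 < ev z k"
  shows "inO 34 (ln w) (enc_ln X m z)"
proof -
  define oz where "oz = jet0 (jet 34 X z)"
  define ov where "ov = omul 34 (oadd oz (onum 34 (- 1))) (oinv 34 (oadd oz (onum 34 1)))"
  have z0: "inO 34 (ev z k) oz" unfolding oz_def by (rule inO_jet(1)[OF k])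
  define v where "v = (ev z k - 1) / (ev z k + 1)"
  have v0: "inO 34 ((ev z k + of_int (- 1)) * inverse (ev z k + of_int 1)) ov"
    unfolding ov_def by (intro inO_omul inO_oadd inO_oinv inO_onum z0)
  show ?thesis
  proof (cases ov)
  case None
  then show ?thesis by (simp add: enc_ln_def enc_ln_z_def enc_ln_aux_def inO_def flip: oz_def ov_def)
next
  case (Some V)
  have V: "in_ivl 34 v V" using v0 unfolding Some by (simp add: inO_def v_def divide_inverse)
  have e: "enc_ln X m z = (if opos (oadd oz (onum 34 (- 1))) \<and> opos (oadd (onum 34 5) (oneg (omul 34 (onum 34 3) oz)))
     then oadd (omul 34 (onum 34 (int m)) (olit 11908177887 11908177888)) (oadd (jet0 (jet 34 V t_ln)) (olit 0 172)) else None)"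
    unfolding enc_ln_def enc_ln_z_def enc_ln_aux_def oz_def[symmetric] ov_def[symmetric] Some by simp
  show ?thesis
  proof (cases "opos (oadd oz (onum 34 (- 1))) \<and> opos (oadd (onum 34 5) (oneg (omul 34 (onum 34 3) oz)))")
    case True
    have "0 < ev z k + of_int (- 1)" by (rule opos_pos[of 34, OF _ conjunct1[OF True]]) (intro inO_oadd inO_onum z0)
    then have z1: "1 < ev z k" by simp
    have "0 < of_int 5 + - (of_int 3 * ev z k)" by (rule opos_pos[of 34, OF _ conjunct2[OF True]]) (intro inO_oadd inO_oneg inO_omul inO_onum z0)
    then have z2: "ev z k \<le> 5 / 3" by simp
    have "ev t_ln v = 2 * v * (1 + v\<^sup>2 * (1 / 3 + v\<^sup>2 * (1 / 5 + v\<^sup>2 * (1 / 7 + v\<^sup>2 * (1 / 9 + v\<^sup>2 * (1 / 11))))))"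
      by (simp add: t_ln_def power2_eq_square)
    note b = ln_atanh_bounds[OF z1 z2 v_def, folded this]
    have l2: "inO 34 (ln 2) (olit 11908177887 11908177888)" by (rule inO_olit) (use ln_2_bounds in simp_all)
    have d: "inO 34 (ln (ev z k) - ev t_ln v) (olit 0 172)" by (rule inO_olit) (use b in simp_all)
    have "inO 34 (of_int (int m) * ln 2 + (ev t_ln v + (ln (ev z k) - ev t_ln v))) (enc_ln X m z)"
      unfolding e if_P[OF True] by (intro inO_oadd inO_omul inO_onum inO_jet V l2 d)
    moreover have "ln w = ln (ev z k) + ln (2 ^ m)" unfolding z(1) by (rule ln_mult_pos) (use z(2) in simp_all)
    then have "ln w = of_int (int m) * ln 2 + (ev t_ln v + (ln (ev z k) - ev t_ln v))" by (simp add: ln_realpow)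
    ultimately show ?thesis by simp
  next
    case False
    show ?thesis unfolding e if_not_P[OF False] by (simp add: inO_def)
  qed
  qed
qed

lemma enc_Lpar:
  assumes "in_ivl 34 k X" "0 < k" "k < 1"
  shows "inO 34 (Lpar k) (enc_ln X m (t_zL m))" "inO 34 (Tpar k) (enc_ln X m (t_zT m))"
proof -
  have s: "sqrt (1 + k) * sqrt (1 - k) = sqrt (1 - k\<^sup>2)" using sqrt_one_minus_sq[of k] assms by simp
  have "0 \<le> sqrt (1 - k\<^sup>2)" using assms by (simp add: abs_square_le_1)
  then have p: "1 + sqrt (1 - k\<^sup>2) > 0" by linarith
  show "inO 34 (Lpar k) (enc_ln X m (t_zL m))" unfolding Lpar_ln(1)[OF assms(2,3)]
    by (rule enc_ln_sound[OF assms(1)]) (use assms p in \<open>simp_all add: t_zL_def t_q_def t_r_def s\<close>)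
  have S: "ev t_S k = Spar k" using ev_t_b(3)[of k] assms by simp
  have "3 + 2 * k + 3 * Spar k > 0" using Spar_ge(1)[of k] assms by linarith
  then show "inO 34 (Tpar k) (enc_ln X m (t_zT m))" unfolding cosh_Tpar(5)[OF assms(2,3)]
    by (intro enc_ln_sound[OF assms(1)]) (use assms in \<open>simp_all add: t_zT_def S\<close>)
qed

lemma enc_J_sound:
  assumes k: "in_ivl 34 k X" "0 \<le> k" "k \<le> 1 / 10"
  shows "inO 34 (Jpar k) (enc_J X)"
proof -
  have "inO 34 (Jpar 0) (olit 87182800689 87182826459)" by (rule inO_olit) (use Jpar_0_bounds in simp_all)
  moreover have "inO 34 (Jpar k - Jpar 0) (ohull (jet0 (jet 34 X t_Jlo)) (jet0 (jet 34 X t_Jhi)))"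
  proof (rule inO_ohull)
    have "ev t_Jlo k = 2 * sqrt 3 * (k + k ^ 2 / 12 + 11 / 54 * k ^ 3 + k ^ 4 / 27)"
      "ev t_Jhi k = 2 * sqrt 3 * (k + k ^ 2 / 12 + 11 / 54 * k ^ 3 + k ^ 4 / 27 + 11 / 100 * k ^ 5)"
      by (simp_all add: t_Jlo_def t_Jhi_def power_numeral_reduce)
    then show "ev t_Jlo k \<le> Jpar k - Jpar 0" "Jpar k - Jpar 0 \<le> ev t_Jhi k" using Jpar_bounds[of k] k by linarith+
  qed (intro inO_jet k)+
  ultimately have "inO 34 (Jpar 0 + (Jpar k - Jpar 0)) (enc_J X)" unfolding enc_J_def by (rule inO_oadd)
  then show ?thesis by simp
qed

text \<open>Every real quantity is enclosed by the term that the check computes for it; the success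
  of the tests on the enclosures gives the signs. The test 10 k < 1 brings k into the range in which
  the bounds for \<open>Jpar\<close> hold.\<close>

lemma (in packing) point_check_sound:
  assumes p: "6 < p" "p < 7" and Y: "in_ivl 34 (pi * (p - 6) / (3 * p)) Y"
    and c: "\<And>X L. in_ivl 34 (kpar p) X \<Longrightarrow> inO 34 (Lpar (kpar p)) L \<Longrightarrow> inO 34 (c (kpar p)) (enc_c X L mt)"
    and chk: "point_check sg r m mt ta tb Y"
  shows "0 < of_int sg * (Uf (kpar p) * Vpar (kpar p) - 6 * Lpar (kpar p) * Nf (kpar p))"
    "0 < of_int sg * (of_int (6 * r) * Lpar (kpar p) - 100000 * Uf (kpar p))"
proof -
  define y where "y = pi * (p - 6) / (3 * p)"
  define k where "k = kpar p"
  have k: "0 < k" "k < 1" using kpar_bounds[OF p] by (simp_all add: k_def)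
  have y0: "0 \<le> y" using p by (simp add: y_def)
  have y1: "2 * pi / p = pi / 3 - y" using p by (simp add: y_def field_simps)
  have A: "Apar k = of_int 3 * y" unfolding Apar_def k_def kpar_bounds(4)[OF p] y1 by simp
  have oA: "inO 34 (Apar k) (omul 34 (onum 34 3) (Some Y))" unfolding A by (intro inO_omul inO_onum inO_Some) (use Y y_def in simp)
  have Y': "in_ivl 34 y Y" using Y by (simp add: y_def)
  have oX: "inO 34 k (ohull (jet0 (jet 34 Y t_klo)) (jet0 (jet 34 Y t_khi)))"
  proof (rule inO_ohull)
    have "ev t_klo y = (1 - y ^ 2 / 2 + y ^ 4 / 24 - y ^ 6 / 720) + sqrt 3 * (y - y ^ 3 / 6) - 1"
      "ev t_khi y = (1 - y ^ 2 / 2 + y ^ 4 / 24) + sqrt 3 * (y - y ^ 3 / 6 + y ^ 5 / 120) - 1"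
      by (simp_all add: t_klo_def t_khi_def power_numeral_reduce mult.assoc)
    then show "ev t_klo y \<le> k" "k \<le> ev t_khi y" using kpar_bounds_taylor[OF y0 y1] by (simp_all add: k_def)
  qed (intro inO_jet Y')+
  obtain X where X: "ohull (jet0 (jet 34 Y t_klo)) (jet0 (jet 34 Y t_khi)) = Some X"
    and c1: "opos (oadd (onum 34 1) (oneg (omul 34 (onum 34 10) (Some X))))"
    and c2: "check_L sg r mt ta tb (omul 34 (onum 34 3) (Some Y)) X (enc_ln X m (t_zL m))"
    using chk unfolding point_check_def check_X_def by (auto split: option.splits)
  have kX: "in_ivl 34 k X" using oX X by (simp add: inO_def)
  have "0 < of_int 1 + - (of_int 10 * k)" by (rule opos_pos[of 34, OF _ c1]) (intro inO_oadd inO_oneg inO_omul inO_onum inO_Some kX)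
  then have k10: "k \<le> 1 / 10" by simp
  note oL = enc_Lpar(1)[OF kX k, of m]
  note oc = c[folded k_def, OF kX oL]
  note oJ = enc_J_sound[OF kX less_imp_le[OF k(1)] k10]
  have "ev (Sqrt t_D2) k = Dpar k" by (simp add: t_D2_def Dpar_def algebra_simps)
  then have oD: "inO 34 (Dpar k) (jet0 (jet 34 X (Sqrt t_D2)))" using inO_jet(1)[OF kX, of "Sqrt t_D2"] by simp
  have oi: "inO 34 (inverse k) (jet0 (jet 34 X (Inv Var)))" using inO_jet(1)[OF kX, of "Inv Var"] by simp
  note a = inO_jet[OF kX, of ta] and b = inO_jet[OF kX, of tb]
  define oN where "oN = oadd (omul 34 (jet0 (jet 34 X ta)) (jet0 (jet 34 X (Inv Var)))) (enc_c X (enc_ln X m (t_zL m)) mt)"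
  define oN1 where "oN1 = omul 34 (oadd (jet1 (jet 34 X ta)) (oneg (oadd (omul 34 (jet0 (jet 34 X ta)) (jet0 (jet 34 X (Inv Var)))) (jet0 (jet 34 X tb))))) (jet0 (jet 34 X (Inv Var)))"
  have "inO 34 (ev ta k * inverse k + c k) oN" unfolding oN_def by (intro inO_oadd inO_omul a oi oc)
  then have hN: "inO 34 (nf k) oN" by (simp add: nf_def divide_inverse)
  have "inO 34 ((ev1 ta k + - (ev ta k * inverse k + ev tb k)) * inverse k) oN1"
    unfolding oN1_def by (intro inO_oadd inO_omul inO_oneg a b oi)
  moreover have "(ev1 ta k + - (ev ta k * inverse k + ev tb k)) * inverse k = n1f k"
    unfolding n1f_def divide_inverse by (simp add: algebra_simps)
  ultimately have hN1: "inO 34 (n1f k) oN1" by simp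
  define oU where "oU = oadd (omul 34 (onum 34 3) oN) (omul 34 (omul 34 (onum 34 3) (Some Y)) (omul 34 oN1 (jet0 (jet 34 X (Sqrt t_D2)))))"
  define oV where "oV = oadd (omul 34 (onum 34 2) (omul 34 (omul 34 (onum 34 3) (Some Y)) (enc_ln X m (t_zL m)))) (enc_J X)"
  have "inO 34 (of_int 3 * nf k + Apar k * (n1f k * Dpar k)) oU" unfolding oU_def by (intro inO_oadd inO_omul inO_onum hN hN1 oA oD)
  then have hU: "inO 34 (Uf k) oU" by (simp add: Uf_def mult.assoc)
  have "inO 34 (of_int 2 * (Apar k * Lpar k) + Jpar k) oV" unfolding oV_def by (intro inO_oadd inO_omul inO_onum oA oL oJ)
  then have hV: "inO 34 (Vpar k) oV" by (simp add: Vpar_def mult.assoc)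
  have c3: "check_U sg r oU oV (omul 34 (onum 34 3) (Some Y)) (enc_ln X m (t_zL m)) oN"
    using c2 unfolding check_L_def check_j_def check_a_def check_N_def oU_def oV_def oN_def oN1_def .
  note d1 = conjunct1[OF c3[unfolded check_U_def]] and d2 = conjunct2[OF c3[unfolded check_U_def]]
  have "0 < of_int sg * (Uf k * Vpar k + - (of_int 6 * (Lpar k * (Apar k * nf k))))"
    by (rule opos_pos[of 34, OF _ d1]) (intro inO_oadd inO_omul inO_oneg inO_onum hU hV oL oA hN)
  then show "0 < of_int sg * (Uf (kpar p) * Vpar (kpar p) - 6 * Lpar (kpar p) * Nf (kpar p))"
    unfolding k_def[symmetric] by (simp add: Nf_def mult.assoc)
  have "0 < of_int sg * (of_int (6 * r) * Lpar k + - (of_int 100000 * Uf k))"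
    by (rule opos_pos[of 34, OF _ d2]) (intro inO_oadd inO_omul inO_oneg inO_onum hU oL)
  then show "0 < of_int sg * (of_int (6 * r) * Lpar (kpar p) - 100000 * Uf (kpar p))"
    unfolding k_def[symmetric] by simp
qed

text \<open>The last argument encloses \<open>2\<^bsup>34\<^esup> A / 3 = 2\<^bsup>34\<^esup> \<pi> (p - 6) / (3 p)\<close> for the endpoints of the claimed interval for \<open>p\<close>;
  the second one is a bound for \<open>10\<^sup>5\<close> times the density there.\<close>
lemma point1a: "point_check 1 70428 4 None t_a1 t_b1 (963754454, 963754455)" by code_simp
lemma point1b: "point_check (- 1) 70426 4 None t_a1 t_b1 (963808170, 963808171)" by code_simp
lemma point2a: "point_check 1 85685 6 (Some 7) t_a2 t_b2 (311218111, 311218112)" by code_simp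
lemma point2b: "point_check (- 1) 85683 6 (Some 7) t_a2 t_b2 (311276023, 311276024)" by code_simp
lemma point3a: "point_check 1 86146 4 None t_a3 t_b1 (757761760, 757761761)" by code_simp
lemma point3b: "point_check (- 1) 86144 4 None t_a3 t_b1 (757816784, 757816785)" by code_simp

section \<open>The three families of packings\<close>

text \<open>The addition theorem gives q (2 r (3 + 2 k) - 3 (2 - k^2) m) / k^3, with r, m, q the
  roots of 1 - k, 1 + k / 3 and 1 + k. The identity \<open>key\<close> multiplies the bracket by a
  factor without zero and exhibits a factor k^2.\<close>

lemma ev_t_T:
  assumes k: "0 < k" "k < 1"
  shows "sinh (2 * Lpar k - Tpar k) = ev t_T k / k"
proof -
  define r m q where "r = sqrt (1 - k)" and "m = sqrt (1 + k / 3)" and "q = sqrt (1 + k)"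
  have r: "r > 0" "r * r = 1 - k" and m: "m > 0" "m * m = 1 + k / 3" using k by (simp_all add: r_def m_def)
  have R: "sqrt (1 - k\<^sup>2) = q * r" using sqrt_one_minus_sq[of k] k by (simp add: q_def r_def)
  have S: "Spar k = q * m" by (simp add: Spar_def q_def m_def)
  have z: "(1 + k) * r + m > 0" "1 + r * m > 0" using r(1) m(1) k by (simp_all add: add_pos_pos)
  have "3 * (m * m) = 3 + k" using m(2) by simp
  with r(2) have key: "(2 * r * (3 + 2 * k) - 3 * (2 - k\<^sup>2) * m) * (3 * (1 + r * m) * ((1 + k) * r + m))
    = k\<^sup>2 * ((2 + k) * (2 - 3 * (k + k * k)))" by algebra
  have "ev t_T k = q * ((2 + k) * (2 - 3 * (k + k * k))) / (3 * (1 + r * m) * ((1 + k) * r + m))"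
    by (simp add: t_T_def t_z_def t_q_def t_r_def t_m_def q_def r_def m_def)
  also have "(2 + k) * (2 - 3 * (k + k * k)) = (2 * r * (3 + 2 * k) - 3 * (2 - k\<^sup>2) * m) * (3 * (1 + r * m) * ((1 + k) * r + m)) / k\<^sup>2"
    unfolding key using k by simp
  also have "q * ((2 * r * (3 + 2 * k) - 3 * (2 - k\<^sup>2) * m) * (3 * (1 + r * m) * ((1 + k) * r + m)) / k\<^sup>2) / (3 * (1 + r * m) * ((1 + k) * r + m))
    = q * (2 * r * (3 + 2 * k) - 3 * (2 - k\<^sup>2) * m) / k\<^sup>2"
    using z by simp
  finally have T: "ev t_T k = q * (2 * r * (3 + 2 * k) - 3 * (2 - k\<^sup>2) * m) / k\<^sup>2" .
  have "sinh (2 * Lpar k - Tpar k) = sinh (2 * Lpar k) * cosh (Tpar k) - cosh (2 * Lpar k) * sinh (Tpar k)"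
    by (rule sinh_diff)
  also have "sinh (2 * Lpar k) = 2 * (q * r / k) * (1 / k)"
    unfolding sinh_double cosh_params(1,2)[OF k] R ..
  also have "cosh (2 * Lpar k) = (2 - k\<^sup>2) / k\<^sup>2"
    unfolding cosh_double_cosh cosh_params(1)[OF k] using k by (simp add: power_divide diff_divide_distrib)
  also have "2 * (q * r / k) * (1 / k) * cosh (Tpar k) - (2 - k\<^sup>2) / k\<^sup>2 * sinh (Tpar k) = ev t_T k / k"
    unfolding cosh_Tpar(1,2)[OF k] S T using k by (simp add: field_simps power2_eq_square)
  finally show ?thesis .
qed

lemma ev_t_a1: assumes k: "0 < k" "k < 1" shows "ev t_a1 k / k = 2 * sinh (Lpar k)" "ev t_a1 k = 2 * sqrt (1 - k\<^sup>2)"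
proof -
  show e: "ev t_a1 k = 2 * sqrt (1 - k\<^sup>2)" using sqrt_one_minus_sq[of k] k by (simp add: t_a1_def t_q_def t_r_def)
  show "ev t_a1 k / k = 2 * sinh (Lpar k)" unfolding e cosh_params(2)[OF k] by simp
qed

text \<open>cosh (w - t) is a multiple of (1 + k - e) / k with e^2 = 1 + k + k^2 / 3. Expanding by 1
  + k + e removes the division by k, and the double argument formula completes the
  computation.\<close>

lemma ev_t_C:
  assumes k: "0 < k" "k < 1"
  shows "cosh (2 * wpar k - Tpar k) = ev t_C k"
proof -
  define e where "e = sqrt (1 + k + k * k / 3)"
  define h where "h = sqrt ((3 + k) / 2)"
  have e: "e > 0" "e * e = 1 + k + k * k / 3" and h: "h * h = (3 + k) / 2" using k by (simp_all add: e_def h_def add_pos_pos)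
  note c = cosh_params[OF k]
  have q: "(cosh (wpar k))\<^sup>2 = (1 + k) * (3 + k) / k" "(cosh (tpar k))\<^sup>2 = 3 * (1 + k) / (2 * k)"
    "(sinh (wpar k))\<^sup>2 = (3 + 3 * k + k\<^sup>2) / k" "(sinh (tpar k))\<^sup>2 = (3 + k) / (2 * k)"
    unfolding c(4,5,10,11) using k by simp_all
  have h2: "h\<^sup>2 = (3 + k) / 2" "e\<^sup>2 = 1 + k + k * k / 3" "h > 0" using h e(2) k by (simp_all add: power2_eq_square h_def)
  have c1: "cosh (wpar k) * cosh (tpar k) = sqrt 3 * h * (1 + k) / k"
  proof (rule power2_eq_imp_eq)
    show "(cosh (wpar k) * cosh (tpar k))\<^sup>2 = (sqrt 3 * h * (1 + k) / k)\<^sup>2"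
      unfolding power_mult_distrib power_divide q h2 using k by (simp add: field_simps power2_eq_square)
  qed (use h2 k in simp_all)
  have c2: "sinh (wpar k) * sinh (tpar k) = sqrt 3 * h * e / k"
  proof (rule power2_eq_imp_eq)
    show "(sinh (wpar k) * sinh (tpar k))\<^sup>2 = (sqrt 3 * h * e / k)\<^sup>2"
      unfolding power_mult_distrib power_divide q h2 using k by (simp add: field_simps power2_eq_square)
  qed (use h2 e k c(6,12) in simp_all)
  have d: "cosh (wpar k - tpar k) = sqrt 3 * h * ((1 + k) - e) / k"
    unfolding cosh_diff c1 c2 by (simp add: algebra_simps diff_divide_distrib)
  have ne: "1 + k + e \<noteq> 0" using e k by simp
  have "((1 + k) - e) * (1 + k + e) = k * (3 + 2 * k) / 3" using e(2) by (simp add: algebra_simps)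
  then have "(1 + k) - e = k * (3 + 2 * k) / 3 / (1 + k + e)" using ne by (metis nonzero_mult_div_cancel_right)
  then have d2: "((1 + k) - e) / k = (3 + 2 * k) / (3 * (1 + k + e))" using k by simp
  have "cosh (2 * wpar k - Tpar k) = 2 * (cosh (wpar k - tpar k))\<^sup>2 - 1"
    unfolding cosh_Tpar(4)[OF k] using cosh_double_cosh[of "wpar k - tpar k"] by (simp add: right_diff_distrib)
  also have "(cosh (wpar k - tpar k))\<^sup>2 = 3 * (h * h) * (((1 + k) - e) / k)\<^sup>2"
    unfolding d by (simp add: power_mult_distrib power_divide power2_eq_square[of h])
  also have "\<dots> = 3 * ((3 + k) / 2) * ((3 + 2 * k) / (3 * (1 + k + e)))\<^sup>2" unfolding h d2 ..
  also have "2 * \<dots> - 1 = ev t_C k"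
  proof -
    have c0: "ev t_C k = (3 + k) / 3 * ((3 + 2 * k) / (1 + k + e) * ((3 + 2 * k) / (1 + k + e))) - 1"
      by (simp add: t_C_def t_iv_def t_e_def e_def add.assoc)
    have g: "2 * (3 * ((3 + k) / 2) * (u / (3 * v))\<^sup>2) = (3 + k) / 3 * (u / v * (u / v))" for u v :: real
    proof -
      have a: "(u / (3 * v))\<^sup>2 = u / v * (u / v) / 9" by (simp add: power2_eq_square)
      have "2 * (3 * ((3 + k) / 2) * (z / 9)) = (3 + k) / 3 * z" for z by (simp add: field_simps)
      then show ?thesis unfolding a .
    qed
    show ?thesis unfolding c0 g ..
  qed
  finally show ?thesis .
qed

text \<open>The numerator k + 2 - 2 (1 + k) r of the addition theorem, with r^2 = 1 - k, times its
  conjugate is k^2 (5 + 4 k); this cancels the k^2 in the denominator.\<close>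

lemma ev_t_a3:
  assumes k: "0 < k" "k < 1"
  shows "ev t_a3 k / k = 2 * sinh (Lpar k) * cosh (2 * spar k - Lpar k)"
proof -
  define r where "r = sqrt (1 - k)"
  have r: "r > 0" "r * r = 1 - k" using k by (simp_all add: r_def)
  have q: "sqrt (1 + k) * sqrt (1 + k) = 1 + k" using k by simp
  have R: "sqrt (1 - k\<^sup>2) = sqrt (1 + k) * r" using sqrt_one_minus_sq[of k] k by (simp add: r_def)
  have d: "(k + 2) + 2 * ((1 + k) * r) > 0" using r k by (simp add: add_pos_pos)
  have kk: "sqrt (1 / k) * sqrt ((1 + k) / k) = sqrt (1 + k) / k"
    using k by (simp add: real_sqrt_divide)
  have "cosh (2 * spar k) = 1 + 2 / k"
    unfolding cosh_double_cosh cosh_params(8)[OF k] using k by (simp add: field_simps)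
  moreover have "sinh (2 * spar k) = 2 * (sqrt (1 + k) / k)"
    unfolding sinh_double cosh_params(7,8)[OF k] using kk by simp
  ultimately have "cosh (2 * spar k - Lpar k) = (1 + 2 / k) * (1 / k) - 2 * (sqrt (1 + k) / k) * (sqrt (1 + k) * r / k)"
    unfolding cosh_diff cosh_params(1,2)[OF k] R by simp
  also have "\<dots> = ((k + 2) - 2 * (sqrt (1 + k) * sqrt (1 + k) * r)) / k\<^sup>2"
    using k by (simp add: field_simps power2_eq_square)
  also have "\<dots> = ((k + 2) - 2 * ((1 + k) * r)) / k\<^sup>2" unfolding q ..
  also have "(k + 2) - 2 * ((1 + k) * r) = k\<^sup>2 * (5 + 4 * k) / ((k + 2) + 2 * ((1 + k) * r))"
  proof -
    have "((k + 2) - 2 * ((1 + k) * r)) * ((k + 2) + 2 * ((1 + k) * r)) = k\<^sup>2 * (5 + 4 * k)"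
      using r(2) by algebra
    then show ?thesis using d by (simp add: eq_divide_eq)
  qed
  finally have c: "cosh (2 * spar k - Lpar k) = (5 + 4 * k) / ((k + 2) + 2 * ((1 + k) * r))" using k by simp
  have "ev t_a3 k = ev t_a1 k * cosh (2 * spar k - Lpar k)" unfolding c by (simp add: t_a3_def t_r_def r_def)
  then have "ev t_a3 k / k = ev t_a1 k / k * cosh (2 * spar k - Lpar k)" by simp
  then show ?thesis unfolding ev_t_a1(1)[OF k] .
qed

text \<open>All comparisons are made between hyperbolic cosines, which are algebraic in k. The
  inequality w \<le> 2 h = L is the one that uses p < 7, in the form (1 + k) (3 + k) / k \<le> 1 /
  k^2.\<close>

lemma param_order:
  assumes k: "0 < k" "k < 1" and k7: "k * (1 + k) * (3 + k) < 1"
  shows "tpar k \<le> wpar k" "spar k \<le> wpar k" "wpar k \<le> Lpar k" "Lpar k \<le> 2 * tpar k" "wpar k \<le> 2 * tpar k" "Lpar k \<le> 2 * spar k"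
proof -
  note c = cosh_params[OF k]
  have le: "x \<le> y" if "cosh x \<le> cosh y" "0 < x" "0 < y" for x y :: real
    using that cosh_real_nonneg_le_iff[of x y] by simp
  have t2: "cosh (2 * tpar k) = (3 + 2 * k) / k" using cosh_Tpar(1,4)[OF k] by simp
  have s2: "cosh (2 * spar k) = 1 + 2 / k" unfolding cosh_double_cosh c(8) using k by (simp add: field_simps)
  have "(1 + k) / k * (3 / 2) \<le> (1 + k) / k * (3 + k)" using k by (intro mult_left_mono) auto
  then have o1: "3 * (1 + k) / (2 * k) \<le> (1 + k) * (3 + k) / k" by (simp add: mult.commute)
  show "tpar k \<le> wpar k" by (rule le[OF _ c(6,12)]) (simp only: c(5,10) real_sqrt_le_iff o1)
  show "spar k \<le> wpar k"
    by (rule le) (use c k in \<open>simp_all add: divide_right_mono\<close>)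
  have "(1 + k) * (3 + k) \<le> 1 / k" using k k7 by (simp add: pos_le_divide_eq mult_ac)
  then have "(1 + k) * (3 + k) / k \<le> 1 / k / k" using k by (intro divide_right_mono) auto
  then have "(1 + k) * (3 + k) / k \<le> (1 / k)\<^sup>2" by (simp add: power2_eq_square)
  then have "sqrt ((1 + k) * (3 + k) / k) \<le> 1 / k" using k by (intro real_le_lsqrt) auto
  note o2 = this
  show "wpar k \<le> Lpar k" by (rule le[OF _ c(12,3)]) (simp only: c(1,10) o2)
  show "Lpar k \<le> 2 * tpar k" by (rule le) (use c t2 k in \<open>simp_all add: divide_right_mono\<close>)
  have "(1 + k) * (3 + k) / k \<le> ((3 + 2 * k) / k)\<^sup>2"
  proof -
    have "k * ((1 + k) * (3 + k)) \<le> 1" using k7 by (simp add: mult.assoc)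
    also have "1 \<le> (3 + 2 * k)\<^sup>2" using k by simp
    finally have "(1 + k) * (3 + k) * k \<le> (3 + 2 * k)\<^sup>2" by (simp add: mult.commute)
    note h = this
    have "(1 + k) * (3 + k) / k = (1 + k) * (3 + k) * k / (k * k)" using k by simp
    also have "\<dots> \<le> (3 + 2 * k)\<^sup>2 / (k * k)" by (rule divide_right_mono[OF h]) simp
    also have "\<dots> = ((3 + 2 * k) / k)\<^sup>2" by (simp add: power_divide power2_eq_square)
    finally show ?thesis .
  qed
  then have "sqrt ((1 + k) * (3 + k) / k) \<le> (3 + 2 * k) / k" using k by (intro real_le_lsqrt) auto
  note o3 = this
  have tp: "0 < 2 * tpar k" "0 < 2 * spar k" using c(6,9) by simp_all
  show "wpar k \<le> 2 * tpar k" by (rule le[OF _ c(12) tp(1)]) (simp only: c(10) t2 o3)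
  have o4: "1 / k \<le> 1 + 2 / k" using k by (simp add: field_simps)
  show "Lpar k \<le> 2 * spar k" by (rule le[OF _ c(3) tp(2)]) (simp only: c(1) s2 o4)
qed

interpretation P1: packing 12 t_a1 t_b1 0 "\<lambda>k. 2 * Lpar k" by (rule packing1)
interpretation P2: packing 12 t_a2 t_b2 1 "\<lambda>k. 3 * Lpar k - Tpar k" by (rule packing2)
interpretation P3: packing 12 t_a3 t_b1 0 "\<lambda>k. 2 * Lpar k" by (rule packing3)

lemma sum_1_8: "(\<Sum>i\<in>{1..8::nat}. f i) = f 1 + f 2 + f 3 + f 4 + f 5 + f 6 + f 7 + f 8" for f :: "nat \<Rightarrow> real"
proof -
  have "{1..8::nat} = {1, 2, 3, 4, 5, 6, 7, 8}" by auto
  then show ?thesis by (simp add: add.assoc)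
qed

section \<open>The densities for fixed p\<close>

context
  fixes p k :: real
  assumes p: "6 < p" "p < 7" and k_def: "k = kpar p"
begin

lemma k_range: "0 < k" "k < 1" "k < 247 / 1000" "k * (1 + k) * (3 + k) < 1"
  using kpar_bounds[OF p] by (simp_all add: k_def)

lemmas param_le = param_order[OF k_range(1,2,4)]
lemmas param_pos = cosh_params(3,6,9,12)[OF k_range(1,2)]

lemma params: "hh p = Lpar k / 2" "tt p = Tpar k / 2" "ss p = spar k" "ww p = wpar k" "tpar k = Tpar k / 2"
  using hh_eq[OF p] tt_eq[OF p] ss_eq[OF p] ww_eq[OF p] cosh_Tpar(4)[OF k_range(1,2)] by (simp_all add: k_def)

lemma Vpiece_sinh:
  assumes "0 \<le> x" "x \<le> wpar k" "i \<in> {1..8}"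
  shows "Vpiece p i x = Apar k / 4 * (sinh (2 * x) + 2 * x)"
proof -
  have "cosh x \<le> cosh (wpar k)" using assms by (simp add: cosh_real_nonneg_le_iff)
  then have "(cosh x)\<^sup>2 \<le> (cosh (wpar k))\<^sup>2" by (intro power_mono) auto
  also have "\<dots> = (1 + k) * (3 + k) / k" using cosh_params(10)[OF k_range(1,2)] k_range(1) by simp
  finally have c: "(cosh x)\<^sup>2 \<le> (1 + k) * (3 + k) / k" .
  show ?thesis using Vpiece_eq[OF p assms(3,1)] c unfolding k_def Apar_def by simp
qed

lemma V0_pos: "V0 p > 0" "V0 p = Vpar k"
  using V0_eq_Vpar[OF p] Vpar_pos[OF k_range(1,2)] by (simp_all add: k_def)

text \<open>On the stated range all heights lie between 0 and w, as the volume formula requires: h +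
  x \<le> t \<le> w and h - x \<ge> 2 h - t \<ge> 0.\<close>

lemma delta1_eq:
  assumes x: "0 \<le> x" "x \<le> tt p - hh p"
  shows "delta1 p x = Apar k / 4 * (2 * sinh (Lpar k + 2 * x) + 6 * sinh (Lpar k - 2 * x) + 8 * Lpar k - 8 * x) / V0 p"
proof -
  note x' = x[unfolded params]
  have a: "Vpiece p i (hh p + x) = Apar k / 4 * (sinh (Lpar k + 2 * x) + (Lpar k + 2 * x))" if "i \<in> {1..8}" for i
    unfolding params using Vpiece_sinh[of "Lpar k / 2 + x" i] that x' param_le[unfolded params] param_pos by (simp add: distrib_left)
  have b: "Vpiece p i (hh p - x) = Apar k / 4 * (sinh (Lpar k - 2 * x) + (Lpar k - 2 * x))" if "i \<in> {1..8}" for i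
    unfolding params using Vpiece_sinh[of "Lpar k / 2 - x" i] that x' param_le[unfolded params] param_pos by (simp add: right_diff_distrib)
  have "(\<Sum>i\<in>{1..8::nat}. Vpiece p i (if i \<in> {2, 8} then hh p + x else hh p - x))
    = 2 * (Apar k / 4 * (sinh (Lpar k + 2 * x) + (Lpar k + 2 * x))) + 6 * (Apar k / 4 * (sinh (Lpar k - 2 * x) + (Lpar k - 2 * x)))"
    unfolding sum_1_8 by (simp add: a b del: One_nat_def)
  also have "\<dots> = Apar k / 4 * (2 * sinh (Lpar k + 2 * x) + 6 * sinh (Lpar k - 2 * x) + 8 * Lpar k - 8 * x)" by (simp add: algebra_simps)
  finally show ?thesis unfolding delta1_def by (rule arg_cong[where f = "\<lambda>z. z / V0 p"])
qed

text \<open>The heights come in pairs u + x and u - x with equal multiplicity, so the linear parts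
  cancel in x and the sinh parts add up to a multiple of cosh (2 x).\<close>

lemma delta2_eq:
  assumes x: "0 \<le> x" "x \<le> ww p - tt p"
  shows "delta2 p x = Apar k / 4 * (cosh (2 * x) * (2 * sinh (Tpar k) + 6 * sinh (2 * Lpar k - Tpar k)) + 12 * Lpar k - 4 * Tpar k) / V0 p"
proof -
  note x' = x[unfolded params]
  have a: "Vpiece p i (tt p + x) = Apar k / 4 * (sinh (Tpar k + 2 * x) + (Tpar k + 2 * x))" if "i \<in> {1..8}" for i
    unfolding params using Vpiece_sinh[of "Tpar k / 2 + x" i] that x' param_le[unfolded params] param_pos by (simp add: distrib_left)
  have b: "Vpiece p i (tt p - x) = Apar k / 4 * (sinh (Tpar k - 2 * x) + (Tpar k - 2 * x))" if "i \<in> {1..8}" for i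
    unfolding params using Vpiece_sinh[of "Tpar k / 2 - x" i] that x' param_le[unfolded params] param_pos by (simp add: right_diff_distrib)
  have c: "Vpiece p i (2 * hh p - tt p - x) = Apar k / 4 * (sinh (2 * Lpar k - Tpar k - 2 * x) + (2 * Lpar k - Tpar k - 2 * x))" if "i \<in> {1..8}" for i
    unfolding params using Vpiece_sinh[of "Lpar k - Tpar k / 2 - x" i] that x' param_le[unfolded params] param_pos by (simp add: right_diff_distrib)
  have d: "Vpiece p i (2 * hh p - tt p + x) = Apar k / 4 * (sinh (2 * Lpar k - Tpar k + 2 * x) + (2 * Lpar k - Tpar k + 2 * x))" if "i \<in> {1..8}" for i
    unfolding params using Vpiece_sinh[of "Lpar k - Tpar k / 2 + x" i] that x' param_le[unfolded params] param_pos by (simp add: right_diff_distrib distrib_left)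
  have s: "sinh (u + 2 * x) + sinh (u - 2 * x) = 2 * (cosh (2 * x) * sinh u)" for u :: real
    by (simp add: sinh_add sinh_diff)
  have "(\<Sum>i\<in>{1..8::nat}. Vpiece p i (if i = 2 then tt p + x else if i = 8 then tt p - x
      else if i \<in> {1, 3, 6} then 2 * hh p - tt p - x else 2 * hh p - tt p + x))
    = Apar k / 4 * (sinh (Tpar k + 2 * x) + (Tpar k + 2 * x)) + Apar k / 4 * (sinh (Tpar k - 2 * x) + (Tpar k - 2 * x))
      + 3 * (Apar k / 4 * (sinh (2 * Lpar k - Tpar k - 2 * x) + (2 * Lpar k - Tpar k - 2 * x)))
      + 3 * (Apar k / 4 * (sinh (2 * Lpar k - Tpar k + 2 * x) + (2 * Lpar k - Tpar k + 2 * x)))"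
    unfolding sum_1_8 by (simp add: a b c d del: One_nat_def)
  also have "\<dots> = Apar k / 4 * ((sinh (Tpar k + 2 * x) + sinh (Tpar k - 2 * x))
      + 3 * (sinh (2 * Lpar k - Tpar k + 2 * x) + sinh (2 * Lpar k - Tpar k - 2 * x)) + 12 * Lpar k - 4 * Tpar k)"
    by (simp add: algebra_simps)
  also have "\<dots> = Apar k / 4 * (cosh (2 * x) * (2 * sinh (Tpar k) + 6 * sinh (2 * Lpar k - Tpar k)) + 12 * Lpar k - 4 * Tpar k)"
    unfolding s by (simp add: algebra_simps)
  finally show ?thesis unfolding delta2_def by (rule arg_cong[where f = "\<lambda>z. z / V0 p"])
qed

lemma delta3_eq:
  assumes x: "0 \<le> x" "x \<le> ss p - hh p"
  shows "delta3 p x = Apar k / 4 * (8 * sinh (Lpar k) * cosh (2 * x) + 8 * Lpar k) / V0 p"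
proof -
  note x' = x[unfolded params]
  have a: "Vpiece p i (hh p + x) = Apar k / 4 * (sinh (Lpar k + 2 * x) + (Lpar k + 2 * x))" if "i \<in> {1..8}" for i
    unfolding params using Vpiece_sinh[of "Lpar k / 2 + x" i] that x' param_le[unfolded params] param_pos by (simp add: distrib_left)
  have b: "Vpiece p i (hh p - x) = Apar k / 4 * (sinh (Lpar k - 2 * x) + (Lpar k - 2 * x))" if "i \<in> {1..8}" for i
    unfolding params using Vpiece_sinh[of "Lpar k / 2 - x" i] that x' param_le[unfolded params] param_pos by (simp add: right_diff_distrib)
  have "(\<Sum>i\<in>{1..8::nat}. Vpiece p i (if i \<in> {1, 3, 6, 8} then hh p + x else hh p - x))
    = 4 * (Apar k / 4 * (sinh (Lpar k + 2 * x) + (Lpar k + 2 * x))) + 4 * (Apar k / 4 * (sinh (Lpar k - 2 * x) + (Lpar k - 2 * x)))"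
    unfolding sum_1_8 by (simp add: a b del: One_nat_def)
  also have "\<dots> = Apar k / 4 * (8 * sinh (Lpar k) * cosh (2 * x) + 8 * Lpar k)" by (simp add: sinh_add sinh_diff algebra_simps)
  finally show ?thesis unfolding delta3_def by (rule arg_cong[where f = "\<lambda>z. z / V0 p"])
qed

lemma x_ranges: "0 \<le> tt p - hh p" "0 \<le> ww p - tt p" "0 \<le> ss p - hh p"
  using tt_eq[OF p] hh_eq[OF p] ww_eq[OF p] ss_eq[OF p] param_le by (simp_all add: k_def)

lemma delta_Nf:
  "delta1 p 0 = P1.Nf k / Vpar k" "delta2 p (ww p - tt p) = P2.Nf k / Vpar k" "delta3 p (ss p - hh p) = P3.Nf k / Vpar k"
proof -
  note kk = k_range(1,2)
  show "delta1 p 0 = P1.Nf k / Vpar k"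
    unfolding delta1_eq[OF order_refl x_ranges(1)] V0_pos(2) P1.Nf_def P1.nf_def ev_t_a1(1)[OF kk] by (simp add: algebra_simps)
  have "2 * (ww p - tt p) = 2 * wpar k - Tpar k" unfolding params by simp
  then have "delta2 p (ww p - tt p) = Apar k / 4 * (ev t_C k * (2 * (3 * Spar k / k) + 6 * (ev t_T k / k)) + 12 * Lpar k - 4 * Tpar k) / Vpar k"
    using delta2_eq[OF x_ranges(2)] V0_pos(2) ev_t_C[OF kk] ev_t_T[OF kk] cosh_Tpar(2)[OF kk] by simp
  also have "\<dots> = P2.Nf k / Vpar k"
  proof -
    have a: "ev t_a2 k = 3 / 2 * (ev t_C k * (Spar k + ev t_T k))" using ev_t_b(3)[of k] kk by (simp add: t_a2_def)
    have a2: "ev t_a2 k / k = 3 / 2 * (ev t_C k * (Spar k / k + ev t_T k / k))" unfolding a by (simp add: add_divide_distrib[symmetric])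
    have e: "3 * Spar k / k = 3 * (Spar k / k)" by simp
    have g: "A / 4 * (C * (2 * (3 * s) + 6 * u) + 12 * L - 4 * t) = A * (3 / 2 * (C * (s + u)) + (3 * L - t))" for A C s u L t :: real
      by (simp add: algebra_simps)
    show ?thesis unfolding P2.Nf_def P2.nf_def a2 e g ..
  qed
  finally show "delta2 p (ww p - tt p) = P2.Nf k / Vpar k" .
  have e: "2 * (ss p - hh p) = 2 * spar k - Lpar k" unfolding params by simp
  show "delta3 p (ss p - hh p) = P3.Nf k / Vpar k"
    unfolding delta3_eq[OF x_ranges(3) order_refl] e V0_pos(2) P3.Nf_def P3.nf_def ev_t_a3[OF kk] by (simp add: algebra_simps)
qed

lemma delta2_le: assumes x: "0 \<le> x" "x \<le> ww p - tt p" shows "delta2 p x \<le> delta2 p (ww p - tt p)"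
proof -
  have "2 * Lpar k - Tpar k \<ge> 0" using param_le cosh_Tpar(4)[OF k_range(1,2)] by simp
  then have c: "0 \<le> 2 * sinh (Tpar k) + 6 * sinh (2 * Lpar k - Tpar k)" using cosh_Tpar(3)[OF k_range(1,2)] by simp
  have "cosh (2 * x) \<le> cosh (2 * (ww p - tt p))" using x by (subst cosh_real_nonneg_le_iff) auto
  from mult_right_mono[OF this c] show ?thesis unfolding delta2_eq[OF x] delta2_eq[OF x_ranges(2) order_refl]
    using Apar_pos[OF k_range(1,2)] V0_pos(1) by (intro divide_right_mono mult_left_mono) auto
qed

lemma delta3_le: assumes x: "0 \<le> x" "x \<le> ss p - hh p" shows "delta3 p x \<le> delta3 p (ss p - hh p)"
proof -
  have c: "0 \<le> 8 * sinh (Lpar k)" using param_pos by simp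
  have "cosh (2 * x) \<le> cosh (2 * (ss p - hh p))" using x by (subst cosh_real_nonneg_le_iff) auto
  from mult_left_mono[OF this c] show ?thesis unfolding delta3_eq[OF x] delta3_eq[OF x_ranges(3) order_refl]
    using Apar_pos[OF k_range(1,2)] V0_pos(1) by (intro divide_right_mono mult_left_mono) auto
qed

text \<open>The bracket in \<open>delta1_eq\<close> is convex in \<open>x\<close>, so it suffices to compare the two endpoints.\<close>
lemma delta1_le: assumes x: "0 \<le> x" "x \<le> tt p - hh p" shows "delta1 p x \<le> delta1 p 0"
proof -
  note kk = k_range(1,2)
  define L where "L = Lpar k"
  define b where "b = tpar k - L / 2"
  have b: "b = tt p - hh p" "2 * b = Tpar k - L" using tt_eq[OF p] hh_eq[OF p] cosh_Tpar(4)[OF kk] by (simp_all add: b_def L_def k_def)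
  have xb: "0 \<le> x" "x \<le> b" "2 * b \<le> L" using x b param_le cosh_Tpar(4)[OF kk] by (simp_all add: L_def)
  have L: "L > 0" using param_pos by (simp add: L_def)
  define f where "f x = 2 * sinh (L + 2 * x) + 6 * sinh (L - 2 * x) - 8 * x" for x
  \<comment> \<open>The second derivative is a positive combination of sinh (L + 2 x) and sinh (L -
    2 x); the latter is nonnegative because 2 b = 2 t - L \<le> L.\<close>
  have cvx: "convex_on {0..b} f"
  proof (rule f''_ge0_imp_convex)
    show "(f has_real_derivative 4 * cosh (L + 2 * x) - 12 * cosh (L - 2 * x) - 8) (at x)" for x
      unfolding f_def by (auto intro!: derivative_eq_intros)
    show "((\<lambda>x. 4 * cosh (L + 2 * x) - 12 * cosh (L - 2 * x) - 8) has_real_derivative 8 * sinh (L + 2 * x) + 24 * sinh (L - 2 * x)) (at x)" for x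
      by (auto intro!: derivative_eq_intros)
    show "0 \<le> 8 * sinh (L + 2 * x) + 24 * sinh (L - 2 * x)" if "x \<in> {0..b}" for x
      using that xb L by (intro add_nonneg_nonneg mult_nonneg_nonneg) auto
  qed simp
  have f0: "f 0 = 8 * sinh L" by (simp add: f_def)
  have "f b = 2 * sinh (Tpar k) + 6 * sinh (2 * L - Tpar k) - 4 * (Tpar k - L)"
    unfolding f_def b(2) using b(2) by (simp add: algebra_simps)
  also have "\<dots> = (2 * ev t_st k) / k + 4 * (ev t_a1 k / k) - 4 * (Tpar k - L)"
    unfolding L_def ev_t_T[OF kk] cosh_Tpar(2)[OF kk] using ev_t_b(3)[of k] kk by (simp add: t_st_def field_simps)
  \<comment> \<open>The term 2 \<open>t_st\<close> / k contributes at most 4, which is absorbed by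
    -4 (T - L) \<le> -4; what is left is exactly the value at x = 0.\<close>
  also have "\<dots> \<le> 8 * sinh L"
  proof -
    have "(2 * ev t_st k) / k \<le> 4" using t_st_le[OF k_range(1,3)] kk by (simp add: divide_le_eq)
    moreover have "a + 4 * (2 * h) - 4 * d \<le> 8 * h" if "a \<le> 4" "1 \<le> d" for a d h :: real using that by linarith
    ultimately show ?thesis using Tpar_minus_Lpar_ge[OF kk] unfolding ev_t_a1(1)[OF kk] L_def by blast
  qed
  finally have fb: "f b \<le> 8 * sinh L" .
  have "f x \<le> 8 * sinh L"
  proof (cases "b = 0")
    case True
    then show ?thesis using xb f0 by simp
  next
    case False
    define u where "u = x / b"
    have u: "0 \<le> u" "u \<le> 1" "x = (1 - u) * 0 + u * b" using xb False by (simp_all add: u_def divide_le_eq)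
    have "f ((1 - u) *\<^sub>R 0 + u *\<^sub>R b) \<le> (1 - u) * f 0 + u * f b"
      by (rule convex_onD[OF cvx u(1,2)]) (use xb in auto)
    also have "\<dots> \<le> (1 - u) * (8 * sinh L) + u * (8 * sinh L)"
      using u fb f0 by (intro add_mono mult_left_mono) auto
    finally show ?thesis using u(3) by (simp add: algebra_simps)
  qed
  then have "2 * sinh (Lpar k + 2 * x) + 6 * sinh (Lpar k - 2 * x) + 8 * Lpar k - 8 * x
    \<le> 2 * sinh (Lpar k + 2 * 0) + 6 * sinh (Lpar k - 2 * 0) + 8 * Lpar k - 8 * 0"
    by (simp add: f_def L_def)
  then show ?thesis unfolding delta1_eq[OF x] delta1_eq[OF order_refl x_ranges(1)]
    using Apar_pos[OF kk] V0_pos(1) by (intro divide_right_mono mult_left_mono) auto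
qed

end

section \<open>Optimal values of p\<close>

lemma kpar_strict_mono: assumes "6 < p" "p < q" "q < 7" shows "kpar p < kpar q"
proof -
  have "2 * pi / q < 2 * pi / p" using assms by (intro divide_strict_left_mono) auto
  moreover have "2 * pi / p \<le> pi" using assms by (simp add: divide_le_eq)
  ultimately have "cos (2 * pi / p) < cos (2 * pi / q)" using assms by (intro cos_monotone_0_pi) auto
  then show ?thesis by (simp add: kpar_def)
qed

text \<open>Transfers \<open>Nf_max\<close> from k to p. Every p between 6 and 7 gives a k in the
  range of the locale, so the maximum over k dominates all densities; continuity of
  \<open>kpar\<close> then provides a p that realises the optimal k.\<close>

lemma (in packing) optimum:
  fixes dlt :: "real \<Rightarrow> real" and r1 r2 :: int
  assumes p: "6 < p1" "p1 < p2" "p2 < 7"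
    and dlt: "\<And>p. 6 < p \<Longrightarrow> p < 7 \<Longrightarrow> dlt p = Nf (kpar p) / Vpar (kpar p)"
    and s1: "0 < Uf (kpar p1) * Vpar (kpar p1) - 6 * Lpar (kpar p1) * Nf (kpar p1)"
      "0 < of_int (6 * r1) * Lpar (kpar p1) - 100000 * Uf (kpar p1)"
    and s2: "0 < - (Uf (kpar p2) * Vpar (kpar p2) - 6 * Lpar (kpar p2) * Nf (kpar p2))"
      "0 < - (of_int (6 * r2) * Lpar (kpar p2) - 100000 * Uf (kpar p2))"
  shows "\<exists>q. p1 \<le> q \<and> q \<le> p2 \<and> (\<forall>p. 6 < p \<and> p < 7 \<longrightarrow> dlt p \<le> dlt q) \<and> of_int r2 / 100000 \<le> dlt q \<and> dlt q \<le> of_int r1 / 100000"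
proof -
  have kk: "0 < kpar p" "kpar p < 247 / 1000" "Lpar (kpar p) > 0" if "6 < p" "p < 7" for p
    using kpar_bounds(1,2)[OF that] Lpar_pos[of "kpar p"] by auto
  have "\<exists>q. kpar p1 < q \<and> q < kpar p2 \<and> (\<forall>x. 0 < x \<and> x < 247 / 1000 \<longrightarrow> Nf x / Vpar x \<le> Nf q / Vpar q)
    \<and> Rf (kpar p2) \<le> Nf q / Vpar q \<and> Nf q / Vpar q \<le> Rf (kpar p1)"
    by (rule Nf_max) (use kk[of p1] kk[of p2] p s1 s2 kpar_strict_mono[OF p] in auto)
  then obtain k where k: "kpar p1 < k" "k < kpar p2" "\<And>x. 0 < x \<Longrightarrow> x < 247 / 1000 \<Longrightarrow> Nf x / Vpar x \<le> Nf k / Vpar k"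
    "Rf (kpar p2) \<le> Nf k / Vpar k" "Nf k / Vpar k \<le> Rf (kpar p1)" by auto
  have "\<exists>q\<ge>p1. q \<le> p2 \<and> kpar q = k"
  proof (rule IVT)
    show "\<forall>x. p1 \<le> x \<and> x \<le> p2 \<longrightarrow> isCont kpar x"
      using p unfolding kpar_def[abs_def] by (intro allI impI continuous_intros) auto
  qed (use k p in auto)
  then obtain q where q: "p1 \<le> q" "q \<le> p2" "kpar q = k" by auto
  have dq: "dlt q = Nf k / Vpar k" using dlt[of q] q p by simp
  have R1: "Rf (kpar p1) \<le> of_int r1 / 100000"
    using s1(2) kk(3)[of p1] p unfolding Rf_def by (simp add: pos_divide_le_eq)
  have R2: "of_int r2 / 100000 \<le> Rf (kpar p2)"
    using s2(2) kk(3)[of p2] p unfolding Rf_def by (simp add: pos_le_divide_eq)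
  have v: "of_int r2 / 100000 \<le> dlt q" "dlt q \<le> of_int r1 / 100000"
    unfolding dq by (rule order_trans[OF R2 k(4)], rule order_trans[OF k(5) R1])
  have "dlt p \<le> dlt q" if "6 < p" "p < 7" for p
    unfolding dlt[OF that] dq using kk[OF that] k(3) by simp
  then show ?thesis using q v by (intro exI[of _ q]) auto
qed

lemma pi_ivl:
  fixes c :: real
  assumes "0 \<le> c" "of_int a \<le> 3.141592653588 * c * 2 ^ n" "3.1415926535899 * c * 2 ^ n \<le> of_int b"
  shows "in_ivl n (pi * c) (a, b)"
proof -
  have "3.141592653588 * (c * 2 ^ n) \<le> pi * (c * 2 ^ n)" "pi * (c * 2 ^ n) \<le> 3.1415926535899 * (c * 2 ^ n)"
    using pi_approx assms(1) by (intro mult_right_mono; simp)+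
  then show ?thesis using assms(2,3) by (simp add: in_ivl_def mult.assoc)
qed

lemma optimum1: "\<exists>q. 6.33961 \<le> q \<and> q \<le> 6.33963 \<and> (\<forall>p. 6 < p \<and> p < 7 \<longrightarrow> delta1 p 0 \<le> delta1 q 0) \<and> 70426 / 100000 \<le> delta1 q 0 \<and> delta1 q 0 \<le> 70428 / 100000"
proof -
  have c: "inO 34 (2 * Lpar k) (enc_c X L None)" if "inO 34 (Lpar k) L" for k X L
    using inO_omul[OF inO_onum[of 34 2] that] by (simp add: enc_c_def)
  have Y: "in_ivl 34 (pi * (6.33961 - 6) / (3 * 6.33961)) (963754454, 963754455)"
    "in_ivl 34 (pi * (6.33963 - 6) / (3 * 6.33963)) (963808170, 963808171)"
    unfolding times_divide_eq_right[symmetric] by (rule pi_ivl; simp)+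
  note a = P1.point_check_sound[OF _ _ Y(1) c point1a] and b = P1.point_check_sound[OF _ _ Y(2) c point1b]
  show ?thesis
    using P1.optimum[of "6.33961" "6.33963" "\<lambda>p. delta1 p 0" 70428 70426] a b delta_Nf(1)[OF _ _ refl] by simp
qed

lemma optimum2: "\<exists>q. 6.10562 \<le> q \<and> q \<le> 6.10564 \<and> (\<forall>p. 6 < p \<and> p < 7 \<longrightarrow> delta2 p (ww p - tt p) \<le> delta2 q (ww q - tt q))
  \<and> 85683 / 100000 \<le> delta2 q (ww q - tt q) \<and> delta2 q (ww q - tt q) \<le> 85685 / 100000"
proof -
  have c: "inO 34 (3 * Lpar (kpar p) - Tpar (kpar p)) (enc_c X L (Some 7))"
    if "6 < p" "p < 7" "in_ivl 34 (kpar p) X" "inO 34 (Lpar (kpar p)) L" for p X L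
  proof -
    have "inO 34 (Tpar (kpar p)) (enc_ln X 7 (t_zT 7))" using enc_Lpar(2)[OF that(3)] kpar_bounds[OF that(1,2)] by simp
    then have "inO 34 (of_int 3 * Lpar (kpar p) + - Tpar (kpar p)) (enc_c X L (Some 7))"
      unfolding enc_c_def option.case by (intro inO_oadd inO_oneg inO_omul inO_onum that(4))
    then show ?thesis by simp
  qed
  have Y: "in_ivl 34 (pi * (6.10562 - 6) / (3 * 6.10562)) (311218111, 311218112)"
    "in_ivl 34 (pi * (6.10564 - 6) / (3 * 6.10564)) (311276023, 311276024)"
    unfolding times_divide_eq_right[symmetric] by (rule pi_ivl; simp)+
  note a = P2.point_check_sound[OF _ _ Y(1) c point2a] and b = P2.point_check_sound[OF _ _ Y(2) c point2b]
  show ?thesis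
    using P2.optimum[of "6.10562" "6.10564" "\<lambda>p. delta2 p (ww p - tt p)" 85685 85683] a b delta_Nf(2)[OF _ _ refl] by simp
qed

lemma optimum3: "\<exists>q. 6.26383 \<le> q \<and> q \<le> 6.26385 \<and> (\<forall>p. 6 < p \<and> p < 7 \<longrightarrow> delta3 p (ss p - hh p) \<le> delta3 q (ss q - hh q))
  \<and> 86144 / 100000 \<le> delta3 q (ss q - hh q) \<and> delta3 q (ss q - hh q) \<le> 86146 / 100000"
proof -
  have c: "inO 34 (2 * Lpar k) (enc_c X L None)" if "inO 34 (Lpar k) L" for k X L
    using inO_omul[OF inO_onum[of 34 2] that] by (simp add: enc_c_def)
  have Y: "in_ivl 34 (pi * (6.26383 - 6) / (3 * 6.26383)) (757761760, 757761761)"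
    "in_ivl 34 (pi * (6.26385 - 6) / (3 * 6.26385)) (757816784, 757816785)"
    unfolding times_divide_eq_right[symmetric] by (rule pi_ivl; simp)+
  note a = P3.point_check_sound[OF _ _ Y(1) c point3a] and b = P3.point_check_sound[OF _ _ Y(2) c point3b]
  show ?thesis
    using P3.optimum[of "6.26383" "6.26385" "\<lambda>p. delta3 p (ss p - hh p)" 86146 86144] a b delta_Nf(3)[OF _ _ refl] by simp
qed

theorem theorem3p14:
  shows
  "(\<forall>p. 6 < p \<and> p < 7 \<longrightarrow>
       (\<forall>x. 0 \<le> x \<and> x \<le> tt p - hh p \<longrightarrow> delta1 p x \<le> delta1 p 0)) \<and>
   (\<exists>q. 6 < q \<and> q < 7 \<and> \<bar>q - 6.33962\<bar> \<le> 0.00001 \<and>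
       (\<forall>p. 6 < p \<and> p < 7 \<longrightarrow> delta1 p 0 \<le> delta1 q 0) \<and>
       \<bar>delta1 q 0 - 0.70427\<bar> \<le> 0.00001) \<and>
   (\<forall>p. 6 < p \<and> p < 7 \<longrightarrow>
       (\<forall>x. 0 \<le> x \<and> x \<le> ww p - tt p \<longrightarrow> delta2 p x \<le> delta2 p (ww p - tt p))) \<and>
   (\<exists>q. 6 < q \<and> q < 7 \<and> \<bar>q - 6.10563\<bar> \<le> 0.00001 \<and>
       (\<forall>p. 6 < p \<and> p < 7 \<longrightarrow> delta2 p (ww p - tt p) \<le> delta2 q (ww q - tt q)) \<and>
       \<bar>delta2 q (ww q - tt q) - 0.85684\<bar> \<le> 0.00001) \<and>
   (\<forall>p. 6 < p \<and> p < 7 \<longrightarrow>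
       (\<forall>x. 0 \<le> x \<and> x \<le> ss p - hh p \<longrightarrow> delta3 p x \<le> delta3 p (ss p - hh p))) \<and>
   (\<exists>q. 6 < q \<and> q < 7 \<and> \<bar>q - 6.26384\<bar> \<le> 0.00001 \<and>
       (\<forall>p. 6 < p \<and> p < 7 \<longrightarrow> delta3 p (ss p - hh p) \<le> delta3 q (ss q - hh q)) \<and>
       \<bar>delta3 q (ss q - hh q) - 0.86145\<bar> \<le> 0.00001)"
proof (intro conjI allI impI)
  have near: "\<bar>u - c\<bar> \<le> d" if "c - d \<le> u" "u \<le> c + d" for u c d :: real using that by (simp add: abs_le_iff)
  show "delta1 p x \<le> delta1 p 0" if "6 < p \<and> p < 7" "0 \<le> x \<and> x \<le> tt p - hh p" for p x
    using delta1_le[OF _ _ refl] that by blast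
  show "delta2 p x \<le> delta2 p (ww p - tt p)" if "6 < p \<and> p < 7" "0 \<le> x \<and> x \<le> ww p - tt p" for p x
    using delta2_le[OF _ _ refl] that by blast
  show "delta3 p x \<le> delta3 p (ss p - hh p)" if "6 < p \<and> p < 7" "0 \<le> x \<and> x \<le> ss p - hh p" for p x
    using delta3_le[OF _ _ refl] that by blast
  obtain q where q: "6.33961 \<le> q" "q \<le> 6.33963" "\<forall>p. 6 < p \<and> p < 7 \<longrightarrow> delta1 p 0 \<le> delta1 q 0"
    "70426 / 100000 \<le> delta1 q 0" "delta1 q 0 \<le> 70428 / 100000" using optimum1 by blast
  then have "6 < q" "q < 7" by simp_all
  moreover have "\<bar>q - 6.33962\<bar> \<le> 0.00001" by (rule near) (use q in simp_all)
  moreover have "\<bar>delta1 q 0 - 0.70427\<bar> \<le> 0.00001" by (rule near) (use q in simp_all)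
  ultimately show "\<exists>q. 6 < q \<and> q < 7 \<and> \<bar>q - 6.33962\<bar> \<le> 0.00001 \<and> (\<forall>p. 6 < p \<and> p < 7 \<longrightarrow> delta1 p 0 \<le> delta1 q 0) \<and>
       \<bar>delta1 q 0 - 0.70427\<bar> \<le> 0.00001" using q(3) by blast
  obtain q where q: "6.10562 \<le> q" "q \<le> 6.10564" "\<forall>p. 6 < p \<and> p < 7 \<longrightarrow> delta2 p (ww p - tt p) \<le> delta2 q (ww q - tt q)"
    "85683 / 100000 \<le> delta2 q (ww q - tt q)" "delta2 q (ww q - tt q) \<le> 85685 / 100000" using optimum2 by blast
  then have "6 < q" "q < 7" by simp_all
  moreover have "\<bar>q - 6.10563\<bar> \<le> 0.00001" by (rule near) (use q in simp_all)
  moreover have "\<bar>delta2 q (ww q - tt q) - 0.85684\<bar> \<le> 0.00001" by (rule near) (use q in simp_all)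
  ultimately show "\<exists>q. 6 < q \<and> q < 7 \<and> \<bar>q - 6.10563\<bar> \<le> 0.00001 \<and>
       (\<forall>p. 6 < p \<and> p < 7 \<longrightarrow> delta2 p (ww p - tt p) \<le> delta2 q (ww q - tt q)) \<and>
       \<bar>delta2 q (ww q - tt q) - 0.85684\<bar> \<le> 0.00001" using q(3) by blast
  obtain q where q: "6.26383 \<le> q" "q \<le> 6.26385" "\<forall>p. 6 < p \<and> p < 7 \<longrightarrow> delta3 p (ss p - hh p) \<le> delta3 q (ss q - hh q)"
    "86144 / 100000 \<le> delta3 q (ss q - hh q)" "delta3 q (ss q - hh q) \<le> 86146 / 100000" using optimum3 by blast
  then have "6 < q" "q < 7" by simp_all
  moreover have "\<bar>q - 6.26384\<bar> \<le> 0.00001" by (rule near) (use q in simp_all)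
  moreover have "\<bar>delta3 q (ss q - hh q) - 0.86145\<bar> \<le> 0.00001" by (rule near) (use q in simp_all)
  ultimately show "\<exists>q. 6 < q \<and> q < 7 \<and> \<bar>q - 6.26384\<bar> \<le> 0.00001 \<and>
       (\<forall>p. 6 < p \<and> p < 7 \<longrightarrow> delta3 p (ss p - hh p) \<le> delta3 q (ss q - hh q)) \<and>
       \<bar>delta3 q (ss q - hh q) - 0.86145\<bar> \<le> 0.00001" using q(3) by blast
qed

end
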